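(* Let $H$ be a Hopf algebra with invertible antipode, $B$ a $\sigma$-twisted left $H$-module algebra, $(\Omega^\bullet(B),\mathrm{d}_B)$ a $\sigma$-twisted $H$-module DC on $B$ and $(\Omega^\bullet(H),\mathrm{d}_H)$ a DC on $H$ with respect to which $\Delta:H\to H\otimes H$ is differentiable. For all $n\ge0$ define $$\Omega^n(B\#_\sigma H):=\bigoplus_{i=0}^n\Omega^{n-i}(B)\otimes\Omega^i(H),$$ and set $$(\omega\otimes\gamma)\wedge(\omega'\otimes\gamma'):=(-1)^{jk}\big(\omega\wedge(\gamma_{-2}\cdot\omega')\,\sigma(\gamma_{-1}\otimes\gamma'_{-1})\big)\otimes(\gamma_0\wedge\gamma'_0),$$ $$\mathrm{d}_{\#_\sigma}(\omega\otimes\gamma):=\mathrm{d}_B\omega\otimes\gamma+(-1)^i\omega\otimes\mathrm{d}_H\gamma$$ for $\omega\in\Omega^i(B)$, $\gamma\in\Omega^j(H)$, $\omega'\in\Omega^k(B)$, $\gamma'\in\Omega^\bullet(H)$. Then $(\Omega^\bullet(B\#_\sigma H),\mathrm{d}_{\#_\sigma})$ is a right $H$-covariant DC on $B\#_\sigma H$. Furthermore, the right $H$-coaction $\rho=\mathrm{Id}_B\otimes\Delta:B\#_\sigma H\to(B\#_\sigma H)\otimes H$ is differentiable with differential $$\Omega^\bullet(\rho):\Omega^\bullet(B\#_\sigma H)\to\Omega^\bullet((B\#_\sigma H)\otimes H),\qquad \omega\otimes\gamma\mapsto\omega\otimes\gamma_{[1]}\otimes\gamma_{[2]}.$$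
   Context: Everything is over a field $\Bbbk$; algebras are associative and unital; Sweedler notation $\Delta(h)=h_1\otimes h_2$. $B$ is a $\sigma$-twisted left $H$-module algebra: there are a linear map $\cdot:H\otimes B\to B$ (a measure) with $h\cdot 1_B=\varepsilon(h)1_B$, $h\cdot(bb')=(h_1\cdot b)(h_2\cdot b')$, and a convolution invertible linear map $\sigma:H\otimes H\to B$ with convolution inverse $\sigma^{-1}$, such that $1_H\cdot b=b$, $h\cdot(h'\cdot b)=\sigma(h_1\otimes h'_1)(h_2h'_2\cdot b)\sigma^{-1}(h_3\otimes h'_3)$, $\sigma(h\otimes1_H)=\varepsilon(h)1_B=\sigma(1_H\otimes h)$ and $(h_1\cdot\sigma(h'_1\otimes h''_1))\sigma(h_2\otimes h'_2h''_2)=\sigma(h_1\otimes h'_1)\sigma(h_2h'_2\otimes h'')$. The crossed product algebra $B\#_\sigma H$ is $B\otimes H$ with unit $1_B\otimes1_H$ and product $(b\otimes h)(b'\otimes h')=b(h_1\cdot b')\sigma(h_2\otimes h'_1)\otimes h_3h'_2$; it is a right $H$-comodule algebra via $\mathrm{Id}_B\otimes\Delta$. A differential calculus (DC) on an algebra $A$ is a differential graded algebra $(\Omega^\bullet(A),\wedge,\mathrm{d})$, graded by $\mathbb N$, with $\Omega^0(A)=A$ (associative unital degree-$0$ product $\wedge$, degree-$1$ differential, $\mathrm{d}^2=0$, graded Leibniz rule $\mathrm{d}(\omega\wedge\eta)=\mathrm{d}\omega\wedge\eta+(-1)^{|\omega|}\omega\wedge\mathrm{d}\eta$) such that $\Omega^n(A)$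 is spanned by the elements $a^0\mathrm{d}a^1\wedge\cdots\wedge\mathrm{d}a^n$. For a right $H$-comodule algebra $A$, a DC is right $H$-covariant if $(\Omega^\bullet(A),\wedge)$ is a graded right $H$-comodule algebra (the coaction preserves each $\Omega^n(A)$ and is an algebra map) with coaction extending that of $A$ and $\mathrm{d}$ right $H$-colinear. An algebra map $f:A\to A'$ between algebras with DCi is differentiable if it extends to a (necessarily unique) morphism of differential graded algebras $\Omega^\bullet(f):\Omega^\bullet(A)\to\Omega^\bullet(A')$, the differential of $f$. The tensor product DC on $A\otimes A'$ is $\Omega^n(A\otimes A')=\bigoplus_{k=0}^n\Omega^k(A)\otimes\Omega^{n-k}(A')$ with $(\omega\otimes\omega')\wedge(\eta\otimes\eta')=(-1)^{|\omega'||\eta|}(\omega\wedge\eta)\otimes(\omega'\wedge\eta')$ and $\mathrm{d}_\otimes(\omega\otimes\omega')=\mathrm{d}\omega\otimes\omega'+(-1)^{|\omega|}\omega\otimes\mathrm{d}'\omega'$; this is the calculus used on $H\otimes H$ and on $(B\#_\sigma H)\otimes H$. If $\Delta$ is differentiable, write $\Omega^\bullet(\Delta)(\gamma)=\gamma_{[1]}\otimes\gamma_{[2]}$. For $\gamma\in\Omega^n(H)$ the component of this in $H\otimes\Omega^n(H)$ is the left $H$-coaction $\gamma\mapsto\gamma_{-1}\otimes\gamma_0$, the component in $\Omega^n(H)\otimes H$ is the right $H$-coaction $\gamma\mapsto\gamma_0\otimes\gamma_1$, and $\gamma_{-2}\otimes\gamma_{-1}\otimes\gamma_0$ is the iterated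 left coaction. A DC $(\Omega^\bullet(B),\mathrm{d}_B)$ on $B$ is a $\sigma$-twisted $H$-module DC if there are linear maps $\cdot:H\otimes\Omega^n(B)\to\Omega^n(B)$, $n\ge1$, with $h\cdot(b^0\mathrm{d}_Bb^1\wedge\cdots\wedge\mathrm{d}_Bb^n)=(h_1\cdot b^0)(h_2\cdot\mathrm{d}_Bb^1)\wedge\cdots\wedge(h_{n+1}\cdot\mathrm{d}_Bb^n)$, $h\cdot\mathrm{d}_Bb=\mathrm{d}_B(h\cdot b)$ and $\mathrm{d}_B\circ\sigma=0$ for all $b,b^0,\dots,b^n\in B$, $h\in H$. *)

theory Defs
  imports "HOL.Vector_Spaces"
begin

section \<open>Vector spaces and tensor products\<close>

text \<open>
  A vector space over a field \<open>'k\<close> is a subspace \<open>carrier V\<close> of a type \<open>'v\<close> that carries a global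
  vector space structure \<open>scale V\<close>. Hence \<open>A = \<Omega>\<^sup>0(A)\<close> and \<open>\<Omega>\<^sup>n(A) \<subseteq> \<Omega>(A)\<close> hold literally.
\<close>

record ('k, 'v) vspace =
  carrier :: "'v set"
  scale :: "'k \<Rightarrow> 'v \<Rightarrow> 'v"

definition is_vspace :: "('k::field, 'v::ab_group_add, 'm) vspace_scheme \<Rightarrow> bool" where
  "is_vspace V \<longleftrightarrow> vector_space (scale V) \<and> module.subspace (scale V) (carrier V)"

definition lin_on ::
  "('k::field, 'v::ab_group_add, 'm) vspace_scheme \<Rightarrow> ('k, 'x::ab_group_add, 'n) vspace_scheme \<Rightarrow> ('v \<Rightarrow> 'x) \<Rightarrow> bool"
where
  "lin_on V X f \<longleftrightarrow>
     (\<forall>v\<in>carrier V. f v \<in> carrier X) \<and>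
     (\<forall>v\<in>carrier V. \<forall>w\<in>carrier V. f (v + w) = f v + f w) \<and>
     (\<forall>c. \<forall>v\<in>carrier V. f (scale V c v) = scale X c (f v))"

text \<open>Linear maps out of \<open>V \<otimes> W\<close> that occur as data (measures, cocycles) are given as bilinear maps.\<close>

definition bilin_on ::
  "('k::field, 'v::ab_group_add, 'm) vspace_scheme \<Rightarrow> ('k, 'w::ab_group_add, 'n) vspace_scheme \<Rightarrow>
   ('k, 'x::ab_group_add, 'p) vspace_scheme \<Rightarrow> ('v \<Rightarrow> 'w \<Rightarrow> 'x) \<Rightarrow> bool"
where
  "bilin_on V W X f \<longleftrightarrow>
     (\<forall>v\<in>carrier V. lin_on W X (f v)) \<and> (\<forall>w\<in>carrier W. lin_on V X (\<lambda>v. f v w))"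

text \<open>
  The pure tensor \<open>x \<otimes> y\<close> is realised as evaluation \<open>\<beta> \<mapsto> \<beta> x y\<close> on the bilinear forms of the two
  ambient spaces (extended by \<open>0\<close> to all functions \<open>\<beta>\<close>), and \<open>V \<otimes> W\<close> as the span of the pure tensors
  inside the type \<open>tensor\<close> of all functionals.
  Over a field this is the tensor product: its universal property is
  \<open>tlift_pure\<close>, \<open>tlift_lin\<close>, \<open>tlift_unique\<close> below.
  For subspaces \<open>V' \<subseteq> V\<close>, \<open>W' \<subseteq> W\<close> it makes \<open>V' \<otimes> W'\<close> literally a subspace of \<open>V \<otimes> W\<close>.
\<close>

typedef ('k, 'v, 'w) tensor = "UNIV :: (('v \<Rightarrow> 'w \<Rightarrow> 'k) \<Rightarrow> 'k) set"
  morphisms tensor_eval Tensor ..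

lemma tensor_eqI: "(\<And>\<beta>. tensor_eval s \<beta> = tensor_eval t \<beta>) \<Longrightarrow> s = t"
  by (metis ext tensor_eval_inject)

instantiation tensor :: (ab_group_add, type, type) ab_group_add
begin

definition "0 = Tensor (\<lambda>\<beta>. 0)"
definition "s + t = Tensor (\<lambda>\<beta>. tensor_eval s \<beta> + tensor_eval t \<beta>)"
definition "s - t = Tensor (\<lambda>\<beta>. tensor_eval s \<beta> - tensor_eval t \<beta>)"
definition "- t = Tensor (\<lambda>\<beta>. - tensor_eval t \<beta>)"

lemmas tensor_defs =
  zero_tensor_def plus_tensor_def minus_tensor_def uminus_tensor_def Tensor_inverse[OF UNIV_I]

instance
  by standard (rule tensor_eqI; simp add: tensor_defs algebra_simps)+

end

definition tscale :: "'k::field \<Rightarrow> ('k, 'v, 'w) tensor \<Rightarrow> ('k, 'v, 'w) tensor" where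
  "tscale c t = Tensor (\<lambda>\<beta>. c * tensor_eval t \<beta>)"

lemma tensor_eval_simps [simp]:
  "tensor_eval 0 \<beta> = 0"
  "tensor_eval (s + t) \<beta> = tensor_eval s \<beta> + tensor_eval t \<beta>"
  "tensor_eval (s - t) \<beta> = tensor_eval s \<beta> - tensor_eval t \<beta>"
  "tensor_eval (- t) \<beta> = - tensor_eval t \<beta>"
  "tensor_eval (tscale c t) \<beta> = c * tensor_eval t \<beta>"
  by (simp_all add: tensor_defs tscale_def)

definition tens ::
  "('k::field, 'v::ab_group_add, 'm) vspace_scheme \<Rightarrow> ('k, 'w::ab_group_add, 'n) vspace_scheme \<Rightarrow>
   'v \<Rightarrow> 'w \<Rightarrow> ('k, 'v, 'w) tensor"
where
  "tens V W x y = Tensor (\<lambda>\<beta>.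
     if (\<forall>v. Vector_Spaces.linear (scale W) (*) (\<beta> v)) \<and>
        (\<forall>w. Vector_Spaces.linear (scale V) (*) (\<lambda>v. \<beta> v w))
     then \<beta> x y else 0)"

definition tensor_span ::
  "('k::field, 'v::ab_group_add, 'm) vspace_scheme \<Rightarrow> ('k, 'w::ab_group_add, 'n) vspace_scheme \<Rightarrow>
   'v set \<Rightarrow> 'w set \<Rightarrow> ('k, 'v, 'w) tensor set"
where
  "tensor_span V W X Y = module.span tscale {tens V W x y | x y. x \<in> X \<and> y \<in> Y}"

definition tensor_space ::
  "('k::field, 'v::ab_group_add, 'm) vspace_scheme \<Rightarrow> ('k, 'w::ab_group_add, 'n) vspace_scheme \<Rightarrow>
   ('k, ('k, 'v, 'w) tensor) vspace"
where
  "tensor_space V W = \<lparr>carrier = tensor_span V W (carrier V) (carrier W), scale = tscale\<rparr>"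

text \<open>
  \<open>add_ext I e f\<close> is the additive map sending \<open>e i\<close> to \<open>f i\<close> for all \<open>i \<in> I\<close>, defined on the sums of
  elements \<open>e i\<close>. It is used to extend formulas given on pure tensors; there the index set is closed
  under scalar multiplication, so the extension is linear.
\<close>

definition add_ext ::
  "'i set \<Rightarrow> ('i \<Rightarrow> 'v::ab_group_add) \<Rightarrow> ('i \<Rightarrow> 'x::ab_group_add) \<Rightarrow> 'v \<Rightarrow> 'x"
where
  "add_ext I e f t =
     (THE y. \<exists>is. set is \<subseteq> I \<and> t = sum_list (map e is) \<and> y = sum_list (map f is))"

definition tlift ::
  "('k::field, 'v::ab_group_add, 'm) vspace_scheme \<Rightarrow> ('k, 'w::ab_group_add, 'n) vspace_scheme \<Rightarrow>
   ('v \<Rightarrow> 'w \<Rightarrow> 'x::ab_group_add) \<Rightarrow> ('k, 'v, 'w) tensor \<Rightarrow> 'x"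
where
  "tlift V W f = add_ext (carrier V \<times> carrier W) (\<lambda>(v, w). tens V W v w) (\<lambda>(v, w). f v w)"

lemma map_case_prod: "map (\<lambda>(v, w). F v w) xs = map (\<lambda>i. F (fst i) (snd i)) xs"
  by (rule map_cong) auto

lemma is_vspaceD: "is_vspace V \<Longrightarrow> vector_space (scale V)"
  "is_vspace V \<Longrightarrow> module.subspace (scale V) (carrier V)"
  by (simp_all add: is_vspace_def)

lemma vector_space_mult: "vector_space ((*) :: 'k::field \<Rightarrow> 'k \<Rightarrow> 'k)"
  by unfold_locales (simp_all add: algebra_simps)

lemma vector_space_tscale: "vector_space (tscale :: 'k::field \<Rightarrow> _)"
  by unfold_locales (rule tensor_eqI; simp add: algebra_simps)+

lemma vspace_closed:
  assumes "is_vspace V" "v \<in> carrier V" "w \<in> carrier V"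
  shows "v + w \<in> carrier V" "scale V c v \<in> carrier V" "0 \<in> carrier V" "v - w \<in> carrier V" "- v \<in> carrier V"
proof -
  interpret vector_space "scale V" using assms by (simp add: is_vspace_def)
  have s: "subspace (carrier V)" using assms by (simp add: is_vspace_def)
  show "v + w \<in> carrier V" "scale V c v \<in> carrier V" "0 \<in> carrier V" "v - w \<in> carrier V" "- v \<in> carrier V"
    using s assms by (auto intro: subspace_add subspace_scale subspace_0 subspace_diff subspace_neg)
qed

lemma vspace_projection:
  assumes "is_vspace V"
  obtains P where "Vector_Spaces.linear (scale V) (scale V) P"
    "\<And>v. P v \<in> carrier V" "\<And>v. v \<in> carrier V \<Longrightarrow> P v = v"
proof -
  interpret vector_space "scale V" using assms by (simp add: is_vspace_def)
  have s: "subspace (carrier V)" using assms by (simp add: is_vspace_def)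
  obtain C where C: "C \<subseteq> carrier V" "independent C" "carrier V \<subseteq> span C"
    using maximal_independent_subset by blast
  interpret vector_space_pair "scale V" "scale V" by unfold_locales
  have sp: "span C = carrier V"
    using C s by (simp add: span_subspace)
  have lin: "Vector_Spaces.linear (scale V) (scale V) (construct C (\<lambda>x. x))"
    by (rule linear_construct[OF C(2)])
  show thesis
  proof
    show "construct C (\<lambda>x. x) v \<in> carrier V" for v
      using construct_in_span[OF C(2), of "\<lambda>x. x" v] sp by simp
    show "construct C (\<lambda>x. x) v = v" if "v \<in> carrier V" for v
      by (rule linear_eq_on[OF lin linear_id[unfolded id_def], of v C])
        (use that sp construct_basis[OF C(2)] in auto)
  qed (rule lin)
qed

lemma functional_separates:
  assumes "vector_space s" "x \<noteq> 0"
  obtains \<phi> where "Vector_Spaces.linear s (*) \<phi>" "\<phi> x = 1"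
proof -
  interpret vector_space s by fact
  interpret vector_space_pair s "(*)" using vector_space_mult by (simp add: vector_space_pair_def assms)
  have i: "independent {x}" using assms(2) by simp
  show thesis
    using that[of "construct {x} (\<lambda>_. 1)"] linear_construct[OF i] construct_basis[OF i] by blast
qed

lemma linear_sum_list: "Vector_Spaces.linear s s' \<phi> \<Longrightarrow> \<phi> (sum_list xs) = sum_list (map \<phi> xs)"
proof -
  assume "Vector_Spaces.linear s s' \<phi>"
  then interpret Vector_Spaces.linear s s' \<phi> .
  show ?thesis by (induction xs) (simp_all add: add)
qed

lemma sum_list_apply: "tensor_eval (sum_list ts) \<beta> = sum_list (map (\<lambda>t. tensor_eval t \<beta>) ts)"
  for ts :: "('k::field, 'v, 'w) tensor list"
  by (induction ts) simp_all

lemma add_ext_sum_list: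
  assumes "set xs \<subseteq> I"
    and "\<And>js. set js \<subseteq> I \<Longrightarrow> sum_list (map e js) = sum_list (map e xs) \<Longrightarrow>
      sum_list (map f js) = sum_list (map f xs)"
  shows "add_ext I e f (sum_list (map e xs)) = sum_list (map f xs)"
  unfolding add_ext_def using assms by (intro the_equality) (blast, metis)

text \<open>Forms \<open>\<beta>\<close> on the ambient spaces detect equality of tensors.\<close>

lemma tens_separation:
  fixes V :: "('k::field, 'v::ab_group_add, 'm) vspace_scheme"
    and W :: "('k, 'w::ab_group_add, 'n) vspace_scheme"
    and X :: "('k, 'x::ab_group_add, 'p) vspace_scheme"
  assumes X: "vector_space (scale X)"
    and ext: "\<And>v. Vector_Spaces.linear (scale W) (scale X) (g v)"
      "\<And>w. Vector_Spaces.linear (scale V) (scale X) (\<lambda>v. g v w)"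
    and fg: "\<And>i. i \<in> set xs \<union> set js \<Longrightarrow> f i = g (a i) (b i)"
    and eq: "sum_list (map (\<lambda>i. tens V W (a i) (b i)) js) = sum_list (map (\<lambda>i. tens V W (a i) (b i)) xs)"
  shows "sum_list (map f js) = sum_list (map f xs)"
proof (rule ccontr)
  assume "\<not> ?thesis"
  then have "sum_list (map f js) - sum_list (map f xs) \<noteq> 0" by simp
  then obtain \<phi> where \<phi>: "Vector_Spaces.linear (scale X) (*) \<phi>"
    "\<phi> (sum_list (map f js) - sum_list (map f xs)) = 1"
    using functional_separates[OF X] by blast
  interpret \<phi>: Vector_Spaces.linear "scale X" "(*)" \<phi> by (rule \<phi>(1))
  let ?\<beta> = "\<lambda>v w. \<phi> (g v w)"
  have 1: "Vector_Spaces.linear (scale W) (*) (?\<beta> v)" for v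
    using Vector_Spaces.linear_compose[OF ext(1) \<phi>(1)] by (simp add: o_def)
  have 2: "Vector_Spaces.linear (scale V) (*) (\<lambda>v. ?\<beta> v w)" for w
    using Vector_Spaces.linear_compose[OF ext(2) \<phi>(1)] by (simp add: o_def)
  have ev: "tensor_eval (tens V W x y) ?\<beta> = \<phi> (g x y)" for x y
    using 1 2 by (simp add: tens_def Tensor_inverse)
  have key: "tensor_eval (sum_list (map (\<lambda>i. tens V W (a i) (b i)) zs)) ?\<beta> = sum_list (map (\<lambda>i. \<phi> (f i)) zs)"
    if "set zs \<subseteq> set xs \<union> set js" for zs
    using that by (induction zs) (simp_all add: ev fg)
  have "sum_list (map (\<lambda>i. \<phi> (f i)) js) = sum_list (map (\<lambda>i. \<phi> (f i)) xs)"
    using key[of js] key[of xs] eq by simp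
  then have "\<phi> (sum_list (map f js)) = \<phi> (sum_list (map f xs))"
    by (simp add: linear_sum_list[OF \<phi>(1)] o_def)
  with \<phi>(2) show False by (simp add: \<phi>.diff)
qed

lemma tens_bilinear:
  shows "tens V W (x + x') y = tens V W x y + tens V W x' y"
    and "tens V W x (y + y') = tens V W x y + tens V W x y'"
    and "tens V W (scale V c x) y = tscale c (tens V W x y)"
    and "tens V W x (scale W c y) = tscale c (tens V W x y)"
  by (rule tensor_eqI; simp add: tens_def Tensor_inverse Vector_Spaces.linear_iff)+

lemma tensor_span_sum_list:
  fixes V :: "('k::field, 'v::ab_group_add, 'm) vspace_scheme"
    and W :: "('k, 'w::ab_group_add, 'n) vspace_scheme"
  assumes "module.subspace (scale V) X" "vector_space (scale V)"
  shows "t \<in> tensor_span V W X Y \<longleftrightarrow> (\<exists>xs. set xs \<subseteq> X \<times> Y \<and> t = sum_list (map (\<lambda>(x, y). tens V W x y) xs))"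
proof -
  interpret V: vector_space "scale V" by fact
  interpret T: vector_space "tscale :: 'k \<Rightarrow> ('k, 'v, 'w) tensor \<Rightarrow> _" by (rule vector_space_tscale)
  let ?S = "{tens V W x y | x y. x \<in> X \<and> y \<in> Y}"
  have "\<exists>xs. set xs \<subseteq> X \<times> Y \<and> t = sum_list (map (\<lambda>(x, y). tens V W x y) xs)" if "t \<in> T.span ?S"
    using that
  proof (induction rule: T.span_induct_alt)
    case base
    show ?case by (rule exI[of _ "[]"]) simp
  next
    case (step c t u)
    then obtain x y xs where "x \<in> X" "y \<in> Y" "t = tens V W x y" "set xs \<subseteq> X \<times> Y"
      "u = sum_list (map (\<lambda>(x, y). tens V W x y) xs)" by blast
    then show ?case
      by (intro exI[of _ "(scale V c x, y) # xs"])
        (auto simp: tens_bilinear V.subspace_scale[OF assms(1)])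
  qed
  moreover have "sum_list (map (\<lambda>(x, y). tens V W x y) xs) \<in> T.span ?S" if "set xs \<subseteq> X \<times> Y" for xs
    using that
    by (induction xs) (auto simp: T.span_zero intro!: T.span_add intro: T.span_base)
  ultimately show ?thesis unfolding tensor_span_def by blast
qed

context
  fixes V :: "('k::field, 'v::ab_group_add, 'm) vspace_scheme"
    and W :: "('k, 'w::ab_group_add, 'n) vspace_scheme"
    and X :: "('k, 'x::ab_group_add, 'p) vspace_scheme"
    and f :: "'v \<Rightarrow> 'w \<Rightarrow> 'x"
  assumes VW: "is_vspace V" "is_vspace W" and X: "is_vspace X" and f: "bilin_on V W X f"
begin

lemma bilin_on_extend:
  obtains g where "\<And>v. Vector_Spaces.linear (scale W) (scale X) (g v)"
    "\<And>w. Vector_Spaces.linear (scale V) (scale X) (\<lambda>v. g v w)"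
    "\<And>v w. v \<in> carrier V \<Longrightarrow> w \<in> carrier W \<Longrightarrow> g v w = f v w"
proof -
  obtain P where P: "Vector_Spaces.linear (scale V) (scale V) P"
    "\<And>v. P v \<in> carrier V" "\<And>v. v \<in> carrier V \<Longrightarrow> P v = v" using vspace_projection[OF VW(1)] by blast
  obtain Q where Q: "Vector_Spaces.linear (scale W) (scale W) Q"
    "\<And>v. Q v \<in> carrier W" "\<And>v. v \<in> carrier W \<Longrightarrow> Q v = v" using vspace_projection[OF VW(2)] by blast
  have Pl: "P (x + y) = P x + P y" "P (scale V c x) = scale V c (P x)" for x y c
    using P(1) by (simp_all add: Vector_Spaces.linear_iff)
  have Ql: "Q (x + y) = Q x + Q y" "Q (scale W c x) = scale W c (Q x)" for x y c
    using Q(1) by (simp_all add: Vector_Spaces.linear_iff)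
  have fl1: "f (v + v') w = f v w + f v' w" "f (scale V c v) w = scale X c (f v w)"
    if "v \<in> carrier V" "v' \<in> carrier V" "w \<in> carrier W" for v v' w c
    using f that unfolding bilin_on_def lin_on_def by blast+
  have fl2: "f v (w + w') = f v w + f v w'" "f v (scale W c w) = scale X c (f v w)"
    if "v \<in> carrier V" "w \<in> carrier W" "w' \<in> carrier W" for v w w' c
    using f that unfolding bilin_on_def lin_on_def by blast+
  note vs = is_vspaceD(1)[OF VW(1)] is_vspaceD(1)[OF VW(2)] is_vspaceD(1)[OF X]
  show thesis
  proof (rule that[of "\<lambda>v w. f (P v) (Q w)"])
    show "Vector_Spaces.linear (scale W) (scale X) (\<lambda>w. f (P v) (Q w))" for v
      unfolding Vector_Spaces.linear_iff using vs by (simp add: Ql fl2(1) fl2(2)[OF P(2) Q(2) Q(2)] P(2) Q(2))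
    show "Vector_Spaces.linear (scale V) (scale X) (\<lambda>v. f (P v) (Q w))" for w
      unfolding Vector_Spaces.linear_iff using vs by (simp add: Pl fl1(1) fl1(2)[OF P(2) P(2) Q(2)] P(2) Q(2))
  qed (simp add: P(3) Q(3))
qed

lemma tlift_sum_list:
  assumes "set xs \<subseteq> carrier V \<times> carrier W"
  shows "tlift V W f (sum_list (map (\<lambda>(v, w). tens V W v w) xs)) = sum_list (map (\<lambda>(v, w). f v w) xs)"
  unfolding tlift_def
proof (rule add_ext_sum_list[OF assms])
  fix js
  assume js: "set js \<subseteq> carrier V \<times> carrier W"
    "sum_list (map (\<lambda>(v, w). tens V W v w) js) = sum_list (map (\<lambda>(v, w). tens V W v w) xs)"
  obtain g where g: "\<And>v. Vector_Spaces.linear (scale W) (scale X) (g v)"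
    "\<And>w. Vector_Spaces.linear (scale V) (scale X) (\<lambda>v. g v w)"
    "\<And>v w. v \<in> carrier V \<Longrightarrow> w \<in> carrier W \<Longrightarrow> g v w = f v w" using bilin_on_extend by blast
  have "sum_list (map (\<lambda>i. f (fst i) (snd i)) js) = sum_list (map (\<lambda>i. f (fst i) (snd i)) xs)"
  proof (rule tens_separation[where a = fst and b = snd and g = g and V = V and W = W and X = X])
    show "vector_space (scale X)" by (rule is_vspaceD(1)[OF X])
    show "f (fst i) (snd i) = g (fst i) (snd i)" if "i \<in> set xs \<union> set js" for i
    proof -
      have "i \<in> carrier V \<times> carrier W" using that js(1) assms by blast
      then show ?thesis by (cases i) (simp add: g(3))
    qed
    show "sum_list (map (\<lambda>i. tens V W (fst i) (snd i)) js) = sum_list (map (\<lambda>i. tens V W (fst i) (snd i)) xs)"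
      using js(2) unfolding map_case_prod .
  qed (rule g)+
  then show "sum_list (map (\<lambda>(v, w). f v w) js) = sum_list (map (\<lambda>(v, w). f v w) xs)"
    unfolding map_case_prod .
qed

lemma tlift_pure: "v \<in> carrier V \<Longrightarrow> w \<in> carrier W \<Longrightarrow> tlift V W f (tens V W v w) = f v w"
proof -
  assume a: "v \<in> carrier V" "w \<in> carrier W"
  then have "set [(v, w)] \<subseteq> carrier V \<times> carrier W" by auto
  from tlift_sum_list[OF this] show "tlift V W f (tens V W v w) = f v w" by simp
qed

lemma tlift_lin: "lin_on (tensor_space V W) X (tlift V W f)"
  unfolding lin_on_def
proof (intro conjI ballI allI)
  note ts = tensor_span_sum_list[OF is_vspaceD(2)[OF VW(1)] is_vspaceD(1)[OF VW(1)], of _ W]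
  interpret T: vector_space "tscale :: 'k \<Rightarrow> ('k, 'v, 'w) tensor \<Rightarrow> _" by (rule vector_space_tscale)
  interpret X: vector_space "scale X" using X by (rule is_vspaceD)
  have fc: "v \<in> carrier V \<Longrightarrow> w \<in> carrier W \<Longrightarrow> f v w \<in> carrier X" for v w
    using f by (auto simp: bilin_on_def lin_on_def)
  fix t assume "t \<in> carrier (tensor_space V W)"
  then obtain xs where xs: "set xs \<subseteq> carrier V \<times> carrier W" "t = sum_list (map (\<lambda>(v, w). tens V W v w) xs)"
    by (auto simp: tensor_space_def ts)
  show "tlift V W f t \<in> carrier X"
    unfolding xs tlift_sum_list[OF xs(1)] using xs(1)
    by (induction xs) (auto intro: vspace_closed X.subspace_0[OF is_vspaceD(2)[OF X]] vspace_closed(1)[OF X] fc)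
  show "tlift V W f (scale (tensor_space V W) c t) = scale X c (tlift V W f t)" for c
  proof -
    let ?js = "map (\<lambda>(v, w). (scale V c v, w)) xs"
    have "scale (tensor_space V W) c t = sum_list (map (\<lambda>(v, w). tens V W v w) ?js)"
      unfolding xs by (induction xs) (auto simp: tensor_space_def tens_bilinear T.scale_right_distrib)
    moreover have "set ?js \<subseteq> carrier V \<times> carrier W"
      using xs(1) by (auto intro: vspace_closed(2)[OF VW(1)])
    ultimately have "tlift V W f (scale (tensor_space V W) c t) = sum_list (map (\<lambda>(v, w). f v w) ?js)"
      by (simp only: tlift_sum_list)
    also have "\<dots> = scale X c (sum_list (map (\<lambda>(v, w). f v w) xs))"
      using xs(1) by (induction xs) (use f in \<open>auto simp: X.scale_right_distrib bilin_on_def lin_on_def\<close>)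
    finally show ?thesis unfolding xs tlift_sum_list[OF xs(1)] .
  qed
  fix u assume "u \<in> carrier (tensor_space V W)"
  then obtain js where js: "set js \<subseteq> carrier V \<times> carrier W" "u = sum_list (map (\<lambda>(v, w). tens V W v w) js)"
    by (auto simp: tensor_space_def ts)
  show "tlift V W f (t + u) = tlift V W f t + tlift V W f u"
    using tlift_sum_list[where xs = "xs @ js"] xs js tlift_sum_list[OF xs(1)] tlift_sum_list[OF js(1)] by simp
qed

lemma tlift_unique:
  assumes "lin_on (tensor_space V W) X g"
    and "\<And>v w. v \<in> carrier V \<Longrightarrow> w \<in> carrier W \<Longrightarrow> g (tens V W v w) = f v w"
    and "t \<in> carrier (tensor_space V W)"
  shows "g t = tlift V W f t"
proof -
  interpret T: vector_space "tscale :: 'k \<Rightarrow> ('k, 'v, 'w) tensor \<Rightarrow> _" by (rule vector_space_tscale)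
  note ts = tensor_span_sum_list[OF is_vspaceD(2)[OF VW(1)] is_vspaceD(1)[OF VW(1)], of _ W]
  have z: "tscale 0 t = 0" for t :: "('k, 'v, 'w) tensor" by simp
  have z': "scale X 0 x = 0" for x using module.scale_zero_left is_vspaceD(1)[OF X]
    by (metis module_iff_vector_space)
  have g0: "g 0 = 0"
  proof -
    have "0 \<in> carrier (tensor_space V W)" by (simp add: tensor_space_def tensor_span_def T.span_zero)
    then have "g (tscale 0 0) = scale X 0 (g 0)"
      using assms(1) by (simp add: lin_on_def tensor_space_def del: T.scale_zero_left T.scale_zero_right)
    then show ?thesis by (simp only: z z')
  qed
  obtain xs where xs: "set xs \<subseteq> carrier V \<times> carrier W" "t = sum_list (map (\<lambda>(v, w). tens V W v w) xs)"
    using assms(3) by (auto simp: tensor_space_def ts)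
  have "g (sum_list (map (\<lambda>(v, w). tens V W v w) xs)) = sum_list (map (\<lambda>(v, w). f v w) xs)"
    using xs(1)
  proof (induction xs)
    case Nil then show ?case by (simp add: g0)
  next
    case (Cons i xs)
    obtain v w where i: "i = (v, w)" by (cases i)
    have "tens V W v w \<in> carrier (tensor_space V W)"
      using Cons.prems by (auto simp: i tensor_space_def tensor_span_def intro!: T.span_base)
    moreover have "sum_list (map (\<lambda>(v, w). tens V W v w) xs) \<in> carrier (tensor_space V W)"
      using Cons.prems by (auto simp: tensor_space_def ts)
    ultimately show ?case
      using Cons assms(1,2) by (simp add: i lin_on_def)
  qed
  then show ?thesis unfolding xs tlift_sum_list[OF xs(1)] .
qed

end


section \<open>Algebras, Hopf algebras and comodule algebras\<close>

record ('k, 'a) alg = "('k, 'a) vspace" +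
  mult :: "'a \<Rightarrow> 'a \<Rightarrow> 'a" (infixl \<open>\<odot>\<index>\<close> 70)
  one :: "'a" (\<open>\<one>\<index>\<close>)

locale kalgebra =
  fixes A :: "('k::field, 'a::ab_group_add, 'm) alg_scheme" (structure)
  assumes vspace: "is_vspace A"
    and mult_bilin: "bilin_on A A A (\<odot>)"
    and one_closed: "\<one> \<in> carrier A"
    and mult_assoc: "\<lbrakk>a \<in> carrier A; b \<in> carrier A; c \<in> carrier A\<rbrakk> \<Longrightarrow> (a \<odot> b) \<odot> c = a \<odot> (b \<odot> c)"
    and mult_one: "a \<in> carrier A \<Longrightarrow> \<one> \<odot> a = a" "a \<in> carrier A \<Longrightarrow> a \<odot> \<one> = a"

definition tensor_alg ::
  "('k::field, 'a::ab_group_add, 'm) alg_scheme \<Rightarrow> ('k, 'b::ab_group_add, 'n) alg_scheme \<Rightarrow>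
   ('k, ('k, 'a, 'b) tensor) alg"
where
  "tensor_alg A B = \<lparr>
     carrier = tensor_span A B (carrier A) (carrier B),
     scale = tscale,
     mult = (\<lambda>t t'. tlift A B (\<lambda>a b. tlift A B (\<lambda>a' b'. tens A B (a \<odot>\<^bsub>A\<^esub> a') (b \<odot>\<^bsub>B\<^esub> b')) t') t),
     one = tens A B \<one>\<^bsub>A\<^esub> \<one>\<^bsub>B\<^esub>\<rparr>"

record ('k, 'a) hopf = "('k, 'a) alg" +
  comult :: "'a \<Rightarrow> ('k, 'a, 'a) tensor"
  counit :: "'a \<Rightarrow> 'k"
  antipode :: "'a \<Rightarrow> 'a"

text \<open>
  Sweedler notation: \<open>sw2 H h (\<lambda>h1 h2. f h1 h2)\<close> is \<open>f(h\<^sub>1, h\<^sub>2)\<close> for bilinear \<open>f\<close>, and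
  \<open>sw3 H h (\<lambda>h1 h2 h3. f h1 h2 h3)\<close> is \<open>f(h\<^sub>1, h\<^sub>2, h\<^sub>3)\<close> for trilinear \<open>f\<close>.
\<close>

definition sw2 ::
  "('k::field, 'h::ab_group_add, 'm) hopf_scheme \<Rightarrow> 'h \<Rightarrow> ('h \<Rightarrow> 'h \<Rightarrow> 'x::ab_group_add) \<Rightarrow> 'x"
where
  "sw2 H h f = tlift H H f (comult H h)"

definition sw3 ::
  "('k::field, 'h::ab_group_add, 'm) hopf_scheme \<Rightarrow> 'h \<Rightarrow> ('h \<Rightarrow> 'h \<Rightarrow> 'h \<Rightarrow> 'x::ab_group_add) \<Rightarrow> 'x"
where
  "sw3 H h f = sw2 H h (\<lambda>a h3. sw2 H a (\<lambda>h1 h2. f h1 h2 h3))"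

text \<open>Coassociativity is stated in \<open>(H \<otimes> H) \<otimes> H\<close>.\<close>

locale hopf_algebra = kalgebra H
  for H :: "('k::field, 'h::ab_group_add, 'm) hopf_scheme" (structure) +
  assumes comult_lin: "lin_on H (tensor_space H H) (comult H)"
    and counit_add: "\<lbrakk>g \<in> carrier H; h \<in> carrier H\<rbrakk> \<Longrightarrow> counit H (g + h) = counit H g + counit H h"
    and counit_scale: "h \<in> carrier H \<Longrightarrow> counit H (scale H c h) = c * counit H h"
    and coassoc: "h \<in> carrier H \<Longrightarrow>
      sw2 H h (\<lambda>a h3. sw2 H a (\<lambda>h1 h2. tens (tensor_space H H) H (tens H H h1 h2) h3)) =
      sw2 H h (\<lambda>h1 a. sw2 H a (\<lambda>h2 h3. tens (tensor_space H H) H (tens H H h1 h2) h3))"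
    and counital: "h \<in> carrier H \<Longrightarrow> sw2 H h (\<lambda>h1 h2. scale H (counit H h1) h2) = h"
      "h \<in> carrier H \<Longrightarrow> sw2 H h (\<lambda>h1 h2. scale H (counit H h2) h1) = h"
    and comult_mult: "\<lbrakk>g \<in> carrier H; h \<in> carrier H\<rbrakk> \<Longrightarrow>
      comult H (g \<odot> h) = comult H g \<odot>\<^bsub>tensor_alg H H\<^esub> comult H h"
    and comult_one: "comult H \<one> = \<one>\<^bsub>tensor_alg H H\<^esub>"
    and counit_mult: "\<lbrakk>g \<in> carrier H; h \<in> carrier H\<rbrakk> \<Longrightarrow> counit H (g \<odot> h) = counit H g * counit H h"
    and counit_one: "counit H \<one> = 1"
    and antipode_lin: "lin_on H H (antipode H)"
    and antipode: "h \<in> carrier H \<Longrightarrow> sw2 H h (\<lambda>h1 h2. antipode H h1 \<odot> h2) = scale H (counit H h) \<one>"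
      "h \<in> carrier H \<Longrightarrow> sw2 H h (\<lambda>h1 h2. h1 \<odot> antipode H h2) = scale H (counit H h) \<one>"

text \<open>A right coaction \<open>\<rho>\<close> of \<open>H\<close> on \<open>A\<close> that is an algebra map \<open>A \<rightarrow> A \<otimes> H\<close>.\<close>

locale comodule_algebra = hopf_algebra H + A: kalgebra A
  for H :: "('k::field, 'h::ab_group_add, 'm) hopf_scheme"
    and A :: "('k, 'a::ab_group_add, 'n) alg_scheme"
    and \<rho> :: "'a \<Rightarrow> ('k, 'a, 'h) tensor" +
  assumes coact_lin: "lin_on A (tensor_space A H) \<rho>"
    and coact_coassoc: "a \<in> carrier A \<Longrightarrow>
      tlift A H (\<lambda>a0 h. tlift A H (\<lambda>x g. tens (tensor_space A H) H (tens A H x g) h) (\<rho> a0)) (\<rho> a) =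
      tlift A H (\<lambda>a0 h. sw2 H h (\<lambda>h1 h2. tens (tensor_space A H) H (tens A H a0 h1) h2)) (\<rho> a)"
    and coact_counital: "a \<in> carrier A \<Longrightarrow> tlift A H (\<lambda>a0 h. scale A (counit H h) a0) (\<rho> a) = a"
    and coact_mult: "\<lbrakk>a \<in> carrier A; b \<in> carrier A\<rbrakk> \<Longrightarrow>
      \<rho> (a \<odot>\<^bsub>A\<^esub> b) = \<rho> a \<odot>\<^bsub>tensor_alg A H\<^esub> \<rho> b"
    and coact_one: "\<rho> \<one>\<^bsub>A\<^esub> = \<one>\<^bsub>tensor_alg A H\<^esub>"


section \<open>Twisted module algebras and crossed products\<close>

definition conv_inverse ::
  "('k::field, 'h::ab_group_add, 'm) hopf_scheme \<Rightarrow> ('k, 'b::ab_group_add, 'n) alg_scheme \<Rightarrow>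
   ('h \<Rightarrow> 'h \<Rightarrow> 'b) \<Rightarrow> ('h \<Rightarrow> 'h \<Rightarrow> 'b) \<Rightarrow> bool"
where
  "conv_inverse H B \<sigma> \<tau> \<longleftrightarrow> bilin_on H H B \<tau> \<and>
     (\<forall>h\<in>carrier H. \<forall>g\<in>carrier H.
        sw2 H h (\<lambda>h1 h2. sw2 H g (\<lambda>g1 g2. \<sigma> h1 g1 \<odot>\<^bsub>B\<^esub> \<tau> h2 g2)) = scale B (counit H h * counit H g) \<one>\<^bsub>B\<^esub> \<and>
        sw2 H h (\<lambda>h1 h2. sw2 H g (\<lambda>g1 g2. \<tau> h1 g1 \<odot>\<^bsub>B\<^esub> \<sigma> h2 g2)) = scale B (counit H h * counit H g) \<one>\<^bsub>B\<^esub>)"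

locale twisted_module_algebra = hopf_algebra H + B: kalgebra B
  for H :: "('k::field, 'h::ab_group_add, 'm) hopf_scheme"
    and B :: "('k, 'b::ab_group_add, 'n) alg_scheme"
    and act :: "'h \<Rightarrow> 'b \<Rightarrow> 'b"
    and \<sigma> :: "'h \<Rightarrow> 'h \<Rightarrow> 'b" +
  assumes act_bilin: "bilin_on H B B act"
    and act_one: "h \<in> carrier H \<Longrightarrow> act h \<one>\<^bsub>B\<^esub> = scale B (counit H h) \<one>\<^bsub>B\<^esub>"
    and act_mult: "\<lbrakk>h \<in> carrier H; b \<in> carrier B; b' \<in> carrier B\<rbrakk> \<Longrightarrow>
      act h (b \<odot>\<^bsub>B\<^esub> b') = sw2 H h (\<lambda>h1 h2. act h1 b \<odot>\<^bsub>B\<^esub> act h2 b')"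
    and one_act: "b \<in> carrier B \<Longrightarrow> act \<one>\<^bsub>H\<^esub> b = b"
    and cocycle_bilin: "bilin_on H H B \<sigma>"
    and twisted_act: "\<exists>\<tau>. conv_inverse H B \<sigma> \<tau> \<and>
      (\<forall>h\<in>carrier H. \<forall>g\<in>carrier H. \<forall>b\<in>carrier B.
         act h (act g b) =
         sw3 H h (\<lambda>h1 h2 h3. sw3 H g (\<lambda>g1 g2 g3. (\<sigma> h1 g1 \<odot>\<^bsub>B\<^esub> act (h2 \<odot>\<^bsub>H\<^esub> g2) b) \<odot>\<^bsub>B\<^esub> \<tau> h3 g3)))"
    and cocycle_one: "h \<in> carrier H \<Longrightarrow> \<sigma> h \<one>\<^bsub>H\<^esub> = scale B (counit H h) \<one>\<^bsub>B\<^esub>"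
      "h \<in> carrier H \<Longrightarrow> \<sigma> \<one>\<^bsub>H\<^esub> h = scale B (counit H h) \<one>\<^bsub>B\<^esub>"
    and cocycle: "\<lbrakk>h \<in> carrier H; g \<in> carrier H; f \<in> carrier H\<rbrakk> \<Longrightarrow>
      sw2 H h (\<lambda>h1 h2. sw2 H g (\<lambda>g1 g2. sw2 H f (\<lambda>f1 f2.
        act h1 (\<sigma> g1 f1) \<odot>\<^bsub>B\<^esub> \<sigma> h2 (g2 \<odot>\<^bsub>H\<^esub> f2)))) =
      sw2 H h (\<lambda>h1 h2. sw2 H g (\<lambda>g1 g2. \<sigma> h1 g1 \<odot>\<^bsub>B\<^esub> \<sigma> (h2 \<odot>\<^bsub>H\<^esub> g2) f))"

definition crossed_product ::
  "('k::field, 'h::ab_group_add, 'm) hopf_scheme \<Rightarrow> ('k, 'b::ab_group_add, 'n) alg_scheme \<Rightarrow>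
   ('h \<Rightarrow> 'b \<Rightarrow> 'b) \<Rightarrow> ('h \<Rightarrow> 'h \<Rightarrow> 'b) \<Rightarrow> ('k, ('k, 'b, 'h) tensor) alg"
where
  "crossed_product H B act \<sigma> = \<lparr>
     carrier = tensor_span B H (carrier B) (carrier H),
     scale = tscale,
     mult = (\<lambda>t t'. tlift B H (\<lambda>b h. tlift B H (\<lambda>b' h'.
       sw3 H h (\<lambda>h1 h2 h3. sw2 H h' (\<lambda>h'1 h'2.
         tens B H ((b \<odot>\<^bsub>B\<^esub> act h1 b') \<odot>\<^bsub>B\<^esub> \<sigma> h2 h'1) (h3 \<odot>\<^bsub>H\<^esub> h'2)))) t') t),
     one = tens B H \<one>\<^bsub>B\<^esub> \<one>\<^bsub>H\<^esub>\<rparr>"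

text \<open>\<open>Id\<^sub>B \<otimes> \<Delta> : B \<otimes> H \<rightarrow> (B \<otimes> H) \<otimes> H\<close>\<close>

definition crossed_coaction ::
  "('k::field, 'h::ab_group_add, 'm) hopf_scheme \<Rightarrow> ('k, 'b::ab_group_add, 'n) alg_scheme \<Rightarrow>
   ('k, 'b, 'h) tensor \<Rightarrow> ('k, ('k, 'b, 'h) tensor, 'h) tensor"
where
  "crossed_coaction H B = tlift B H (\<lambda>b h. sw2 H h (\<lambda>h1 h2. tens (tensor_space B H) H (tens B H b h1) h2))"


section \<open>Differential calculi\<close>

text \<open>\<open>carrier \<Omega>\<close> is the total space \<open>\<Omega>\<^sup>\<bullet> = \<Oplus>\<^sub>n \<Omega>\<^sup>n\<close>, and \<open>deg \<Omega> n\<close> is \<open>\<Omega>\<^sup>n\<close>.\<close>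

record ('k, 'a) dga = "('k, 'a) alg" +
  deg :: "nat \<Rightarrow> 'a set"
  diff :: "'a \<Rightarrow> 'a"

definition signed :: "nat \<Rightarrow> 'a::ab_group_add \<Rightarrow> 'a" where
  "signed n x = (if even n then x else - x)"

locale dg_algebra = kalgebra \<Omega>
  for \<Omega> :: "('k::field, 'a::ab_group_add, 'm) dga_scheme" (structure) +
  assumes deg_subspace: "module.subspace (scale \<Omega>) (deg \<Omega> n)"
    and deg_total: "carrier \<Omega> = module.span (scale \<Omega>) (\<Union>n. deg \<Omega> n)"
    and deg_direct: "\<lbrakk>\<And>n. f n \<in> deg \<Omega> n; (\<Sum>n\<le>N. f n) = 0; n \<le> N\<rbrakk> \<Longrightarrow> f n = 0"
    and one_deg: "\<one> \<in> deg \<Omega> 0"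
    and mult_deg: "\<lbrakk>x \<in> deg \<Omega> m; y \<in> deg \<Omega> n\<rbrakk> \<Longrightarrow> x \<odot> y \<in> deg \<Omega> (m + n)"
    and diff_lin: "lin_on \<Omega> \<Omega> (diff \<Omega>)"
    and diff_deg: "x \<in> deg \<Omega> n \<Longrightarrow> diff \<Omega> x \<in> deg \<Omega> (Suc n)"
    and diff_diff: "x \<in> carrier \<Omega> \<Longrightarrow> diff \<Omega> (diff \<Omega> x) = 0"
    and leibniz: "\<lbrakk>x \<in> deg \<Omega> n; y \<in> carrier \<Omega>\<rbrakk> \<Longrightarrow>
      diff \<Omega> (x \<odot> y) = diff \<Omega> x \<odot> y + signed n (x \<odot> diff \<Omega> y)"

context dg_algebra
begin

abbreviation (input) decomposes :: "(nat \<Rightarrow> 'a) \<Rightarrow> 'a \<Rightarrow> bool" where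
  "decomposes F x \<equiv> (\<forall>n. F n \<in> deg \<Omega> n) \<and> (\<exists>N. (\<forall>n>N. F n = 0) \<and> x = (\<Sum>n\<le>N. F n))"

definition component :: "'a \<Rightarrow> nat \<Rightarrow> 'a" where
  "component x = (SOME F. decomposes F x)"

lemma decomposes_sum:
  assumes "decomposes F x" obtains N where "\<And>M. M \<ge> N \<Longrightarrow> x = (\<Sum>n\<le>M. F n)"
proof -
  obtain N where N: "\<forall>n>N. F n = 0" "x = (\<Sum>n\<le>N. F n)" using assms by blast
  have "x = (\<Sum>n\<le>M. F n)" if "M \<ge> N" for M
    unfolding N(2) using N(1) that by (intro sum.mono_neutral_left) auto
  then show thesis by (rule that)
qed

lemma decomposes_unique:
  assumes "decomposes F x" "decomposes G x"
  shows "F = G"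
proof
  interpret V: vector_space "scale \<Omega>" using vspace by (rule is_vspaceD)
  fix n
  obtain N where N: "\<And>M. M \<ge> N \<Longrightarrow> x = (\<Sum>n\<le>M. F n)" using decomposes_sum[OF assms(1)] by blast
  obtain N' where N': "\<And>M. M \<ge> N' \<Longrightarrow> x = (\<Sum>n\<le>M. G n)" using decomposes_sum[OF assms(2)] by blast
  define M where "M = max n (max N N')"
  have "F n - G n = 0"
  proof (rule deg_direct[where f = "\<lambda>n. F n - G n" and N = M])
    show "F n - G n \<in> deg \<Omega> n" for n
      using assms by (intro V.subspace_diff[OF deg_subspace]) blast+
    show "(\<Sum>n\<le>M. F n - G n) = 0"
      using N[of M] N'[of M] by (simp add: M_def sum_subtractf)
  qed (simp add: M_def)
  then show "F n = G n" by simp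
qed

lemma decomposes_add: "decomposes F x \<Longrightarrow> decomposes G y \<Longrightarrow> decomposes (\<lambda>n. F n + G n) (x + y)"
proof -
  interpret V: vector_space "scale \<Omega>" using vspace by (rule is_vspaceD)
  assume F: "decomposes F x" and G: "decomposes G y"
  obtain N1 N2 where N: "\<forall>n>N1. F n = 0" "\<forall>n>N2. G n = 0" using F G by blast
  obtain N where N': "\<And>M. M \<ge> N \<Longrightarrow> x = (\<Sum>n\<le>M. F n)" using decomposes_sum[OF F] by blast
  obtain N'' where N'': "\<And>M. M \<ge> N'' \<Longrightarrow> y = (\<Sum>n\<le>M. G n)" using decomposes_sum[OF G] by blast
  define M where "M = max (max N1 N2) (max N N'')"
  have "x + y = (\<Sum>n\<le>M. F n + G n)" "\<forall>n>M. F n + G n = 0"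
    using N'[of M, symmetric] N''[of M, symmetric] N by (simp_all add: M_def sum.distrib)
  moreover have "\<forall>n. F n + G n \<in> deg \<Omega> n"
    using F G by (auto intro: V.subspace_add[OF deg_subspace])
  ultimately show ?thesis by blast
qed

lemma decomposes_scale: "decomposes F x \<Longrightarrow> decomposes (\<lambda>n. scale \<Omega> c (F n)) (scale \<Omega> c x)"
proof -
  interpret V: vector_space "scale \<Omega>" using vspace by (rule is_vspaceD)
  assume F: "decomposes F x"
  then obtain N where "\<forall>n>N. F n = 0" "x = (\<Sum>n\<le>N. F n)" by blast
  then have "\<forall>n>N. scale \<Omega> c (F n) = 0" "scale \<Omega> c x = (\<Sum>n\<le>N. scale \<Omega> c (F n))"
    by (simp_all add: V.scale_sum_right)
  moreover have "\<forall>n. scale \<Omega> c (F n) \<in> deg \<Omega> n"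
    using F by (auto intro: V.subspace_scale[OF deg_subspace])
  ultimately show ?thesis by blast
qed

lemma decomposes_deg: "x \<in> deg \<Omega> p \<Longrightarrow> decomposes (\<lambda>n. if n = p then x else 0) x"
proof -
  interpret V: vector_space "scale \<Omega>" using vspace by (rule is_vspaceD)
  assume "x \<in> deg \<Omega> p"
  then have "\<forall>n. (if n = p then x else 0) \<in> deg \<Omega> n" by (auto intro: V.subspace_0[OF deg_subspace])
  moreover have "\<forall>n>p. (if n = p then x else 0) = 0" "x = (\<Sum>n\<le>p. if n = p then x else 0)" by auto
  ultimately show ?thesis by blast
qed

lemma decomposes_component:
  assumes "x \<in> carrier \<Omega>"
  shows "decomposes (component x) x"
proof -
  interpret V: vector_space "scale \<Omega>" using vspace by (rule is_vspaceD)
  have "x \<in> V.span (\<Union>n. deg \<Omega> n)" using assms by (simp add: deg_total)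
  then have "\<exists>F. decomposes F x"
  proof (induction rule: V.span_induct_alt)
    case base
    show ?case by (rule exI[of _ "\<lambda>_. 0"]) (simp add: V.subspace_0[OF deg_subspace])
  next
    case (step c x y)
    from step(1) obtain p where p: "x \<in> deg \<Omega> p" by blast
    from step(2) obtain F where F: "decomposes F y" by (rule exE)
    show ?case by (rule exI) (rule decomposes_add[OF decomposes_scale[OF decomposes_deg[OF p]] F])
  qed
  then show ?thesis unfolding component_def by (rule someI_ex)
qed

lemma deg_carrier: "x \<in> deg \<Omega> n \<Longrightarrow> x \<in> carrier \<Omega>"
proof -
  interpret V: vector_space "scale \<Omega>" using vspace by (rule is_vspaceD)
  show "x \<in> deg \<Omega> n \<Longrightarrow> x \<in> carrier \<Omega>" by (auto simp: deg_total intro: V.span_base)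
qed

lemma component_deg: "x \<in> deg \<Omega> p \<Longrightarrow> component x = (\<lambda>n. if n = p then x else 0)"
  by (rule decomposes_unique[OF decomposes_component[OF deg_carrier] decomposes_deg])

lemma component_add:
  assumes "x \<in> carrier \<Omega>" "y \<in> carrier \<Omega>"
  shows "component (x + y) n = component x n + component y n"
proof -
  have "component (x + y) = (\<lambda>n. component x n + component y n)"
    by (rule decomposes_unique[OF decomposes_component[OF vspace_closed(1)[OF vspace assms]]
      decomposes_add[OF decomposes_component[OF assms(1)] decomposes_component[OF assms(2)]]])
  then show ?thesis by simp
qed

lemma component_scale:
  assumes "x \<in> carrier \<Omega>"
  shows "component (scale \<Omega> c x) n = scale \<Omega> c (component x n)"
proof -
  have "component (scale \<Omega> c x) = (\<lambda>n. scale \<Omega> c (component x n))"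
    by (rule decomposes_unique[OF decomposes_component[OF vspace_closed(2)[OF vspace assms assms]]
      decomposes_scale[OF decomposes_component[OF assms]]])
  then show ?thesis by simp
qed

lemma component_closed: "x \<in> carrier \<Omega> \<Longrightarrow> component x n \<in> deg \<Omega> n"
  using decomposes_component by blast

end

fun wedge_list :: "('k, 'a, 'm) alg_scheme \<Rightarrow> 'a list \<Rightarrow> 'a" where
  "wedge_list \<Omega> [] = \<one>\<^bsub>\<Omega>\<^esub>"
| "wedge_list \<Omega> [x] = x"
| "wedge_list \<Omega> (x # y # ys) = x \<odot>\<^bsub>\<Omega>\<^esub> wedge_list \<Omega> (y # ys)"

locale calculus = A: kalgebra A + dg_algebra \<Omega>
  for A :: "('k::field, 'a::ab_group_add, 'm) alg_scheme"
    and \<Omega> :: "('k, 'a, 'n) dga_scheme" +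
  assumes scale_eq: "scale \<Omega> = scale A"
    and deg_zero: "deg \<Omega> 0 = carrier A"
    and mult_eq: "\<lbrakk>a \<in> carrier A; b \<in> carrier A\<rbrakk> \<Longrightarrow> a \<odot>\<^bsub>\<Omega>\<^esub> b = a \<odot>\<^bsub>A\<^esub> b"
    and one_eq: "\<one>\<^bsub>\<Omega>\<^esub> = \<one>\<^bsub>A\<^esub>"
    and generated: "deg \<Omega> n = module.span (scale \<Omega>)
      {wedge_list \<Omega> (a # map (diff \<Omega>) as) | a as. a \<in> carrier A \<and> set as \<subseteq> carrier A \<and> length as = n}"

locale covariant_calculus = comodule_algebra H A \<rho> + calculus A \<Omega>
  for H :: "('k::field, 'h::ab_group_add, 'm) hopf_scheme"
    and A :: "('k, 'a::ab_group_add, 'n) alg_scheme"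
    and \<rho> :: "'a \<Rightarrow> ('k, 'a, 'h) tensor"
    and \<Omega> :: "('k, 'a, 'p) dga_scheme" +
  assumes coaction: "\<exists>\<delta>. comodule_algebra H \<Omega> \<delta> \<and>
      (\<forall>n. \<forall>x\<in>deg \<Omega> n. \<delta> x \<in> tensor_span \<Omega> H (deg \<Omega> n) (carrier H)) \<and>
      (\<forall>a\<in>carrier A. \<delta> a = \<rho> a) \<and>
      (\<forall>x\<in>carrier \<Omega>. \<delta> (diff \<Omega> x) = tlift \<Omega> H (\<lambda>y h. tens \<Omega> H (diff \<Omega> y) h) (\<delta> x))"

definition dga_hom ::
  "('k::field, 'a::ab_group_add, 'm) dga_scheme \<Rightarrow> ('k, 'b::ab_group_add, 'n) dga_scheme \<Rightarrow> ('a \<Rightarrow> 'b) \<Rightarrow> bool"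
where
  "dga_hom \<Omega> \<Omega>' F \<longleftrightarrow> lin_on \<Omega> \<Omega>' F \<and>
     (\<forall>n. \<forall>x\<in>deg \<Omega> n. F x \<in> deg \<Omega>' n) \<and>
     (\<forall>x\<in>carrier \<Omega>. \<forall>y\<in>carrier \<Omega>. F (x \<odot>\<^bsub>\<Omega>\<^esub> y) = F x \<odot>\<^bsub>\<Omega>'\<^esub> F y) \<and>
     F \<one>\<^bsub>\<Omega>\<^esub> = \<one>\<^bsub>\<Omega>'\<^esub> \<and>
     (\<forall>x\<in>carrier \<Omega>. F (diff \<Omega> x) = diff \<Omega>' (F x))"

text \<open>
  Differentiability of a map \<open>f\<close> from the algebra \<open>\<Omega>\<^sup>0\<close> to the algebra \<open>\<Omega>'\<^sup>0\<close>. When \<open>\<Omega>\<close> is a calculus,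
  the extension is unique on \<open>carrier \<Omega>\<close>.
\<close>

definition differentiable ::
  "('k::field, 'a::ab_group_add, 'm) dga_scheme \<Rightarrow> ('k, 'b::ab_group_add, 'n) dga_scheme \<Rightarrow> ('a \<Rightarrow> 'b) \<Rightarrow> bool"
where
  "differentiable \<Omega> \<Omega>' f \<longleftrightarrow> (\<exists>F. dga_hom \<Omega> \<Omega>' F \<and> (\<forall>a\<in>deg \<Omega> 0. F a = f a))"

definition differential ::
  "('k::field, 'a::ab_group_add, 'm) dga_scheme \<Rightarrow> ('k, 'b::ab_group_add, 'n) dga_scheme \<Rightarrow> ('a \<Rightarrow> 'b) \<Rightarrow> 'a \<Rightarrow> 'b"
where
  "differential \<Omega> \<Omega>' f = (SOME F. dga_hom \<Omega> \<Omega>' F \<and> (\<forall>a\<in>deg \<Omega> 0. F a = f a))"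

text \<open>
  Linear extension of \<open>x \<otimes> y \<mapsto> f p x q y\<close>, given for homogeneous \<open>x\<close> of degree \<open>p\<close> and \<open>y\<close> of
  degree \<open>q\<close>, to \<open>\<Omega> \<otimes> \<Omega>'\<close> (see \<open>hlift_pure\<close>, \<open>hlift_add\<close>).
\<close>

definition hlift ::
  "('k::field, 'a::ab_group_add, 'm) dga_scheme \<Rightarrow> ('k, 'b::ab_group_add, 'n) dga_scheme \<Rightarrow>
   (nat \<Rightarrow> 'a \<Rightarrow> nat \<Rightarrow> 'b \<Rightarrow> 'x::ab_group_add) \<Rightarrow> ('k, 'a, 'b) tensor \<Rightarrow> 'x"
where
  "hlift \<Omega> \<Omega>' f = add_ext {(p, x, q, y). x \<in> deg \<Omega> p \<and> y \<in> deg \<Omega>' q}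
     (\<lambda>(p, x, q, y). tens \<Omega> \<Omega>' x y) (\<lambda>(p, x, q, y). f p x q y)"

lemma hlift_sum_list:
  fixes \<Omega> :: "('k::field, 'a::ab_group_add, 'm) dga_scheme"
    and \<Omega>' :: "('k, 'b::ab_group_add, 'n) dga_scheme"
    and X :: "('k, 'x::ab_group_add, 'p) vspace_scheme"
  assumes dga: "dg_algebra \<Omega>" "dg_algebra \<Omega>'" and X: "is_vspace X"
    and f: "\<And>p q. bilin_on (\<Omega>\<lparr>carrier := deg \<Omega> p\<rparr>) (\<Omega>'\<lparr>carrier := deg \<Omega>' q\<rparr>) X (\<lambda>x y. f p x q y)"
    and xs: "set xs \<subseteq> {(p, x, q, y). x \<in> deg \<Omega> p \<and> y \<in> deg \<Omega>' q}"
  shows "hlift \<Omega> \<Omega>' f (sum_list (map (\<lambda>(p, x, q, y). tens \<Omega> \<Omega>' x y) xs)) =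
    sum_list (map (\<lambda>(p, x, q, y). f p x q y) xs)"
  unfolding hlift_def
proof (rule add_ext_sum_list[OF xs])
  interpret A: dg_algebra \<Omega> by (rule dga)
  interpret B: dg_algebra \<Omega>' by (rule dga)
  interpret X: vector_space "scale X" using X by (rule is_vspaceD)
  obtain P where P: "Vector_Spaces.linear (scale \<Omega>) (scale \<Omega>) P"
    "\<And>v. P v \<in> carrier \<Omega>" "\<And>v. v \<in> carrier \<Omega> \<Longrightarrow> P v = v" using vspace_projection[OF A.vspace] by blast
  obtain Q where Q: "Vector_Spaces.linear (scale \<Omega>') (scale \<Omega>') Q"
    "\<And>v. Q v \<in> carrier \<Omega>'" "\<And>v. v \<in> carrier \<Omega>' \<Longrightarrow> Q v = v" using vspace_projection[OF B.vspace] by blast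
  have Pl: "P (x + y) = P x + P y" "P (scale \<Omega> c x) = scale \<Omega> c (P x)" for x y c
    using P(1) by (simp_all add: Vector_Spaces.linear_iff)
  have Ql: "Q (x + y) = Q x + Q y" "Q (scale \<Omega>' c x) = scale \<Omega>' c (Q x)" for x y c
    using Q(1) by (simp_all add: Vector_Spaces.linear_iff)
  have fl1: "f p (v + v') q w = f p v q w + f p v' q w" "f p (scale \<Omega> c v) q w = scale X c (f p v q w)"
    if "v \<in> deg \<Omega> p" "v' \<in> deg \<Omega> p" "w \<in> deg \<Omega>' q" for v v' w c p q
    using f[of p q] that unfolding bilin_on_def lin_on_def by simp_all
  have fl2: "f p v q (w + w') = f p v q w + f p v q w'" "f p v q (scale \<Omega>' c w) = scale X c (f p v q w)"
    if "v \<in> deg \<Omega> p" "w \<in> deg \<Omega>' q" "w' \<in> deg \<Omega>' q" for v w w' c p q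
    using f[of p q] that unfolding bilin_on_def lin_on_def by simp_all
  have zero: "0 \<in> deg \<Omega> p" "0 \<in> deg \<Omega>' q" for p q
    using A.deg_subspace B.deg_subspace is_vspaceD(1)[OF A.vspace] is_vspaceD(1)[OF B.vspace]
    by (metis module_iff_vector_space module.subspace_0)+
  have f0: "f p 0 q w = 0" if "w \<in> deg \<Omega>' q" for p q w
    using fl1(1)[OF zero(1) zero(1) that, of p] by simp
  have f0': "f p v q 0 = 0" if "v \<in> deg \<Omega> p" for p q v
    using fl2(1)[OF that zero(2) zero(2), of q] by simp
  fix js
  assume js: "set js \<subseteq> {(p, x, q, y). x \<in> deg \<Omega> p \<and> y \<in> deg \<Omega>' q}"
    "sum_list (map (\<lambda>(p, x, q, y). tens \<Omega> \<Omega>' x y) js) = sum_list (map (\<lambda>(p, x, q, y). tens \<Omega> \<Omega>' x y) xs)"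
  define ps where "ps = fst ` (set xs \<union> set js)"
  define qs where "qs = (\<lambda>i. fst (snd (snd i))) ` (set xs \<union> set js)"
  define g where "g v w = (\<Sum>p\<in>ps. \<Sum>q\<in>qs. f p (A.component (P v) p) q (B.component (Q w) q))" for v w
  have fin: "finite ps" "finite qs" by (simp_all add: ps_def qs_def)
  note cc = A.component_closed[OF P(2)] B.component_closed[OF Q(2)]
  have "sum_list (map (\<lambda>i. case i of (p, x, q, y) \<Rightarrow> f p x q y) js) =
    sum_list (map (\<lambda>i. case i of (p, x, q, y) \<Rightarrow> f p x q y) xs)"
  proof (rule tens_separation[where a = "\<lambda>(p, x, q, y). x" and b = "\<lambda>(p, x, q, y). y" and g = g
        and V = \<Omega> and W = \<Omega>' and X = X])
    show "vector_space (scale X)" by (rule is_vspaceD(1)[OF X])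
    show "Vector_Spaces.linear (scale \<Omega>') (scale X) (g v)" for v
      unfolding Vector_Spaces.linear_iff g_def
      using is_vspaceD(1)[OF B.vspace] is_vspaceD(1)[OF X]
      by (simp add: Ql B.component_add B.component_scale Q(2) fl2(1) fl2(2)[OF cc(1) cc(2) cc(2)] cc
        sum.distrib X.scale_sum_right)
    show "Vector_Spaces.linear (scale \<Omega>) (scale X) (\<lambda>v. g v w)" for w
      unfolding Vector_Spaces.linear_iff g_def
      using is_vspaceD(1)[OF A.vspace] is_vspaceD(1)[OF X]
      by (simp add: Pl A.component_add A.component_scale P(2) fl1(1) fl1(2)[OF cc(1) cc(1) cc(2)] cc
        sum.distrib X.scale_sum_right)
    show "(case i of (p, x, q, y) \<Rightarrow> f p x q y) = g (case i of (p, x, q, y) \<Rightarrow> x) (case i of (p, x, q, y) \<Rightarrow> y)"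
      if i: "i \<in> set xs \<union> set js" for i
    proof -
      obtain p x q y where ieq: "i = (p, x, q, y)" by (cases i)
      have xy: "x \<in> deg \<Omega> p" "y \<in> deg \<Omega>' q" using i js(1) xs by (auto simp: ieq)
      have pq: "p \<in> ps" "q \<in> qs" using i by (force simp: ps_def qs_def ieq)+
      have "g x y = (\<Sum>p'\<in>ps. \<Sum>q'\<in>qs. f p' (if p' = p then x else 0) q' (if q' = q then y else 0))"
        by (simp add: g_def P(3) Q(3) A.deg_carrier[OF xy(1)] B.deg_carrier[OF xy(2)]
          A.component_deg[OF xy(1)] B.component_deg[OF xy(2)])
      also have "\<dots> = (\<Sum>p'\<in>ps. if p' = p then f p x q y else 0)"
      proof (rule sum.cong[OF refl])
        fix p'
        have "(\<Sum>q'\<in>qs. f p' (if p' = p then x else 0) q' (if q' = q then y else 0)) =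
          (\<Sum>q'\<in>qs. if q' = q then (if p' = p then f p x q y else 0) else 0)"
          by (rule sum.cong[OF refl]) (use xy in \<open>auto simp: f0 f0' zero\<close>)
        then show "(\<Sum>q'\<in>qs. f p' (if p' = p then x else 0) q' (if q' = q then y else 0)) =
          (if p' = p then f p x q y else 0)" using fin pq by simp
      qed
      finally show ?thesis using fin pq by (simp add: ieq)
    qed
    have e: "(\<lambda>i. tens \<Omega> \<Omega>' (case i of (p, x, q, y) \<Rightarrow> x) (case i of (p, x, q, y) \<Rightarrow> y)) =
      (\<lambda>(p, x, q, y). tens \<Omega> \<Omega>' x y)" by (auto simp: fun_eq_iff)
    show "(\<Sum>i\<leftarrow>js. tens \<Omega> \<Omega>' (case i of (p, x, q, y) \<Rightarrow> x) (case i of (p, x, q, y) \<Rightarrow> y)) =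
      (\<Sum>i\<leftarrow>xs. tens \<Omega> \<Omega>' (case i of (p, x, q, y) \<Rightarrow> x) (case i of (p, x, q, y) \<Rightarrow> y))"
      unfolding e by (rule js(2))
  qed
  then show "sum_list (map (\<lambda>(p, x, q, y). f p x q y) js) = sum_list (map (\<lambda>(p, x, q, y). f p x q y) xs)" .
qed

lemma hlift_pure:
  fixes \<Omega> :: "('k::field, 'a::ab_group_add, 'm) dga_scheme"
    and \<Omega>' :: "('k, 'b::ab_group_add, 'n) dga_scheme"
    and X :: "('k, 'x::ab_group_add, 'p) vspace_scheme"
  assumes "dg_algebra \<Omega>" "dg_algebra \<Omega>'" "is_vspace X"
    and "\<And>p q. bilin_on (\<Omega>\<lparr>carrier := deg \<Omega> p\<rparr>) (\<Omega>'\<lparr>carrier := deg \<Omega>' q\<rparr>) X (\<lambda>x y. f p x q y)"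
    and "x \<in> deg \<Omega> p" "y \<in> deg \<Omega>' q"
  shows "hlift \<Omega> \<Omega>' f (tens \<Omega> \<Omega>' x y) = f p x q y"
  using hlift_sum_list[OF assms(1-4), of "[(p, x, q, y)]"] assms(5,6) by simp

lemma hlift_add:
  fixes \<Omega> :: "('k::field, 'a::ab_group_add, 'm) dga_scheme"
    and \<Omega>' :: "('k, 'b::ab_group_add, 'n) dga_scheme"
    and X :: "('k, 'x::ab_group_add, 'p) vspace_scheme"
  assumes "dg_algebra \<Omega>" "dg_algebra \<Omega>'" "is_vspace X"
    and "\<And>p q. bilin_on (\<Omega>\<lparr>carrier := deg \<Omega> p\<rparr>) (\<Omega>'\<lparr>carrier := deg \<Omega>' q\<rparr>) X (\<lambda>x y. f p x q y)"
    and st: "s \<in> tensor_span \<Omega> \<Omega>' (carrier \<Omega>) (carrier \<Omega>')" "t \<in> tensor_span \<Omega> \<Omega>' (carrier \<Omega>) (carrier \<Omega>')"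
  shows "hlift \<Omega> \<Omega>' f (s + t) = hlift \<Omega> \<Omega>' f s + hlift \<Omega> \<Omega>' f t"
proof -
  interpret A: dg_algebra \<Omega> by (rule assms)
  interpret B: dg_algebra \<Omega>' by (rule assms)
  let ?I = "{(p, x, q, y). x \<in> deg \<Omega> p \<and> y \<in> deg \<Omega>' q}"
  let ?t = "\<lambda>xs. sum_list (map (\<lambda>(p, x, q, y). tens \<Omega> \<Omega>' x y) xs)"
  have zero: "tens \<Omega> \<Omega>' 0 y = 0" "tens \<Omega> \<Omega>' x 0 = 0" for x y
    using tens_bilinear(1)[of \<Omega> \<Omega>' 0 0 y] tens_bilinear(2)[of \<Omega> \<Omega>' x 0 0] by simp_all
  have sumr: "tens \<Omega> \<Omega>' x (sum G S) = (\<Sum>q\<in>S. tens \<Omega> \<Omega>' x (G q))" for x G and S :: "nat set"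
    by (induction S rule: infinite_finite_induct) (simp_all add: zero tens_bilinear)
  have suml: "tens \<Omega> \<Omega>' (sum F S) y = (\<Sum>p\<in>S. tens \<Omega> \<Omega>' (F p) y)" for y F and S :: "nat set"
    by (induction S rule: infinite_finite_induct) (simp_all add: zero tens_bilinear)
  have pure: "\<exists>xs. set xs \<subseteq> ?I \<and> tens \<Omega> \<Omega>' x y = ?t xs" if xy: "x \<in> carrier \<Omega>" "y \<in> carrier \<Omega>'" for x y
  proof -
    obtain F N where F: "\<forall>n. F n \<in> deg \<Omega> n" "x = (\<Sum>n\<le>N. F n)"
      using A.decomposes_component[OF xy(1)] by blast
    obtain G M where G: "\<forall>n. G n \<in> deg \<Omega>' n" "y = (\<Sum>n\<le>M. G n)"
      using B.decomposes_component[OF xy(2)] by blast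
    let ?xs = "concat (map (\<lambda>p. map (\<lambda>q. (p, F p, q, G q)) [0..<Suc M]) [0..<Suc N])"
    have inner: "?t (map (\<lambda>q. (p, F p, q, G q)) [0..<Suc M]) = tens \<Omega> \<Omega>' (F p) y" for p
      unfolding G(2) sumr by (simp add: o_def sum_list_distinct_conv_sum_set atLeast0AtMost
        lessThan_Suc_atMost atLeast0LessThan del: upt_Suc)
    have conc: "?t (concat (map h ps)) = sum_list (map (\<lambda>p. ?t (h p)) ps)" for h and ps :: "nat list"
      by (induction ps) simp_all
    have "?t ?xs = (\<Sum>p\<leftarrow>[0..<Suc N]. tens \<Omega> \<Omega>' (F p) y)"
      unfolding conc inner ..
    also have "\<dots> = tens \<Omega> \<Omega>' x y"
      unfolding F(2) suml by (simp add: sum_list_distinct_conv_sum_set lessThan_Suc_atMost atLeast0LessThan del: upt_Suc)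
    finally show ?thesis
      by (intro exI[of _ ?xs]) (use F(1) G(1) in auto)
  qed
  have "\<exists>xs. set xs \<subseteq> ?I \<and> t = ?t xs" if t: "t \<in> tensor_span \<Omega> \<Omega>' (carrier \<Omega>) (carrier \<Omega>')" for t
  proof -
    obtain zs where zs: "set zs \<subseteq> carrier \<Omega> \<times> carrier \<Omega>'" "t = sum_list (map (\<lambda>(x, y). tens \<Omega> \<Omega>' x y) zs)"
      using t tensor_span_sum_list[OF is_vspaceD(2)[OF A.vspace] is_vspaceD(1)[OF A.vspace]] by metis
    show ?thesis unfolding zs(2) using zs(1)
    proof (induction zs)
      case Nil
      show ?case by (rule exI[of _ "[]"]) simp
    next
      case (Cons z zs)
      obtain x y where z: "z = (x, y)" by (cases z)
      obtain us where us: "set us \<subseteq> ?I" "tens \<Omega> \<Omega>' x y = ?t us"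
        using pure[of x y] Cons.prems unfolding z by (meson SigmaD1 SigmaD2 list.set_intros(1) subsetD)
      obtain vs where vs: "set vs \<subseteq> ?I" "sum_list (map (\<lambda>(x, y). tens \<Omega> \<Omega>' x y) zs) = ?t vs"
        using Cons.IH Cons.prems by (meson set_subset_Cons subset_trans)
      show ?case by (rule exI[of _ "us @ vs"]) (use us vs z in auto)
    qed
  qed
  from this[OF st(1)] this[OF st(2)] obtain us vs where
    us: "set us \<subseteq> ?I" "s = ?t us" and vs: "set vs \<subseteq> ?I" "t = ?t vs" by blast
  have "set (us @ vs) \<subseteq> ?I" using us vs by simp
  from hlift_sum_list[OF assms(1-4) this] show ?thesis
    unfolding us(2) vs(2)
    by (simp add: hlift_sum_list[OF assms(1-4) us(1)] hlift_sum_list[OF assms(1-4) vs(1)])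
qed

definition tensor_deg ::
  "('k::field, 'a::ab_group_add, 'm) dga_scheme \<Rightarrow> ('k, 'b::ab_group_add, 'n) dga_scheme \<Rightarrow>
   nat \<Rightarrow> ('k, 'a, 'b) tensor set"
where
  "tensor_deg \<Omega> \<Omega>' n = module.span tscale (\<Union>k\<le>n. tensor_span \<Omega> \<Omega>' (deg \<Omega> (n - k)) (deg \<Omega>' k))"

definition tensor_diff ::
  "('k::field, 'a::ab_group_add, 'm) dga_scheme \<Rightarrow> ('k, 'b::ab_group_add, 'n) dga_scheme \<Rightarrow>
   ('k, 'a, 'b) tensor \<Rightarrow> ('k, 'a, 'b) tensor"
where
  "tensor_diff \<Omega> \<Omega>' = hlift \<Omega> \<Omega>' (\<lambda>p x q y.
     tens \<Omega> \<Omega>' (diff \<Omega> x) y + signed p (tens \<Omega> \<Omega>' x (diff \<Omega>' y)))"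

definition tensor_dga ::
  "('k::field, 'a::ab_group_add, 'm) dga_scheme \<Rightarrow> ('k, 'b::ab_group_add, 'n) dga_scheme \<Rightarrow>
   ('k, ('k, 'a, 'b) tensor) dga"
where
  "tensor_dga \<Omega> \<Omega>' = \<lparr>
     carrier = tensor_span \<Omega> \<Omega>' (carrier \<Omega>) (carrier \<Omega>'),
     scale = tscale,
     mult = (\<lambda>t t'. hlift \<Omega> \<Omega>' (\<lambda>p x q y. hlift \<Omega> \<Omega>' (\<lambda>p' x' q' y'.
       signed (q * p') (tens \<Omega> \<Omega>' (x \<odot>\<^bsub>\<Omega>\<^esub> x') (y \<odot>\<^bsub>\<Omega>'\<^esub> y'))) t') t),
     one = tens \<Omega> \<Omega>' \<one>\<^bsub>\<Omega>\<^esub> \<one>\<^bsub>\<Omega>'\<^esub>,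
     deg = tensor_deg \<Omega> \<Omega>',
     diff = tensor_diff \<Omega> \<Omega>'\<rparr>"


section \<open>Twisted module calculi and the crossed product calculus\<close>

text \<open>\<open>(h\<^sub>1 \<cdot> x\<^sub>1) \<and> \<dots> \<and> (h\<^sub>n \<cdot> x\<^sub>n)\<close> for a nonempty list of forms\<close>

fun act_list ::
  "('k::field, 'h::ab_group_add, 'm) hopf_scheme \<Rightarrow> ('k, 'b::ab_group_add, 'n) alg_scheme \<Rightarrow>
   ('h \<Rightarrow> 'b \<Rightarrow> 'b) \<Rightarrow> 'h \<Rightarrow> 'b list \<Rightarrow> 'b"
where
  "act_list H \<Omega> act h [] = scale \<Omega> (counit H h) \<one>\<^bsub>\<Omega>\<^esub>"
| "act_list H \<Omega> act h [x] = act h x"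
| "act_list H \<Omega> act h (x # y # ys) = sw2 H h (\<lambda>h1 h2. act h1 x \<odot>\<^bsub>\<Omega>\<^esub> act_list H \<Omega> act h2 (y # ys))"

text \<open>
  One function \<open>act\<close> is used for the measure \<open>H \<otimes> B \<rightarrow> B\<close> (on \<open>B = \<Omega>\<^sup>0(B)\<close>) and for the maps
  \<open>H \<otimes> \<Omega>\<^sup>n(B) \<rightarrow> \<Omega>\<^sup>n(B)\<close>; the latter are determined by the former.
\<close>

locale twisted_module_calculus = twisted_module_algebra H B act \<sigma> + calculus B \<Omega>
  for H :: "('k::field, 'h::ab_group_add, 'm) hopf_scheme"
    and B :: "('k, 'b::ab_group_add, 'n) alg_scheme"
    and act :: "'h \<Rightarrow> 'b \<Rightarrow> 'b"
    and \<sigma> :: "'h \<Rightarrow> 'h \<Rightarrow> 'b"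
    and \<Omega> :: "('k, 'b, 'p) dga_scheme" +
  assumes act_forms_bilin: "bilin_on H \<Omega> \<Omega> act"
    and act_deg: "\<lbrakk>h \<in> carrier H; x \<in> deg \<Omega> n\<rbrakk> \<Longrightarrow> act h x \<in> deg \<Omega> n"
    and act_forms: "\<lbrakk>h \<in> carrier H; b \<in> carrier B; set bs \<subseteq> carrier B\<rbrakk> \<Longrightarrow>
      act h (wedge_list \<Omega> (b # map (diff \<Omega>) bs)) = act_list H \<Omega> act h (b # map (diff \<Omega>) bs)"
    and act_diff: "\<lbrakk>h \<in> carrier H; b \<in> carrier B\<rbrakk> \<Longrightarrow> act h (diff \<Omega> b) = diff \<Omega> (act h b)"
    and diff_cocycle: "\<lbrakk>h \<in> carrier H; g \<in> carrier H\<rbrakk> \<Longrightarrow> diff \<Omega> (\<sigma> h g) = 0"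

definition dcomult ::
  "('k::field, 'h::ab_group_add, 'm) hopf_scheme \<Rightarrow> ('k, 'h, 'n) dga_scheme \<Rightarrow> 'h \<Rightarrow> ('k, 'h, 'h) tensor"
where
  "dcomult H \<Omega> = differential \<Omega> (tensor_dga \<Omega> \<Omega>) (comult H)"

text \<open>
  \<open>lcoact2 H \<Omega> \<gamma> (\<lambda>a g. f a g)\<close> is \<open>f(\<gamma>\<^sub>-\<^sub>1, \<gamma>\<^sub>0)\<close> and \<open>lcoact3 H \<Omega> \<gamma> (\<lambda>a b g. f a b g)\<close> is
  \<open>f(\<gamma>\<^sub>-\<^sub>2, \<gamma>\<^sub>-\<^sub>1, \<gamma>\<^sub>0)\<close>, where \<open>\<gamma>\<^sub>-\<^sub>1 \<otimes> \<gamma>\<^sub>0\<close> is the component of the differential of \<open>\<Delta>\<close>, evaluated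
  at \<open>\<gamma>\<close>, whose first leg has degree \<open>0\<close>.
\<close>

definition lcoact ::
  "('k::field, 'h::ab_group_add, 'm) hopf_scheme \<Rightarrow> ('k, 'h, 'n) dga_scheme \<Rightarrow> 'h \<Rightarrow> ('k, 'h, 'h) tensor"
where
  "lcoact H \<Omega> \<gamma> = hlift \<Omega> \<Omega> (\<lambda>p x q y. if p = 0 then tens \<Omega> \<Omega> x y else 0) (dcomult H \<Omega> \<gamma>)"

definition lcoact2 ::
  "('k::field, 'h::ab_group_add, 'm) hopf_scheme \<Rightarrow> ('k, 'h, 'n) dga_scheme \<Rightarrow> 'h \<Rightarrow>
   ('h \<Rightarrow> 'h \<Rightarrow> 'x::ab_group_add) \<Rightarrow> 'x"
where
  "lcoact2 H \<Omega> \<gamma> f = tlift H \<Omega> f (lcoact H \<Omega> \<gamma>)"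

definition lcoact3 ::
  "('k::field, 'h::ab_group_add, 'm) hopf_scheme \<Rightarrow> ('k, 'h, 'n) dga_scheme \<Rightarrow> 'h \<Rightarrow>
   ('h \<Rightarrow> 'h \<Rightarrow> 'h \<Rightarrow> 'x::ab_group_add) \<Rightarrow> 'x"
where
  "lcoact3 H \<Omega> \<gamma> f = lcoact2 H \<Omega> \<gamma> (\<lambda>c g. sw2 H c (\<lambda>a b. f a b g))"

definition crossed_calculus ::
  "('k::field, 'h::ab_group_add, 'm) hopf_scheme \<Rightarrow> ('k, 'b::ab_group_add, 'n) dga_scheme \<Rightarrow>
   ('k, 'h, 'p) dga_scheme \<Rightarrow> ('h \<Rightarrow> 'b \<Rightarrow> 'b) \<Rightarrow> ('h \<Rightarrow> 'h \<Rightarrow> 'b) \<Rightarrow> ('k, ('k, 'b, 'h) tensor) dga"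
where
  "crossed_calculus H \<Omega>B \<Omega>H act \<sigma> = \<lparr>
     carrier = tensor_span \<Omega>B \<Omega>H (carrier \<Omega>B) (carrier \<Omega>H),
     scale = tscale,
     mult = (\<lambda>t t'. hlift \<Omega>B \<Omega>H (\<lambda>i \<omega> j \<gamma>. hlift \<Omega>B \<Omega>H (\<lambda>k \<omega>' l \<gamma>'.
       signed (j * k) (lcoact3 H \<Omega>H \<gamma> (\<lambda>a b g. lcoact2 H \<Omega>H \<gamma>' (\<lambda>c g'.
         tens \<Omega>B \<Omega>H ((\<omega> \<odot>\<^bsub>\<Omega>B\<^esub> act a \<omega>') \<odot>\<^bsub>\<Omega>B\<^esub> \<sigma> b c) (g \<odot>\<^bsub>\<Omega>H\<^esub> g'))))) t') t),
     one = tens \<Omega>B \<Omega>H \<one>\<^bsub>\<Omega>B\<^esub> \<one>\<^bsub>\<Omega>H\<^esub>,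
     deg = tensor_deg \<Omega>B \<Omega>H,
     diff = tensor_diff \<Omega>B \<Omega>H\<rparr>"

end

theory Submission
  imports Defs
begin

text \<open>
  The differential of \<open>\<Delta>\<close> is a coassociative coproduct on \<open>\<Omega>\<^sup>\<bullet>(H)\<close>: both of its iterates are
  morphisms of differential graded algebras that agree in degree zero, and degree zero generates. The left
  coaction \<open>\<gamma>\<^sub>-\<^sub>1 \<otimes> \<gamma>\<^sub>0\<close> is the component of this coproduct whose first leg has degree zero. Once the
  action and \<open>\<sigma>\<close> are extended by zero to forms on \<open>H\<close> of positive degree, the full coproduct may replace
  the coactions everywhere, and all identities between iterated coactions become instances of
  one law, \<open>coassoc\<close>. All operations are moreover made total by precomposition with a linear
  projection onto the carrier, and the Koszul sign \<open>(-1)\<^bsup>jk\<^esup>\<close> is written by splitting one form into its even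
  and odd parts and applying the sign automorphism to the other. Both sides of every identity
  are then multilinear expressions in arbitrary elements, without degrees or membership hypotheses.

  The product of the crossed product calculus is composed of the braiding
  \<open>\<gamma> \<otimes> \<omega> \<mapsto> (-1)\<^bsup>|\<gamma>||\<omega>|\<^esup> (\<gamma>\<^sub>-\<^sub>1 \<cdot> \<omega>) \<otimes> \<gamma>\<^sub>0\<close> and the cocycle product
  \<open>\<gamma> \<otimes> \<delta> \<mapsto> \<sigma>(\<gamma>\<^sub>-\<^sub>1 \<otimes> \<delta>\<^sub>-\<^sub>1) \<otimes> \<gamma>\<^sub>0 \<and> \<delta>\<^sub>0\<close>. Its associativity follows formally from three properties of these maps,
  which express the three algebraic axioms: \<open>braid_mult\<close> (the measure is multiplicative), \<open>cup_assoc\<close>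
  (the cocycle identity) and \<open>braid_twist\<close> (the twisted module condition). For this the axioms have to be lifted
  from \<open>B\<close> to forms on \<open>B\<close>. The action on forms is multiplicative and commutes with the differential (\<open>ac_mult\<close>,
  \<open>ac_td\<close>); the twisted module condition, convolved with \<open>\<sigma>\<close> from the right so that \<open>\<sigma>\<inverse>\<close> disappears,
  is preserved by products and, because \<open>d \<circ> \<sigma> = 0\<close>, by the differential (\<open>twist\<close>). The Leibniz rule holds because
  braiding and cocycle product commute with the total differentials (\<open>braid_diff\<close>, \<open>cup_diff\<close>).

  The calculus is generated by \<open>B \<otimes> H\<close>: the forms \<open>\<omega> \<otimes> 1\<close> are clearly generated, but
  \<open>(1 \<otimes> \<gamma>) \<and> (1 \<otimes> dh)\<close> differs from \<open>1 \<otimes> \<gamma> \<and> dh\<close> by a value of \<open>\<sigma>\<close>, and the convolution inverse of \<open>\<sigma>\<close> is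
  what undoes this (\<open>cup_inverse\<close>, \<open>subalgebra_total\<close>).

  Finally \<open>\<omega> \<otimes> \<gamma> \<mapsto> \<omega> \<otimes> \<gamma>\<^sub>[\<^sub>1\<^sub>] \<otimes> \<gamma>\<^sub>[\<^sub>2\<^sub>]\<close> is a morphism of differential graded algebras extending \<open>\<rho>\<close>, since
  braiding and cocycle product are compatible with the coproduct of their second leg (\<open>braid_comult\<close>,
  \<open>cup_comult\<close>). It is therefore the differential of \<open>\<rho>\<close>, and the coaction on the calculus is its
  component with last leg of degree zero: restriction to this component preserves products, coassociativity is
  again \<open>coassoc\<close>, and colinearity of the differential is the degree zero part of
  compatibility with the differentials.
\<close>

section \<open>Multilinear maps and finite sums of pure tensors\<close>

abbreviation lin :: "('k::field \<Rightarrow> 'v \<Rightarrow> 'v) \<Rightarrow> ('k \<Rightarrow> 'x \<Rightarrow> 'x) \<Rightarrow> ('v::ab_group_add \<Rightarrow> 'x::ab_group_add) \<Rightarrow> bool"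
  where "lin \<equiv> Vector_Spaces.linear"

definition bil ::
  "('k::field \<Rightarrow> 'v \<Rightarrow> 'v) \<Rightarrow> ('k \<Rightarrow> 'w \<Rightarrow> 'w) \<Rightarrow> ('k \<Rightarrow> 'x \<Rightarrow> 'x) \<Rightarrow>
   ('v::ab_group_add \<Rightarrow> 'w::ab_group_add \<Rightarrow> 'x::ab_group_add) \<Rightarrow> bool"
where
  "bil sV sW sX f \<longleftrightarrow> (\<forall>w. lin sV sX (\<lambda>v. f v w)) \<and> (\<forall>v. lin sW sX (f v))"

definition tril ::
  "('k::field \<Rightarrow> 'v \<Rightarrow> 'v) \<Rightarrow> ('k \<Rightarrow> 'x \<Rightarrow> 'x) \<Rightarrow>
   ('v::ab_group_add \<Rightarrow> 'v \<Rightarrow> 'v \<Rightarrow> 'x::ab_group_add) \<Rightarrow> bool"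
where
  "tril s sX G \<longleftrightarrow> (\<forall>b c. lin s sX (\<lambda>a. G a b c)) \<and> (\<forall>a c. lin s sX (\<lambda>b. G a b c)) \<and>
     (\<forall>a b. lin s sX (G a b))"

text \<open>
  Rules that decompose the linearity of an expression in one variable along the structure of the expression.
\<close>

named_theorems multilin

lemma linI:
  "vector_space s \<Longrightarrow> vector_space s' \<Longrightarrow> (\<And>x y. f (x + y) = f x + f y) \<Longrightarrow>
    (\<And>c x. f (s c x) = s' c (f x)) \<Longrightarrow> lin s s' f"
  by (simp add: Vector_Spaces.linear_iff)

lemma lin_add: "lin s s' f \<Longrightarrow> f (x + y) = f x + f y"
  and lin_scale: "lin s s' f \<Longrightarrow> f (s c x) = s' c (f x)"
  and lin_vs: "lin s s' f \<Longrightarrow> vector_space s" "lin s s' f \<Longrightarrow> vector_space s'"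
  by (simp_all add: Vector_Spaces.linear_iff)

lemma lin_0: "lin s s' f \<Longrightarrow> f 0 = 0"
  using lin_add[of s s' f 0 0] by simp

lemma lin_minus: "lin s s' f \<Longrightarrow> f (- x) = - f x"
  using lin_add[of s s' f x "- x"] lin_0[of s s' f] by (simp add: eq_neg_iff_add_eq_0 add.commute)

lemma lin_diff: "lin s s' f \<Longrightarrow> f (x - y) = f x - f y"
  using lin_add[of s s' f x "- y"] lin_minus[of s s' f y] by simp

lemma lin_sum: "lin s s' f \<Longrightarrow> f (sum g I) = (\<Sum>i\<in>I. f (g i))"
  by (induction I rule: infinite_finite_induct) (simp_all add: lin_0 lin_add)

lemma lin_comp: "lin s' s'' f \<Longrightarrow> lin s s' g \<Longrightarrow> lin s s'' (\<lambda>x. f (g x))"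
  using Vector_Spaces.linear_compose[of s s' g s'' f] by (simp add: o_def)

lemma lin_ident: "vector_space s \<Longrightarrow> lin s s (\<lambda>x. x)"
  by (simp add: Vector_Spaces.linear_iff)

lemma lin_zero: "vector_space s \<Longrightarrow> vector_space s' \<Longrightarrow> lin s s' (\<lambda>x. 0)"
  by (rule linI) (simp_all add: module.scale_zero_right module_iff_vector_space)

lemma lin_plus [multilin]: "lin s s' f \<Longrightarrow> lin s s' g \<Longrightarrow> lin s s' (\<lambda>x. f x + g x)"
  by (rule linI) (auto simp: lin_vs lin_add lin_scale vector_space.vector_space_assms(1)[OF lin_vs(2)])

lemma lin_uminus [multilin]: "lin s s' f \<Longrightarrow> lin s s' (\<lambda>x. - f x)"
  by (rule linI) (auto simp: lin_vs lin_add lin_scale module.scale_minus_right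
    vector_space.vector_space_assms(1)[OF lin_vs(2)] module_iff_vector_space)

lemma lin_minus_fun [multilin]: "lin s s' f \<Longrightarrow> lin s s' g \<Longrightarrow> lin s s' (\<lambda>x. f x - g x)"
  using lin_plus[OF _ lin_uminus] by fastforce

lemma lin_signed_fun [multilin]: "lin s s' f \<Longrightarrow> lin s s' (\<lambda>x. signed n (f x))"
  by (cases "even n") (auto simp: signed_def intro: lin_uminus)

lemma lin_setsum [multilin]:
  "vector_space s \<Longrightarrow> vector_space s' \<Longrightarrow> (\<And>i. i \<in> I \<Longrightarrow> lin s s' (\<lambda>x. f x i)) \<Longrightarrow> lin s s' (\<lambda>x. \<Sum>i\<in>I. f x i)"
proof (induction I rule: infinite_finite_induct)
  case (insert i I)
  then show ?case by (simp add: lin_plus)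
qed (simp_all add: lin_zero)

lemma lin_scaled: "lin s s' f \<Longrightarrow> lin s s' (\<lambda>x. s' c (f x))"
  by (rule linI) (auto simp: lin_vs lin_add lin_scale vector_space.vector_space_assms(1)[OF lin_vs(2)]
    vector_space.vector_space_assms(3)[OF lin_vs(2)] mult.commute)

lemma lin_scaled_const: "vector_space s' \<Longrightarrow> lin s (*) f \<Longrightarrow> lin s s' (\<lambda>x. s' (f x) v)"
  by (rule linI) (auto simp: lin_vs lin_add lin_scale vector_space.vector_space_assms)

lemma bilI: "(\<And>w. lin sV sX (\<lambda>v. f v w)) \<Longrightarrow> (\<And>v. lin sW sX (\<lambda>w. f v w)) \<Longrightarrow> bil sV sW sX f"
  by (simp add: bil_def)

lemma bil_left: "bil sV sW sX f \<Longrightarrow> lin s sV g \<Longrightarrow> lin s sX (\<lambda>x. f (g x) w)"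
  and bil_right: "bil sV sW sX f \<Longrightarrow> lin s sW h \<Longrightarrow> lin s sX (\<lambda>x. f v (h x))"
  by (auto simp: bil_def intro: lin_comp[of _ _ "\<lambda>v. f v w" for w] lin_comp[of _ _ "f v" for v])

lemma bilD:
  assumes "bil sV sW sX f"
  shows "f (v + v') w = f v w + f v' w" "f (sV c v) w = sX c (f v w)"
    "f v (w + w') = f v w + f v w'" "f v (sW c w) = sX c (f v w)"
  using assms lin_add[of sV sX "\<lambda>v. f v w"] lin_add[of sW sX "f v"]
    lin_scale[of sV sX "\<lambda>v. f v w"] lin_scale[of sW sX "f v"] by (auto simp: bil_def)

lemma trilI: "(\<And>b c. lin s sX (\<lambda>a. G a b c)) \<Longrightarrow> (\<And>a c. lin s sX (\<lambda>b. G a b c)) \<Longrightarrow>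
    (\<And>a b. lin s sX (\<lambda>c. G a b c)) \<Longrightarrow> tril s sX G"
  by (simp add: tril_def)

lemma tril_lin: "tril s sX G \<Longrightarrow> lin s' s g \<Longrightarrow> lin s' sX (\<lambda>x. G (g x) b c)"
    "tril s sX G \<Longrightarrow> lin s' s g \<Longrightarrow> lin s' sX (\<lambda>x. G a (g x) c)"
    "tril s sX G \<Longrightarrow> lin s' s g \<Longrightarrow> lin s' sX (\<lambda>x. G a b (g x))"
  unfolding tril_def using lin_comp[of s sX "\<lambda>v. G v b c"] lin_comp[of s sX "\<lambda>v. G a v c"]
    lin_comp[of s sX "G a b"] by auto

text \<open>
  Sums over finite lists of pairs stand for the implicit summation of Sweedler notation. Unlike
  maps induced on tensor products they are defined for arbitrary summands, so that exchanging two
  summations carries no side condition.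
\<close>

definition lsum :: "('a \<times> 'b) list \<Rightarrow> ('a \<Rightarrow> 'b \<Rightarrow> 'x::ab_group_add) \<Rightarrow> 'x" where
  "lsum xs f = (\<Sum>(a, b)\<leftarrow>xs. f a b)"

lemma lsum_simps [simp]:
  "lsum [] f = 0" "lsum ((a, b) # xs) f = f a b + lsum xs f" "lsum (xs @ ys) f = lsum xs f + lsum ys f"
  "lsum xs (\<lambda>a b. 0) = 0"
proof -
  show "lsum xs (\<lambda>a b. 0) = 0" by (induction xs) (auto simp: lsum_def)
qed (simp_all add: lsum_def)

lemma lsum_add: "lsum xs (\<lambda>a b. f a b + g a b) = lsum xs f + lsum xs g"
  by (induction xs) auto

lemma lsum_neg: "lsum xs (\<lambda>a b. - f a b) = - lsum xs f"
  by (induction xs) auto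

lemma lsum_diff: "lsum xs (\<lambda>a b. f a b - g a b) = lsum xs f - lsum xs g"
  by (induction xs) auto

lemma lsum_swap: "lsum xs (\<lambda>a b. lsum ys (\<lambda>c d. f a b c d)) = lsum ys (\<lambda>c d. lsum xs (\<lambda>a b. f a b c d))"
  by (induction xs) (auto simp: lsum_add)

lemma lsum_map: "lsum (map (\<lambda>(a, b). (g a, h b)) xs) f = lsum xs (\<lambda>a b. f (g a) (h b))"
  by (induction xs) auto

lemma lsum_cong:
  "(\<And>a b. (a, b) \<in> set xs \<Longrightarrow> f a b = g a b) \<Longrightarrow> lsum xs f = lsum xs g"
  by (induction xs) auto

lemma lin_lsum [multilin]:
  "vector_space s \<Longrightarrow> vector_space s' \<Longrightarrow> (\<And>a b. lin s s' (\<lambda>v. f v a b)) \<Longrightarrow> lin s s' (\<lambda>v. lsum xs (f v))"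
proof (induction xs)
  case (Cons z xs)
  then show ?case by (cases z) (simp add: lin_plus)
qed (simp add: lin_zero)

lemma lin_pull: "lin s s' \<phi> \<Longrightarrow> \<phi> (lsum xs f) = lsum xs (\<lambda>a b. \<phi> (f a b))"
  by (induction xs) (auto simp: lin_0 lin_add)

lemma lin_vimage_subspace:
  assumes L: "lin s s' L" and K: "module.subspace s' K"
  shows "module.subspace s {x. L x \<in> K}"
proof -
  interpret V: vector_space s by (rule lin_vs[OF L])
  interpret X: vector_space s' by (rule lin_vs[OF L])
  show ?thesis
    by (intro V.subspaceI) (auto simp: lin_0[OF L] lin_add[OF L] lin_scale[OF L]
      intro: X.subspace_0[OF K] X.subspace_add[OF K] X.subspace_scale[OF K])
qed

lemma lin_equalizer_subspace:
  assumes f: "lin s s' f" and g: "lin s s' g"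
  shows "module.subspace s {x. f x = g x}"
proof -
  interpret V: vector_space s by (rule lin_vs[OF f])
  show ?thesis
    by (intro V.subspaceI) (auto simp: lin_0[OF f] lin_0[OF g] lin_add[OF f] lin_add[OF g] lin_scale[OF f] lin_scale[OF g])
qed

lemma tens_cong: "scale V = scale V' \<Longrightarrow> scale W = scale W' \<Longrightarrow> tens V W = tens V' W'"
  unfolding tens_def by presburger

lemma tens_lin:
  assumes "vector_space (scale V)" "vector_space (scale W)"
  shows "bil (scale V) (scale W) tscale (tens V W)"
  using assms vector_space_tscale by (intro bilI linI) (simp_all add: tens_bilinear)

lemma tens_zero [simp]: "tens V W 0 y = 0" "tens V W x 0 = 0"
  using tens_bilinear(1)[of V W 0 0 y] tens_bilinear(2)[of V W x 0 0] by simp_all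

lemma tens_neg: "tens V W (- x) y = - tens V W x y" "tens V W x (- y) = - tens V W x y"
  using tens_bilinear(1)[of V W x "- x" y] tens_bilinear(2)[of V W x y "- y"]
  by (simp_all add: eq_neg_iff_add_eq_0 add.commute)

text \<open>
  A bilinear map factors through a linear map that is defined on all elements of the type
  \<^typ>\<open>('k, 'v, 'w) tensor\<close>: an identity between sums of pure tensors may thus be turned into an
  identity between the values of an arbitrary bilinear map.
\<close>

lemma bil_factors:
  fixes V :: "('k::field, 'v::ab_group_add, 'm) vspace_scheme"
    and W :: "('k, 'w::ab_group_add, 'n) vspace_scheme"
  assumes f: "bil (scale V) (scale W) sX f"
  obtains L where "lin tscale sX L" "\<And>a b. L (tens V W a b) = f a b"
proof -
  let ?V = "\<lparr>carrier = UNIV :: 'v set, scale = scale V\<rparr>"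
  let ?W = "\<lparr>carrier = UNIV :: 'w set, scale = scale W\<rparr>"
  let ?X = "\<lparr>carrier = UNIV, scale = sX\<rparr>"
  have vs: "vector_space (scale V)" "vector_space (scale W)" "vector_space sX"
    using f lin_vs unfolding bil_def by blast+
  have U: "is_vspace \<lparr>carrier = UNIV, scale = s\<rparr>" if "vector_space s" for s :: "'k \<Rightarrow> 'z::ab_group_add \<Rightarrow> 'z"
  proof -
    interpret vector_space s by fact
    show ?thesis by (simp add: is_vspace_def that subspace_UNIV)
  qed
  note sp = U[OF vs(1)] U[OF vs(2)] U[OF vs(3)]
  have b: "bilin_on ?V ?W ?X f"
    by (simp add: bilin_on_def lin_on_def bilD[OF f])
  have T: "is_vspace (tensor_space ?V ?W)"
  proof -
    interpret T: vector_space "tscale :: 'k \<Rightarrow> ('k, 'v, 'w) tensor \<Rightarrow> _" by (rule vector_space_tscale)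
    show ?thesis
      by (simp add: is_vspace_def tensor_space_def tensor_span_def vector_space_tscale T.subspace_span)
  qed
  obtain Q where Q: "lin (scale (tensor_space ?V ?W)) (scale (tensor_space ?V ?W)) Q"
    "\<And>t. Q t \<in> carrier (tensor_space ?V ?W)" "\<And>t. t \<in> carrier (tensor_space ?V ?W) \<Longrightarrow> Q t = t"
    using vspace_projection[OF T] by blast
  have Q': "lin tscale tscale Q" using Q(1) by (simp add: tensor_space_def)
  let ?L = "\<lambda>t. tlift ?V ?W f (Q t)"
  have tl: "tlift ?V ?W f (t + u) = tlift ?V ?W f t + tlift ?V ?W f u"
    "tlift ?V ?W f (tscale c t) = sX c (tlift ?V ?W f t)"
    if "t \<in> carrier (tensor_space ?V ?W)" "u \<in> carrier (tensor_space ?V ?W)" for t u c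
    using tlift_lin[OF sp b] that unfolding lin_on_def by (auto simp: tensor_space_def)
  have "lin tscale sX ?L"
    by (intro linI vector_space_tscale vs) (simp_all add: lin_add[OF Q'] lin_scale[OF Q'] tl(1) tl(2)[OF Q(2) Q(2)] Q(2))
  moreover have "?L (tens V W a b) = f a b" for a b
  proof -
    have e: "tens V W = tens ?V ?W" by (rule tens_cong) simp_all
    interpret T: vector_space "tscale :: 'k \<Rightarrow> ('k, 'v, 'w) tensor \<Rightarrow> _" by (rule vector_space_tscale)
    have "tens ?V ?W a b \<in> carrier (tensor_space ?V ?W)"
      by (auto simp: tensor_space_def tensor_span_def intro: T.span_base)
    then show ?thesis unfolding e using tlift_pure[OF sp b] Q(3) by simp
  qed
  ultimately show thesis by (rule that)
qed

lemma tens_lsum_eq: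
  assumes "bil (scale V) (scale W) sX f" "lsum xs (tens V W) = lsum ys (tens V W)"
  shows "lsum xs f = lsum ys f"
proof -
  obtain L where L: "lin tscale sX L" "\<And>a b. L (tens V W a b) = f a b" using bil_factors[OF assms(1)] by blast
  show ?thesis using arg_cong[OF assms(2), of L] by (simp add: lin_pull[OF L(1)] L(2))
qed

lemma tensor_span_lsum:
  assumes "module.subspace (scale V) X" "vector_space (scale V)"
  shows "t \<in> tensor_span V W X Y \<longleftrightarrow> (\<exists>xs. set xs \<subseteq> X \<times> Y \<and> t = lsum xs (tens V W))"
  using tensor_span_sum_list[OF assms] by (simp add: lsum_def)

lemma tensor_span_cong: "scale V = scale V' \<Longrightarrow> scale W = scale W' \<Longrightarrow> tensor_span V W = tensor_span V' W'"
  by (simp add: tensor_span_def fun_eq_iff tens_cong[of V V' W W'])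

lemma tensor_span_tens: "x \<in> X \<Longrightarrow> y \<in> Y \<Longrightarrow> tens V W x y \<in> tensor_span V W X Y"
  unfolding tensor_span_def
  by (rule module.span_base) (auto intro: vector_space_tscale[unfolded module_iff_vector_space[symmetric]])

lemma tensor_span_subspace: "module.subspace tscale (tensor_span V W X Y)"
  unfolding tensor_span_def
  by (rule module.subspace_span) (rule vector_space_tscale[unfolded module_iff_vector_space[symmetric]])

lemma bil_bilin_on:
  "bil (scale V) (scale W) (scale X) f \<Longrightarrow> (\<And>v w. v \<in> carrier V \<Longrightarrow> w \<in> carrier W \<Longrightarrow> f v w \<in> carrier X) \<Longrightarrow>
    bilin_on V W X f"
  by (simp add: bilin_on_def lin_on_def bilD)

lemma add_ext_cong:
  assumes "\<And>i. i \<in> I \<Longrightarrow> f i = g i"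
  shows "add_ext I e f = add_ext I e g"
proof
  fix t
  have "map f is = map g is" if "set is \<subseteq> I" for "is"
    using that assms by (intro map_cong) auto
  then have "(\<exists>is. set is \<subseteq> I \<and> t = sum_list (map e is) \<and> y = sum_list (map f is)) \<longleftrightarrow>
    (\<exists>is. set is \<subseteq> I \<and> t = sum_list (map e is) \<and> y = sum_list (map g is))" for y
    by (metis (no_types, lifting))
  then show "add_ext I e f t = add_ext I e g t" unfolding add_ext_def by simp
qed

lemma tlift_cong:
  "(\<And>v w. v \<in> carrier V \<Longrightarrow> w \<in> carrier W \<Longrightarrow> f v w = g v w) \<Longrightarrow> tlift V W f = tlift V W g"
  unfolding tlift_def by (rule add_ext_cong) auto

text \<open>
  The map \<open>f\<close> is typically built from operations that are linear on carriers only, and \<open>g\<close> from their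
  total versions; only \<open>g\<close> has to be bilinear on the whole types.
\<close>

lemma tlift_lsum:
  fixes V :: "('k::field, 'v::ab_group_add, 'm) vspace_scheme"
    and W :: "('k, 'w::ab_group_add, 'n) vspace_scheme"
  assumes V: "is_vspace V" and W: "is_vspace W" and g: "bil (scale V) (scale W) sX g"
    and xs: "set xs \<subseteq> carrier V \<times> carrier W"
    and f: "\<And>v w. v \<in> carrier V \<Longrightarrow> w \<in> carrier W \<Longrightarrow> f v w = g v w"
  shows "tlift V W f (lsum xs (tens V W)) = lsum xs g"
proof -
  have vs: "vector_space sX" using g lin_vs unfolding bil_def by blast
  interpret X: vector_space sX by fact
  have X: "is_vspace \<lparr>carrier = UNIV, scale = sX\<rparr>" by (simp add: is_vspace_def vs)
  have b: "bilin_on V W \<lparr>carrier = UNIV, scale = sX\<rparr> g" using g by (intro bil_bilin_on) simp_all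
  have fg: "tlift V W f = tlift V W g" by (rule tlift_cong) (rule f)
  show ?thesis unfolding fg
    using tlift_sum_list[OF V W X b xs] by (simp add: lsum_def)
qed

section \<open>Globally linear operations of a differential graded algebra\<close>

context dg_algebra
begin

lemma scale_vs: "vector_space (scale \<Omega>)"
  by (rule is_vspaceD[OF vspace])

text \<open>
  All operations are precomposed with a linear projection of the ambient type onto the carrier. The
  resulting identities hold without membership hypotheses, at the price that
  \<open>proj x\<close> replaces \<open>x\<close> where the unit would have reproduced it.
\<close>

definition proj :: "'a \<Rightarrow> 'a" where
  "proj = (SOME P. lin (scale \<Omega>) (scale \<Omega>) P \<and> (\<forall>v. P v \<in> carrier \<Omega>) \<and> (\<forall>v\<in>carrier \<Omega>. P v = v))"

lemma proj_props:
  "lin (scale \<Omega>) (scale \<Omega>) proj \<and> (\<forall>v. proj v \<in> carrier \<Omega>) \<and> (\<forall>v\<in>carrier \<Omega>. proj v = v)"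
proof -
  have "\<exists>P. lin (scale \<Omega>) (scale \<Omega>) P \<and> (\<forall>v. P v \<in> carrier \<Omega>) \<and> (\<forall>v\<in>carrier \<Omega>. P v = v)"
    using vspace_projection[OF vspace] by metis
  from someI_ex[OF this] show ?thesis unfolding proj_def .
qed

lemma proj_lin: "lin (scale \<Omega>) (scale \<Omega>) proj"
  and proj_carrier: "proj x \<in> carrier \<Omega>"
  and proj_id: "x \<in> carrier \<Omega> \<Longrightarrow> proj x = x"
  using proj_props by blast+

definition hom_part :: "nat \<Rightarrow> 'a \<Rightarrow> 'a" where
  "hom_part n x = component (proj x) n"

definition sel :: "(nat \<Rightarrow> bool) \<Rightarrow> 'a \<Rightarrow> 'a" where
  "sel g x = (\<Sum>n | hom_part n x \<noteq> 0. if g n then hom_part n x else 0)"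

text \<open>
  The component of degree zero, the even and the odd part, and the sign automorphism \<open>x \<mapsto> (-1)\<^bsup>|x|\<^esup> x\<close>. Being
  linear maps, they express Koszul signs by formulas that make sense for inhomogeneous elements.
\<close>

definition pz :: "'a \<Rightarrow> 'a" where "pz = hom_part 0"
definition ev :: "'a \<Rightarrow> 'a" where "ev = sel even"
definition od :: "'a \<Rightarrow> 'a" where "od = sel odd"
definition sg :: "'a \<Rightarrow> 'a" where "sg x = ev x - od x"
definition tmul :: "'a \<Rightarrow> 'a \<Rightarrow> 'a" where "tmul x y = proj x \<odot> proj y"
definition td :: "'a \<Rightarrow> 'a" where "td x = diff \<Omega> (proj x)"

lemma hom_part_lin: "lin (scale \<Omega>) (scale \<Omega>) (hom_part n)"
  unfolding hom_part_def
  by (intro linI scale_vs)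
    (simp_all add: lin_add[OF proj_lin] lin_scale[OF proj_lin] component_add component_scale proj_carrier)

lemma hom_part_deg: "hom_part n x \<in> deg \<Omega> n"
  by (simp add: hom_part_def component_closed proj_carrier)

lemma hom_part_id: "x \<in> deg \<Omega> p \<Longrightarrow> hom_part n x = (if n = p then x else 0)"
  by (simp add: hom_part_def component_deg proj_id deg_carrier)

lemma hom_part_decomp: obtains N where "\<And>n. n > N \<Longrightarrow> hom_part n x = 0" "proj x = (\<Sum>n\<le>N. hom_part n x)"
  using decomposes_component[OF proj_carrier, of x] unfolding hom_part_def by blast

lemma finite_hom_part: "finite {n. hom_part n x \<noteq> 0}"
proof -
  obtain N where "\<And>n. n > N \<Longrightarrow> hom_part n x = 0" using hom_part_decomp by blast
  then have "{n. hom_part n x \<noteq> 0} \<subseteq> {..N}" by (auto simp: not_less[symmetric])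
  then show ?thesis by (rule finite_subset) simp
qed

lemma sel_eq_sum:
  "finite M \<Longrightarrow> {n. hom_part n x \<noteq> 0} \<subseteq> M \<Longrightarrow> sel g x = (\<Sum>n\<in>M. if g n then hom_part n x else 0)"
  unfolding sel_def by (rule sum.mono_neutral_left) auto

lemma sel_lin: "lin (scale \<Omega>) (scale \<Omega>) (sel g)"
proof (intro linI scale_vs)
  interpret V: vector_space "scale \<Omega>" by (rule scale_vs)
  fix x y c
  let ?M = "{n. hom_part n x \<noteq> 0} \<union> {n. hom_part n y \<noteq> 0}"
  have f: "finite ?M" by (simp add: finite_hom_part)
  have "{n. hom_part n (x + y) \<noteq> 0} \<subseteq> ?M" by (auto simp: lin_add[OF hom_part_lin])
  then have "sel g (x + y) = (\<Sum>n\<in>?M. if g n then hom_part n (x + y) else 0)" by (rule sel_eq_sum[OF f])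
  also have "\<dots> = (\<Sum>n\<in>?M. (if g n then hom_part n x else 0) + (if g n then hom_part n y else 0))"
    by (rule sum.cong) (simp_all add: lin_add[OF hom_part_lin])
  also have "\<dots> = sel g x + sel g y"
    by (simp add: sum.distrib sel_eq_sum[OF f, of x] sel_eq_sum[OF f, of y])
  finally show "sel g (x + y) = sel g x + sel g y" .
  have "{n. hom_part n (scale \<Omega> c x) \<noteq> 0} \<subseteq> {n. hom_part n x \<noteq> 0}"
    by (auto simp: lin_scale[OF hom_part_lin])
  then have "sel g (scale \<Omega> c x) =
    (\<Sum>n\<in>{n. hom_part n x \<noteq> 0}. if g n then hom_part n (scale \<Omega> c x) else 0)"
    by (rule sel_eq_sum[OF finite_hom_part])
  also have "\<dots> = (\<Sum>n\<in>{n. hom_part n x \<noteq> 0}. scale \<Omega> c (if g n then hom_part n x else 0))"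
    by (rule sum.cong) (simp_all add: lin_scale[OF hom_part_lin])
  also have "\<dots> = scale \<Omega> c (sel g x)" by (simp add: sel_def V.scale_sum_right)
  finally show "sel g (scale \<Omega> c x) = scale \<Omega> c (sel g x)" .
qed

lemma sel_id: "x \<in> deg \<Omega> p \<Longrightarrow> sel g x = (if g p then x else 0)"
proof -
  assume x: "x \<in> deg \<Omega> p"
  have "sel g x = (\<Sum>n\<in>{p}. if g n then hom_part n x else 0)"
    by (rule sel_eq_sum) (auto simp: hom_part_id[OF x])
  then show ?thesis by (simp add: hom_part_id[OF x])
qed

lemma one_carrier: "\<one> \<in> carrier \<Omega>"
  by (rule one_closed)

lemma mult_carrier: "x \<in> carrier \<Omega> \<Longrightarrow> y \<in> carrier \<Omega> \<Longrightarrow> x \<odot> y \<in> carrier \<Omega>"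
  using mult_bilin unfolding bilin_on_def lin_on_def by blast

lemma diff_carrier: "x \<in> carrier \<Omega> \<Longrightarrow> diff \<Omega> x \<in> carrier \<Omega>"
  using diff_lin unfolding lin_on_def by blast

lemma tmul_bil: "bil (scale \<Omega>) (scale \<Omega>) (scale \<Omega>) tmul"
  unfolding tmul_def using mult_bilin
  by (intro bilI linI scale_vs)
    (simp_all add: lin_add[OF proj_lin] lin_scale[OF proj_lin] proj_carrier bilin_on_def lin_on_def)

lemma td_lin: "lin (scale \<Omega>) (scale \<Omega>) td"
  unfolding td_def using diff_lin
  by (intro linI scale_vs)
    (simp_all add: lin_add[OF proj_lin] lin_scale[OF proj_lin] proj_carrier lin_on_def)

lemma ev_lin: "lin (scale \<Omega>) (scale \<Omega>) ev" and od_lin: "lin (scale \<Omega>) (scale \<Omega>) od"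
  and pz_lin: "lin (scale \<Omega>) (scale \<Omega>) pz"
  by (simp_all add: ev_def od_def pz_def sel_lin hom_part_lin)

lemma sg_lin: "lin (scale \<Omega>) (scale \<Omega>) sg"
  unfolding sg_def[abs_def] by (rule lin_minus_fun[OF ev_lin od_lin])

lemmas op_lin [multilin] =
  lin_comp[OF proj_lin] lin_comp[OF ev_lin] lin_comp[OF od_lin] lin_comp[OF sg_lin] lin_comp[OF pz_lin]
  lin_comp[OF td_lin] lin_comp[OF hom_part_lin] bil_left[OF tmul_bil] bil_right[OF tmul_bil] scale_vs lin_ident[OF scale_vs]
  proj_lin ev_lin od_lin sg_lin pz_lin td_lin hom_part_lin bil_right[OF tmul_bil lin_ident[OF scale_vs]]

lemmas lin_op_simps [simp] =
  lin_add[OF proj_lin] lin_diff[OF proj_lin] lin_minus[OF proj_lin] lin_0[OF proj_lin] lin_scale[OF proj_lin]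
  lin_add[OF ev_lin] lin_diff[OF ev_lin] lin_minus[OF ev_lin] lin_0[OF ev_lin] lin_scale[OF ev_lin]
  lin_add[OF od_lin] lin_diff[OF od_lin] lin_minus[OF od_lin] lin_0[OF od_lin] lin_scale[OF od_lin]
  lin_add[OF sg_lin] lin_diff[OF sg_lin] lin_minus[OF sg_lin] lin_0[OF sg_lin] lin_scale[OF sg_lin]
  lin_add[OF pz_lin] lin_diff[OF pz_lin] lin_minus[OF pz_lin] lin_0[OF pz_lin] lin_scale[OF pz_lin]
  lin_add[OF td_lin] lin_diff[OF td_lin] lin_minus[OF td_lin] lin_0[OF td_lin] lin_scale[OF td_lin]

lemmas tmul_left = bil_left[OF tmul_bil lin_ident[OF scale_vs]]
lemmas tmul_right = bil_right[OF tmul_bil lin_ident[OF scale_vs]]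

lemmas tmul_simps [simp] =
  lin_add[OF tmul_left] lin_diff[OF tmul_left] lin_minus[OF tmul_left] lin_0[OF tmul_left] lin_scale[OF tmul_left]
  lin_add[OF tmul_right] lin_diff[OF tmul_right] lin_minus[OF tmul_right] lin_0[OF tmul_right] lin_scale[OF tmul_right]

text \<open>
  The reduction to homogeneous elements. Outside the carrier nothing is known about \<open>f\<close> and \<open>g\<close>, whence
  the projection in the conclusion.
\<close>

lemma deg_ext:
  assumes "lin (scale \<Omega>) sX f" "lin (scale \<Omega>) sX g" "\<And>n x. x \<in> deg \<Omega> n \<Longrightarrow> f x = g x"
  shows "f (proj x) = g (proj x)"
proof -
  obtain N where "proj x = (\<Sum>n\<le>N. hom_part n x)" using hom_part_decomp by blast
  then show ?thesis
    by (simp add: lin_sum[OF assms(1)] lin_sum[OF assms(2)] assms(3)[OF hom_part_deg])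
qed

lemma deg_ext2:
  assumes f: "bil (scale \<Omega>) (scale \<Omega>) sX f" and g: "bil (scale \<Omega>) (scale \<Omega>) sX g"
    and "\<And>p q x y. x \<in> deg \<Omega> p \<Longrightarrow> y \<in> deg \<Omega> q \<Longrightarrow> f x y = g x y"
  shows "f (proj x) (proj y) = g (proj x) (proj y)"
proof (rule deg_ext[where f = "\<lambda>x. f x (proj y)" and g = "\<lambda>x. g x (proj y)" and sX = sX])
  fix n x assume x: "x \<in> deg \<Omega> n"
  show "f x (proj y) = g x (proj y)"
    by (rule deg_ext[where f = "f x" and g = "g x" and sX = sX]) (use f g assms(3) x in \<open>auto simp: bil_def\<close>)
qed (use f g in \<open>auto simp: bil_def\<close>)

lemma hom_simps:
  assumes "x \<in> deg \<Omega> p"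
  shows "proj x = x" "ev x = (if even p then x else 0)" "od x = (if odd p then x else 0)"
    "sg x = signed p x" "pz x = (if p = 0 then x else 0)" "td x = diff \<Omega> x"
  using assms by (auto simp: proj_id deg_carrier ev_def od_def sg_def pz_def sel_id hom_part_id signed_def td_def)

lemma tmul_hom: "x \<in> deg \<Omega> p \<Longrightarrow> y \<in> deg \<Omega> q \<Longrightarrow> tmul x y = x \<odot> y"
  by (simp add: tmul_def hom_simps)

lemma tmul_carrier: "x \<in> carrier \<Omega> \<Longrightarrow> y \<in> carrier \<Omega> \<Longrightarrow> tmul x y = x \<odot> y"
  by (simp add: tmul_def proj_id)

lemma td_carrier: "x \<in> carrier \<Omega> \<Longrightarrow> td x = diff \<Omega> x"
  by (simp add: td_def proj_id)

lemma absorb [simp]: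
  "proj (proj x) = proj x" "tmul (proj x) y = tmul x y" "tmul x (proj y) = tmul x y"
  "proj (tmul x y) = tmul x y" "td (proj x) = td x" "proj (td x) = td x" "hom_part n (proj x) = hom_part n x"
  "ev (proj x) = ev x" "od (proj x) = od x" "sg (proj x) = sg x" "pz (proj x) = pz x"
  "proj (pz x) = pz x"
proof -
  have hp: "hom_part n (proj x) = hom_part n x" for n x
    by (simp add: hom_part_def proj_id proj_carrier)
  show "hom_part n (proj x) = hom_part n x" by (rule hp)
  have "sel g (proj x) = sel g x" for g unfolding sel_def hp ..
  then show "ev (proj x) = ev x" "od (proj x) = od x" "sg (proj x) = sg x" "pz (proj x) = pz x"
    by (simp_all add: ev_def od_def sg_def pz_def hp)
  show "proj (pz x) = pz x"
    by (simp add: pz_def proj_id deg_carrier[OF hom_part_deg])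
qed (simp_all add: proj_id proj_carrier tmul_def td_def mult_carrier diff_carrier)

text \<open>Each identity is linear in its arguments and is checked on homogeneous elements.\<close>

lemma one_simps [simp]: "proj \<one> = \<one>" "ev \<one> = \<one>" "od \<one> = 0" "sg \<one> = \<one>" "pz \<one> = \<one>"
  by (simp_all add: hom_simps[OF one_deg] signed_def)

lemma parity_simps [simp]:
  "proj (ev x) = ev x" "proj (od x) = od x" "proj (sg x) = sg x"
  "ev (ev x) = ev x" "ev (od x) = 0" "od (ev x) = 0" "od (od x) = od x" "ev x + od x = proj x"
  "sg (ev x) = ev x" "sg (od x) = - od x" "ev (sg x) = ev x" "od (sg x) = - od x" "sg (sg x) = proj x"
  "pz (pz x) = pz x" "pz (ev x) = pz x" "pz (od x) = 0" "pz (sg x) = pz x"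
  "ev (pz x) = pz x" "od (pz x) = 0" "sg (pz x) = pz x"
  "td (td x) = 0" "ev (td x) = td (od x)" "od (td x) = td (ev x)" "sg (td x) = - td (sg x)" "pz (td x) = 0"
proof -
  have ext: "f x = g x"
    if "lin (scale \<Omega>) (scale \<Omega>) f" "lin (scale \<Omega>) (scale \<Omega>) g" "\<And>n x. x \<in> deg \<Omega> n \<Longrightarrow> f x = g x"
      "f (proj x) = f x" "g (proj x) = g x" for f g
    using deg_ext[where x = x, OF that(1-3)] that(4,5) by simp
  note i = multilin lin_zero
  note h = hom_simps hom_simps[OF diff_deg] signed_def diff_diff deg_carrier
  show "proj (ev x) = ev x" by (rule ext[of "\<lambda>x. proj (ev x)" ev], intro i, intro i) (simp_all add: h)
  show "proj (od x) = od x" by (rule ext[of "\<lambda>x. proj (od x)" od], intro i, intro i) (simp_all add: h)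
  show "ev (ev x) = ev x" by (rule ext[of "\<lambda>x. ev (ev x)" ev], intro i, intro i) (simp_all add: h)
  show "od (od x) = od x" by (rule ext[of "\<lambda>x. od (od x)" od], intro i, intro i) (simp_all add: h)
  show "ev (od x) = 0" by (rule ext[of "\<lambda>x. ev (od x)" "\<lambda>x. 0"], intro i, intro i) (simp_all add: h)
  show "od (ev x) = 0" by (rule ext[of "\<lambda>x. od (ev x)" "\<lambda>x. 0"], intro i, intro i) (simp_all add: h)
  show s: "ev x + od x = proj x" by (rule ext[of "\<lambda>x. ev x + od x" proj], intro i, intro i) (simp_all add: h)
  show "proj (sg x) = sg x" by (simp add: sg_def \<open>proj (ev x) = ev x\<close> \<open>proj (od x) = od x\<close>)
  show "sg (ev x) = ev x" "ev (sg x) = ev x" "sg (od x) = - od x" "od (sg x) = - od x"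
    by (simp_all add: sg_def \<open>ev (ev x) = ev x\<close> \<open>od (ev x) = 0\<close> \<open>od (od x) = od x\<close> \<open>ev (od x) = 0\<close>)
  then show "sg (sg x) = proj x" by (simp add: sg_def s[symmetric])
  show "pz (pz x) = pz x" by (rule ext[of "\<lambda>x. pz (pz x)" pz], intro i, intro i) (simp_all add: h)
  show "pz (ev x) = pz x" by (rule ext[of "\<lambda>x. pz (ev x)" pz], intro i, intro i) (simp_all add: h)
  show "ev (pz x) = pz x" by (rule ext[of "\<lambda>x. ev (pz x)" pz], intro i, intro i) (simp_all add: h)
  show "pz (od x) = 0" by (rule ext[of "\<lambda>x. pz (od x)" "\<lambda>x. 0"], intro i, intro i) (simp_all add: h)
  show "od (pz x) = 0" by (rule ext[of "\<lambda>x. od (pz x)" "\<lambda>x. 0"], intro i, intro i) (simp_all add: h)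
  show "pz (sg x) = pz x" "sg (pz x) = pz x"
    by (simp_all add: sg_def \<open>pz (ev x) = pz x\<close> \<open>pz (od x) = 0\<close> \<open>ev (pz x) = pz x\<close> \<open>od (pz x) = 0\<close>)
  show "td (td x) = 0" by (simp add: td_def proj_id diff_carrier proj_carrier diff_diff)
  show "ev (td x) = td (od x)" by (rule ext[of "\<lambda>x. ev (td x)" "\<lambda>x. td (od x)"], intro i, intro i) (simp_all add: h)
  show "od (td x) = td (ev x)" by (rule ext[of "\<lambda>x. od (td x)" "\<lambda>x. td (ev x)"], intro i, intro i) (simp_all add: h)
  show "pz (td x) = 0" by (rule ext[of "\<lambda>x. pz (td x)" "\<lambda>x. 0"], intro i, intro i) (simp_all add: h)
  show "sg (td x) = - td (sg x)"
    by (simp add: sg_def \<open>ev (td x) = td (od x)\<close> \<open>od (td x) = td (ev x)\<close>)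
qed

lemma tmul_assoc: "tmul (tmul x y) z = tmul x (tmul y z)"
  by (simp add: tmul_def proj_id mult_carrier proj_carrier mult_assoc)

lemma tmul_one [simp]: "tmul \<one> x = proj x" "tmul x \<one> = proj x"
  by (simp_all add: tmul_def proj_id one_closed proj_carrier mult_one)

lemma tmul_parity:
  "ev (tmul x y) = tmul (ev x) (ev y) + tmul (od x) (od y)"
  "od (tmul x y) = tmul (ev x) (od y) + tmul (od x) (ev y)"
  "sg (tmul x y) = tmul (sg x) (sg y)"
  "pz (tmul x y) = tmul (pz x) (pz y)"
  "td (tmul x y) = tmul (td x) y + tmul (sg x) (td y)"
proof -
  have ext: "f x y = g x y"
    if "bil (scale \<Omega>) (scale \<Omega>) (scale \<Omega>) f" "bil (scale \<Omega>) (scale \<Omega>) (scale \<Omega>) g"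
      "\<And>p q x y. x \<in> deg \<Omega> p \<Longrightarrow> y \<in> deg \<Omega> q \<Longrightarrow> f x y = g x y"
      "f (proj x) (proj y) = f x y" "g (proj x) (proj y) = g x y" for f g
    using deg_ext2[where x = x and y = y, OF that(1-3)] that(4,5) by simp
  note h = hom_simps hom_simps[OF diff_deg] tmul_hom tmul_hom[OF diff_deg] tmul_hom[OF _ diff_deg]
    hom_simps[OF mult_deg] signed_def leibniz deg_carrier
  show e: "ev (tmul x y) = tmul (ev x) (ev y) + tmul (od x) (od y)"
    by (rule ext[of "\<lambda>x y. ev (tmul x y)" "\<lambda>x y. tmul (ev x) (ev y) + tmul (od x) (od y)"], intro bilI multilin,
      intro bilI multilin) (simp_all add: h)
  show o: "od (tmul x y) = tmul (ev x) (od y) + tmul (od x) (ev y)"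
    by (rule ext[of "\<lambda>x y. od (tmul x y)" "\<lambda>x y. tmul (ev x) (od y) + tmul (od x) (ev y)"], intro bilI multilin,
      intro bilI multilin) (simp_all add: h)
  show "sg (tmul x y) = tmul (sg x) (sg y)" by (simp add: sg_def e o)
  show "pz (tmul x y) = tmul (pz x) (pz y)"
    by (rule ext[of "\<lambda>x y. pz (tmul x y)" "\<lambda>x y. tmul (pz x) (pz y)"], intro bilI multilin, intro bilI multilin)
      (simp_all add: h)
  show "td (tmul x y) = tmul (td x) y + tmul (sg x) (td y)"
    by (rule ext[of "\<lambda>x y. td (tmul x y)" "\<lambda>x y. tmul (td x) y + tmul (sg x) (td y)"], intro bilI multilin, intro
      bilI multilin) (simp_all add: h)
qed

lemma td_one [simp]: "td \<one> = 0"
  using tmul_parity(5)[of \<one> \<one>] by simp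

lemma op_carrier:
  "tmul x y \<in> carrier \<Omega>" "td x \<in> carrier \<Omega>" "ev x \<in> carrier \<Omega>" "od x \<in> carrier \<Omega>" "sg x \<in> carrier \<Omega>"
  "pz x \<in> deg \<Omega> 0"
proof -
  show "ev x \<in> carrier \<Omega>" "od x \<in> carrier \<Omega>" "sg x \<in> carrier \<Omega>"
    using proj_carrier[of "ev x"] proj_carrier[of "od x"] proj_carrier[of "sg x"] by simp_all
qed (simp_all add: tmul_def td_def mult_carrier diff_carrier proj_carrier pz_def hom_part_deg)

end

section \<open>Tensor products of differential graded algebras\<close>

lemma hlift_cong:
  "(\<And>p x q y. x \<in> deg \<Omega> p \<Longrightarrow> y \<in> deg \<Omega>' q \<Longrightarrow> f p x q y = g p x q y) \<Longrightarrow> hlift \<Omega> \<Omega>' f = hlift \<Omega> \<Omega>' g"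
  unfolding hlift_def by (rule add_ext_cong) auto

locale dg_pair = X: dg_algebra \<Omega> + Y: dg_algebra \<Omega>'
  for \<Omega> :: "('k::field, 'a::ab_group_add, 'm) dga_scheme"
    and \<Omega>' :: "('k, 'b::ab_group_add, 'n) dga_scheme"
begin

abbreviation T :: "'a \<Rightarrow> 'b \<Rightarrow> ('k, 'a, 'b) tensor" where "T \<equiv> tens \<Omega> \<Omega>'"

abbreviation TC :: "('k, 'a, 'b) tensor set" where "TC \<equiv> tensor_span \<Omega> \<Omega>' (carrier \<Omega>) (carrier \<Omega>')"

sublocale TV: vector_space "tscale :: 'k \<Rightarrow> ('k, 'a, 'b) tensor \<Rightarrow> _"
  by (rule vector_space_tscale)

lemma T_bil: "bil (scale \<Omega>) (scale \<Omega>') tscale T"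
  by (rule tens_lin[OF X.scale_vs Y.scale_vs])

lemmas T_lin [multilin] = bil_left[OF T_bil] bil_right[OF T_bil] bil_right[OF T_bil lin_ident[OF Y.scale_vs]]
  vector_space_tscale

lemma TC_lsum: "t \<in> TC \<longleftrightarrow> (\<exists>xs. set xs \<subseteq> carrier \<Omega> \<times> carrier \<Omega>' \<and> t = lsum xs T)"
  by (rule tensor_span_lsum[OF is_vspaceD(2)[OF X.vspace] X.scale_vs])

lemma TC_subspace: "TV.subspace TC"
  by (rule tensor_span_subspace)

lemma lsum_TC: "set xs \<subseteq> carrier \<Omega> \<times> carrier \<Omega>' \<Longrightarrow> lsum xs T \<in> TC"
  using TC_lsum by blast

text \<open>
  Additive closure suffices because a scalar can be absorbed into the first leg of a pure tensor. In this form the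
  principle applies to \<open>hlift\<close>, which is additive by \<open>hlift_add\<close>.
\<close>

lemma TC_add_induct:
  assumes t: "t \<in> TC" and zero: "P 0" and add: "\<And>s t. s \<in> TC \<Longrightarrow> t \<in> TC \<Longrightarrow> P s \<Longrightarrow> P t \<Longrightarrow> P (s + t)"
    and hom: "\<And>p q x y. x \<in> deg \<Omega> p \<Longrightarrow> y \<in> deg \<Omega>' q \<Longrightarrow> P (T x y)"
  shows "P t"
proof -
  let ?K = "{t \<in> TC. P t}"
  have K0: "0 \<in> ?K" using zero TV.subspace_0[OF TC_subspace] by simp
  have Ka: "s + t \<in> ?K" if "s \<in> ?K" "t \<in> ?K" for s t
    using that add TV.subspace_add[OF TC_subspace] by simp
  have Ks: "sum f I \<in> ?K" if "\<And>i. f i \<in> ?K" for f :: "nat \<Rightarrow> _" and I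
  proof (induction I rule: infinite_finite_induct)
    case (insert i I)
    show ?case unfolding sum.insert[OF insert.hyps] by (rule Ka[OF that insert.IH])
  next
    case (infinite I)
    show ?case unfolding sum.infinite[OF infinite] by (rule K0)
  qed (simp only: sum.empty K0)
  have pure: "T x y \<in> ?K" if xy: "x \<in> carrier \<Omega>" "y \<in> carrier \<Omega>'" for x y
  proof -
    obtain N where N: "x = (\<Sum>n\<le>N. X.hom_part n x)" using X.hom_part_decomp[of x] X.proj_id[OF xy(1)] by metis
    obtain M where M: "y = (\<Sum>n\<le>M. Y.hom_part n y)" using Y.hom_part_decomp[of y] Y.proj_id[OF xy(2)] by metis
    have "T x y = (\<Sum>n\<le>N. \<Sum>m\<le>M. T (X.hom_part n x) (Y.hom_part m y))"
      by (subst N, subst M) (simp add: lin_sum[OF T_lin(1)[OF lin_ident[OF X.scale_vs]]]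
        lin_sum[OF T_lin(2)[OF lin_ident[OF Y.scale_vs]]] sum.swap[of _ "{..N}" "{..M}"])
    also have "\<dots> \<in> ?K"
      by (intro Ks CollectI conjI hom[OF X.hom_part_deg Y.hom_part_deg]
        tensor_span_tens X.deg_carrier[OF X.hom_part_deg] Y.deg_carrier[OF Y.hom_part_deg])
    finally show ?thesis .
  qed
  obtain xs where xs: "set xs \<subseteq> carrier \<Omega> \<times> carrier \<Omega>'" "t = lsum xs T" using t TC_lsum by blast
  from xs(1) have "lsum xs T \<in> ?K"
  proof (induction xs)
    case (Cons z xs)
    obtain x y where z: "z = (x, y)" by (cases z)
    show ?case unfolding z lsum_simps using Cons z by (intro Ka pure) auto
  qed (simp only: lsum_simps K0)
  then show ?thesis by (simp add: xs(2))
qed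

lemma TC_induct:
  assumes K: "TV.subspace K" and t: "t \<in> TC"
    and hom: "\<And>p q x y. x \<in> deg \<Omega> p \<Longrightarrow> y \<in> deg \<Omega>' q \<Longrightarrow> T x y \<in> K"
  shows "t \<in> K"
  using t by (rule TC_add_induct) (auto intro: TV.subspace_0[OF K] TV.subspace_add[OF K] hom)

lemma hlift_lsum:
  assumes g: "bil (scale \<Omega>) (scale \<Omega>') sX g"
    and f: "\<And>p q x y. x \<in> deg \<Omega> p \<Longrightarrow> y \<in> deg \<Omega>' q \<Longrightarrow> f p x q y = g x y"
    and xs: "set xs \<subseteq> carrier \<Omega> \<times> carrier \<Omega>'"
  shows "hlift \<Omega> \<Omega>' f (lsum xs T) = lsum xs g"
proof -
  let ?X = "\<lparr>carrier = UNIV, scale = sX\<rparr>"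
  let ?h = "hlift \<Omega> \<Omega>' (\<lambda>p x q y. g x y)"
  have vs: "vector_space sX" using g lin_vs unfolding bil_def by blast
  interpret sX: vector_space sX by (rule vs)
  have X: "is_vspace ?X" by (simp add: is_vspace_def vs)
  have b: "bilin_on (\<Omega>\<lparr>carrier := deg \<Omega> p\<rparr>) (\<Omega>'\<lparr>carrier := deg \<Omega>' q\<rparr>) ?X g" for p q
    using g by (intro bil_bilin_on) simp_all
  note dg = X.dg_algebra_axioms Y.dg_algebra_axioms
  obtain L where L: "lin tscale sX L" "\<And>a b. L (T a b) = g a b" using bil_factors[OF g] by blast
  have add: "?h (s + t) = ?h s + ?h t" if "s \<in> TC" "t \<in> TC" for s t
    by (rule hlift_add[OF dg X b that])
  have "?h (lsum xs T) = L (lsum xs T)"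
    using lsum_TC[OF xs]
  proof (rule TC_add_induct)
    have "?h (0 + 0) = ?h 0 + ?h 0" using TV.subspace_0[OF TC_subspace] by (intro add)
    then show "?h 0 = L 0" by (simp add: lin_0[OF L(1)])
    show "?h (T x y) = L (T x y)" if "x \<in> deg \<Omega> p" "y \<in> deg \<Omega>' q" for p q x y
      using hlift_pure[OF dg X b that] by (simp add: L(2))
  qed (simp add: add lin_add[OF L(1)])
  then have "?h (lsum xs T) = lsum xs g" by (simp add: lin_pull[OF L(1)] L(2))
  moreover have "hlift \<Omega> \<Omega>' f = ?h" by (rule hlift_cong) (rule f)
  ultimately show ?thesis by simp
qed

text \<open>
  The product of pure tensors: the sign \<open>(-1)\<^bsup>|y||x'|\<^esup>\<close> is trivial on the even part of \<open>y\<close> and the sign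
  automorphism of \<open>x'\<close> on its odd part.
\<close>

definition pmul :: "'a \<Rightarrow> 'b \<Rightarrow> 'a \<Rightarrow> 'b \<Rightarrow> ('k, 'a, 'b) tensor" where
  "pmul x y x' y' = T (X.tmul x x') (Y.tmul (Y.ev y) y') + T (X.tmul x (X.sg x')) (Y.tmul (Y.od y) y')"

lemma tensor_dga_mult:
  assumes "set xs \<subseteq> carrier \<Omega> \<times> carrier \<Omega>'" "set ys \<subseteq> carrier \<Omega> \<times> carrier \<Omega>'"
  shows "lsum xs T \<odot>\<^bsub>tensor_dga \<Omega> \<Omega>'\<^esub> lsum ys T = lsum xs (\<lambda>x y. lsum ys (\<lambda>x' y'. pmul x y x' y'))"
proof -
  have "hlift \<Omega> \<Omega>' (\<lambda>p x q y. hlift \<Omega> \<Omega>' (\<lambda>p' x' q' y'.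
      signed (q * p') (T (x \<odot>\<^bsub>\<Omega>\<^esub> x') (y \<odot>\<^bsub>\<Omega>'\<^esub> y'))) (lsum ys T)) (lsum xs T) =
    lsum xs (\<lambda>x y. lsum ys (\<lambda>x' y'. pmul x y x' y'))"
  proof (rule hlift_lsum[OF _ _ assms(1)])
    show "bil (scale \<Omega>) (scale \<Omega>') tscale (\<lambda>x y. lsum ys (\<lambda>x' y'. pmul x y x' y'))"
      unfolding pmul_def by (intro bilI multilin)
    fix p q x y assume xy: "x \<in> deg \<Omega> p" "y \<in> deg \<Omega>' q"
    show "hlift \<Omega> \<Omega>' (\<lambda>p' x' q' y'. signed (q * p') (T (x \<odot>\<^bsub>\<Omega>\<^esub> x') (y \<odot>\<^bsub>\<Omega>'\<^esub> y'))) (lsum ys T) =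
      lsum ys (\<lambda>x' y'. pmul x y x' y')"
    proof (rule hlift_lsum[OF _ _ assms(2)])
      show "bil (scale \<Omega>) (scale \<Omega>') tscale (\<lambda>x' y'. pmul x y x' y')"
        unfolding pmul_def by (intro bilI multilin)
      fix p' q' x' y' assume xy': "x' \<in> deg \<Omega> p'" "y' \<in> deg \<Omega>' q'"
      show "signed (q * p') (T (x \<odot>\<^bsub>\<Omega>\<^esub> x') (y \<odot>\<^bsub>\<Omega>'\<^esub> y')) = pmul x y x' y'"
        using xy xy' by (simp add: pmul_def signed_def X.hom_simps Y.hom_simps X.tmul_hom Y.tmul_hom tens_neg)
    qed
  qed
  then show ?thesis by (simp add: tensor_dga_def)
qed

definition pdiff :: "'a \<Rightarrow> 'b \<Rightarrow> ('k, 'a, 'b) tensor" where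
  "pdiff x y = T (X.td x) y + T (X.sg x) (Y.td y)"

lemma tensor_diff_lsum:
  assumes "set xs \<subseteq> carrier \<Omega> \<times> carrier \<Omega>'"
  shows "tensor_diff \<Omega> \<Omega>' (lsum xs T) = lsum xs pdiff"
  unfolding tensor_diff_def
proof (rule hlift_lsum[OF _ _ assms])
  show "bil (scale \<Omega>) (scale \<Omega>') tscale pdiff"
    unfolding pdiff_def by (intro bilI multilin)
  show "T (diff \<Omega> x) y + signed p (T x (diff \<Omega>' y)) = pdiff x y"
    if "x \<in> deg \<Omega> p" "y \<in> deg \<Omega>' q" for p q x y
    using that by (simp add: pdiff_def signed_def X.hom_simps Y.hom_simps tens_neg)
qed

lemma tensor_dga_simps [simp]:
  "carrier (tensor_dga \<Omega> \<Omega>') = TC" "scale (tensor_dga \<Omega> \<Omega>') = tscale"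
  "\<one>\<^bsub>tensor_dga \<Omega> \<Omega>'\<^esub> = T \<one>\<^bsub>\<Omega>\<^esub> \<one>\<^bsub>\<Omega>'\<^esub>" "deg (tensor_dga \<Omega> \<Omega>') = tensor_deg \<Omega> \<Omega>'"
  "diff (tensor_dga \<Omega> \<Omega>') = tensor_diff \<Omega> \<Omega>'"
  by (simp_all add: tensor_dga_def)

lemma tensor_deg_subspace: "TV.subspace (tensor_deg \<Omega> \<Omega>' n)"
  by (simp add: tensor_deg_def)

lemma tensor_deg_T: "x \<in> deg \<Omega> p \<Longrightarrow> y \<in> deg \<Omega>' q \<Longrightarrow> T x y \<in> tensor_deg \<Omega> \<Omega>' (p + q)"
  unfolding tensor_deg_def
  by (rule TV.span_base, rule UN_I[of q]) (auto intro: tensor_span_tens)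

lemma tensor_deg_induct:
  assumes "TV.subspace K" "t \<in> tensor_deg \<Omega> \<Omega>' n"
    and "\<And>p q x y. p + q = n \<Longrightarrow> x \<in> deg \<Omega> p \<Longrightarrow> y \<in> deg \<Omega>' q \<Longrightarrow> T x y \<in> K"
  shows "t \<in> K"
proof -
  have "tensor_span \<Omega> \<Omega>' (deg \<Omega> (n - k)) (deg \<Omega>' k) \<subseteq> K" if "k \<le> n" for k
    unfolding tensor_span_def by (rule TV.span_minimal[OF _ assms(1)]) (use that assms(3)[of "n - k" k] in auto)
  then show ?thesis
    using assms(2) TV.span_minimal[OF _ assms(1), of "\<Union>k\<le>n. tensor_span \<Omega> \<Omega>' (deg \<Omega> (n - k)) (deg \<Omega>' k)"]
    unfolding tensor_deg_def by blast
qed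

lemma tensor_deg_TC: "t \<in> tensor_deg \<Omega> \<Omega>' n \<Longrightarrow> t \<in> TC"
  by (rule tensor_deg_induct[OF TC_subspace]) (auto intro: tensor_span_tens X.deg_carrier Y.deg_carrier)

lemma tensor_deg_ext:
  assumes "lin tscale sX f" "lin tscale sX g" "t \<in> tensor_deg \<Omega> \<Omega>' n"
    and "\<And>p q x y. p + q = n \<Longrightarrow> x \<in> deg \<Omega> p \<Longrightarrow> y \<in> deg \<Omega>' q \<Longrightarrow> f (T x y) = g (T x y)"
  shows "f t = g t"
proof -
  have "TV.subspace {t. f t = g t}"
    by (rule lin_equalizer_subspace[OF assms(1,2)])
  from tensor_deg_induct[OF this assms(3)] assms(4) show ?thesis by blast
qed

lemma TC_ext:
  assumes "lin tscale sX f" "lin tscale sX g" "t \<in> TC"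
    and "\<And>p q x y. x \<in> deg \<Omega> p \<Longrightarrow> y \<in> deg \<Omega>' q \<Longrightarrow> f (T x y) = g (T x y)"
  shows "f t = g t"
proof -
  have "TV.subspace {t. f t = g t}"
    by (rule lin_equalizer_subspace[OF assms(1,2)])
  from TC_induct[OF this assms(3)] assms(4) show ?thesis by blast
qed

lemma tensor_deg_total: "TC = TV.span (\<Union>n. tensor_deg \<Omega> \<Omega>' n)"
proof
  show "TC \<subseteq> TV.span (\<Union>n. tensor_deg \<Omega> \<Omega>' n)"
    by (rule subsetI, erule TC_induct[OF TV.subspace_span], rule TV.span_base) (use tensor_deg_T in fast)
  show "TV.span (\<Union>n. tensor_deg \<Omega> \<Omega>' n) \<subseteq> TC"
    by (rule TV.span_minimal[OF _ TC_subspace]) (auto intro: tensor_deg_TC)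
qed

text \<open>
  The projection onto total degree \<open>n\<close>, a sum of projections onto bidegrees; its existence shows that
  the total degrees are independent.
\<close>

lemma tensor_deg_projection:
  obtains Q where "lin tscale tscale Q"
    "\<And>m t. t \<in> tensor_deg \<Omega> \<Omega>' m \<Longrightarrow> Q t = (if m = n then t else 0)"
proof -
  have "bil (scale \<Omega>) (scale \<Omega>') tscale (\<lambda>x y. \<Sum>k\<le>n. T (X.hom_part (n - k) x) (Y.hom_part k y))"
    by (intro bilI multilin)
  then obtain Q where Q: "lin tscale tscale Q"
    "\<And>x y. Q (T x y) = (\<Sum>k\<le>n. T (X.hom_part (n - k) x) (Y.hom_part k y))"
    using bil_factors by blast
  have "Q t = (if m = n then t else 0)" if t: "t \<in> tensor_deg \<Omega> \<Omega>' m" for m t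
  proof (rule tensor_deg_ext[OF Q(1) _ t, of "\<lambda>t. if m = n then t else 0"])
    show "lin tscale tscale (\<lambda>t::('k, 'a, 'b) tensor. if m = n then t else 0)"
      by (cases "m = n") (simp_all add: lin_ident lin_zero vector_space_tscale)
    fix p q x y assume h: "p + q = m" "x \<in> deg \<Omega> p" "y \<in> deg \<Omega>' q"
    have "Q (T x y) = (\<Sum>k\<le>n. if k = q then (if m = n then T x y else 0) else 0)"
      unfolding Q(2) by (rule sum.cong) (use h in \<open>auto simp: X.hom_part_id Y.hom_part_id\<close>)
    then show "Q (T x y) = (if m = n then T x y else 0)" using h by auto
  qed
  with Q(1) show thesis by (rule that)
qed

lemma tensor_deg_direct:
  assumes "\<And>n. f n \<in> tensor_deg \<Omega> \<Omega>' n" "(\<Sum>n\<le>N. f n) = 0" "n \<le> N"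
  shows "f n = 0"
proof -
  obtain Q where Q: "lin tscale tscale Q" "\<And>m t. t \<in> tensor_deg \<Omega> \<Omega>' m \<Longrightarrow> Q t = (if m = n then t else 0)"
    using tensor_deg_projection by blast
  have "Q (\<Sum>n\<le>N. f n) = (\<Sum>m\<le>N. if m = n then f m else 0)"
    unfolding lin_sum[OF Q(1)] by (rule sum.cong) (auto simp: Q(2)[OF assms(1)])
  then show ?thesis using assms(2,3) by (simp add: lin_0[OF Q(1)])
qed

lemma pdiff_linear:
  obtains D where "lin tscale tscale D" "\<And>x y. D (T x y) = pdiff x y"
    "\<And>t. t \<in> TC \<Longrightarrow> tensor_diff \<Omega> \<Omega>' t = D t"
proof -
  have "bil (scale \<Omega>) (scale \<Omega>') tscale pdiff"
    unfolding pdiff_def by (intro bilI multilin)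
  then obtain D where D: "lin tscale tscale D" "\<And>x y. D (T x y) = pdiff x y"
    using bil_factors by blast
  moreover have "tensor_diff \<Omega> \<Omega>' t = D t" if "t \<in> TC" for t
    using that unfolding TC_lsum by (auto simp: tensor_diff_lsum lin_pull[OF D(1)] D(2))
  ultimately show thesis by (rule that)
qed

lemma pdiff_TC: "pdiff x y \<in> TC" if "x \<in> carrier \<Omega>" "y \<in> carrier \<Omega>'"
  unfolding pdiff_def using that
  by (intro TV.subspace_add[OF TC_subspace] tensor_span_tens X.op_carrier Y.op_carrier)

lemma tensor_diff_lin: "t \<in> TC \<Longrightarrow> tensor_diff \<Omega> \<Omega>' t \<in> TC"
    "s \<in> TC \<Longrightarrow> t \<in> TC \<Longrightarrow> tensor_diff \<Omega> \<Omega>' (s + t) = tensor_diff \<Omega> \<Omega>' s + tensor_diff \<Omega> \<Omega>' t"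
    "t \<in> TC \<Longrightarrow> tensor_diff \<Omega> \<Omega>' (tscale c t) = tscale c (tensor_diff \<Omega> \<Omega>' t)"
proof -
  obtain D where D: "lin tscale tscale D" "\<And>x y. D (T x y) = pdiff x y"
    "\<And>t. t \<in> TC \<Longrightarrow> tensor_diff \<Omega> \<Omega>' t = D t" using pdiff_linear by blast
  have "TV.subspace {t. D t \<in> TC}"
    by (rule lin_vimage_subspace[OF D(1) TC_subspace])
  from TC_induct[OF this] show "t \<in> TC \<Longrightarrow> tensor_diff \<Omega> \<Omega>' t \<in> TC"
    by (auto simp: D(2,3) intro: pdiff_TC X.deg_carrier Y.deg_carrier)
  show "s \<in> TC \<Longrightarrow> t \<in> TC \<Longrightarrow> tensor_diff \<Omega> \<Omega>' (s + t) = tensor_diff \<Omega> \<Omega>' s + tensor_diff \<Omega> \<Omega>' t"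
    "t \<in> TC \<Longrightarrow> tensor_diff \<Omega> \<Omega>' (tscale c t) = tscale c (tensor_diff \<Omega> \<Omega>' t)"
    using TV.subspace_add[OF TC_subspace, of s t] TV.subspace_scale[OF TC_subspace, of t c]
    by (simp_all add: D(3) lin_add[OF D(1)] lin_scale[OF D(1)])
qed

lemma tensor_diff_deg: "t \<in> tensor_deg \<Omega> \<Omega>' n \<Longrightarrow> tensor_diff \<Omega> \<Omega>' t \<in> tensor_deg \<Omega> \<Omega>' (Suc n)"
proof -
  assume t: "t \<in> tensor_deg \<Omega> \<Omega>' n"
  obtain D where D: "lin tscale tscale D" "\<And>x y. D (T x y) = pdiff x y"
    "\<And>t. t \<in> TC \<Longrightarrow> tensor_diff \<Omega> \<Omega>' t = D t" using pdiff_linear by blast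
  note sub = tensor_deg_subspace[of "Suc n"]
  have "TV.subspace {t. D t \<in> tensor_deg \<Omega> \<Omega>' (Suc n)}"
    by (rule lin_vimage_subspace[OF D(1) sub])
  from tensor_deg_induct[OF this t] have "D t \<in> tensor_deg \<Omega> \<Omega>' (Suc n)"
  proof
    fix p q x y assume h: "p + q = n" "x \<in> deg \<Omega> p" "y \<in> deg \<Omega>' q"
    have "T (diff \<Omega> x) y \<in> tensor_deg \<Omega> \<Omega>' (Suc n)" "T x (diff \<Omega>' y) \<in> tensor_deg \<Omega> \<Omega>' (Suc n)"
      using tensor_deg_T[OF X.diff_deg[OF h(2)] h(3)] tensor_deg_T[OF h(2) Y.diff_deg[OF h(3)]] h(1) by simp_all
    then show "T x y \<in> {t. D t \<in> tensor_deg \<Omega> \<Omega>' (Suc n)}"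
      using TV.subspace_add[OF sub] TV.subspace_diff[OF sub] h(2,3)
      by (auto simp: D(2) pdiff_def X.hom_simps Y.hom_simps signed_def tens_neg)
  qed simp
  then show ?thesis by (simp add: D(3) tensor_deg_TC[OF t])
qed

lemma tensor_diff_diff: "t \<in> TC \<Longrightarrow> tensor_diff \<Omega> \<Omega>' (tensor_diff \<Omega> \<Omega>' t) = 0"
proof -
  assume t: "t \<in> TC"
  obtain D where D: "lin tscale tscale D" "\<And>x y. D (T x y) = pdiff x y"
    "\<And>t. t \<in> TC \<Longrightarrow> tensor_diff \<Omega> \<Omega>' t = D t" using pdiff_linear by blast
  have "D (D t) = 0"
    by (rule TC_ext[where f = "\<lambda>t. D (D t)" and g = "\<lambda>t. 0", OF lin_comp[OF D(1) D(1)] _ t])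
      (simp_all add: D(2) pdiff_def lin_add[OF D(1)] lin_zero vector_space_tscale tens_neg)
  then show ?thesis using tensor_diff_lin(1)[OF t] by (simp add: D(3) t)
qed

end

section \<open>Generation by the degree zero part\<close>

context dg_algebra
begin

lemma wedge_list_Cons: "x \<in> carrier \<Omega> \<Longrightarrow> wedge_list \<Omega> (x # xs) = x \<odot> wedge_list \<Omega> xs"
  by (cases xs) (simp_all add: mult_one)

lemma wedge_list_carrier: "set xs \<subseteq> carrier \<Omega> \<Longrightarrow> wedge_list \<Omega> xs \<in> carrier \<Omega>"
  by (induction xs) (auto simp: wedge_list_Cons intro: mult_carrier one_carrier)

lemma wedge_list_append:
  "set xs \<subseteq> carrier \<Omega> \<Longrightarrow> set ys \<subseteq> carrier \<Omega> \<Longrightarrow>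
    wedge_list \<Omega> (xs @ ys) = wedge_list \<Omega> xs \<odot> wedge_list \<Omega> ys"
  by (induction xs) (simp_all add: wedge_list_Cons mult_one mult_assoc wedge_list_carrier)

end

context calculus
begin

lemma A_carrier: "a \<in> carrier A \<Longrightarrow> a \<in> carrier \<Omega>"
  using deg_carrier[of a 0] by (simp add: deg_zero)

text \<open>
  The spanning forms \<open>a da\<^sub>1 \<dots> da\<^sub>n\<close> are products of elements of degree zero and their differentials, and
  scalars are multiples of the unit.
\<close>

lemma calculus_induct_gen [consumes 1, case_names base dbase add mult]:
  assumes "x \<in> carrier \<Omega>"
    and base: "\<And>a. a \<in> carrier A \<Longrightarrow> P a"
    and dbase: "\<And>a. a \<in> carrier A \<Longrightarrow> P (diff \<Omega> a)"
    and add: "\<And>x y. x \<in> carrier \<Omega> \<Longrightarrow> y \<in> carrier \<Omega> \<Longrightarrow> P x \<Longrightarrow> P y \<Longrightarrow> P (x + y)"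
    and mult: "\<And>x y. x \<in> carrier \<Omega> \<Longrightarrow> y \<in> carrier \<Omega> \<Longrightarrow> P x \<Longrightarrow> P y \<Longrightarrow> P (x \<odot>\<^bsub>\<Omega>\<^esub> y)"
  shows "P x"
proof -
  interpret V: vector_space "scale \<Omega>" by (rule scale_vs)
  let ?K = "{x \<in> carrier \<Omega>. P x}"
  have one: "\<one>\<^bsub>\<Omega>\<^esub> \<in> carrier A" using one_deg deg_zero by simp
  have scale: "P (scale \<Omega> c x)" if "x \<in> carrier \<Omega>" "P x" for c x
  proof -
    have c: "scale \<Omega> c \<one>\<^bsub>\<Omega>\<^esub> \<in> carrier A"
      using vspace_closed(2)[OF A.vspace one one] by (simp add: scale_eq)
    have "scale \<Omega> c \<one>\<^bsub>\<Omega>\<^esub> \<odot>\<^bsub>\<Omega>\<^esub> x = scale \<Omega> c x"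
      using bilD(2)[OF tmul_bil, of c "\<one>\<^bsub>\<Omega>\<^esub>" x] tmul_carrier[OF A_carrier[OF c] that(1)]
        proj_id[OF that(1)] by simp
    with mult[OF A_carrier[OF c] that(1) base[OF c] that(2)] show ?thesis by simp
  qed
  have K: "V.subspace ?K"
    using base[OF vspace_closed(3)[OF A.vspace one one]] V.subspace_0[OF is_vspaceD(2)[OF vspace]]
    by (intro V.subspaceI) (auto intro: add scale vspace_closed[OF vspace])
  have wl: "wedge_list \<Omega> xs \<in> ?K" if "set xs \<subseteq> ?K" for xs
    using that base[OF one]
    by (induction xs) (auto simp: wedge_list_Cons intro: mult mult_carrier one_carrier)
  have "deg \<Omega> n \<subseteq> ?K" for n
    unfolding generated
  proof (rule V.span_minimal[OF _ K], safe)
    fix a as assume "a \<in> carrier A" "set as \<subseteq> carrier A"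
    then have "set (a # map (diff \<Omega>) as) \<subseteq> ?K"
      by (auto intro: base dbase A_carrier diff_carrier)
    then show "wedge_list \<Omega> (a # map (diff \<Omega>) as) \<in> carrier \<Omega>" "P (wedge_list \<Omega> (a # map (diff \<Omega>) as))"
      using wl by blast+
  qed
  then have "V.span (\<Union>n. deg \<Omega> n) \<subseteq> ?K" by (intro V.span_minimal[OF _ K]) (rule UN_least)
  then have "carrier \<Omega> \<subseteq> ?K" by (simp only: deg_total)
  then show ?thesis using assms(1) by blast
qed

lemma calculus_induct [consumes 1, case_names base add diff mult]:
  assumes "x \<in> carrier \<Omega>"
    and "\<And>a. a \<in> carrier A \<Longrightarrow> P a"
    and "\<And>x y. x \<in> carrier \<Omega> \<Longrightarrow> y \<in> carrier \<Omega> \<Longrightarrow> P x \<Longrightarrow> P y \<Longrightarrow> P (x + y)"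
    and "\<And>x. x \<in> carrier \<Omega> \<Longrightarrow> P x \<Longrightarrow> P (diff \<Omega> x)"
    and "\<And>x y. x \<in> carrier \<Omega> \<Longrightarrow> y \<in> carrier \<Omega> \<Longrightarrow> P x \<Longrightarrow> P y \<Longrightarrow> P (x \<odot>\<^bsub>\<Omega>\<^esub> y)"
  shows "P x"
  using assms(1)
proof (induction rule: calculus_induct_gen)
  case (dbase a)
  show ?case by (rule assms(4)[OF A_carrier[OF dbase] assms(2)[OF dbase]])
qed (rule assms(2) assms(3) assms(5); assumption)+

lemma wedge_ext:
  assumes f: "lin (scale \<Omega>) sX f" and g: "lin (scale \<Omega>) sX g"
    and eq: "\<And>a as. a \<in> carrier A \<Longrightarrow> set as \<subseteq> carrier A \<Longrightarrow>
      f (wedge_list \<Omega> (a # map (diff \<Omega>) as)) = g (wedge_list \<Omega> (a # map (diff \<Omega>) as))"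
  shows "f (proj x) = g (proj x)"
proof (rule deg_ext[OF f g])
  fix n x assume x: "x \<in> deg \<Omega> n"
  interpret V: vector_space "scale \<Omega>" by (rule scale_vs)
  have "V.subspace {x. f x = g x}"
    by (rule lin_equalizer_subspace[OF f g])
  then have "deg \<Omega> n \<subseteq> {x. f x = g x}"
    unfolding generated by (intro V.span_minimal) (auto simp: eq)
  with x show "f x = g x" by blast
qed

lemma dga_hom_unique:
  assumes F: "dga_hom \<Omega> \<Omega>' F" and G: "dga_hom \<Omega> \<Omega>' G" and eq: "\<And>a. a \<in> carrier A \<Longrightarrow> F a = G a"
    and x: "x \<in> carrier \<Omega>"
  shows "F x = G x"
  using x
proof (induction rule: calculus_induct)
  case (add x y)
  then show ?case using F G unfolding dga_hom_def lin_on_def by simp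
qed (use F G eq in \<open>auto simp: dga_hom_def\<close>)

lemma differential_unique:
  assumes F: "dga_hom \<Omega> \<Omega>' F" and eq: "\<And>a. a \<in> carrier A \<Longrightarrow> F a = f a" and x: "x \<in> carrier \<Omega>"
  shows "differential \<Omega> \<Omega>' f x = F x"
proof -
  have "dga_hom \<Omega> \<Omega>' (differential \<Omega> \<Omega>' f) \<and> (\<forall>a\<in>deg \<Omega> 0. differential \<Omega> \<Omega>' f a = f a)"
    unfolding differential_def by (rule someI[of _ F]) (use F eq deg_zero in auto)
  then show ?thesis using dga_hom_unique[OF _ F _ x] eq deg_zero by metis
qed

end

context dg_algebra
begin

lemma diff_wedge_list: "set as \<subseteq> carrier \<Omega> \<Longrightarrow> td (wedge_list \<Omega> (map (diff \<Omega>) as)) = 0"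
proof (induction as)
  case Nil
  show ?case by simp
next
  case (Cons a as)
  have "wedge_list \<Omega> (map (diff \<Omega>) (a # as)) = tmul (td a) (wedge_list \<Omega> (map (diff \<Omega>) as))"
  proof -
    have "set (map (diff \<Omega>) as) \<subseteq> carrier \<Omega>" using Cons.prems by (auto intro: diff_carrier)
    from wedge_list_carrier[OF this] show ?thesis
      using Cons.prems by (simp add: wedge_list_Cons diff_carrier tmul_carrier td_carrier)
  qed
  then show ?case using Cons by (simp add: tmul_parity)
qed

text \<open>
  By the Leibniz rule, sums of forms \<open>a da\<^sub>1 \<dots> da\<^sub>n\<close> are closed under right multiplication by elements of
  degree zero, hence under products. It thus suffices that degree zero generates in the weak sense of \<open>gen\<close>.
\<close>

lemma generatedI:
  assumes gen: "\<And>K. \<lbrakk>module.subspace (scale \<Omega>) K; deg \<Omega> 0 \<subseteq> K; K \<subseteq> carrier \<Omega>; \<And>x. x \<in> K \<Longrightarrow> diff \<Omega> x \<in> K;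
      \<And>x y. x \<in> K \<Longrightarrow> y \<in> K \<Longrightarrow> x \<odot> y \<in> K\<rbrakk> \<Longrightarrow> carrier \<Omega> \<subseteq> K"
  shows "deg \<Omega> n = module.span (scale \<Omega>)
      {wedge_list \<Omega> (a # map (diff \<Omega>) as) | a as. a \<in> deg \<Omega> 0 \<and> set as \<subseteq> deg \<Omega> 0 \<and> length as = n}"
proof -
  interpret V: vector_space "scale \<Omega>" by (rule scale_vs)
  let ?G = "\<lambda>n. {wedge_list \<Omega> (a # map (diff \<Omega>) as) | a as. a \<in> deg \<Omega> 0 \<and> set as \<subseteq> deg \<Omega> 0 \<and> length as = n}"
  let ?W = "\<lambda>n. V.span (?G n)"
  note dc = deg_carrier[of _ 0]
  have wd: "wedge_list \<Omega> (map (diff \<Omega>) as) \<in> deg \<Omega> (length as)" if "set as \<subseteq> deg \<Omega> 0" for as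
    using that
  proof (induction as)
    case (Cons a as)
    then show ?case
      using mult_deg[OF diff_deg[of a 0], of "wedge_list \<Omega> (map (diff \<Omega>) as)" "length as"]
      by (simp add: wedge_list_Cons diff_carrier dc)
  qed (simp add: one_deg)
  have wedge: "wedge_list \<Omega> (a # map (diff \<Omega>) as) = tmul a (wedge_list \<Omega> (map (diff \<Omega>) as))"
    if "a \<in> deg \<Omega> 0" "set as \<subseteq> deg \<Omega> 0" for a as
    using that wd[OF that(2)] by (simp add: wedge_list_Cons dc tmul_hom)
  have Wdeg: "?W n \<subseteq> deg \<Omega> n" for n
    by (rule V.span_minimal[OF _ deg_subspace]) (use mult_deg[of _ 0] wd in \<open>auto simp: wedge_list_Cons dc\<close>)
  have W0: "deg \<Omega> 0 \<subseteq> ?W 0"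
    by (auto intro!: V.span_base exI[of _ "[]"])
  have app: "tmul w (td b) \<in> ?W (Suc n)" if w: "w \<in> ?W n" and b: "b \<in> deg \<Omega> 0" for w b n
  proof -
    have sub: "V.subspace {w. tmul w (td b) \<in> ?W (Suc n)}"
      by (rule lin_vimage_subspace[OF tmul_left V.subspace_span])
    have "?G n \<subseteq> {w. tmul w (td b) \<in> ?W (Suc n)}"
    proof safe
      fix a as assume h: "a \<in> deg \<Omega> 0" "set as \<subseteq> deg \<Omega> 0" "n = length as"
      have c: "set (a # map (diff \<Omega>) as) \<subseteq> carrier \<Omega>" using h dc by (auto intro: diff_carrier)
      have "tmul (wedge_list \<Omega> (a # map (diff \<Omega>) as)) (td b) = wedge_list \<Omega> (a # map (diff \<Omega>) (as @ [b]))"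
        using wedge_list_append[OF c, of "[diff \<Omega> b]"] wedge_list_carrier[OF c] dc[OF b]
        by (simp add: tmul_carrier diff_carrier td_carrier)
      also have "\<dots> \<in> ?W (Suc (length as))"
        using h b by (intro V.span_base CollectI exI[of _ a] exI[of _ "as @ [b]"]) auto
      finally show "tmul (wedge_list \<Omega> (a # map (diff \<Omega>) as)) (td b) \<in> ?W (Suc (length as))" .
    qed
    then show ?thesis using w V.span_minimal[OF _ sub] by blast
  qed
  have right0: "tmul (wedge_list \<Omega> (a # map (diff \<Omega>) as)) b \<in> ?W (length as)"
    if "a \<in> deg \<Omega> 0" "set as \<subseteq> deg \<Omega> 0" "b \<in> deg \<Omega> 0" for a as b
    using that
  proof (induction as arbitrary: b rule: rev_induct)
    case Nil
    then show ?case using W0 mult_deg[of a 0 b 0] by (auto simp: tmul_hom)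
  next
    case (snoc c as)
    let ?w = "wedge_list \<Omega> (a # map (diff \<Omega>) as)"
    have as: "set as \<subseteq> deg \<Omega> 0" "c \<in> deg \<Omega> 0" using snoc.prems by auto
    have cc: "set (a # map (diff \<Omega>) as) \<subseteq> carrier \<Omega>" using snoc.prems dc by (auto intro: diff_carrier)
    have "wedge_list \<Omega> (a # map (diff \<Omega>) (as @ [c])) = tmul ?w (td c)"
      using wedge_list_append[OF cc, of "[diff \<Omega> c]"] wedge_list_carrier[OF cc] dc[OF as(2)]
      by (simp add: tmul_carrier diff_carrier td_carrier)
    (* the Leibniz rule moves b to the left of dc *)
    moreover have "tmul (td c) b = td (tmul c b) - tmul c (td b)"
      using as(2) by (simp add: tmul_parity hom_simps signed_def)
    moreover have "tmul c b \<in> deg \<Omega> 0" using mult_deg[OF as(2) snoc.prems(3)] as(2) snoc.prems(3) by (simp add: tmul_hom)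
    moreover have "?w \<in> ?W (length as)" using snoc.prems(1) as(1) by (intro V.span_base) blast
    ultimately show ?case
      using app[of ?w "length as" "tmul c b"] app[OF snoc.IH[OF snoc.prems(1) as(1,2)] snoc.prems(3)]
      by (simp add: tmul_assoc V.span_diff)
  qed
  have multW: "tmul x y \<in> ?W (m + n)" if x: "x \<in> ?W m" and y: "y \<in> ?W n" for x y m n
  proof -
    have right: "tmul x b \<in> ?W m" if b: "b \<in> deg \<Omega> 0" for b
    proof -
      have sub: "V.subspace {x. tmul x b \<in> ?W m}"
        by (rule lin_vimage_subspace[OF tmul_left V.subspace_span])
      have "?G m \<subseteq> {x. tmul x b \<in> ?W m}" using right0[OF _ _ b] by blast
      then show ?thesis using V.span_minimal[OF _ sub] x by blast
    qed
    have many: "tmul w (wedge_list \<Omega> (map (diff \<Omega>) bs)) \<in> ?W (k + length bs)"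
      if "w \<in> ?W k" "set bs \<subseteq> deg \<Omega> 0" for w bs k
      using that
    proof (induction bs arbitrary: w k)
      case Nil
      then show ?case using Wdeg[of k] by (auto simp: hom_simps)
    next
      case (Cons b bs)
      have "tmul w (wedge_list \<Omega> (map (diff \<Omega>) (b # bs))) = tmul (tmul w (td b)) (wedge_list \<Omega> (map (diff \<Omega>) bs))"
        using Cons.prems(2) wd[of bs] by (simp add: wedge_list_Cons diff_carrier dc tmul_assoc td_carrier
          tmul_carrier deg_carrier[of _ "length bs"])
      then show ?case using Cons.IH[OF app[OF Cons.prems(1)]] Cons.prems(2) by auto
    qed
    have sub: "V.subspace {y. tmul x y \<in> ?W (m + n)}"
      by (rule lin_vimage_subspace[OF tmul_right V.subspace_span])
    have "?G n \<subseteq> {y. tmul x y \<in> ?W (m + n)}"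
      using many[OF right] by (auto simp: wedge tmul_assoc[symmetric])
    then show ?thesis using V.span_minimal[OF _ sub] y by blast
  qed
  have diffW: "td x \<in> ?W (Suc n)" if x: "x \<in> ?W n" for x n
  proof -
    have sub: "V.subspace {x. td x \<in> ?W (Suc n)}"
      by (rule lin_vimage_subspace[OF td_lin V.subspace_span])
    have "?G n \<subseteq> {x. td x \<in> ?W (Suc n)}"
    proof safe
      fix a as assume h: "a \<in> deg \<Omega> 0" "set as \<subseteq> deg \<Omega> 0" "n = length as"
      have "set as \<subseteq> carrier \<Omega>" using h dc by auto
      then have "td (wedge_list \<Omega> (a # map (diff \<Omega>) as)) = tmul (td a) (wedge_list \<Omega> (map (diff \<Omega>) as))"
        using wedge[OF h(1,2)] h(1) by (simp add: tmul_parity diff_wedge_list hom_simps)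
      also have "\<dots> = wedge_list \<Omega> (\<one> # map (diff \<Omega>) (a # as))"
        using h wd[OF h(2)] by (simp add: wedge_list_Cons diff_carrier dc one_carrier mult_one mult_carrier
          tmul_carrier td_carrier deg_carrier[of _ "length as"])
      also have "\<dots> \<in> ?W (Suc (length as))"
        using h one_deg by (intro V.span_base CollectI exI[of _ \<one>] exI[of _ "a # as"]) auto
      finally show "td (wedge_list \<Omega> (a # map (diff \<Omega>) as)) \<in> ?W (Suc (length as))" .
    qed
    then show ?thesis using V.span_minimal[OF _ sub] x by blast
  qed
  define K where "K = V.span (\<Union>n. ?W n)"
  have K: "V.subspace K" by (simp add: K_def)
  have WK: "?W n \<subseteq> K" for n by (auto simp: K_def intro: V.span_base)
  have Kc: "K \<subseteq> carrier \<Omega>" unfolding K_def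
    by (rule V.span_minimal[OF _ is_vspaceD(2)[OF vspace]]) (use Wdeg deg_carrier in blast)
  have Kd: "td x \<in> K" if x: "x \<in> K" for x
  proof -
    have sub: "V.subspace {x. td x \<in> K}"
      by (rule lin_vimage_subspace[OF td_lin K])
    show ?thesis using V.span_minimal[OF _ sub, of "\<Union>n. ?W n"] diffW WK x unfolding K_def by blast
  qed
  have Km: "tmul x y \<in> K" if x: "x \<in> K" and y: "y \<in> K" for x y
  proof -
    have sub1: "V.subspace {x. tmul x y \<in> K}" for y
      by (rule lin_vimage_subspace[OF tmul_left K])
    have sub2: "V.subspace {y. tmul x y \<in> K}" for x
      by (rule lin_vimage_subspace[OF tmul_right K])
    have "tmul w y \<in> K" if "w \<in> ?W m" for w m
      using V.span_minimal[OF _ sub2, of "\<Union>n. ?W n" w] multW[OF that] WK y unfolding K_def by blast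
    then show ?thesis using V.span_minimal[OF _ sub1, of "\<Union>n. ?W n" y] x unfolding K_def by blast
  qed
  have cK: "carrier \<Omega> \<subseteq> K"
  proof (rule gen[OF K])
    show "deg \<Omega> 0 \<subseteq> K" using W0 WK by blast
    show "diff \<Omega> x \<in> K" if "x \<in> K" for x using Kd[OF that] that Kc td_carrier by auto
    show "x \<odot> y \<in> K" if "x \<in> K" "y \<in> K" for x y
      using Km[OF that] that Kc tmul_carrier[of x y] by (simp add: subset_iff)
  qed (rule Kc)
  have hp: "hom_part n x \<in> ?W n" if "x \<in> K" for x
  proof -
    have sub: "V.subspace {x. hom_part n x \<in> ?W n}"
      by (rule lin_vimage_subspace[OF hom_part_lin V.subspace_span])
    have "?W m \<subseteq> {x. hom_part n x \<in> ?W n}" for m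
      using Wdeg[of m] by (auto simp: hom_part_id V.span_zero)
    then show ?thesis using V.span_minimal[OF _ sub, of "\<Union>n. ?W n"] that unfolding K_def by blast
  qed
  have "deg \<Omega> n \<subseteq> ?W n"
  proof
    fix x assume x: "x \<in> deg \<Omega> n"
    then have "hom_part n x \<in> ?W n" using hp deg_carrier cK by blast
    then show "x \<in> ?W n" using x by (simp add: hom_part_id)
  qed
  with Wdeg show ?thesis by blast
qed

end

section \<open>The differential of the comultiplication\<close>

text \<open>
  The analogue of \<open>bil_factors\<close> for trilinear maps and \<open>(V \<otimes> V) \<otimes> V\<close>. The map factoring \<open>G _ _ c\<close> depends linearly on
  \<open>c\<close> only on sums of pure tensors, so that the first leg is projected onto their span.
\<close>

lemma tril_factors:
  fixes V :: "('k::field, 'v::ab_group_add, 'm) vspace_scheme"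
    and W :: "('k, ('k, 'v, 'v) tensor, 'n) vspace_scheme"
  assumes G: "tril (scale V) sX G" and W: "scale W = tscale"
  obtains L where "lin tscale sX L" "\<And>a b c. L (tens W V (tens V V a b) c) = G a b c"
proof -
  let ?S = "tensor_span V V UNIV UNIV"
  note tl = tril_lin[OF G]
  have vs: "vector_space (scale V)" "vector_space sX" using G lin_vs unfolding tril_def by blast+
  interpret V: vector_space "scale V" by fact
  let ?Z = "\<lparr>carrier = ?S, scale = tscale\<rparr>"
  have Z: "is_vspace ?Z"
    by (simp add: is_vspace_def tensor_span_subspace vector_space_tscale)
  obtain Q where "lin (scale ?Z) (scale ?Z) Q" "\<And>t. Q t \<in> carrier ?Z" "\<And>t. t \<in> carrier ?Z \<Longrightarrow> Q t = t"
    using vspace_projection[OF Z] by blast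
  then have Q: "lin tscale tscale Q" "\<And>t. Q t \<in> ?S" "\<And>t. t \<in> ?S \<Longrightarrow> Q t = t"
    by simp_all
  have "\<exists>L. lin tscale sX L \<and> (\<forall>a b. L (tens V V a b) = G a b c)" for c
  proof -
    have b: "bil (scale V) (scale V) sX (\<lambda>a b. G a b c)"
      by (intro bilI tl lin_ident vs)
    show ?thesis using bil_factors[OF b] by metis
  qed
  then obtain L where L: "\<And>c. lin tscale sX (L c)" "\<And>c a b. L c (tens V V a b) = G a b c"
    by metis
  have "bil tscale (scale V) sX (\<lambda>t c. L c (Q t))"
  proof (rule bilI)
    show "lin tscale sX (\<lambda>t. L c (Q t))" for c by (rule lin_comp[OF L(1) Q(1)])
    fix t
    obtain xs where xs: "Q t = lsum xs (tens V V)"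
      using Q(2)[of t] tensor_span_lsum[OF V.subspace_UNIV vs(1)] by blast
    have "lin (scale V) sX (\<lambda>c. lsum xs (\<lambda>a b. G a b c))"
      by (intro lin_lsum vs tl lin_ident)
    then show "lin (scale V) sX (\<lambda>c. L c (Q t))" by (simp add: xs lin_pull[OF L(1)] L(2))
  qed
  then obtain M where M: "lin tscale sX M" "\<And>t c. M (tens W V t c) = L c (Q t)"
    using bil_factors[of W V sX "\<lambda>t c. L c (Q t)"] unfolding W by blast
  have "M (tens W V (tens V V a b) c) = G a b c" for a b c
    by (simp add: M(2) Q(3) tensor_span_tens L(2))
  with M(1) show thesis by (rule that)
qed

locale differentiable_hopf_algebra = Hopf: hopf_algebra H + calculus H \<Omega>
  for H :: "('k::field, 'h::ab_group_add) hopf"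
    and \<Omega> :: "('k, 'h) dga" +
  assumes comult_differentiable: "differentiable \<Omega> (tensor_dga \<Omega> \<Omega>) (comult H)"
begin

sublocale TT: dg_pair \<Omega> \<Omega> by unfold_locales

abbreviation s where "s \<equiv> scale \<Omega>"

lemma dcomult_hom: "dga_hom \<Omega> (tensor_dga \<Omega> \<Omega>) (dcomult H \<Omega>)"
  and dcomult_base: "h \<in> carrier H \<Longrightarrow> dcomult H \<Omega> h = comult H h"
  using someI_ex[OF comult_differentiable[unfolded differentiable_def]]
  unfolding dcomult_def differential_def deg_zero by auto

text \<open>
  Here \<open>sw x f\<close> is \<open>f(x\<^sub>[\<^sub>1\<^sub>], x\<^sub>[\<^sub>2\<^sub>])\<close>, summed over a chosen representative of \<open>\<Omega>\<^sup>\<bullet>(\<Delta>)(x)\<close>. For bilinear \<open>f\<close> the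
  choice is immaterial.
\<close>

definition S :: "'h \<Rightarrow> ('h \<times> 'h) list" where
  "S x = (SOME xs. set xs \<subseteq> carrier \<Omega> \<times> carrier \<Omega> \<and> dcomult H \<Omega> (proj x) = lsum xs TT.T)"

definition sw :: "'h \<Rightarrow> ('h \<Rightarrow> 'h \<Rightarrow> 'x::ab_group_add) \<Rightarrow> 'x" where
  "sw x f = lsum (S x) f"

lemma S_carrier: "set (S x) \<subseteq> carrier \<Omega> \<times> carrier \<Omega>"
  and dcomult_sw: "dcomult H \<Omega> (proj x) = sw x TT.T"
proof -
  have "dcomult H \<Omega> (proj x) \<in> TT.TC"
    using dcomult_hom proj_carrier[of x] unfolding dga_hom_def lin_on_def by simp
  then have "\<exists>xs. set xs \<subseteq> carrier \<Omega> \<times> carrier \<Omega> \<and> dcomult H \<Omega> (proj x) = lsum xs TT.T"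
    unfolding TT.TC_lsum .
  from someI_ex[OF this] show "set (S x) \<subseteq> carrier \<Omega> \<times> carrier \<Omega>" "dcomult H \<Omega> (proj x) = sw x TT.T"
    unfolding S_def sw_def by blast+
qed

lemma sw_cong:
  "(\<And>a b. a \<in> carrier \<Omega> \<Longrightarrow> b \<in> carrier \<Omega> \<Longrightarrow> f a b = g a b) \<Longrightarrow> sw x f = sw x g"
  unfolding sw_def by (rule lsum_cong) (use S_carrier in auto)

lemma sw_swap: "sw x (\<lambda>a b. sw y (\<lambda>c d. f a b c d)) = sw y (\<lambda>c d. sw x (\<lambda>a b. f a b c d))"
  unfolding sw_def by (rule lsum_swap)

lemma sw_lsum_swap: "sw x (\<lambda>a b. lsum ys (\<lambda>c d. f a b c d)) = lsum ys (\<lambda>c d. sw x (\<lambda>a b. f a b c d))"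
  unfolding sw_def by (rule lsum_swap)

lemma sw_add: "sw x (\<lambda>a b. f a b + g a b) = sw x f + sw x g"
  and sw_neg: "sw x (\<lambda>a b. - f a b) = - sw x f"
  and sw_diff: "sw x (\<lambda>a b. f a b - g a b) = sw x f - sw x g"
  unfolding sw_def by (rule lsum_add lsum_neg lsum_diff)+

lemma sw_0 [simp]: "sw x (\<lambda>a b. 0) = 0"
  by (simp add: sw_def)

lemma sw_pull: "lin s1 s2 \<phi> \<Longrightarrow> \<phi> (sw x f) = sw x (\<lambda>a b. \<phi> (f a b))"
  unfolding sw_def by (rule lin_pull)

lemma sw_proj [simp]: "sw (proj x) f = sw x f"
  by (simp add: sw_def S_def)

lemma sw_absorb: "sw x (\<lambda>a b. f (proj a) b) = sw x f" "sw x (\<lambda>a b. f a (proj b)) = sw x f"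
proof -
  show "sw x (\<lambda>a b. f (proj a) b) = sw x f"
    by (rule sw_cong[where f = "\<lambda>a b. f (proj a) b" and g = f]) (simp only: proj_id)
  show "sw x (\<lambda>a b. f a (proj b)) = sw x f"
    by (rule sw_cong[where f = "\<lambda>a b. f a (proj b)" and g = f]) (simp only: proj_id)
qed

lemma dcomult_lin: "lin s tscale (\<lambda>x. dcomult H \<Omega> (proj x))"
  using dcomult_hom unfolding dga_hom_def lin_on_def
  by (intro linI scale_vs vector_space_tscale) (simp_all add: proj_carrier)

lemma sw_factor:
  assumes "bil s s sX f"
  obtains L where "lin tscale sX L" "\<And>x. sw x f = L (dcomult H \<Omega> (proj x))" "\<And>a b. L (TT.T a b) = f a b"
proof -
  obtain L where L: "lin tscale sX L" "\<And>a b. L (TT.T a b) = f a b" using bil_factors[OF assms] by blast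
  moreover have "sw x f = L (dcomult H \<Omega> (proj x))" for x
    by (simp add: dcomult_sw sw_pull[OF L(1)] L(2))
  ultimately show thesis by (intro that)
qed

lemma sw_arg_lin: "lin s' s g \<Longrightarrow> bil s s sX f \<Longrightarrow> lin s' sX (\<lambda>x. sw (g x) f)"
proof -
  assume g: "lin s' s g" and f: "bil s s sX f"
  obtain L where L: "lin tscale sX L" "\<And>x. sw x f = L (dcomult H \<Omega> (proj x))"
    "\<And>a b. L (TT.T a b) = f a b" using sw_factor[OF f] by blast
  show ?thesis unfolding L(2) by (rule lin_comp[OF L(1) lin_comp[OF dcomult_lin g]])
qed

lemma sw_body_lin:
  "vector_space s1 \<Longrightarrow> vector_space s2 \<Longrightarrow> (\<And>a b. lin s1 s2 (\<lambda>v. f v a b)) \<Longrightarrow> lin s1 s2 (\<lambda>v. sw x (f v))"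
  unfolding sw_def by (rule lin_lsum)

lemmas sw_lin [multilin] = sw_arg_lin sw_body_lin

lemma sw_one:
  assumes f: "bil s s sX f"
  shows "sw \<one>\<^bsub>\<Omega>\<^esub> f = f \<one>\<^bsub>\<Omega>\<^esub> \<one>\<^bsub>\<Omega>\<^esub>"
proof -
  obtain L where L: "lin tscale sX L" "\<And>x. sw x f = L (dcomult H \<Omega> (proj x))"
    "\<And>a b. L (TT.T a b) = f a b" using sw_factor[OF f] by blast
  show ?thesis using dcomult_hom unfolding dga_hom_def by (simp add: L)
qed

text \<open>
  \<open>\<Omega>\<^sup>\<bullet>(\<Delta>)\<close> is a morphism of algebras, of complexes and of graded spaces; each of these properties
  becomes a rule for expanding a summation.
\<close>

lemma sw_mult:
  assumes f: "bil s s sX f"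
  shows "sw (tmul x y) f = sw x (\<lambda>a b. sw y (\<lambda>a' b'.
    f (tmul a a') (tmul (ev b) b') + f (tmul a (sg a')) (tmul (od b) b')))"
proof -
  obtain L where L: "lin tscale sX L" "\<And>x. sw x f = L (dcomult H \<Omega> (proj x))"
    "\<And>a b. L (TT.T a b) = f a b" using sw_factor[OF f] by blast
  have "dcomult H \<Omega> (tmul x y) = dcomult H \<Omega> (proj x) \<odot>\<^bsub>tensor_dga \<Omega> \<Omega>\<^esub> dcomult H \<Omega> (proj y)"
    using dcomult_hom proj_carrier unfolding dga_hom_def tmul_def by blast
  also have "\<dots> = sw x (\<lambda>a b. sw y (\<lambda>a' b'. TT.pmul a b a' b'))"
    unfolding dcomult_sw sw_def by (rule TT.tensor_dga_mult[OF S_carrier S_carrier])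
  finally show ?thesis
    by (simp add: L(2) sw_pull[OF L(1)] TT.pmul_def lin_add[OF L(1)] L(3))
qed

lemma sw_td:
  assumes f: "bil s s sX f"
  shows "sw (td x) f = sw x (\<lambda>a b. f (td a) b + f (sg a) (td b))"
proof -
  obtain L where L: "lin tscale sX L" "\<And>x. sw x f = L (dcomult H \<Omega> (proj x))"
    "\<And>a b. L (TT.T a b) = f a b" using sw_factor[OF f] by blast
  have "dcomult H \<Omega> (td x) = tensor_diff \<Omega> \<Omega> (dcomult H \<Omega> (proj x))"
    using dcomult_hom proj_carrier unfolding dga_hom_def td_def by simp
  also have "\<dots> = sw x TT.pdiff"
    unfolding dcomult_sw sw_def by (rule TT.tensor_diff_lsum[OF S_carrier])
  finally show ?thesis
    by (simp add: L(2) sw_pull[OF L(1)] TT.pdiff_def lin_add[OF L(1)] L(3))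
qed

lemma dcomult_graded:
  assumes E: "lin tscale tscale E" and e: "lin s s e"
    and hom: "\<And>p q x y. x \<in> deg \<Omega> p \<Longrightarrow> y \<in> deg \<Omega> q \<Longrightarrow> E (TT.T x y) = (if g (p + q) then TT.T x y else 0)"
    and ehom: "\<And>p x. x \<in> deg \<Omega> p \<Longrightarrow> e x = (if g p then x else 0)"
  shows "dcomult H \<Omega> (proj (e (proj x))) = E (dcomult H \<Omega> (proj x))"
proof -
  have "dcomult H \<Omega> (proj (e (proj x))) = E (dcomult H \<Omega> (proj (proj x)))"
  proof (rule deg_ext[where f = "\<lambda>x. dcomult H \<Omega> (proj (e x))" and g = "\<lambda>x. E (dcomult H \<Omega> (proj x))" and sX = tscale])
    show "lin s tscale (\<lambda>x. dcomult H \<Omega> (proj (e x)))" by (rule lin_comp[OF dcomult_lin e])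
    show "lin s tscale (\<lambda>x. E (dcomult H \<Omega> (proj x)))" by (rule lin_comp[OF E dcomult_lin])
    fix n x assume x: "x \<in> deg \<Omega> n"
    then have d: "dcomult H \<Omega> x \<in> tensor_deg \<Omega> \<Omega> n"
      using dcomult_hom unfolding dga_hom_def by simp
    have "E (dcomult H \<Omega> x) = (if g n then dcomult H \<Omega> x else 0)"
    proof (rule TT.tensor_deg_ext[OF E _ d, where g = "\<lambda>t. if g n then t else 0"])
      show "lin tscale tscale (\<lambda>t::('k, 'h, 'h) tensor. if g n then t else 0)"
        by (cases "g n") (simp_all add: lin_ident lin_zero vector_space_tscale)
    qed (auto simp: hom)
    then show "dcomult H \<Omega> (proj (e x)) = E (dcomult H \<Omega> (proj x))"
      using lin_0[OF dcomult_lin] by (simp add: ehom[OF x] hom_simps(1)[OF x])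
  qed
  then show ?thesis by simp
qed

lemma sw_parity:
  assumes f: "bil s s sX f"
  shows "sw (ev x) f = sw x (\<lambda>a b. f (ev a) (ev b) + f (od a) (od b))"
    and "sw (od x) f = sw x (\<lambda>a b. f (ev a) (od b) + f (od a) (ev b))"
    and "sw (sg x) f = sw x (\<lambda>a b. f (sg a) (sg b))"
    and "sw (pz x) f = sw x (\<lambda>a b. f (pz a) (pz b))"
proof -
  obtain L where L: "lin tscale sX L" "\<And>x. sw x f = L (dcomult H \<Omega> (proj x))"
    "\<And>a b. L (TT.T a b) = f a b" using sw_factor[OF f] by blast
  have ex: "\<exists>E. lin tscale tscale E \<and> (\<forall>a b. E (TT.T a b) = h a b)" if h: "bil s s tscale h" for h
    using bil_factors[OF h] by metis
  have gen: "sw (e x) f = sw x (\<lambda>a b. L (h a b))"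
    if h: "bil s s tscale h" and e: "lin s s e" "\<And>x. e (proj x) = e x"
      and hom: "\<And>p q x y. x \<in> deg \<Omega> p \<Longrightarrow> y \<in> deg \<Omega> q \<Longrightarrow> h x y = (if g (p + q) then TT.T x y else 0)"
      and ehom: "\<And>p x. x \<in> deg \<Omega> p \<Longrightarrow> e x = (if g p then x else 0)" for h e g
  proof -
    obtain E where E: "lin tscale tscale E" "\<And>a b. E (TT.T a b) = h a b" using ex[OF h] by blast
    have "dcomult H \<Omega> (proj (e (proj x))) = E (dcomult H \<Omega> (proj x))"
      by (rule dcomult_graded[OF E(1) e(1), of g]) (simp_all add: E(2) hom ehom)
    then show ?thesis by (simp add: L(2) e(2)) (simp add: dcomult_sw sw_pull[OF E(1)] sw_pull[OF L(1)] E(2))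
  qed
  show e: "sw (ev x) f = sw x (\<lambda>a b. f (ev a) (ev b) + f (od a) (od b))"
    using gen[of "\<lambda>a b. TT.T (ev a) (ev b) + TT.T (od a) (od b)" ev even, OF bilI[OF lin_plus lin_plus]]
    by (simp add: multilin hom_simps lin_add[OF L(1)] L(3))
  show o: "sw (od x) f = sw x (\<lambda>a b. f (ev a) (od b) + f (od a) (ev b))"
    using gen[of "\<lambda>a b. TT.T (ev a) (od b) + TT.T (od a) (ev b)" od odd, OF bilI[OF lin_plus lin_plus]]
    by (simp add: multilin hom_simps lin_add[OF L(1)] L(3))
  show "sw (pz x) f = sw x (\<lambda>a b. f (pz a) (pz b))"
    using gen[of "\<lambda>a b. TT.T (pz a) (pz b)" pz "\<lambda>n. n = 0", OF bilI]
    by (simp add: multilin hom_simps L(3))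
  have fl: "f (a - a') b = f a b - f a' b" "f a (b - b') = f a b - f a b'" for a a' b b'
    using lin_diff[OF bil_left[OF f lin_ident[OF scale_vs]]] lin_diff[OF bil_right[OF f lin_ident[OF scale_vs]]]
    by simp_all
  have "sw (sg x) f = sw (ev x) f - sw (od x) f"
    unfolding sg_def by (rule lin_diff[OF sw_arg_lin[OF lin_ident[OF scale_vs] f]])
  also have "\<dots> = sw x (\<lambda>a b. f (sg a) (sg b))"
    unfolding e o sw_diff[symmetric] sg_def by (rule arg_cong[where f = "sw x"]) (auto simp: fl fun_eq_iff)
  finally show "sw (sg x) f = sw x (\<lambda>a b. f (sg a) (sg b))" .
qed

lemma H_vspace: "is_vspace H"
  by (rule Hopf.vspace)

text \<open>
  Elements of degree zero have two representing lists, the chosen one and one with entries in \<open>H\<close>.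
\<close>

lemma comult_list:
  assumes h: "h \<in> carrier H"
  obtains xs where "set xs \<subseteq> carrier H \<times> carrier H" "comult H h = lsum xs TT.T" "sw h TT.T = lsum xs TT.T"
proof -
  have T: "tens H H = TT.T" by (rule tens_cong) (simp_all add: scale_eq)
  have "comult H h \<in> tensor_span H H (carrier H) (carrier H)"
    using Hopf.comult_lin h unfolding lin_on_def tensor_space_def by simp
  then obtain xs where xs: "set xs \<subseteq> carrier H \<times> carrier H" "comult H h = lsum xs TT.T"
    unfolding tensor_span_lsum[OF is_vspaceD(2)[OF H_vspace] is_vspaceD(1)[OF H_vspace]] T by blast
  moreover have "sw h TT.T = lsum xs TT.T"
    unfolding dcomult_sw[symmetric] using h by (simp add: proj_id A_carrier dcomult_base xs(2))
  ultimately show thesis by (rule that)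
qed

lemma comult_sw:
  assumes h: "h \<in> carrier H" and g: "bil s s sX g"
    and f: "\<And>a b. a \<in> carrier H \<Longrightarrow> b \<in> carrier H \<Longrightarrow> f a b = g a b"
  shows "sw2 H h f = sw h g"
proof -
  obtain xs where xs: "set xs \<subseteq> carrier H \<times> carrier H" "comult H h = lsum xs TT.T" "sw h TT.T = lsum xs TT.T"
    using comult_list[OF h] by blast
  have T: "tens H H = TT.T" by (rule tens_cong) (simp_all add: scale_eq)
  have "sw2 H h f = lsum xs g"
    unfolding sw2_def xs(2) T[symmetric]
    by (rule tlift_lsum[OF H_vspace H_vspace _ xs(1)]) (use g f in \<open>simp_all add: scale_eq\<close>)
  then show ?thesis using tens_lsum_eq[of \<Omega> \<Omega> sX g "S h" xs] g xs(3) by (simp add: sw_def)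
qed

lemma pz_H: "pz x \<in> carrier H"
  using op_carrier(6)[of x] by (simp add: deg_zero)

lemma pz_id: "h \<in> carrier H \<Longrightarrow> pz h = h"
  by (simp add: hom_simps(5)[of h 0] deg_zero)

lemma H_mult: "a \<in> carrier H \<Longrightarrow> b \<in> carrier H \<Longrightarrow> a \<odot>\<^bsub>H\<^esub> b = tmul a b"
  by (simp add: tmul_carrier A_carrier mult_eq)

lemma H_mult_closed: "a \<in> carrier H \<Longrightarrow> b \<in> carrier H \<Longrightarrow> tmul a b \<in> carrier H"
  using mult_deg[of a 0 b 0] by (simp add: deg_zero tmul_carrier A_carrier)

lemma sw_H_cong:
  assumes h: "h \<in> carrier H" and f: "bil s s sX f" and g: "bil s s sX g"
    and "\<And>a b. a \<in> carrier H \<Longrightarrow> b \<in> carrier H \<Longrightarrow> f a b = g a b"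
  shows "sw h f = sw h g"
  using comult_sw[OF h f, of f] comult_sw[OF h g, of f] assms(4) by simp

text \<open>
  Extension by zero makes the counit multiplicative on forms, and a counit for \<open>\<Omega>\<^sup>\<bullet>(\<Delta>)\<close> on both sides.
\<close>

definition eps :: "'h \<Rightarrow> 'k" where "eps x = counit H (pz x)"

lemma eps_lin: "lin s (*) eps"
  unfolding eps_def using Hopf.counit_add[OF pz_H pz_H] Hopf.counit_scale[OF pz_H]
  by (intro linI scale_vs vector_space_mult) (simp_all add: scale_eq[symmetric])

lemma eps_simps [simp]:
  "eps (tmul x y) = eps x * eps y" "eps \<one>\<^bsub>\<Omega>\<^esub> = 1" "eps (td x) = 0" "eps (ev x) = eps x" "eps (od x) = 0"
  "eps (sg x) = eps x" "eps (pz x) = eps x" "eps (proj x) = eps x"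
  using Hopf.counit_mult[OF pz_H pz_H] Hopf.counit_one lin_0[OF eps_lin] mult_eq[OF pz_H pz_H]
  by (simp_all add: eps_def tmul_parity tmul_carrier A_carrier pz_H one_eq[symmetric])

lemma eps_multilin [multilin]:
  "lin s' s g \<Longrightarrow> lin s' (*) (\<lambda>x. eps (g x))" "lin s (*) eps"
  "lin s' s g \<Longrightarrow> vector_space sX \<Longrightarrow> lin s' sX (\<lambda>x. sX (eps (g x)) v)"
  by (auto intro: lin_comp[OF eps_lin] eps_lin lin_scaled_const)

lemma counit_H:
  assumes h: "h \<in> carrier H"
  shows "sw h (\<lambda>a b. s (eps a) b) = h" "sw h (\<lambda>a b. s (eps b) a) = h"
proof -
  have "bil s s s (\<lambda>a b. s (eps a) b)" "bil s s s (\<lambda>a b. s (eps b) a)"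
    by (intro bilI multilin lin_scaled)+
  from comult_sw[OF h this(1), of "\<lambda>a b. scale H (counit H a) b"] comult_sw[OF h this(2), of "\<lambda>a b. scale H (counit H b) a"]
  show "sw h (\<lambda>a b. s (eps a) b) = h" "sw h (\<lambda>a b. s (eps b) a) = h"
    using Hopf.counital[OF h] by (simp_all add: eps_def pz_id scale_eq)
qed

text \<open>
  The maps \<open>(\<epsilon> \<otimes> id) \<circ> \<Omega>\<^sup>\<bullet>(\<Delta>)\<close> and \<open>(id \<otimes> \<epsilon>) \<circ> \<Omega>\<^sup>\<bullet>(\<Delta>)\<close> are multiplicative, commute with the
  differential and are the identity in degree zero.
\<close>

lemma counit_proj: "sw x (\<lambda>a b. s (eps a) b) = proj x" "sw x (\<lambda>a b. s (eps b) a) = proj x"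
proof -
  interpret V: vector_space s by (rule scale_vs)
  have b: "bil s s s (\<lambda>a b. s (eps a) b)" "bil s s s (\<lambda>a b. s (eps b) a)"
    by (intro bilI multilin lin_scaled)+
  have "sw x (\<lambda>a b. s (eps a) b) = x \<and> sw x (\<lambda>a b. s (eps b) a) = x" if "x \<in> carrier \<Omega>" for x
    using that
  proof (induction rule: calculus_induct)
    case (base h)
    then show ?case using counit_H by simp
  next
    case (add x y)
    then show ?case
      using lin_add[OF sw_arg_lin[OF lin_ident[OF scale_vs] b(1)]] lin_add[OF sw_arg_lin[OF lin_ident[OF scale_vs] b(2)]]
      by simp
  next
    case (diff x)
    have "sw (td x) (\<lambda>a b. s (eps a) b) = td (sw x (\<lambda>a b. s (eps a) b))"
      "sw (td x) (\<lambda>a b. s (eps b) a) = td (sw x (\<lambda>a b. s (eps b) a))"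
      by (simp_all add: sw_td[OF b(1)] sw_td[OF b(2)] sw_pull[OF td_lin])
    then show ?case using diff by (simp add: td_carrier)
  next
    case (mult x y)
    have e: "tmul (ev b) b' + tmul (od b) b' = tmul b b'" for b b'
      using bilD(1)[OF tmul_bil, of "ev b" "od b" b'] by (simp add: absorb)
    have "sw (tmul x y) (\<lambda>a b. s (eps a) b) =
      sw x (\<lambda>a b. sw y (\<lambda>a' b'. tmul (s (eps a) b) (s (eps a') b')))"
      by (simp add: sw_mult[OF b(1)] V.scale_right_distrib[symmetric] e mult.commute)
    also have "\<dots> = tmul (sw x (\<lambda>a b. s (eps a) b)) (sw y (\<lambda>a b. s (eps a) b))"
      by (simp only: sw_pull[OF tmul_left] sw_pull[OF tmul_right]) (rule sw_swap)
    finally have 1: "sw (tmul x y) (\<lambda>a b. s (eps a) b) = tmul x y" using mult.IH by simp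
    have "sw (tmul x y) (\<lambda>a b. s (eps b) a) =
      sw x (\<lambda>a b. sw y (\<lambda>a' b'. tmul (s (eps b) a) (s (eps b') a')))"
      by (simp add: sw_mult[OF b(2)] mult.commute)
    also have "\<dots> = tmul (sw x (\<lambda>a b. s (eps b) a)) (sw y (\<lambda>a b. s (eps b) a))"
      by (simp only: sw_pull[OF tmul_left] sw_pull[OF tmul_right]) (rule sw_swap)
    finally show ?case using 1 mult by (simp add: tmul_carrier)
  qed
  from this[OF proj_carrier[of x]] show "sw x (\<lambda>a b. s (eps a) b) = proj x" "sw x (\<lambda>a b. s (eps b) a) = proj x"
    by simp_all
qed

lemma sw_counit:
  assumes f: "lin s sX f"
  shows "sw x (\<lambda>a b. sX (eps a) (f b)) = f (proj x)" "sw x (\<lambda>a b. sX (eps b) (f a)) = f (proj x)"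
  using arg_cong[OF counit_proj(1)[of x], of f] arg_cong[OF counit_proj(2)[of x], of f]
  by (simp_all add: sw_pull[OF f] lin_scale[OF f])

text \<open>
  Coassociativity of \<open>\<Omega>\<^sup>\<bullet>(\<Delta>)\<close> propagates from degree zero: both iterated coproducts are
  multiplicative and commute with the differential. The coassociativity of the left and right
  coactions on forms and the compatibility of the two are its components.
\<close>

lemma coassoc_carrier:
  assumes vs: "vector_space sX" and "x \<in> carrier \<Omega>" "tril s sX G"
  shows "sw x (\<lambda>a b. sw a (\<lambda>c d. G c d b)) = sw x (\<lambda>a b. sw b (\<lambda>c d. G a c d))"
  using assms(2,3)
proof (induction arbitrary: G rule: calculus_induct)
  case (base h)
  note tl = tril_lin[OF base(2)]
  let ?W = "tensor_space H H"
  let ?G = "\<lambda>a b c. tens ?W H (tens H H a b) c"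
  have W: "scale ?W = tscale" by (simp add: tensor_space_def)
  have "bil (scale ?W) (scale H) tscale (tens ?W H)" "bil (scale H) (scale H) tscale (tens H H)"
    by (rule tens_lin; simp add: W vector_space_tscale is_vspaceD(1)[OF H_vspace])+
  then have Tb: "bil tscale s tscale (tens ?W H)" "bil s s tscale (tens H H)" by (simp_all add: W scale_eq)
  have G: "bil s s tscale (\<lambda>a b. ?G a b c)" "bil s s tscale (\<lambda>b c. ?G a b c)" for a c
    by (intro bilI bil_left[OF Tb(1)] bil_right[OF Tb(1)] bil_left[OF Tb(2)] bil_right[OF Tb(2)] multilin)+
  have bl: "bil s s tscale (\<lambda>a b. sw a (\<lambda>c d. ?G c d b))" "bil s s tscale (\<lambda>a b. sw b (\<lambda>c d. ?G a c d))"
    by (intro bilI bil_left[OF Tb(1)] bil_right[OF Tb(1)] bil_left[OF Tb(2)] bil_right[OF Tb(2)] multilin)+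
  obtain L where L: "lin tscale sX L" "\<And>a b c. L (tens ?W \<Omega> (tens \<Omega> \<Omega> a b) c) = G a b c"
    using tril_factors[OF base(2) W] by blast
  have e: "tens ?W \<Omega> = tens ?W H" "tens \<Omega> \<Omega> = tens H H" by (rule tens_cong; simp add: scale_eq)+
  have "sw h (\<lambda>a b. sw a (\<lambda>c d. ?G c d b)) = sw2 H h (\<lambda>a b. sw2 H a (\<lambda>c d. ?G c d b))"
    by (rule comult_sw[OF base(1) bl(1), symmetric]) (rule comult_sw[OF _ G(1)], simp_all)
  also have "\<dots> = sw2 H h (\<lambda>a b. sw2 H b (\<lambda>c d. ?G a c d))"
    by (rule Hopf.coassoc[OF base(1)])
  also have "\<dots> = sw h (\<lambda>a b. sw b (\<lambda>c d. ?G a c d))"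
    by (rule comult_sw[OF base(1) bl(2)]) (rule comult_sw[OF _ G(2)], simp_all)
  finally have "L (sw h (\<lambda>a b. sw a (\<lambda>c d. ?G c d b))) = L (sw h (\<lambda>a b. sw b (\<lambda>c d. ?G a c d)))" by simp
  then show ?case by (simp add: sw_pull[OF L(1)] L(2)[unfolded e])
next
  case (add x y)
  note tl = tril_lin[OF add.prems]
  have "bil s s sX (\<lambda>a b. sw a (\<lambda>c d. G c d b))" "bil s s sX (\<lambda>a b. sw b (\<lambda>c d. G a c d))"
    by (intro bilI tl multilin vs)+
  from lin_add[OF sw_arg_lin[OF lin_ident[OF scale_vs] this(1)]] lin_add[OF sw_arg_lin[OF lin_ident[OF scale_vs] this(2)]]
  show ?case by (simp add: add.IH[OF add.prems])
next
  case (diff x)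
  note tl = tril_lin[OF diff.prems]
  have b: "bil s s sX (\<lambda>a b. sw a (\<lambda>c d. G c d b))" "bil s s sX (\<lambda>a b. sw b (\<lambda>c d. G a c d))"
    by (intro bilI tl multilin vs)+
  have b': "bil s s sX (\<lambda>a b. G a b z)" "bil s s sX (\<lambda>b c. G z b c)" for z
    by (intro bilI tl multilin vs)+
  let ?G = "\<lambda>a b c. G (td a) b c + G (sg a) (td b) c + G (sg a) (sg b) (td c)"
  have "tril s sX ?G" by (intro trilI tl multilin vs)
  from diff.IH[OF this] have "sw (td x) (\<lambda>a b. sw a (\<lambda>c d. G c d b)) = sw (td x) (\<lambda>a b. sw b (\<lambda>c d. G a c d))"
    unfolding sw_td[OF b(1)] sw_td[OF b(2)] sw_td[OF b'(1)] sw_td[OF b'(2)] sw_parity(3)[OF b'(1)] sw_parity(3)[OF b'(2)]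
    by (simp add: sw_add add.assoc)
  then show ?case using diff.hyps by (simp add: td_carrier)
next
  case (mult x y)
  note tl = tril_lin[OF mult.prems]
  have b: "bil s s sX (\<lambda>a b. sw a (\<lambda>c d. G c d b))" "bil s s sX (\<lambda>a b. sw b (\<lambda>c d. G a c d))"
    by (intro bilI tl multilin vs)+
  have b': "bil s s sX (\<lambda>a b. G a b z)" "bil s s sX (\<lambda>b c. G z b c)" for z
    by (intro bilI tl multilin vs)+
  have b1: "bil s s sX (\<lambda>c' d'. G (tmul c c') (tmul (ev d) d') z + G (tmul c (sg c')) (tmul (od d) d') z)" for c d z
    by (intro bilI tl multilin vs)
  have b2: "bil s s sX (\<lambda>c d. sw w (\<lambda>c' d'. G z (tmul c c') (tmul (ev d) d') + G z (tmul c (sg c')) (tmul (od d)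
    d')))" for w z
    by (intro bilI tl multilin vs)
  let ?G = "\<lambda>a b c a' b' c'. G (tmul a a') (tmul (ev b) b') (tmul (ev c) c')
    + G (tmul a (sg a')) (tmul (od b) b') (tmul (ev c) c')
    + G (tmul a (sg a')) (tmul (ev b) (sg b')) (tmul (od c) c')
    + G (tmul a a') (tmul (od b) (sg b')) (tmul (od c) c')"
  have "sw (tmul x y) (\<lambda>a b. sw a (\<lambda>c d. G c d b)) =
    sw x (\<lambda>a b. sw y (\<lambda>a' b'. sw a (\<lambda>c d. sw a' (\<lambda>c' d'. ?G c d b c' d' b'))))"
    unfolding sw_mult[OF b(1)] sw_mult[OF b'(1)] sw_parity(3)[OF b1] by (simp add: sw_add ac_simps)
  also have "\<dots> = sw x (\<lambda>a b. sw a (\<lambda>c d. sw y (\<lambda>a' b'. sw a' (\<lambda>c' d'. ?G c d b c' d' b'))))"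
    unfolding sw_swap[where x = y] ..
  also have "\<dots> = sw x (\<lambda>a b. sw b (\<lambda>c d. sw y (\<lambda>a' b'. sw a' (\<lambda>c' d'. ?G a c d c' d' b'))))"
    by (rule mult.IH(1)) (intro trilI tl multilin vs)
  also have "\<dots> = sw x (\<lambda>a b. sw b (\<lambda>c d. sw y (\<lambda>a' b'. sw b' (\<lambda>c' d'. ?G a c d a' c' d'))))"
  proof -
    have "sw y (\<lambda>a' b'. sw a' (\<lambda>c' d'. ?G a c d c' d' b')) = sw y (\<lambda>a' b'. sw b' (\<lambda>c' d'. ?G a c d a' c' d'))" for a c d
      by (rule mult.IH(2)) (intro trilI tl multilin vs)
    then show ?thesis by simp
  qed
  also have "\<dots> = sw x (\<lambda>a b. sw y (\<lambda>a' b'. sw b (\<lambda>c d. sw b' (\<lambda>c' d'. ?G a c d a' c' d'))))"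
    unfolding sw_swap[where x = y] ..
  also have "\<dots> = sw (tmul x y) (\<lambda>a b. sw b (\<lambda>c d. G a c d))"
    unfolding sw_mult[OF b(2)] sw_mult[OF b'(2)] sw_parity(1)[OF b2] sw_parity(2)[OF b2]
    by (simp add: sw_add ac_simps lin_0[OF tl(3)[OF lin_ident[OF scale_vs]]])
  finally show ?case using mult.hyps by (simp add: tmul_carrier)
qed

lemma coassoc:
  assumes G: "tril s sX G"
  shows "sw x (\<lambda>a b. sw a (\<lambda>c d. G c d b)) = sw x (\<lambda>a b. sw b (\<lambda>c d. G a c d))"
proof -
  have "vector_space sX" using G lin_vs unfolding tril_def by blast
  from coassoc_carrier[OF this proj_carrier G, of x] show ?thesis by simp
qed

text \<open>
  The hypothesis \<open>sgn\<close> holds when \<open>F\<close> only sees the degree zero part of its first argument; then no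
  Koszul sign survives.
\<close>

lemma sw_mult_even:
  assumes F: "bil s s sX F" and sgn: "\<And>a a' b. F (tmul a (sg a')) b = F (tmul a a') b"
  shows "sw (tmul x y) F = sw x (\<lambda>a b. sw y (\<lambda>a' b'. F (tmul a a') (tmul b b')))"
proof -
  have "F p (tmul (ev b) b') + F p (tmul (od b) b') = F p (tmul b b')" for p b b'
    unfolding bilD(3)[OF F, symmetric] tmul_simps[symmetric] by simp
  then show ?thesis unfolding sw_mult[OF F] sgn by simp
qed

lemma coassoc2:
  assumes "\<And>a' b' c'. tril s sX (\<lambda>a b c. G a a' b b' c c')" "\<And>a b c. tril s sX (\<lambda>a' b' c'. G a a' b b' c c')"
  shows "sw x (\<lambda>a b. sw y (\<lambda>a' b'. sw a (\<lambda>c d. sw a' (\<lambda>c' d'. G c c' d d' b b')))) =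
    sw x (\<lambda>a b. sw y (\<lambda>a' b'. sw b (\<lambda>c d. sw b' (\<lambda>c' d'. G a a' c c' d d'))))"
proof -
  have vs: "vector_space sX" using assms(1) lin_vs unfolding tril_def by blast
  note tl = tril_lin[OF assms(1)] tril_lin[OF assms(2)]
  have "sw x (\<lambda>a b. sw y (\<lambda>a' b'. sw a (\<lambda>c d. sw a' (\<lambda>c' d'. G c c' d d' b b')))) =
    sw x (\<lambda>a b. sw a (\<lambda>c d. sw y (\<lambda>a' b'. sw a' (\<lambda>c' d'. G c c' d d' b b'))))"
    unfolding sw_swap[where x = y] ..
  also have "\<dots> = sw x (\<lambda>a b. sw b (\<lambda>c d. sw y (\<lambda>a' b'. sw a' (\<lambda>c' d'. G a c' c d' d b'))))"
    by (rule coassoc[where sX = sX]) (intro trilI multilin tl vs)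
  also have "\<dots> = sw x (\<lambda>a b. sw b (\<lambda>c d. sw y (\<lambda>a' b'. sw b' (\<lambda>c' d'. G a a' c c' d d'))))"
    unfolding coassoc[OF assms(2)] ..
  also have "\<dots> = sw x (\<lambda>a b. sw y (\<lambda>a' b'. sw b (\<lambda>c d. sw b' (\<lambda>c' d'. G a a' c c' d d'))))"
    unfolding sw_swap[where x = y] ..
  finally show ?thesis .
qed

end

section \<open>The twisted action on forms\<close>

locale crossed_product_calculus =
  differentiable_hopf_algebra H \<Omega>H + tw: twisted_module_calculus H B act \<sigma> \<Omega>B
  for H :: "('k::field, 'h::ab_group_add) hopf"
    and B :: "('k, 'b::ab_group_add) alg"
    and act :: "'h \<Rightarrow> 'b \<Rightarrow> 'b"
    and \<sigma> :: "'h \<Rightarrow> 'h \<Rightarrow> 'b"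
    and \<Omega>B :: "('k, 'b) dga"
    and \<Omega>H :: "('k, 'h) dga"
begin

notation tmul (infixl "\<star>" 70)
notation tw.tmul (infixl "\<bullet>" 70)

abbreviation sB where "sB \<equiv> scale \<Omega>B"

text \<open>
  The action and the cocycle, extended by zero to forms on \<open>H\<close> of positive degree. With this extension
  \<open>\<gamma>\<^sub>-\<^sub>1\<close> may be replaced by the first leg \<open>\<gamma>\<^sub>[\<^sub>1\<^sub>]\<close> of the full coproduct.
\<close>

definition ac :: "'h \<Rightarrow> 'b \<Rightarrow> 'b" where "ac h x = act (pz h) (tw.proj x)"

definition sig :: "'h \<Rightarrow> 'h \<Rightarrow> 'b" where "sig h g = \<sigma> (pz h) (pz g)"

lemma scale_B: "scale B = sB"
  by (simp add: tw.scale_eq)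

lemma scale_H: "scale H = s"
  by (simp add: scale_eq)

lemma ac_closed: "ac h x \<in> carrier \<Omega>B"
  using tw.act_forms_bilin pz_H tw.proj_carrier unfolding ac_def bilin_on_def lin_on_def by blast

lemma sig_B: "sig h g \<in> carrier B"
  using tw.cocycle_bilin pz_H unfolding sig_def bilin_on_def lin_on_def by blast

lemma ac_bil: "bil s sB sB ac"
  using tw.act_forms_bilin pz_H tw.proj_carrier unfolding ac_def bilin_on_def lin_on_def
  by (intro bilI linI scale_vs tw.scale_vs) (simp_all add: scale_H)

lemma sig_bil: "bil s s sB sig"
  using tw.cocycle_bilin pz_H unfolding sig_def bilin_on_def lin_on_def
  by (intro bilI linI scale_vs tw.scale_vs) (simp_all add: scale_H scale_B)

lemmas ac_sig_lin [multilin] =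
  bil_left[OF ac_bil] bil_right[OF ac_bil] bil_right[OF ac_bil lin_ident[OF tw.scale_vs]]
  bil_left[OF sig_bil] bil_right[OF sig_bil] bil_right[OF sig_bil lin_ident[OF scale_vs]]

lemmas ac_left = bil_left[OF ac_bil lin_ident[OF scale_vs]]
lemmas ac_right = bil_right[OF ac_bil lin_ident[OF tw.scale_vs]]
lemmas sig_left = bil_left[OF sig_bil lin_ident[OF scale_vs]]
lemmas sig_right = bil_right[OF sig_bil lin_ident[OF scale_vs]]

lemmas ac_sig_simps [simp] =
  lin_add[OF ac_left] lin_diff[OF ac_left] lin_minus[OF ac_left] lin_0[OF ac_left] lin_scale[OF ac_left]
  lin_add[OF ac_right] lin_diff[OF ac_right] lin_minus[OF ac_right] lin_0[OF ac_right] lin_scale[OF ac_right]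
  lin_add[OF sig_left] lin_diff[OF sig_left] lin_minus[OF sig_left] lin_0[OF sig_left] lin_scale[OF sig_left]
  lin_add[OF sig_right] lin_diff[OF sig_right] lin_minus[OF sig_right] lin_0[OF sig_right] lin_scale[OF sig_right]

lemma ac_pz: "ac (pz h) x = ac h x" and ac_proj [simp]: "ac (proj h) x = ac h x" "ac h (tw.proj x) = ac h x"
  and sig_pz: "sig (pz h) g = sig h g" "sig h (pz g) = sig h g"
  and sig_proj [simp]: "sig (proj h) g = sig h g" "sig h (proj g) = sig h g"
  by (simp_all add: ac_def sig_def)

lemma ac_cong: "pz h = pz h' \<Longrightarrow> ac h x = ac h' x"
  by (simp add: ac_def)

lemma sig_cong: "pz h = pz h' \<Longrightarrow> pz g = pz g' \<Longrightarrow> sig h g = sig h' g'"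
  by (simp add: sig_def)

lemma pz_0_ac: "pz h = 0 \<Longrightarrow> ac h x = 0"
  using ac_pz[of h x] by simp

lemma pz_0_sig: "pz h = 0 \<Longrightarrow> sig h g = 0" "pz h = 0 \<Longrightarrow> sig g h = 0"
  using sig_pz[of h g] sig_pz(2)[of g h] by simp_all

text \<open>Only degree zero parts of elements of \<open>\<Omega>\<^sup>\<bullet>(H)\<close> act, so parities and differentials disappear.\<close>

lemma ac_left_simps [simp]:
  "ac (ev h) x = ac h x" "ac (od h) x = 0" "ac (sg h) x = ac h x" "ac (td h) x = 0"
  "ac (ev h \<star> g) x = ac (h \<star> g) x" "ac (od h \<star> g) x = 0" "ac (sg h \<star> g) x = ac (h \<star> g) x"
  "ac (h \<star> ev g) x = ac (h \<star> g) x" "ac (h \<star> od g) x = 0" "ac (h \<star> sg g) x = ac (h \<star> g) x"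
  by (rule ac_cong pz_0_ac; simp add: tmul_parity)+

lemma sig_simps [simp]:
  "sig (ev h) g = sig h g" "sig (od h) g = 0" "sig (sg h) g = sig h g" "sig (td h) g = 0"
  "sig g (ev h) = sig g h" "sig g (od h) = 0" "sig g (sg h) = sig g h" "sig g (td h) = 0"
  "sig (ev h \<star> k) g = sig (h \<star> k) g" "sig (od h \<star> k) g = 0" "sig (sg h \<star> k) g = sig (h \<star> k) g"
  "sig (h \<star> ev k) g = sig (h \<star> k) g" "sig (h \<star> od k) g = 0" "sig (h \<star> sg k) g = sig (h \<star> k) g"
  "sig g (ev h \<star> k) = sig g (h \<star> k)" "sig g (od h \<star> k) = 0" "sig g (sg h \<star> k) = sig g (h \<star> k)"
  "sig g (h \<star> ev k) = sig g (h \<star> k)" "sig g (h \<star> od k) = 0" "sig g (h \<star> sg k) = sig g (h \<star> k)"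
  by (rule sig_cong pz_0_sig; simp add: tmul_parity)+

lemma sig_deg: "sig h g \<in> deg \<Omega>B 0"
  using sig_B tw.deg_zero by simp

lemma sig_right_simps [simp]:
  "tw.proj (sig h g) = sig h g" "tw.ev (sig h g) = sig h g" "tw.od (sig h g) = 0" "tw.sg (sig h g) = sig h g"
  "tw.pz (sig h g) = sig h g" "tw.td (sig h g) = 0"
  using tw.hom_simps[OF sig_deg, of h g] tw.diff_cocycle[OF pz_H pz_H, of h g]
  by (simp_all add: signed_def sig_def)

lemma ac_right_simps [simp]:
  "tw.proj (ac h x) = ac h x" "tw.ev (ac h x) = ac h (tw.ev x)" "tw.od (ac h x) = ac h (tw.od x)"
  "tw.sg (ac h x) = ac h (tw.sg x)"
proof -
  show "tw.proj (ac h x) = ac h x" by (simp add: tw.proj_id ac_closed)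
  have d: "ac h x \<in> deg \<Omega>B n" if "x \<in> deg \<Omega>B n" for x n
    unfolding ac_def using that by (simp add: tw.hom_simps tw.act_deg pz_H)
  have "tw.ev (ac h (tw.proj x)) = ac h (tw.ev (tw.proj x))"
    by (rule tw.deg_ext[where f = "\<lambda>x. tw.ev (ac h x)" and g = "\<lambda>x. ac h (tw.ev x)" and sX = sB],
      intro multilin, intro multilin) (simp add: tw.hom_simps tw.hom_simps[OF d])
  then show e: "tw.ev (ac h x) = ac h (tw.ev x)" by simp
  have "tw.od (ac h (tw.proj x)) = ac h (tw.od (tw.proj x))"
    by (rule tw.deg_ext[where f = "\<lambda>x. tw.od (ac h x)" and g = "\<lambda>x. ac h (tw.od x)" and sX = sB],
      intro multilin, intro multilin) (simp add: tw.hom_simps tw.hom_simps[OF d])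
  then show o: "tw.od (ac h x) = ac h (tw.od x)" by simp
  show "tw.sg (ac h x) = ac h (tw.sg x)" by (simp add: tw.sg_def e o)
qed

lemma ac_B: "b \<in> carrier B \<Longrightarrow> ac h b \<in> carrier B"
  using tw.act_deg[OF pz_H, of b 0 h] by (simp add: ac_def tw.deg_zero tw.proj_id tw.A_carrier)

lemma B_simps: "b \<in> carrier B \<Longrightarrow> tw.proj b = b" "b \<in> carrier B \<Longrightarrow> tw.ev b = b" "b \<in> carrier B \<Longrightarrow> tw.od b = 0"
  "b \<in> carrier B \<Longrightarrow> tw.sg b = b" "b \<in> carrier B \<Longrightarrow> tw.td b = diff \<Omega>B b"
  using tw.hom_simps[of b 0] by (simp_all add: tw.deg_zero signed_def)

lemma B_mult: "b \<in> carrier B \<Longrightarrow> c \<in> carrier B \<Longrightarrow> b \<bullet> c = b \<odot>\<^bsub>B\<^esub> c"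
  by (simp add: tw.tmul_carrier tw.A_carrier tw.mult_eq)

lemma B_mult_closed: "b \<in> carrier B \<Longrightarrow> c \<in> carrier B \<Longrightarrow> b \<bullet> c \<in> carrier B"
  using tw.mult_deg[of b 0 c 0] by (simp add: tw.deg_zero tw.tmul_carrier tw.A_carrier)

lemma ac_H: "h \<in> carrier H \<Longrightarrow> x \<in> carrier \<Omega>B \<Longrightarrow> ac h x = act h x"
  by (simp add: ac_def pz_id tw.proj_id)

lemma sig_H: "h \<in> carrier H \<Longrightarrow> g \<in> carrier H \<Longrightarrow> sig h g = \<sigma> h g"
  by (simp add: sig_def pz_id)

lemma ac_one [simp]: "ac h \<one>\<^bsub>\<Omega>B\<^esub> = sB (eps h) \<one>\<^bsub>\<Omega>B\<^esub>"
  using tw.act_one[OF pz_H, of h] by (simp add: ac_def eps_def tw.one_eq[symmetric] scale_B)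

lemma sig_one [simp]: "sig h \<one>\<^bsub>\<Omega>H\<^esub> = sB (eps h) \<one>\<^bsub>\<Omega>B\<^esub>" "sig \<one>\<^bsub>\<Omega>H\<^esub> h = sB (eps h) \<one>\<^bsub>\<Omega>B\<^esub>"
  using tw.cocycle_one[OF pz_H, of h] by (simp_all add: sig_def eps_def one_eq[symmetric] tw.one_eq[symmetric] scale_B)

text \<open>
  The counterpart of \<open>act_list\<close> in terms of the extended action. The recursion runs down to the empty
  product, on which \<open>h\<close> acts by the counit.
\<close>

primrec al :: "'b list \<Rightarrow> 'h \<Rightarrow> 'b" where
  "al [] = (\<lambda>h. sB (eps h) \<one>\<^bsub>\<Omega>B\<^esub>)"
| "al (x # xs) = (\<lambda>h. sw h (\<lambda>a b. ac a x \<bullet> al xs b))"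

lemma al_lin: "lin s sB (al xs)"
proof (induction xs)
  case Nil
  show ?case unfolding al.simps by (intro multilin)
next
  case (Cons x xs)
  show ?case unfolding al.simps by (intro multilin bilI lin_comp[OF Cons])
qed

lemmas al_multilin [multilin] = lin_comp[OF al_lin] al_lin

lemma al_pz: "al xs (pz h) = al xs h"
proof (induction xs arbitrary: h)
  case (Cons x xs)
  have b: "bil s s sB (\<lambda>a b. ac a x \<bullet> al xs b)" by (intro bilI multilin)
  show ?case by (simp add: sw_parity(4)[OF b] ac_pz Cons)
qed simp

lemma al_proj [simp]: "al xs (proj h) = al xs h" "tw.proj (al xs h) = al xs h"
proof -
  show "al xs (proj h) = al xs h" using al_pz[of xs "proj h"] al_pz[of xs h] by simp
  interpret V: vector_space sB by (rule tw.scale_vs)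
  show "tw.proj (al xs h) = al xs h"
    by (cases xs) (simp_all add: sw_pull[OF tw.proj_lin])
qed

lemma al_one: "al (\<one>\<^bsub>\<Omega>B\<^esub> # xs) h = al xs h"
  using sw_counit(1)[OF al_lin, of h xs] by simp

lemma al_single: "al [x] h = ac h x"
  using sw_counit(2)[OF ac_left, of h x] by simp

lemma act_list_al:
  "h \<in> carrier H \<Longrightarrow> set xs \<subseteq> carrier \<Omega>B \<Longrightarrow> act_list H \<Omega>B act h xs = al xs h"
proof (induction xs arbitrary: h)
  case Nil
  then show ?case by (simp add: eps_def pz_id)
next
  case (Cons x xs)
  show ?case
  proof (cases xs)
    case Nil
    then show ?thesis using Cons.prems al_single[of x h] by (simp add: ac_H)
  next
    case (Cons y ys)
    have b: "bil s s sB (\<lambda>a b. ac a x \<bullet> al xs b)" by (intro bilI multilin)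
    have "sw2 H h (\<lambda>h1 h2. act h1 x \<odot>\<^bsub>\<Omega>B\<^esub> act_list H \<Omega>B act h2 xs) = sw h (\<lambda>a b. ac a x \<bullet> al xs b)"
    proof (rule comult_sw[OF \<open>h \<in> carrier H\<close> b])
      fix a b assume h: "a \<in> carrier H" "b \<in> carrier H"
      have "al xs b \<in> carrier \<Omega>B" using tw.proj_carrier[of "al xs b"] by simp
      then show "act a x \<odot>\<^bsub>\<Omega>B\<^esub> act_list H \<Omega>B act b xs = ac a x \<bullet> al xs b"
        using Cons.IH[OF h(2)] Cons.prems ac_H[OF h(1), of x] ac_closed[of a x] by (simp add: tw.tmul_carrier)
    qed
    then show ?thesis by (simp add: Cons)
  qed
qed

abbreviation wl where "wl bs \<equiv> wedge_list \<Omega>B (map (diff \<Omega>B) bs)"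

lemma wl_carrier: "set bs \<subseteq> carrier B \<Longrightarrow> set (map (diff \<Omega>B) bs) \<subseteq> carrier \<Omega>B"
  by (auto intro: tw.diff_carrier tw.A_carrier)

lemma wedge_wl: "b \<in> carrier B \<Longrightarrow> set bs \<subseteq> carrier B \<Longrightarrow>
    wedge_list \<Omega>B (b # map (diff \<Omega>B) bs) = b \<bullet> wl bs"
  using tw.wedge_list_carrier[OF wl_carrier[of bs]]
  by (simp add: tw.wedge_list_Cons tw.A_carrier tw.tmul_carrier)

lemma ac_wedge:
  assumes "b \<in> carrier B" "set bs \<subseteq> carrier B"
  shows "ac h (b \<bullet> wl bs) = al (b # map (diff \<Omega>B) bs) h"
proof -
  have c: "set (b # map (diff \<Omega>B) bs) \<subseteq> carrier \<Omega>B" using wl_carrier[OF assms(2)] assms(1) tw.A_carrier by auto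
  have "ac (pz h) (b \<bullet> wl bs) = act (pz h) (wedge_list \<Omega>B (b # map (diff \<Omega>B) bs))"
    unfolding wedge_wl[OF assms, symmetric] by (rule ac_H[OF pz_H tw.wedge_list_carrier[OF c]])
  also have "\<dots> = al (b # map (diff \<Omega>B) bs) (pz h)"
    unfolding tw.act_forms[OF pz_H assms] by (rule act_list_al[OF pz_H c])
  finally show ?thesis unfolding ac_pz al_pz .
qed

lemma one_B: "\<one>\<^bsub>\<Omega>B\<^esub> \<in> carrier B"
  using tw.one_deg tw.deg_zero by simp

lemma ac_wl: "set bs \<subseteq> carrier B \<Longrightarrow> ac h (wl bs) = al (map (diff \<Omega>B) bs) h"
  using ac_wedge[OF one_B, of bs h] al_one[of "map (diff \<Omega>B) bs" h] by simp

lemma ac_mult_B: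
  assumes "b \<in> carrier B" "c \<in> carrier B"
  shows "ac h (b \<bullet> c) = sw h (\<lambda>x y. ac x b \<bullet> ac y c)"
proof -
  have bl: "bil s s sB (\<lambda>x y. ac x b \<bullet> ac y c)" by (intro bilI multilin)
  have "ac (pz h) (b \<bullet> c) = act (pz h) (b \<odot>\<^bsub>B\<^esub> c)"
    using ac_H[OF pz_H tw.A_carrier[OF B_mult_closed[OF assms]], of h] by (simp only: B_mult[OF assms])
  also have "\<dots> = sw2 H (pz h) (\<lambda>x y. act x b \<odot>\<^bsub>B\<^esub> act y c)"
    by (rule tw.act_mult[OF pz_H assms])
  also have "\<dots> = sw (pz h) (\<lambda>x y. ac x b \<bullet> ac y c)"
  proof (rule comult_sw[OF pz_H bl])
    fix x y assume "x \<in> carrier H" "y \<in> carrier H"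
    then show "act x b \<odot>\<^bsub>B\<^esub> act y c = ac x b \<bullet> ac y c"
      using assms ac_B[of b x] ac_B[of c y] by (simp add: B_mult ac_H tw.A_carrier)
  qed
  finally show ?thesis unfolding sw_parity(4)[OF bl] ac_pz .
qed

lemma ac_d_B: "b \<in> carrier B \<Longrightarrow> ac h (tw.td b) = tw.td (ac h b)"
  using tw.act_diff[OF pz_H, of b h] ac_closed[of h b]
  by (simp add: ac_def tw.td_carrier tw.A_carrier tw.proj_id tw.diff_carrier)

text \<open>
  The defining formula of the action on \<open>b db\<^sub>1 \<dots> db\<^sub>n\<close> amounts to the module algebra rule for products of
  forms: left multiplication by \<open>b\<close> and by \<open>db\<close> is handled through
  \<open>db c = d(bc) - b dc\<close>, and the forms satisfying the rule are closed under products by coassociativity.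
\<close>

lemma ac_mult: "ac h (x \<bullet> y) = sw h (\<lambda>a b. ac a x \<bullet> ac b y)"
proof -
  let ?d = "map (diff \<Omega>B)"
  have ext: "ac h (x \<bullet> y) = sw h (\<lambda>a b. ac a x \<bullet> ac b y)"
    if "\<And>c es. c \<in> carrier B \<Longrightarrow> set es \<subseteq> carrier B \<Longrightarrow>
      ac h (x \<bullet> (c \<bullet> wl es)) = sw h (\<lambda>a b. ac a x \<bullet> ac b (c \<bullet> wl es))" for x y h
  proof -
    have "ac h (x \<bullet> tw.proj y) = sw h (\<lambda>a b. ac a x \<bullet> ac b (tw.proj y))"
      by (rule tw.wedge_ext[where f = "\<lambda>y. ac h (x \<bullet> y)" and g = "\<lambda>y. sw h (\<lambda>a b. ac a x \<bullet> ac b y)" and sX = sB],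
        intro multilin, intro multilin) (simp add: wedge_wl that)
    then show ?thesis by simp
  qed
  have "\<forall>h y. ac h (x \<bullet> y) = sw h (\<lambda>a b. ac a x \<bullet> ac b y)" if "x \<in> carrier \<Omega>B" for x
    using that
  proof (induction rule: tw.calculus_induct_gen)
    case (base b)
    show ?case
    proof (intro allI, rule ext)
      fix h c es assume c: "c \<in> carrier B" "set es \<subseteq> carrier B"
      have "ac h (b \<bullet> (c \<bullet> wl es)) = ac h ((b \<bullet> c) \<bullet> wl es)" by (simp add: tw.tmul_assoc)
      also have "\<dots> = sw h (\<lambda>a r. ac a (b \<bullet> c) \<bullet> al (?d es) r)"
        unfolding ac_wedge[OF B_mult_closed[OF base c(1)] c(2)] by simp
      also have "\<dots> = sw h (\<lambda>a r. sw a (\<lambda>p q. ac p b \<bullet> (ac q c \<bullet> al (?d es) r)))"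
        by (simp add: ac_mult_B[OF base c(1)] sw_pull[OF tw.tmul_left] tw.tmul_assoc)
      also have "\<dots> = sw h (\<lambda>a r. sw r (\<lambda>p q. ac a b \<bullet> (ac p c \<bullet> al (?d es) q)))"
        by (rule coassoc[where sX = sB]) (intro trilI multilin)
      also have "\<dots> = sw h (\<lambda>a r. ac a b \<bullet> ac r (c \<bullet> wl es))"
        by (simp add: ac_wedge[OF c] sw_pull[OF tw.tmul_right])
      finally show "ac h (b \<bullet> (c \<bullet> wl es)) = sw h (\<lambda>a r. ac a b \<bullet> ac r (c \<bullet> wl es))" .
    qed
  next
    case (dbase b)
    show ?case
    proof (intro allI, rule ext)
      fix h c es assume c: "c \<in> carrier B" "set es \<subseteq> carrier B"
      note bc = B_mult_closed[OF dbase c(1)]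
      have db: "diff \<Omega>B b = tw.td b" "diff \<Omega>B c = tw.td c" "diff \<Omega>B (b \<bullet> c) = tw.td (b \<bullet> c)"
        using dbase c(1) bc by (simp_all add: B_simps)
      have ces: "set (c # es) \<subseteq> carrier B" "set ((b \<bullet> c) # es) \<subseteq> carrier B" using c bc by auto
      have wlC: "wl (z # es) = tw.td z \<bullet> wl es" if "z \<in> carrier B" for z
        using tw.wedge_list_carrier[OF wl_carrier[OF c(2)]] that
        by (simp add: tw.wedge_list_Cons tw.diff_carrier tw.A_carrier tw.tmul_carrier tw.td_carrier)
      have "tw.td b \<bullet> (c \<bullet> wl es) = wl ((b \<bullet> c) # es) - b \<bullet> wl (c # es)"
        unfolding wlC[OF bc] wlC[OF c(1)] by (simp add: tw.tmul_parity tw.tmul_assoc B_simps(4)[OF dbase])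
      then have "ac h (tw.td b \<bullet> (c \<bullet> wl es)) =
        sw h (\<lambda>a r. ac a (tw.td (b \<bullet> c)) \<bullet> al (?d es) r) - sw h (\<lambda>a r. ac a b \<bullet> sw r (\<lambda>p q. ac p (tw.td c) \<bullet> al (?d es) q))"
        using ac_wl[OF ces(2), of h] ac_wedge[OF dbase ces(1), of h] by (simp add: db)
      also have "sw h (\<lambda>a r. ac a (tw.td (b \<bullet> c)) \<bullet> al (?d es) r) =
        sw h (\<lambda>a r. sw a (\<lambda>p q. ac p (tw.td b) \<bullet> (ac q c \<bullet> al (?d es) r) + ac p b \<bullet> (ac q (tw.td c) \<bullet> al (?d es) r)))"
      proof -
        have "ac a (tw.td (b \<bullet> c)) = sw a (\<lambda>p q. ac p (tw.td b) \<bullet> ac q c + ac p b \<bullet> ac q (tw.td c))" for a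
          unfolding ac_d_B[OF bc] ac_mult_B[OF dbase c(1)] sw_pull[OF tw.td_lin]
          by (simp add: tw.tmul_parity(5) ac_d_B[OF dbase] ac_d_B[OF c(1)] B_simps(4)[OF dbase])
        then show ?thesis by (simp add: sw_pull[OF tw.tmul_left] tw.tmul_assoc)
      qed
      also have "\<dots> = sw h (\<lambda>a r. sw r (\<lambda>p q. ac a (tw.td b) \<bullet> (ac p c \<bullet> al (?d es) q) + ac a b \<bullet> (ac p (tw.td c) \<bullet>
        al (?d es) q)))"
        by (rule coassoc[where sX = sB]) (intro trilI multilin)
      also have "\<dots> - sw h (\<lambda>a r. ac a b \<bullet> sw r (\<lambda>p q. ac p (tw.td c) \<bullet> al (?d es) q)) =
        sw h (\<lambda>a r. ac a (tw.td b) \<bullet> ac r (c \<bullet> wl es))"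
        by (simp add: ac_wedge[OF c] sw_pull[OF tw.tmul_right] sw_add)
      finally show "ac h (diff \<Omega>B b \<bullet> (c \<bullet> wl es)) = sw h (\<lambda>a r. ac a (diff \<Omega>B b) \<bullet> ac r (c \<bullet> wl es))"
        by (simp add: db)
    qed
  next
    case (add x y)
    then show ?case by (simp add: sw_add)
  next
    case (mult x x')
    show ?case
    proof (intro allI)
      fix h y
      have "ac h ((x \<bullet> x') \<bullet> y) = sw h (\<lambda>a r. sw r (\<lambda>p q. ac a x \<bullet> (ac p x' \<bullet> ac q y)))"
        by (simp add: tw.tmul_assoc mult.IH sw_pull[OF tw.tmul_right])
      also have "\<dots> = sw h (\<lambda>a r. sw a (\<lambda>p q. ac p x \<bullet> (ac q x' \<bullet> ac r y)))"
        by (rule coassoc[where sX = sB, symmetric]) (intro trilI multilin)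
      also have "\<dots> = sw h (\<lambda>a r. ac a (x \<bullet> x') \<bullet> ac r y)"
        by (simp add: tw.tmul_assoc mult.IH sw_pull[OF tw.tmul_left])
      finally show "ac h (x \<odot>\<^bsub>\<Omega>B\<^esub> x' \<bullet> y) = sw h (\<lambda>a r. ac a (x \<odot>\<^bsub>\<Omega>B\<^esub> x') \<bullet> ac r y)"
        using mult.hyps by (simp add: tw.tmul_carrier)
    qed
  qed
  from this[OF tw.proj_carrier, of x] show ?thesis by simp
qed

lemma ac_td: "ac h (tw.td x) = tw.td (ac h x)"
proof -
  have "\<forall>h. ac h (tw.td x) = tw.td (ac h x)" if "x \<in> carrier \<Omega>B" for x
    using that
  proof (induction rule: tw.calculus_induct_gen)
    case (base b)
    then show ?case by (simp add: ac_d_B)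
  next
    case (dbase b)
    have "tw.td (ac h (tw.td b)) = 0" for h by (simp add: ac_d_B[OF dbase])
    then show ?case unfolding B_simps(5)[OF dbase, symmetric] by simp
  next
    case (mult x y)
    have "ac h (tw.td (x \<bullet> y)) = tw.td (ac h (x \<bullet> y))" for h
      by (simp add: tw.tmul_parity ac_mult mult.IH sw_pull[OF tw.td_lin] sw_add)
    then show ?case using mult.hyps by (simp add: tw.tmul_carrier)
  qed simp
  from this[OF tw.proj_carrier, of x] show ?thesis by simp
qed

lemma one_ac [simp]: "ac \<one>\<^bsub>\<Omega>H\<^esub> x = tw.proj x"
proof -
  have one: "\<one>\<^bsub>\<Omega>H\<^esub> \<in> carrier H" using one_deg deg_zero by simp
  have "ac \<one>\<^bsub>\<Omega>H\<^esub> x = x" if "x \<in> carrier \<Omega>B" for x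
    using that
  proof (induction rule: tw.calculus_induct)
    case (base b)
    then show ?case using tw.one_act[OF base] ac_H[OF one tw.A_carrier[OF base]] by (simp add: one_eq)
  next
    case (diff x)
    then show ?case using ac_td[of "\<one>\<^bsub>\<Omega>H\<^esub>" x] by (simp add: tw.td_carrier)
  next
    case (mult x y)
    have b: "bil s s sB (\<lambda>a b. ac a x \<bullet> ac b y)" by (intro bilI multilin)
    have "ac \<one>\<^bsub>\<Omega>H\<^esub> (x \<bullet> y) = x \<bullet> y" by (simp add: ac_mult sw_one[OF b] mult.IH)
    then show ?case using mult.hyps by (simp add: tw.tmul_carrier)
  qed simp
  from this[OF tw.proj_carrier, of x] show ?thesis by simp
qed

lemma sw2_H:
  assumes h: "h \<in> carrier H" "g \<in> carrier H" and b: "\<And>c d. bil s s sX (\<lambda>a b. G a c b d)" "\<And>a b. bil s s sX (\<lambda>c d. G a c b d)"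
    and vs: "vector_space sX"
    and eq: "\<And>a b c d. \<lbrakk>a \<in> carrier H; b \<in> carrier H; c \<in> carrier H; d \<in> carrier H\<rbrakk> \<Longrightarrow> F a c b d = G a c b d"
  shows "sw2 H h (\<lambda>a b. sw2 H g (\<lambda>c d. F a c b d)) = sw h (\<lambda>a b. sw g (\<lambda>c d. G a c b d))"
proof (rule comult_sw[OF h(1)])
  show "bil s s sX (\<lambda>a b. sw g (\<lambda>c d. G a c b d))"
    by (intro bilI multilin vs bil_left[OF b(1)] bil_right[OF b(1)] lin_ident[OF scale_vs])
qed (rule comult_sw[OF h(2) b(2)], rule eq)

lemma cocycle:
  "sw h (\<lambda>h1 h2. sw g (\<lambda>g1 g2. sw f (\<lambda>f1 f2. ac h1 (sig g1 f1) \<bullet> sig h2 (g2 \<star> f2)))) =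
    sw h (\<lambda>h1 h2. sw g (\<lambda>g1 g2. sig h1 g1 \<bullet> sig (h2 \<star> g2) f))"
proof -
  note cl = H_mult_closed and mH = H_mult
  have aB: "act a x \<odot>\<^bsub>B\<^esub> y = ac a x \<bullet> y" if "a \<in> carrier H" "x \<in> carrier B" "y \<in> carrier B" for a x y
    using that ac_B[of x a] by (simp add: B_mult ac_H tw.A_carrier)
  let ?h = "pz h" and ?g = "pz g" and ?f = "pz f"
  have "sw ?h (\<lambda>h1 h2. sw ?g (\<lambda>g1 g2. sw ?f (\<lambda>f1 f2. ac h1 (sig g1 f1) \<bullet> sig h2 (g2 \<star> f2)))) =
    sw2 H ?h (\<lambda>h1 h2. sw2 H ?g (\<lambda>g1 g2. sw2 H ?f (\<lambda>f1 f2. act h1 (\<sigma> g1 f1) \<odot>\<^bsub>B\<^esub> \<sigma> h2 (g2 \<odot>\<^bsub>H\<^esub> f2))))"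
    (is "?L = ?L'")
  proof (rule sw2_H[where sX = sB, OF pz_H pz_H, symmetric])
    fix a b c d assume h: "a \<in> carrier H" "b \<in> carrier H" "c \<in> carrier H" "d \<in> carrier H"
    have bl: "bil s s sB (\<lambda>f1 f2. ac a (sig c f1) \<bullet> sig b (d \<star> f2))" by (intro bilI multilin)
    show "sw2 H ?f (\<lambda>f1 f2. act a (\<sigma> c f1) \<odot>\<^bsub>B\<^esub> \<sigma> b (d \<odot>\<^bsub>H\<^esub> f2)) = sw ?f (\<lambda>f1 f2. ac a (sig c f1) \<bullet> sig b (d \<star> f2))"
      by (rule comult_sw[OF pz_H bl]) (use h in \<open>simp add: mH cl sig_H[symmetric] aB sig_B\<close>)
  qed (intro bilI multilin)+
  also have "?L' = sw2 H ?h (\<lambda>h1 h2. sw2 H ?g (\<lambda>g1 g2. \<sigma> h1 g1 \<odot>\<^bsub>B\<^esub> \<sigma> (h2 \<odot>\<^bsub>H\<^esub> g2) ?f))"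
    by (rule tw.cocycle[OF pz_H pz_H pz_H])
  also have "\<dots> = sw ?h (\<lambda>h1 h2. sw ?g (\<lambda>g1 g2. sig h1 g1 \<bullet> sig (h2 \<star> g2) ?f))"
  proof (rule sw2_H[where sX = sB, OF pz_H pz_H])
    fix a b c d assume h: "a \<in> carrier H" "b \<in> carrier H" "c \<in> carrier H" "d \<in> carrier H"
    then show "\<sigma> a c \<odot>\<^bsub>B\<^esub> \<sigma> (b \<odot>\<^bsub>H\<^esub> d) ?f = sig a c \<bullet> sig (b \<star> d) ?f"
      by (simp add: mH cl pz_H sig_H[symmetric] B_mult sig_B del: sig_simps) 
  qed (intro bilI multilin)+
  finally have eq: "?L = sw ?h (\<lambda>h1 h2. sw ?g (\<lambda>g1 g2. sig h1 g1 \<bullet> sig (h2 \<star> g2) ?f))" .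
  have bl: "bil s s sB (\<lambda>h1 h2. sw u (\<lambda>g1 g2. sw v (\<lambda>f1 f2. ac h1 (sig g1 f1) \<bullet> sig h2 (g2 \<star> f2))))"
    "bil s s sB (\<lambda>g1 g2. sw v (\<lambda>f1 f2. ac a (sig g1 f1) \<bullet> sig b (g2 \<star> f2)))"
    "bil s s sB (\<lambda>f1 f2. ac a (sig c f1) \<bullet> sig b (d \<star> f2))"
    "bil s s sB (\<lambda>h1 h2. sw u (\<lambda>g1 g2. sig h1 g1 \<bullet> sig (h2 \<star> g2) v))"
    "bil s s sB (\<lambda>g1 g2. sig a g1 \<bullet> sig (b \<star> g2) v)" for u v a b c d
    by (intro bilI multilin)+
  have sp: "sig a (pz b \<star> pz c) = sig a (b \<star> c)" "sig (pz b \<star> pz c) a = sig (b \<star> c) a"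
    "sig a (pz b \<star> c) = sig a (b \<star> c)" "sig (pz b \<star> c) a = sig (b \<star> c) a"
    "sig a (b \<star> pz c) = sig a (b \<star> c)" "sig (b \<star> pz c) a = sig (b \<star> c) a" for a b c
    by (rule sig_cong; simp add: tmul_parity)+
  note e = sw_parity(4)[OF bl(3)] sw_parity(4)[OF bl(2)] sw_parity(4)[OF bl(1)] sw_parity(4)[OF bl(5)]
    sw_parity(4)[OF bl(4)]
  from eq show ?thesis by (simp only: e[unfolded ac_pz sig_pz sp] sig_pz)
qed

text \<open>
  The convolution inverse, extended by zero like \<open>\<sigma>\<close>, still inverts the extended \<open>\<sigma>\<close> from the left.
\<close>

lemma conv_inverse_total:
  assumes conv: "conv_inverse H B \<sigma> \<tau>"
  shows "\<tau> (pz h) (pz g) \<in> carrier B"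
    and "bil s s sB (\<lambda>h g. \<tau> (pz h) (pz g))"
    and "sw h (\<lambda>h1 h2. sw g (\<lambda>g1 g2. \<tau> (pz h1) (pz g1) \<bullet> sig h2 g2)) = sB (eps h * eps g) \<one>\<^bsub>\<Omega>B\<^esub>"
proof -
  define tau where "tau h g = \<tau> (pz h) (pz g)" for h g
  have tbo: "bilin_on H H B \<tau>" using conv unfolding conv_inverse_def by blast
  have tau_bil: "bil s s sB tau"
    using tbo pz_H unfolding tau_def bilin_on_def lin_on_def
    by (intro bilI linI scale_vs tw.scale_vs) (simp_all add: scale_H scale_B)
  then show "bil s s sB (\<lambda>h g. \<tau> (pz h) (pz g))" unfolding tau_def .
  have tau_B: "tau h g \<in> carrier B" for h g
    using tbo pz_H unfolding tau_def bilin_on_def lin_on_def by blast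
  then show "\<tau> (pz h) (pz g) \<in> carrier B" unfolding tau_def .
  have tau_H: "\<tau> h g = tau h g" if "h \<in> carrier H" "g \<in> carrier H" for h g
    using that by (simp add: tau_def pz_id)
  note tl = multilin bil_left[OF tau_bil] bil_right[OF tau_bil] bil_right[OF tau_bil lin_ident[OF scale_vs]]
  have "sw (pz h) (\<lambda>h1 h2. sw (pz g) (\<lambda>g1 g2. tau h1 g1 \<bullet> sig h2 g2)) =
    sw2 H (pz h) (\<lambda>h1 h2. sw2 H (pz g) (\<lambda>g1 g2. \<tau> h1 g1 \<odot>\<^bsub>B\<^esub> \<sigma> h2 g2))"
    by (rule sw2_H[where sX = sB, OF pz_H pz_H, symmetric]) ((intro bilI tl)+, simp add: tau_H sig_H[symmetric]
      B_mult tau_B sig_B)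
  also have "\<dots> = sB (eps h * eps g) \<one>\<^bsub>\<Omega>B\<^esub>"
    using conv pz_H unfolding conv_inverse_def by (simp add: eps_def scale_B tw.one_eq)
  finally have eq: "sw (pz h) (\<lambda>h1 h2. sw (pz g) (\<lambda>g1 g2. tau h1 g1 \<bullet> sig h2 g2)) = sB (eps h * eps g) \<one>\<^bsub>\<Omega>B\<^esub>" .
  have tau_pz: "tau (pz a) (pz b) = tau a b" "tau (pz a) b = tau a b" for a b
    by (simp_all add: tau_def)
  have bl: "bil s s sB (\<lambda>h1 h2. sw u (\<lambda>g1 g2. tau h1 g1 \<bullet> sig h2 g2))"
    "bil s s sB (\<lambda>g1 g2. tau v g1 \<bullet> sig w g2)" for u v w
    by (intro bilI tl)+
  have tau_pz2: "tau a (pz b) = tau a b" for a b by (simp add: tau_def)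
  from eq have "sw h (\<lambda>h1 h2. sw g (\<lambda>g1 g2. tau h1 g1 \<bullet> sig h2 g2)) = sB (eps h * eps g) \<one>\<^bsub>\<Omega>B\<^esub>"
    by (simp only: sw_parity(4)[OF bl(1)] sw_parity(4)[OF bl(2)] tau_pz tau_pz2 sig_pz)
  then show "sw h (\<lambda>h1 h2. sw g (\<lambda>g1 g2. \<tau> (pz h1) (pz g1) \<bullet> sig h2 g2)) = sB (eps h * eps g) \<one>\<^bsub>\<Omega>B\<^esub>"
    unfolding tau_def .
qed

text \<open>
  The twisted module condition, convolved with \<open>\<sigma>\<close> from the right. In this form it no longer involves the
  inverse of \<open>\<sigma>\<close>, and it passes from \<open>x\<close> to \<open>dx\<close> since \<open>\<sigma>\<close> takes values in cycles, and from \<open>x\<close> and \<open>y\<close>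
  to \<open>x \<and> y\<close> by applying it to \<open>y\<close> first and to \<open>x\<close> next.
\<close>

lemma twist:
  "sw h (\<lambda>h1 h2. sw g (\<lambda>g1 g2. ac h1 (ac g1 x) \<bullet> sig h2 g2)) =
    sw h (\<lambda>h1 h2. sw g (\<lambda>g1 g2. sig h1 g1 \<bullet> ac (h2 \<star> g2) x))"
proof -
  note cl = H_mult_closed and mH = H_mult
  obtain \<tau> where conv: "conv_inverse H B \<sigma> \<tau>" and tact: "\<And>h g b. \<lbrakk>h \<in> carrier H; g \<in> carrier H; b \<in> carrier B\<rbrakk> \<Longrightarrow>
    act h (act g b) =
      sw3 H h (\<lambda>h1 h2 h3. sw3 H g (\<lambda>g1 g2 g3. (\<sigma> h1 g1 \<odot>\<^bsub>B\<^esub> act (h2 \<odot>\<^bsub>H\<^esub> g2) b) \<odot>\<^bsub>B\<^esub> \<tau> h3 g3))"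
    using tw.twisted_act by blast
  define tau where "tau h g = \<tau> (pz h) (pz g)" for h g
  note tau_props = conv_inverse_total[OF conv, folded tau_def]
  have tau_B: "tau h g \<in> carrier B" for h g by (rule tau_props(1))
  have tau_H: "\<tau> h g = tau h g" if "h \<in> carrier H" "g \<in> carrier H" for h g
    using that by (simp add: tau_def pz_id)
  have tau_bil: "bil s s sB tau" using tau_props(2) unfolding tau_def[abs_def] .
  note tl = multilin bil_left[OF tau_bil] bil_right[OF tau_bil] bil_right[OF tau_bil lin_ident[OF scale_vs]]
  note tau_sig = tau_props(3)
  define K where "K h g b = sw h (\<lambda>h1 h2. sw g (\<lambda>g1 g2. sig h1 g1 \<bullet> ac (h2 \<star> g2) b))" for h g b
  have K_lin: "lin s sB (\<lambda>h. K h g b)" "lin s sB (\<lambda>g. K h g b)" for h g b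
    unfolding K_def by (intro bilI tl)+
  note Kl = tl lin_comp[OF K_lin(1)] lin_comp[OF K_lin(2)] K_lin
  (* on B: the factor \<tau> of the axiom is cancelled by the \<sigma> on its right *)
  have deg0: "sw h (\<lambda>h1 h2. sw g (\<lambda>g1 g2. ac h1 (ac g1 b) \<bullet> sig h2 g2)) = K h g b"
    if h: "h \<in> carrier H" "g \<in> carrier H" and b: "b \<in> carrier B" for h g b
  proof -
    have aa: "ac h (ac g b) = sw h (\<lambda>a h3. sw g (\<lambda>a' g3. K a a' b \<bullet> tau h3 g3))"
      if h: "h \<in> carrier H" "g \<in> carrier H" for h g
    proof -
      have in1: "sw3 H g (\<lambda>g1 g2 g3. (\<sigma> h1 g1 \<odot>\<^bsub>B\<^esub> act (h2 \<odot>\<^bsub>H\<^esub> g2) b) \<odot>\<^bsub>B\<^esub> \<tau> h3 g3) =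
        sw g (\<lambda>a' g3. sw a' (\<lambda>g1 g2. (sig h1 g1 \<bullet> ac (h2 \<star> g2) b) \<bullet> tau h3 g3))"
        if "h1 \<in> carrier H" "h2 \<in> carrier H" "h3 \<in> carrier H" for h1 h2 h3
        unfolding sw3_def
      proof (rule comult_sw[where sX = sB, OF h(2)])
        fix a' g3 assume a: "a' \<in> carrier H" "g3 \<in> carrier H"
        show "sw2 H a' (\<lambda>g1 g2. (\<sigma> h1 g1 \<odot>\<^bsub>B\<^esub> act (h2 \<odot>\<^bsub>H\<^esub> g2) b) \<odot>\<^bsub>B\<^esub> \<tau> h3 g3) =
          sw a' (\<lambda>g1 g2. (sig h1 g1 \<bullet> ac (h2 \<star> g2) b) \<bullet> tau h3 g3)"
        proof (rule comult_sw[where sX = sB, OF a(1)])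
          fix g1 g2 assume g: "g1 \<in> carrier H" "g2 \<in> carrier H"
          have "act (h2 \<star> g2) b = ac (h2 \<star> g2) b" "ac (h2 \<star> g2) b \<in> carrier B"
            by (rule ac_H[OF cl[OF that(2) g(2)] tw.A_carrier[OF b], symmetric], rule ac_B[OF b])
          then show "(\<sigma> h1 g1 \<odot>\<^bsub>B\<^esub> act (h2 \<odot>\<^bsub>H\<^esub> g2) b) \<odot>\<^bsub>B\<^esub> \<tau> h3 g3 = (sig h1 g1 \<bullet> ac (h2 \<star> g2) b) \<bullet> tau h3 g3"
            using that g a by (simp add: mH tau_H sig_H[symmetric] B_mult[symmetric] tau_B sig_B B_mult_closed)
        qed (intro bilI tl)
      qed (intro bilI tl)
      have "ac h (ac g b) = act h (act g b)"
        using ac_H[OF h(1) ac_closed[of g b]] ac_H[OF h(2) tw.A_carrier[OF b]] by simp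
      also have "\<dots> = sw h (\<lambda>a h3. sw a (\<lambda>h1 h2. sw g (\<lambda>a' g3. sw a' (\<lambda>g1 g2. (sig h1 g1 \<bullet> ac (h2 \<star> g2) b) \<bullet> tau h3 g3))))"
        unfolding tact[OF h b] unfolding sw3_def[of H h]
      proof (rule comult_sw[where sX = sB, OF h(1)])
        fix a h3 assume a: "a \<in> carrier H" "h3 \<in> carrier H"
        show "sw2 H a (\<lambda>h1 h2. sw3 H g (\<lambda>g1 g2 g3. (\<sigma> h1 g1 \<odot>\<^bsub>B\<^esub> act (h2 \<odot>\<^bsub>H\<^esub> g2) b) \<odot>\<^bsub>B\<^esub> \<tau> h3 g3)) =
          sw a (\<lambda>h1 h2. sw g (\<lambda>a' g3. sw a' (\<lambda>g1 g2. (sig h1 g1 \<bullet> ac (h2 \<star> g2) b) \<bullet> tau h3 g3)))"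
          by (rule comult_sw[where sX = sB, OF a(1)]) (intro bilI tl, simp add: in1 a)
      qed (intro bilI tl)
      also have "\<dots> = sw h (\<lambda>a h3. sw g (\<lambda>a' g3. K a a' b \<bullet> tau h3 g3))"
        unfolding K_def sw_pull[OF tw.tmul_left] unfolding sw_swap[where x = g] ..
      finally show ?thesis .
    qed
    have "sw h (\<lambda>h1 h2. sw g (\<lambda>g1 g2. ac h1 (ac g1 b) \<bullet> sig h2 g2)) =
      sw h (\<lambda>x h4. sw g (\<lambda>x' g4. sw x (\<lambda>a h3. sw x' (\<lambda>a' g3. K a a' b \<bullet> (tau h3 g3 \<bullet> sig h4 g4)))))"
    proof (rule sw_H_cong[where sX = sB, OF h(1)])
      fix x h4 assume "x \<in> carrier H"
      show "sw g (\<lambda>g1 g2. ac x (ac g1 b) \<bullet> sig h4 g2) =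
        sw g (\<lambda>x' g4. sw x (\<lambda>a h3. sw x' (\<lambda>a' g3. K a a' b \<bullet> (tau h3 g3 \<bullet> sig h4 g4))))"
      proof (rule sw_H_cong[where sX = sB, OF h(2)])
        fix x' g4 assume "x' \<in> carrier H"
        then show "ac x (ac x' b) \<bullet> sig h4 g4 = sw x (\<lambda>a h3. sw x' (\<lambda>a' g3. K a a' b \<bullet> (tau h3 g3 \<bullet> sig h4 g4)))"
          using \<open>x \<in> carrier H\<close> by (simp add: aa sw_pull[OF tw.tmul_left] tw.tmul_assoc)
      qed (intro bilI Kl)+
    qed (intro bilI Kl)+
    also have "\<dots> = sw h (\<lambda>a r. sw g (\<lambda>a' r'. sw r (\<lambda>h3 h4. sw r' (\<lambda>g3 g4. K a a' b \<bullet> (tau h3 g3 \<bullet> sig h4 g4)))))"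
      by (rule coassoc2[where sX = sB]) (intro trilI Kl)+
    also have "\<dots> = sw h (\<lambda>a r. sw g (\<lambda>a' r'. sB (eps r) (sB (eps r') (K a a' b))))"
    proof (rule sw_H_cong[where sX = sB, OF h(1)])
      fix a r assume r: "r \<in> carrier H"
      show "sw g (\<lambda>a' r'. sw r (\<lambda>h3 h4. sw r' (\<lambda>g3 g4. K a a' b \<bullet> (tau h3 g3 \<bullet> sig h4 g4)))) =
        sw g (\<lambda>a' r'. sB (eps r) (sB (eps r') (K a a' b)))"
      proof (rule sw_H_cong[where sX = sB, OF h(2)])
        fix a' r' assume r': "r' \<in> carrier H"
        have "tw.proj (K a a' b) = K a a' b" by (simp add: K_def sw_pull[OF tw.proj_lin])
        then show "sw r (\<lambda>h3 h4. sw r' (\<lambda>g3 g4. K a a' b \<bullet> (tau h3 g3 \<bullet> sig h4 g4))) = sB (eps r) (sB (eps r') (K a a' b))"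
          using tau_sig[of r r'] vector_space.vector_space_assms(3)[OF tw.scale_vs]
          by (simp add: sw_pull[OF tw.tmul_right, symmetric])
      qed (intro bilI Kl lin_scaled)+
    qed (intro bilI Kl lin_scaled)+
    also have "\<dots> = K h g b"
      using sw_counit(2)[OF K_lin(2)] sw_counit(2)[OF K_lin(1)]
      by (simp add: sw_pull[OF lin_scaled[OF lin_ident[OF tw.scale_vs]], symmetric]) (simp add: K_def)
    finally show ?thesis .
  qed
  have all: "\<forall>h g. sw h (\<lambda>h1 h2. sw g (\<lambda>g1 g2. ac h1 (ac g1 x) \<bullet> sig h2 g2)) = K h g x" if "x \<in> carrier \<Omega>B" for x
    using that
  proof (induction rule: tw.calculus_induct)
    case (base b)
    show ?case
    proof (intro allI)
      fix h g
      have bl: "bil s s sB (\<lambda>h1 h2. sw u (\<lambda>g1 g2. ac h1 (ac g1 b) \<bullet> sig h2 g2))"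
        "bil s s sB (\<lambda>g1 g2. ac v (ac g1 b) \<bullet> sig w g2)"
        "bil s s sB (\<lambda>h1 h2. sw u (\<lambda>g1 g2. sig h1 g1 \<bullet> ac (h2 \<star> g2) b))"
        "bil s s sB (\<lambda>g1 g2. sig v g1 \<bullet> ac (w \<star> g2) b)" for u v w
        by (intro bilI tl)+
      have sp: "ac (pz c \<star> d) b = ac (c \<star> d) b" "ac (d \<star> pz c) b = ac (d \<star> c) b" for c d
        by (rule ac_cong; simp add: tmul_parity)+
      note e = sw_parity(4)[OF bl(1)] sw_parity(4)[OF bl(2)] sw_parity(4)[OF bl(3)] sw_parity(4)[OF bl(4)]
      show "sw h (\<lambda>h1 h2. sw g (\<lambda>g1 g2. ac h1 (ac g1 b) \<bullet> sig h2 g2)) = K h g b"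
        using deg0[OF pz_H pz_H \<open>b \<in> carrier B\<close>, of h g] unfolding K_def
        by (simp only: e[unfolded ac_pz sig_pz sp])
    qed
  next
    case (add x y)
    then show ?case by (simp add: K_def sw_add)
  next
    case (diff x)
    have "sw h (\<lambda>h1 h2. sw g (\<lambda>g1 g2. ac h1 (ac g1 (tw.td x)) \<bullet> sig h2 g2)) = K h g (tw.td x)" for h g
      using arg_cong[OF diff.IH[rule_format, of h g], of tw.td]
      by (simp add: K_def sw_pull[OF tw.td_lin] tw.tmul_parity ac_td)
    with diff.hyps show ?case by (simp add: tw.td_carrier)
  next
    case (mult x y)
    have "sw h (\<lambda>h1 h2. sw g (\<lambda>g1 g2. ac h1 (ac g1 (x \<bullet> y)) \<bullet> sig h2 g2)) = K h g (x \<bullet> y)" for h g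
    proof -
      have "sw h (\<lambda>h1 h2. sw g (\<lambda>g1 g2. ac h1 (ac g1 (x \<bullet> y)) \<bullet> sig h2 g2)) =
        sw h (\<lambda>h1 h2. sw g (\<lambda>g1 g2. sw h1 (\<lambda>a b. sw g1 (\<lambda>a' b'. ac a (ac a' x) \<bullet> (ac b (ac b' y) \<bullet> sig h2 g2)))))"
        unfolding ac_mult sw_pull[OF ac_right] sw_pull[OF tw.tmul_left] tw.tmul_assoc
        by (rule arg_cong[where f = "sw h"], rule ext, rule ext, rule arg_cong[where f = "sw g"], rule ext, rule
          ext, rule sw_swap)
      also have "\<dots> = sw h (\<lambda>a r. sw g (\<lambda>a' r'. sw r (\<lambda>b h2. sw r' (\<lambda>b' g2. ac a (ac a' x) \<bullet> (ac b (ac b' y) \<bullet> sig h2 g2)))))"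
        by (rule coassoc2[where sX = sB]) (intro trilI tl)+
      also have "\<dots> = sw h (\<lambda>a r. sw g (\<lambda>a' r'. sw r (\<lambda>b h2. sw r' (\<lambda>b' g2. (ac a (ac a' x) \<bullet> sig b b') \<bullet> ac (h2 \<star> g2) y))))"
        using mult.IH(2) by (simp add: sw_pull[OF tw.tmul_right, symmetric] K_def tw.tmul_assoc)
      also have "\<dots> = sw h (\<lambda>u r. sw g (\<lambda>u' r'. sw u (\<lambda>a b. sw u' (\<lambda>a' b'. (ac a (ac a' x) \<bullet> sig b b') \<bullet> ac (r \<star> r') y))))"
        by (rule coassoc2[where sX = sB, symmetric]) (intro trilI tl)+
      also have "\<dots> = sw h (\<lambda>u r. sw g (\<lambda>u' r'. sw u (\<lambda>a b. sw u' (\<lambda>a' b'. sig a a' \<bullet> (ac (b \<star> b') x \<bullet> ac (r \<star> r') y)))))"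
        using mult.IH(1) by (simp add: sw_pull[OF tw.tmul_left, symmetric] K_def tw.tmul_assoc[symmetric])
      also have "\<dots> = sw h (\<lambda>a r. sw g (\<lambda>a' r'. sw r (\<lambda>b h2. sw r' (\<lambda>b' g2. sig a a' \<bullet> (ac (b \<star> b') x \<bullet> ac (h2 \<star> g2) y)))))"
        by (rule coassoc2[where sX = sB]) (intro trilI tl)+
      also have "\<dots> = K h g (x \<bullet> y)"
      proof -
        have bl: "bil s s sB (\<lambda>a b. ac a x \<bullet> ac b y)" by (intro bilI tl)
        show ?thesis unfolding K_def ac_mult by (simp add: sw_mult_even[OF bl] sw_pull[OF tw.tmul_right])
      qed
      finally show ?thesis .
    qed
    with mult.hyps show ?case by (simp add: tw.tmul_carrier)
  qed
  from all[OF tw.proj_carrier, of x] show ?thesis by (simp add: K_def)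
qed


section \<open>The braiding and the cocycle product\<close>

lemma lsum_concat: "lsum (concat (map (\<lambda>(a, b). h a b) xs)) f = lsum xs (\<lambda>a b. lsum (h a b) f)"
  by (induction xs) auto

text \<open>
  \<open>braid \<gamma> \<omega>\<close> lists the terms of \<open>(-1)\<^bsup>|\<gamma>||\<omega>|\<^esup> (\<gamma>\<^sub>-\<^sub>1 \<cdot> \<omega>) \<otimes> \<gamma>\<^sub>0\<close>, and \<open>cup \<gamma> \<delta>\<close> those of
  \<open>\<sigma>(\<gamma>\<^sub>-\<^sub>1 \<otimes> \<delta>\<^sub>-\<^sub>1) \<otimes> \<gamma>\<^sub>0\<delta>\<^sub>0\<close>. The product of the crossed product calculus is their composite.
\<close>

definition braid_list :: "'h \<Rightarrow> 'b \<Rightarrow> ('b \<times> 'h) list" where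
  "braid_list \<gamma> \<omega> = concat (map (\<lambda>(x, y). [(ac x \<omega>, ev y), (ac x (tw.sg \<omega>), od y)]) (S \<gamma>))"

definition cup_list :: "'h \<Rightarrow> 'h \<Rightarrow> ('b \<times> 'h) list" where
  "cup_list \<gamma> \<delta> = concat (map (\<lambda>(a, b). map (\<lambda>(a', b'). (sig a a', b \<star> b')) (S \<delta>)) (S \<gamma>))"

definition braid :: "'h \<Rightarrow> 'b \<Rightarrow> ('b \<Rightarrow> 'h \<Rightarrow> 'x::ab_group_add) \<Rightarrow> 'x" where
  "braid \<gamma> \<omega> f = lsum (braid_list \<gamma> \<omega>) f"

definition cup :: "'h \<Rightarrow> 'h \<Rightarrow> ('b \<Rightarrow> 'h \<Rightarrow> 'x::ab_group_add) \<Rightarrow> 'x" where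
  "cup \<gamma> \<delta> f = lsum (cup_list \<gamma> \<delta>) f"

lemma braid_sw: "braid \<gamma> \<omega> f = sw \<gamma> (\<lambda>x y. f (ac x \<omega>) (ev y) + f (ac x (tw.sg \<omega>)) (od y))"
  by (simp add: braid_def braid_list_def lsum_concat sw_def)

lemma cup_sw: "cup \<gamma> \<delta> f = sw \<gamma> (\<lambda>a b. sw \<delta> (\<lambda>a' b'. f (sig a a') (b \<star> b')))"
  by (simp add: cup_def cup_list_def lsum_concat lsum_map sw_def)

lemma braid_add: "braid \<gamma> \<omega> (\<lambda>a b. f a b + g a b) = braid \<gamma> \<omega> f + braid \<gamma> \<omega> g"
  and cup_add: "cup \<gamma> \<delta> (\<lambda>a b. f a b + g a b) = cup \<gamma> \<delta> f + cup \<gamma> \<delta> g"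
  by (simp_all add: braid_def cup_def lsum_add)

lemma braid_pull: "lin s1 s2 \<phi> \<Longrightarrow> \<phi> (braid \<gamma> \<omega> f) = braid \<gamma> \<omega> (\<lambda>a b. \<phi> (f a b))"
  and cup_pull: "lin s1 s2 \<phi> \<Longrightarrow> \<phi> (cup \<gamma> \<delta> f) = cup \<gamma> \<delta> (\<lambda>a b. \<phi> (f a b))"
  by (simp_all add: braid_def cup_def lin_pull)

lemma braid_swap: "braid \<gamma> \<omega> (\<lambda>a b. braid \<gamma>' \<omega>' (f a b)) = braid \<gamma>' \<omega>' (\<lambda>c d. braid \<gamma> \<omega> (\<lambda>a b. f a b c d))"
  and cup_braid_swap: "cup \<gamma> \<delta> (\<lambda>a b. braid \<gamma>' \<omega>' (f' a b)) = braid \<gamma>' \<omega>' (\<lambda>c d. cup \<gamma> \<delta> (\<lambda>a b. f' a b c d))"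
  by (simp_all add: braid_def cup_def lsum_swap[of "braid_list \<gamma> \<omega>"] lsum_swap[of "cup_list \<gamma> \<delta>"])

lemma braid_lin:
  assumes f: "bil sB s sX f"
  shows "lin s' s g \<Longrightarrow> lin s' sX (\<lambda>v. braid (g v) \<omega> f)" "lin s' sB h \<Longrightarrow> lin s' sX (\<lambda>v. braid \<gamma> (h v) f)"
proof -
  have vs: "vector_space sX" using f lin_vs unfolding bil_def by blast
  note fl = multilin bil_left[OF f] bil_right[OF f] bil_right[OF f lin_ident[OF scale_vs]] vs
  show "lin s' s g \<Longrightarrow> lin s' sX (\<lambda>v. braid (g v) \<omega> f)" unfolding braid_sw by (intro bilI fl)
  assume h: "lin s' sB h"
  show "lin s' sX (\<lambda>v. braid \<gamma> (h v) f)"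
    unfolding braid_sw by (intro bilI fl h lin_vs(1)[OF h])
qed

lemma cup_lin:
  assumes f: "bil sB s sX f"
  shows "lin s' s g \<Longrightarrow> lin s' sX (\<lambda>v. cup (g v) \<delta> f)" "lin s' s g \<Longrightarrow> lin s' sX (\<lambda>v. cup \<gamma> (g v) f)"
proof -
  have vs: "vector_space sX" using f lin_vs unfolding bil_def by blast
  note fl = multilin bil_left[OF f] bil_right[OF f] bil_right[OF f lin_ident[OF scale_vs]] vs
  show "lin s' s g \<Longrightarrow> lin s' sX (\<lambda>v. cup (g v) \<delta> f)" unfolding cup_sw by (intro bilI fl)
  assume g: "lin s' s g"
  show "lin s' sX (\<lambda>v. cup \<gamma> (g v) f)"
    unfolding cup_sw by (intro bilI fl g lin_vs(1)[OF g])
qed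

lemma braid_body_lin [multilin]:
  "vector_space s1 \<Longrightarrow> vector_space s2 \<Longrightarrow> (\<And>a b. lin s1 s2 (\<lambda>v. f v a b)) \<Longrightarrow> lin s1 s2 (\<lambda>v. braid \<gamma> \<omega> (f v))"
  and cup_body_lin [multilin]:
  "vector_space s1 \<Longrightarrow> vector_space s2 \<Longrightarrow> (\<And>a b. lin s1 s2 (\<lambda>v. f v a b)) \<Longrightarrow> lin s1 s2 (\<lambda>v. cup \<gamma> \<delta> (f v))"
  unfolding braid_def cup_def by (rule lin_lsum; assumption)+

context
  fixes sX :: "'k \<Rightarrow> 'x::ab_group_add \<Rightarrow> 'x" and f :: "'b \<Rightarrow> 'h \<Rightarrow> 'x"
  assumes f: "bil sB s sX f"
begin

lemma vsX: "vector_space sX"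
  using f lin_vs unfolding bil_def by blast

lemmas fl = multilin bil_left[OF f] bil_right[OF f] bil_right[OF f lin_ident[OF scale_vs]] vsX

lemmas f_left = bil_left[OF f lin_ident[OF tw.scale_vs]]
lemmas f_right = bil_right[OF f lin_ident[OF scale_vs]]

lemma f_parity: "f a (ev b) + f a (od b) = f a (proj b)"
  unfolding lin_add[OF f_right, symmetric] by simp

lemma braid_one: "braid \<one>\<^bsub>\<Omega>H\<^esub> \<omega> f = f (tw.proj \<omega>) \<one>\<^bsub>\<Omega>H\<^esub>" "braid \<gamma> \<one>\<^bsub>\<Omega>B\<^esub> f = f \<one>\<^bsub>\<Omega>B\<^esub> (proj \<gamma>)"
proof -
  have b: "bil s s sX (\<lambda>x y. f (ac x \<omega>) (ev y) + f (ac x (tw.sg \<omega>)) (od y))" by (intro bilI fl)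
  show "braid \<one>\<^bsub>\<Omega>H\<^esub> \<omega> f = f (tw.proj \<omega>) \<one>\<^bsub>\<Omega>H\<^esub>"
    unfolding braid_sw sw_one[OF b] by (simp add: lin_0[OF f_right])
  have "braid \<gamma> \<one>\<^bsub>\<Omega>B\<^esub> f = sw \<gamma> (\<lambda>a b. sX (eps a) (f \<one>\<^bsub>\<Omega>B\<^esub> (proj b)))"
    unfolding braid_sw by (simp add: lin_scale[OF f_left] f_parity[symmetric] vector_space.vector_space_assms(1)[OF vsX])
  then show "braid \<gamma> \<one>\<^bsub>\<Omega>B\<^esub> f = f \<one>\<^bsub>\<Omega>B\<^esub> (proj \<gamma>)"
    using sw_counit(1)[of sX "\<lambda>b. f \<one>\<^bsub>\<Omega>B\<^esub> (proj b)" \<gamma>] by (simp add: fl)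
qed

lemma cup_one: "cup \<one>\<^bsub>\<Omega>H\<^esub> \<delta> f = f \<one>\<^bsub>\<Omega>B\<^esub> (proj \<delta>)" "cup \<gamma> \<one>\<^bsub>\<Omega>H\<^esub> f = f \<one>\<^bsub>\<Omega>B\<^esub> (proj \<gamma>)"
proof -
  have b: "bil s s sX (\<lambda>a b. sw \<delta> (\<lambda>a' b'. f (sig a a') (b \<star> b')))" "bil s s sX (\<lambda>a' b'. f (sig a a') (b \<star> b'))" for a b
    by (intro bilI fl)+
  have l: "lin s sX (\<lambda>b. f \<one>\<^bsub>\<Omega>B\<^esub> (proj b))" by (intro fl)
  show "cup \<one>\<^bsub>\<Omega>H\<^esub> \<delta> f = f \<one>\<^bsub>\<Omega>B\<^esub> (proj \<delta>)" "cup \<gamma> \<one>\<^bsub>\<Omega>H\<^esub> f = f \<one>\<^bsub>\<Omega>B\<^esub> (proj \<gamma>)"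
    unfolding cup_sw sw_one[OF b(1)] sw_one[OF b(2)] using sw_counit(1)[OF l] by (simp_all add: lin_scale[OF f_left])
qed

lemma braid_parity:
  "braid (ev \<gamma>) \<omega> f = sw \<gamma> (\<lambda>x y. f (ac x \<omega>) (ev y))"
  "braid (od \<gamma>) \<omega> f = sw \<gamma> (\<lambda>x y. f (ac x (tw.sg \<omega>)) (od y))"
  "tw.sg \<omega> = \<omega> \<Longrightarrow> braid \<gamma> \<omega> f = sw \<gamma> (\<lambda>x y. f (ac x \<omega>) y)"
proof -
  have b: "bil s s sX (\<lambda>x y. f (ac x \<omega>) (ev y) + f (ac x (tw.sg \<omega>)) (od y))" by (intro bilI fl)
  show "braid (ev \<gamma>) \<omega> f = sw \<gamma> (\<lambda>x y. f (ac x \<omega>) (ev y))"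
    "braid (od \<gamma>) \<omega> f = sw \<gamma> (\<lambda>x y. f (ac x (tw.sg \<omega>)) (od y))"
    unfolding braid_sw sw_parity(1)[OF b] sw_parity(2)[OF b]
    by (simp_all add: lin_0[OF f_right] lin_0[OF f_left])
  show "braid \<gamma> \<omega> f = sw \<gamma> (\<lambda>x y. f (ac x \<omega>) y)" if "tw.sg \<omega> = \<omega>"
    unfolding braid_sw that f_parity by (rule sw_absorb(2))
qed

lemma cup_parity:
  "cup (ev \<gamma>) \<delta> f = sw \<gamma> (\<lambda>a b. sw \<delta> (\<lambda>a' b'. f (sig a a') (ev b \<star> b')))"
  "cup (od \<gamma>) \<delta> f = sw \<gamma> (\<lambda>a b. sw \<delta> (\<lambda>a' b'. f (sig a a') (od b \<star> b')))"
  "cup \<gamma> (ev \<delta>) f = sw \<gamma> (\<lambda>a b. sw \<delta> (\<lambda>a' b'. f (sig a a') (b \<star> ev b')))"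
  "cup \<gamma> (od \<delta>) f = sw \<gamma> (\<lambda>a b. sw \<delta> (\<lambda>a' b'. f (sig a a') (b \<star> od b')))"
proof -
  have b: "bil s s sX (\<lambda>a b. sw \<delta> (\<lambda>a' b'. f (sig a a') (b \<star> b')))" "bil s s sX (\<lambda>a' b'. f (sig a a') (b \<star> b'))" for a b
    by (intro bilI fl)+
  note z = lin_0[OF f_right] lin_0[OF f_left]
  show "cup (ev \<gamma>) \<delta> f = sw \<gamma> (\<lambda>a b. sw \<delta> (\<lambda>a' b'. f (sig a a') (ev b \<star> b')))"
    "cup (od \<gamma>) \<delta> f = sw \<gamma> (\<lambda>a b. sw \<delta> (\<lambda>a' b'. f (sig a a') (od b \<star> b')))"
    "cup \<gamma> (ev \<delta>) f = sw \<gamma> (\<lambda>a b. sw \<delta> (\<lambda>a' b'. f (sig a a') (b \<star> ev b')))"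
    "cup \<gamma> (od \<delta>) f = sw \<gamma> (\<lambda>a b. sw \<delta> (\<lambda>a' b'. f (sig a a') (b \<star> od b')))"
    unfolding cup_sw sw_parity(1)[OF b(1)] sw_parity(2)[OF b(1)] sw_parity(1)[OF b(2)] sw_parity(2)[OF b(2)]
    by (simp_all add: z)
qed

text \<open>
  The action is multiplicative, and so is the sign automorphism of \<open>\<Omega>\<^sup>\<bullet>(B)\<close>.
\<close>

lemma braid_mult:
  "braid \<gamma> (\<omega> \<bullet> \<omega>') f = braid \<gamma> \<omega> (\<lambda>b g. braid g \<omega>' (\<lambda>b' g'. f (b \<bullet> b') g'))"
proof -
  have bl: "bil sB s sX (\<lambda>b' g'. f (b \<bullet> b') g')" for b by (intro bilI fl)
  have "braid \<gamma> (\<omega> \<bullet> \<omega>') f = sw \<gamma> (\<lambda>x y. sw x (\<lambda>c d.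
      f (ac c \<omega> \<bullet> ac d \<omega>') (ev y) + f (ac c (tw.sg \<omega>) \<bullet> ac d (tw.sg \<omega>')) (od y)))"
    unfolding braid_sw tw.tmul_parity(3) ac_mult sw_pull[OF f_left] sw_add ..
  also have "\<dots> = sw \<gamma> (\<lambda>x y. sw y (\<lambda>c d.
      f (ac x \<omega> \<bullet> ac c \<omega>') (ev d) + f (ac x (tw.sg \<omega>) \<bullet> ac c (tw.sg \<omega>')) (od d)))"
    by (rule coassoc[where sX = sX]) (intro trilI fl)
  also have "\<dots> = braid \<gamma> \<omega> (\<lambda>b g. braid g \<omega>' (\<lambda>b' g'. f (b \<bullet> b') g'))"
    unfolding braid_sw[of \<gamma> \<omega>]
    by (simp add: sw_add crossed_product_calculus.braid_parity[OF crossed_product_calculus_axioms bl])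
  finally show ?thesis .
qed

text \<open>
  The cocycle identity, with all remaining coproducts brought to the same side by coassociativity. On the left hand side
  the value of \<open>\<sigma>\<close> produced by the first cocycle product has to be moved past \<open>g\<close>, hence is acted upon.
\<close>

lemma cup_assoc:
  "cup g' \<delta> (\<lambda>b k. braid g b (\<lambda>b' k'. cup k' k (\<lambda>b'' h. f (b' \<bullet> b'') h))) =
    cup g g' (\<lambda>b k. cup k \<delta> (\<lambda>b' h. f (b \<bullet> b') h))"
proof -
  have bl: "bil sB s sX (\<lambda>b' k'. cup k' k (\<lambda>b'' h. f (b' \<bullet> b'') h))" for k
    by (intro bilI cup_lin fl)
  have be: "bil s s sX (\<lambda>p' q'. sw g (\<lambda>x y. sw x (\<lambda>p q. f (ac p (sig a a') \<bullet> sig q p') (y \<star> q'))))"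
    "bil s s sX (\<lambda>u v. sw \<delta> (\<lambda>a' b'. f (sig a c \<bullet> sig u a') (v \<star> b')))" for a a' c
    by (intro bilI fl)+
  have "cup g' \<delta> (\<lambda>b k. braid g b (\<lambda>b' k'. cup k' k (\<lambda>b'' h. f (b' \<bullet> b'') h))) =
    sw g' (\<lambda>a b. sw \<delta> (\<lambda>a' b'. sw (b \<star> b') (\<lambda>p' q'. sw g (\<lambda>x y. sw y (\<lambda>p q.
      f (ac x (sig a a') \<bullet> sig p p') (q \<star> q'))))))"
  proof -
    have "braid g (sig a a') (\<lambda>b' k'. cup k' k (\<lambda>b'' h. f (b' \<bullet> b'') h)) =
      sw k (\<lambda>p' q'. sw g (\<lambda>x y. sw y (\<lambda>p q. f (ac x (sig a a') \<bullet> sig p p') (q \<star> q'))))" for a a' k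
    proof -
      have "braid g (sig a a') (\<lambda>b' k'. cup k' k (\<lambda>b'' h. f (b' \<bullet> b'') h)) =
        sw g (\<lambda>x y. cup y k (\<lambda>b'' h. f (ac x (sig a a') \<bullet> b'') h))"
        by (rule crossed_product_calculus.braid_parity(3)[OF crossed_product_calculus_axioms bl]) simp
      also have "\<dots> = sw g (\<lambda>x y. sw k (\<lambda>p' q'. sw y (\<lambda>p q. f (ac x (sig a a') \<bullet> sig p p') (q \<star> q'))))"
        unfolding cup_sw unfolding sw_swap[where y = k] ..
      also have "\<dots> = sw k (\<lambda>p' q'. sw g (\<lambda>x y. sw y (\<lambda>p q. f (ac x (sig a a') \<bullet> sig p p') (q \<star> q'))))"
        by (rule sw_swap)
      finally show ?thesis .
    qed
    then show ?thesis by (simp add: cup_sw)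
  qed
  also have "\<dots> = sw g' (\<lambda>a b. sw \<delta> (\<lambda>a' b'. sw (b \<star> b') (\<lambda>p' q'. sw g (\<lambda>x y. sw x (\<lambda>p q.
      f (ac p (sig a a') \<bullet> sig q p') (y \<star> q'))))))"
  proof -
    have "sw g (\<lambda>x y. sw y (\<lambda>p q. f (ac x (sig a a') \<bullet> sig p p') (q \<star> q'))) =
      sw g (\<lambda>x y. sw x (\<lambda>p q. f (ac p (sig a a') \<bullet> sig q p') (y \<star> q')))" for a a' p' q'
      by (rule coassoc[where sX = sX, symmetric]) (intro trilI fl)
    then show ?thesis by simp
  qed
  also have "\<dots> = sw g' (\<lambda>a b. sw \<delta> (\<lambda>a' b'. sw b (\<lambda>c d. sw b' (\<lambda>c' d'. sw g (\<lambda>x y. sw x (\<lambda>p q.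
      f (ac p (sig a a') \<bullet> sig q (c \<star> c')) (y \<star> (d \<star> d'))))))))"
    by (simp add: sw_mult_even[OF be(1)])
  also have "\<dots> = sw g' (\<lambda>a b. sw \<delta> (\<lambda>a' b'. sw a (\<lambda>c d. sw a' (\<lambda>c' d'. sw g (\<lambda>x y. sw x (\<lambda>p q.
      f (ac p (sig c c') \<bullet> sig q (d \<star> d')) (y \<star> (b \<star> b'))))))))"
    by (rule coassoc2[where sX = sX, symmetric]) (intro trilI fl)+
  also have "\<dots> = sw g (\<lambda>x y. sw g' (\<lambda>a b. sw \<delta> (\<lambda>a' b'. sw a (\<lambda>c d. sw a' (\<lambda>c' d'. sw x (\<lambda>p q.
      f (ac p (sig c c') \<bullet> sig q (d \<star> d')) (y \<star> (b \<star> b'))))))))"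
    unfolding sw_swap[where y = g] ..
  also have "\<dots> = sw g (\<lambda>x y. sw g' (\<lambda>a b. sw \<delta> (\<lambda>a' b'. sw x (\<lambda>p q. sw a (\<lambda>c d.
      f (sig p c \<bullet> sig (q \<star> d) a') (y \<star> (b \<star> b')))))))"
  proof -
    have "sw a (\<lambda>c d. sw a' (\<lambda>c' d'. sw x (\<lambda>p q. f (ac p (sig c c') \<bullet> sig q (d \<star> d')) z))) =
      sw x (\<lambda>p q. sw a (\<lambda>c d. f (sig p c \<bullet> sig (q \<star> d) a') z))" for a a' x z
    proof -
      have "sw a (\<lambda>c d. sw a' (\<lambda>c' d'. sw x (\<lambda>p q. f (ac p (sig c c') \<bullet> sig q (d \<star> d')) z))) =
        f (sw x (\<lambda>p q. sw a (\<lambda>c d. sw a' (\<lambda>c' d'. ac p (sig c c') \<bullet> sig q (d \<star> d'))))) z"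
        unfolding sw_swap[where x = x] unfolding sw_pull[OF f_left] ..
      then show ?thesis unfolding cocycle sw_pull[OF f_left] .
    qed
    then show ?thesis by simp
  qed
  also have "\<dots> = sw g (\<lambda>x y. sw g' (\<lambda>a b. sw x (\<lambda>p q. sw a (\<lambda>c d. sw \<delta> (\<lambda>a' b'.
      f (sig p c \<bullet> sig (q \<star> d) a') ((y \<star> b) \<star> b'))))))"
    unfolding sw_swap[where x = \<delta>] tmul_assoc ..
  also have "\<dots> = sw g (\<lambda>x y. sw g' (\<lambda>a b. sw y (\<lambda>p q. sw b (\<lambda>c d. sw \<delta> (\<lambda>a' b'.
      f (sig x a \<bullet> sig (p \<star> c) a') ((q \<star> d) \<star> b'))))))"
    by (rule coassoc2[where sX = sX]) (intro trilI fl)+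
  also have "\<dots> = cup g g' (\<lambda>b k. cup k \<delta> (\<lambda>b' h. f (b \<bullet> b') h))"
    by (simp add: cup_sw sw_mult_even[OF be(2)])
  finally show ?thesis .
qed

text \<open>
  The twisted module condition in the form \<open>twist\<close>: moving \<open>\<omega>\<close> past \<open>g'\<close> and then past \<open>g\<close> amounts to moving it
  past their cocycle product.
\<close>

lemma braid_twist:
  "braid g' \<omega> (\<lambda>b k. braid g b (\<lambda>b' k'. cup k' k (\<lambda>c h. f (b' \<bullet> c) h))) =
    cup g g' (\<lambda>b k. braid k \<omega> (\<lambda>b' h. f (b \<bullet> b') h))"
proof -
  have bl: "bil sB s sX (\<lambda>c h. f (b \<bullet> c) h)" for b
    by (intro bilI fl)
  note par = crossed_product_calculus.cup_parity[OF crossed_product_calculus_axioms bl]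
  have be: "bil s s sX (\<lambda>p q. f (sig a a' \<bullet> ac p \<omega>) (ev q) + f (sig a a' \<bullet> ac p (tw.sg \<omega>)) (od q))" for a a'
    by (intro bilI fl)
  have bl2: "bil s s sX (\<lambda>a b. sw z (\<lambda>a' b'. f (u \<bullet> sig a a') (b \<star> b')))"
    "bil s s sX (\<lambda>a' b'. f (u \<bullet> sig v a') (w \<star> b'))" for u v w z
    by (intro bilI fl)+
  have "braid g' \<omega> (\<lambda>b k. braid g b (\<lambda>b' k'. cup k' k (\<lambda>c h. f (b' \<bullet> c) h))) =
    sw g' (\<lambda>x' y'. sw g (\<lambda>x y. sw y (\<lambda>p q. sw y' (\<lambda>p' q'.
      f (ac x (ac x' \<omega>) \<bullet> sig p p') (ev (q \<star> q')) + f (ac x (ac x' (tw.sg \<omega>)) \<bullet> sig p p') (od (q \<star> q'))))))"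
    unfolding braid_sw cup_sw sw_parity(1)[OF bl2(1)] sw_parity(2)[OF bl2(1)] sw_parity(1)[OF bl2(2)] sw_parity(2)[OF bl2(2)]
    by (simp add: sw_add tmul_parity lin_add[OF f_right] lin_0[OF f_right] lin_0[OF f_left] ac_simps)
  also have "\<dots> = sw g (\<lambda>x y. sw g' (\<lambda>x' y'. sw y (\<lambda>p q. sw y' (\<lambda>p' q'.
      f (ac x (ac x' \<omega>) \<bullet> sig p p') (ev (q \<star> q')) + f (ac x (ac x' (tw.sg \<omega>)) \<bullet> sig p p') (od (q \<star> q'))))))"
    by (rule sw_swap)
  also have "\<dots> = sw g (\<lambda>x y. sw g' (\<lambda>x' y'. sw x (\<lambda>p q. sw x' (\<lambda>p' q'.
      f (ac p (ac p' \<omega>) \<bullet> sig q q') (ev (y \<star> y')) + f (ac p (ac p' (tw.sg \<omega>)) \<bullet> sig q q') (od (y \<star> y'))))))"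
    by (rule coassoc2[where sX = sX, symmetric]) (intro trilI fl)+
  also have "\<dots> = sw g (\<lambda>x y. sw g' (\<lambda>x' y'. sw x (\<lambda>p q. sw x' (\<lambda>p' q'.
      f (sig p p' \<bullet> ac (q \<star> q') \<omega>) (ev (y \<star> y')) + f (sig p p' \<bullet> ac (q \<star> q') (tw.sg \<omega>)) (od (y \<star> y'))))))"
    by (simp add: sw_add sw_pull[OF f_left, symmetric] twist)
  also have "\<dots> = sw g (\<lambda>x y. sw g' (\<lambda>x' y'. sw y (\<lambda>p q. sw y' (\<lambda>p' q'.
      f (sig x x' \<bullet> ac (p \<star> p') \<omega>) (ev (q \<star> q')) + f (sig x x' \<bullet> ac (p \<star> p') (tw.sg \<omega>)) (od (q \<star> q'))))))"
    by (rule coassoc2[where sX = sX]) (intro trilI fl)+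
  also have "\<dots> = cup g g' (\<lambda>b k. braid k \<omega> (\<lambda>b' h. f (b \<bullet> b') h))"
    by (simp add: cup_sw braid_sw sw_mult_even[OF be])
  finally show ?thesis .
qed

text \<open>
  The action commutes with the differential and kills differentials of forms on \<open>H\<close>, while \<open>\<sigma>\<close> takes values in cycles.
  The total differential thus passes through braiding and cocycle product.
\<close>

lemma braid_diff:
  "braid \<gamma> \<omega> (\<lambda>b g. f (tw.td b) g + f (tw.sg b) (td g)) = braid (td \<gamma>) \<omega> f + braid (sg \<gamma>) (tw.td \<omega>) f"
proof -
  have b: "bil s s sX (\<lambda>x y. f (ac x \<omega>) (ev y) + f (ac x (tw.sg \<omega>)) (od y))" for \<omega> by (intro bilI fl)
  note z = lin_0[OF f_right] lin_0[OF f_left] lin_minus[OF f_right] lin_minus[OF f_left]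
  show ?thesis
    unfolding braid_sw sw_td[OF b] sw_parity(3)[OF b]
    by (simp add: sw_add[symmetric] z ac_td[symmetric] ac_simps)
qed

lemma cup_diff:
  "cup \<gamma> \<delta> (\<lambda>b g. f (tw.td b) g + f (tw.sg b) (td g)) = cup (td \<gamma>) \<delta> f + cup (sg \<gamma>) (td \<delta>) f"
proof -
  have b: "bil s s sX (\<lambda>a b. sw z (\<lambda>a' b'. f (sig a a') (b \<star> b')))" "bil s s sX (\<lambda>a' b'. f (sig a a') (b \<star> b'))" for a b z
    by (intro bilI fl)+
  note z = lin_0[OF f_right] lin_0[OF f_left] lin_add[OF f_right]
  show ?thesis
    unfolding cup_sw unfolding sw_td[OF b(1)] sw_parity(3)[OF b(1)]
    unfolding sw_td[OF b(2)] sw_parity(3)[OF b(2)]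
    by (simp add: sw_add[symmetric] z tmul_parity ac_simps)
qed

lemma braid_sg: "braid \<gamma> \<omega> (\<lambda>b g. f (tw.sg b) (sg g)) = braid (sg \<gamma>) (tw.sg \<omega>) f"
proof -
  have b: "bil s s sX (\<lambda>x y. f (ac x \<omega>) (ev y) + f (ac x (tw.sg \<omega>)) (od y))" for \<omega> by (intro bilI fl)
  show ?thesis
    unfolding braid_sw sw_parity(3)[OF b] by simp
qed

end

text \<open>
  Braiding and cocycle product leave the second leg to a further coproduct: by coassociativity the action and \<open>\<sigma>\<close>
  only involve the first of three legs. The signs are those of the tensor product calculus.
\<close>

context
  fixes sX :: "'k \<Rightarrow> 'x::ab_group_add \<Rightarrow> 'x" and G :: "'b \<Rightarrow> 'h \<Rightarrow> 'h \<Rightarrow> 'x"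
  assumes G1: "\<And>x y. lin sB sX (\<lambda>b. G b x y)" and G2: "\<And>b. bil s s sX (G b)"
begin

lemmas Gl = multilin lin_comp[OF G1] bil_left[OF G2] bil_right[OF G2] bil_right[OF G2 lin_ident[OF scale_vs]]
  lin_vs(2)[OF G1]

lemma braid_comult:
  "braid \<gamma> \<omega> (\<lambda>b g. sw g (G b)) =
    sw \<gamma> (\<lambda>g1 g2. braid g1 \<omega> (\<lambda>b g. G b g (ev g2)) + braid g1 (tw.sg \<omega>) (\<lambda>b g. G b g (od g2)))"
proof -
  have "braid \<gamma> \<omega> (\<lambda>b g. sw g (G b)) = sw \<gamma> (\<lambda>x y. sw y (\<lambda>p q.
      (G (ac x \<omega>) (ev p) (ev q) + G (ac x \<omega>) (od p) (od q)) + (G (ac x (tw.sg \<omega>)) (ev p) (od q) + G (ac x (tw.sg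
        \<omega>)) (od p) (ev q))))"
    unfolding braid_sw sw_parity(1)[OF G2] sw_parity(2)[OF G2] by (simp add: sw_add)
  also have "\<dots> = sw \<gamma> (\<lambda>x y. sw x (\<lambda>p q.
      (G (ac p \<omega>) (ev q) (ev y) + G (ac p \<omega>) (od q) (od y)) + (G (ac p (tw.sg \<omega>)) (ev q) (od y) + G (ac p (tw.sg
        \<omega>)) (od q) (ev y))))"
    by (rule coassoc[where sX = sX, symmetric]) (intro trilI Gl)
  also have "\<dots> = sw \<gamma> (\<lambda>g1 g2. braid g1 \<omega> (\<lambda>b g. G b g (ev g2)) + braid g1 (tw.sg \<omega>) (\<lambda>b g. G b g (od g2)))"
    unfolding braid_sw by (simp add: sw_add ac_simps)
  finally show ?thesis .
qed

lemma cup_comult: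
  "cup \<gamma> \<delta> (\<lambda>c h. sw h (G c)) =
    sw \<gamma> (\<lambda>g1 g2. sw \<delta> (\<lambda>d1 d2. cup g1 d1 (\<lambda>c h. G c h (ev g2 \<star> d2)) + cup g1 (sg d1) (\<lambda>c h. G c h (od g2 \<star> d2))))"
proof -
  have bl: "bil s s sX (\<lambda>a b. sw z (\<lambda>a' b'. G (sig a a') (b \<star> b') w))" "bil s s sX (\<lambda>a' b'. G (sig v a') (u \<star> b')
    w)" for z w u v
    by (intro bilI Gl)+
  have "cup \<gamma> \<delta> (\<lambda>c h. sw h (G c)) = sw \<gamma> (\<lambda>a b. sw \<delta> (\<lambda>a' b'. sw b (\<lambda>p q. sw b' (\<lambda>p' q'.
      G (sig a a') (p \<star> p') (ev q \<star> q') + G (sig a a') (p \<star> sg p') (od q \<star> q')))))"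
    unfolding cup_sw sw_mult[OF G2] ..
  also have "\<dots> = sw \<gamma> (\<lambda>a b. sw \<delta> (\<lambda>a' b'. sw a (\<lambda>p q. sw a' (\<lambda>p' q'.
      G (sig p p') (q \<star> q') (ev b \<star> b') + G (sig p p') (q \<star> sg q') (od b \<star> b')))))"
    by (rule coassoc2[where sX = sX, symmetric]) (intro trilI Gl)+
  also have "\<dots> = sw \<gamma> (\<lambda>g1 g2. sw \<delta> (\<lambda>d1 d2. cup g1 d1 (\<lambda>c h. G c h (ev g2 \<star> d2)) + cup g1 (sg d1) (\<lambda>c h. G c h (od
    g2 \<star> d2))))"
    unfolding cup_sw unfolding sw_parity(3)[OF bl(2)] by (simp add: sw_add)
  finally show ?thesis .
qed

end

text \<open>
  The convolution inverse of \<open>\<sigma>\<close>, applied to the first legs, cancels the \<open>\<sigma>\<close> of the cocycle product, and leaves the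
  product of forms on \<open>H\<close>.
\<close>

lemma cup_inverse:
  obtains tau where "bil s s sB tau" "\<And>h g. tau h g \<in> carrier B"
    "\<And>h g. tau (pz h) g = tau h g" "\<And>h g. tau h (pz g) = tau h g"
    "\<And>sX f \<gamma> \<delta>. bil sB s sX f \<Longrightarrow>
      sw \<gamma> (\<lambda>a b. sw \<delta> (\<lambda>a' b'. cup b b' (\<lambda>c h. f (tau a a' \<bullet> c) h))) = (f \<one>\<^bsub>\<Omega>B\<^esub> (\<gamma> \<star> \<delta>) :: ('k, 'b, 'h) tensor)"
proof -
  obtain \<tau> where conv: "conv_inverse H B \<sigma> \<tau>" using tw.twisted_act by blast
  define tau where "tau h g = \<tau> (pz h) (pz g)" for h g
  note tp = conv_inverse_total[OF conv, folded tau_def[abs_def]]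
  have tb: "bil s s sB tau" using tp(2) unfolding tau_def[abs_def] .
  note tl = multilin bil_left[OF tb] bil_right[OF tb] bil_right[OF tb lin_ident[OF scale_vs]]
  have inv: "sw \<gamma> (\<lambda>a b. sw \<delta> (\<lambda>a' b'. cup b b' (\<lambda>c h. f (tau a a' \<bullet> c) h))) = f \<one>\<^bsub>\<Omega>B\<^esub> (\<gamma> \<star> \<delta>)"
    if f: "bil sB s sX f" for sX and f :: "'b \<Rightarrow> 'h \<Rightarrow> ('k, 'b, 'h) tensor" and \<gamma> \<delta>
  proof -
    note fl = tl bil_left[OF f] bil_right[OF f] bil_right[OF f lin_ident[OF scale_vs]] vsX[OF f] lin_scaled
    note f_left = bil_left[OF f lin_ident[OF tw.scale_vs]]
    have "sw \<gamma> (\<lambda>a b. sw \<delta> (\<lambda>a' b'. cup b b' (\<lambda>c h. f (tau a a' \<bullet> c) h))) =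
      sw \<gamma> (\<lambda>a b. sw \<delta> (\<lambda>a' b'. sw b (\<lambda>p q. sw b' (\<lambda>p' q'. f (tau a a' \<bullet> sig p p') (q \<star> q')))))"
      unfolding cup_sw ..
    also have "\<dots> = sw \<gamma> (\<lambda>a b. sw \<delta> (\<lambda>a' b'. sw a (\<lambda>p q. sw a' (\<lambda>p' q'. f (tau p p' \<bullet> sig q q') (b \<star> b')))))"
      by (rule coassoc2[where sX = sX, symmetric]) (intro trilI fl)+
    also have "\<dots> = sw \<gamma> (\<lambda>a b. sw \<delta> (\<lambda>a' b'. sX (eps a) (sX (eps a') (f \<one>\<^bsub>\<Omega>B\<^esub> (b \<star> b')))))"
    proof -
      have "sw a (\<lambda>p q. sw a' (\<lambda>p' q'. f (tau p p' \<bullet> sig q q') z)) = sX (eps a) (sX (eps a') (f \<one>\<^bsub>\<Omega>B\<^esub> z))" for a a' z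
        by (simp add: sw_pull[OF f_left, symmetric] tau_def conv_inverse_total(3)[OF conv] lin_scale[OF f_left]
          vector_space.vector_space_assms(3)[OF vsX[OF f]])
      then show ?thesis by simp
    qed
    also have "\<dots> = f \<one>\<^bsub>\<Omega>B\<^esub> (\<gamma> \<star> \<delta>)"
    proof -
      have l: "lin s sX (\<lambda>z. f \<one>\<^bsub>\<Omega>B\<^esub> (z \<star> w))" "lin s sX (\<lambda>z. f \<one>\<^bsub>\<Omega>B\<^esub> (w \<star> z))" for w by (intro fl)+
      show ?thesis
        unfolding sw_pull[OF lin_scaled[OF lin_ident[OF vsX[OF f]]], symmetric] sw_counit(1)[OF l(2)]
          sw_counit(1)[OF l(1)] by simp
    qed
    finally show ?thesis .
  qed
  show thesis
  proof (rule that[of tau])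
    show "tau h g \<in> carrier B" "tau (pz h) g = tau h g" "tau h (pz g) = tau h g" for h g
      by (simp_all add: tau_def conv_inverse_total(1)[OF conv])
  qed (rule tb, rule inv)
qed


section \<open>The crossed product calculus is a differential graded algebra\<close>

sublocale BH: dg_pair \<Omega>B \<Omega>H by unfold_locales

abbreviation T where "T \<equiv> BH.T"
abbreviation TC where "TC \<equiv> BH.TC"
abbreviation \<Omega>A where "\<Omega>A \<equiv> crossed_calculus H \<Omega>B \<Omega>H act \<sigma>"

text \<open>
  The product of \<open>\<omega> \<otimes> \<gamma>\<close> and \<open>\<omega>' \<otimes> \<gamma>'\<close> in the crossed product calculus: \<open>\<gamma>\<close> is moved past \<open>\<omega>'\<close>, then multiplied with \<open>\<gamma>'\<close>.
\<close>

definition pm :: "'b \<Rightarrow> 'h \<Rightarrow> 'b \<Rightarrow> 'h \<Rightarrow> ('k, 'b, 'h) tensor" where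
  "pm \<omega> \<gamma> \<omega>' \<gamma>' = braid \<gamma> \<omega>' (\<lambda>b g. cup g \<gamma>' (\<lambda>c h. T (\<omega> \<bullet> b \<bullet> c) h))"

lemmas mlin = bilI braid_lin cup_lin multilin

lemma pm_bil: "bil sB s tscale (\<lambda>\<omega> \<gamma>. pm \<omega> \<gamma> \<omega>' \<gamma>')" "bil sB s tscale (\<lambda>\<omega>' \<gamma>'. pm \<omega> \<gamma> \<omega>' \<gamma>')"
  unfolding pm_def by (intro mlin)+

lemmas pm_lin = bil_left[OF pm_bil(1)] bil_right[OF pm_bil(1)] bil_left[OF pm_bil(2)] bil_right[OF pm_bil(2)]

text \<open>On homogeneous elements the Koszul sign is a scalar.\<close>

lemma braid_hom:
  assumes f: "bil sB s sX f" and \<gamma>: "\<gamma> \<in> deg \<Omega>H j" and \<omega>: "\<omega> \<in> deg \<Omega>B k"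
  shows "braid \<gamma> \<omega> f = signed (j * k) (sw \<gamma> (\<lambda>x y. f (ac x \<omega>) y))"
proof -
  have f0: "f 0 y = 0" for y using lin_0[OF bil_left[OF f lin_ident[OF tw.scale_vs]]] .
  have fn: "f (- x) y = - f x y" for x y using lin_minus[OF bil_left[OF f lin_ident[OF tw.scale_vs]]] .
  have fz: "braid 0 \<omega> f = 0" for \<omega> using lin_0[OF braid_lin(1)[OF f lin_ident[OF scale_vs]]] .
  have split: "sw \<gamma> (\<lambda>x y. f (ac x \<omega>) y) = sw \<gamma> (\<lambda>x y. f (ac x \<omega>) (ev y)) + sw \<gamma> (\<lambda>x y. f (ac x \<omega>) (od y))" for \<omega>
    unfolding sw_add[symmetric] f_parity[OF f] by (rule sw_absorb(2)[symmetric])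
  note p1 = braid_parity(1)[OF f, of \<gamma>] and p2 = braid_parity(2)[OF f, of \<gamma>]
  have sgg: "ac x (tw.sg (tw.sg \<omega>)) = ac x \<omega>" for x by simp
  show ?thesis
  proof (cases "even j")
    case True
    then have e: "ev \<gamma> = \<gamma>" "od \<gamma> = 0" using \<gamma> by (simp_all add: hom_simps)
    have "sw \<gamma> (\<lambda>x y. f (ac x \<omega>) (od y)) = 0"
      using p2[of "tw.sg \<omega>"] unfolding e fz sgg by simp
    then show ?thesis using p1[of \<omega>] split[of \<omega>] True by (simp add: e signed_def)
  next
    case False
    then have e: "ev \<gamma> = 0" "od \<gamma> = \<gamma>" using \<gamma> by (simp_all add: hom_simps)
    have "sw \<gamma> (\<lambda>x y. f (ac x \<omega>) (ev y)) = 0"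
      using p1[of \<omega>] unfolding e fz by simp
    moreover have "tw.sg \<omega> = signed k \<omega>" using \<omega> by (simp add: tw.hom_simps)
    ultimately show ?thesis using p2[of \<omega>] split[of \<omega>] False
      by (cases "even k") (simp_all add: e signed_def fn sw_neg)
  qed
qed

text \<open>
  The second application of the left coaction is to \<open>\<gamma>\<^sub>0\<close> in \<open>pm\<close>, and to \<open>\<gamma>\<^sub>-\<^sub>1\<close> in the definition of the
  crossed product calculus; coassociativity identifies the two.
\<close>

lemma pm_hom:
  assumes \<gamma>: "\<gamma> \<in> deg \<Omega>H j" and \<omega>': "\<omega>' \<in> deg \<Omega>B k"
  shows "pm \<omega> \<gamma> \<omega>' \<gamma>' = signed (j * k) (sw \<gamma> (\<lambda>x y. sw (pz x) (\<lambda>a b. sw \<gamma>' (\<lambda>u v.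
    T (\<omega> \<bullet> ac a \<omega>' \<bullet> sig b u) (y \<star> v)))))"
proof -
  have bl: "bil sB s tscale (\<lambda>b g. cup g \<gamma>' (\<lambda>c h. T (\<omega> \<bullet> b \<bullet> c) h))" by (intro mlin)
  have b2: "bil s s tscale (\<lambda>a b. sw \<gamma>' (\<lambda>u v. T (\<omega> \<bullet> ac a \<omega>' \<bullet> sig b u) (y \<star> v)))" for y by (intro mlin)
  have "sw \<gamma> (\<lambda>x y. cup y \<gamma>' (\<lambda>c h. T (\<omega> \<bullet> ac x \<omega>' \<bullet> c) h)) =
    sw \<gamma> (\<lambda>x y. sw y (\<lambda>p q. sw \<gamma>' (\<lambda>u v. T (\<omega> \<bullet> ac x \<omega>' \<bullet> sig p u) (q \<star> v))))"
    unfolding cup_sw ..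
  also have "\<dots> = sw \<gamma> (\<lambda>x y. sw x (\<lambda>a b. sw \<gamma>' (\<lambda>u v. T (\<omega> \<bullet> ac a \<omega>' \<bullet> sig b u) (y \<star> v))))"
    by (rule coassoc[where sX = tscale, symmetric]) (intro trilI mlin)
  also have "\<dots> = sw \<gamma> (\<lambda>x y. sw (pz x) (\<lambda>a b. sw \<gamma>' (\<lambda>u v. T (\<omega> \<bullet> ac a \<omega>' \<bullet> sig b u) (y \<star> v))))"
    unfolding sw_parity(4)[OF b2] ac_pz sig_pz ..
  finally show ?thesis unfolding pm_def braid_hom[OF bl \<gamma> \<omega>'] by simp
qed

text \<open>
  The left coaction is the coproduct followed by the projection of the first leg onto degree zero.
\<close>

lemma lcoact2_sw:
  assumes \<gamma>: "\<gamma> \<in> carrier \<Omega>H" and g: "bil s s sX g"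
    and f: "\<And>a y. a \<in> carrier H \<Longrightarrow> y \<in> carrier \<Omega>H \<Longrightarrow> f a y = g a y"
  shows "lcoact2 H \<Omega>H \<gamma> f = sw \<gamma> (\<lambda>x y. g (pz x) y)"
proof -
  have T: "tens H \<Omega>H = TT.T" by (rule tens_cong) (simp_all add: scale_H)
  have "lcoact H \<Omega>H \<gamma> = hlift \<Omega>H \<Omega>H (\<lambda>p x q y. if p = 0 then TT.T x y else 0) (lsum (S \<gamma>) TT.T)"
    using dcomult_sw[of \<gamma>] \<gamma> unfolding lcoact_def sw_def by (simp add: proj_id)
  also have "\<dots> = lsum (S \<gamma>) (\<lambda>x y. TT.T (pz x) y)"
    by (rule TT.hlift_lsum[where sX = tscale, OF _ _ S_carrier]) (intro mlin, simp add: hom_simps)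
  also have "\<dots> = lsum (map (\<lambda>(x, y). (pz x, y)) (S \<gamma>)) (tens H \<Omega>H)"
    using lsum_map[of pz "\<lambda>y. y" "S \<gamma>" "tens H \<Omega>H"] by (simp add: T)
  finally have "lcoact2 H \<Omega>H \<gamma> f = tlift H \<Omega>H f (lsum (map (\<lambda>(x, y). (pz x, y)) (S \<gamma>)) (tens H \<Omega>H))"
    unfolding lcoact2_def by simp
  also have "\<dots> = lsum (map (\<lambda>(x, y). (pz x, y)) (S \<gamma>)) g"
    by (rule tlift_lsum[OF H_vspace vspace _ _ f]) (use g S_carrier[of \<gamma>] pz_H in \<open>auto simp: scale_H\<close>)
  also have "\<dots> = sw \<gamma> (\<lambda>x y. g (pz x) y)"
    unfolding sw_def using lsum_map[of pz "\<lambda>y. y" "S \<gamma>" g] by simp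
  finally show ?thesis .
qed

lemma ca_simps [simp]:
  "carrier \<Omega>A = TC" "scale \<Omega>A = tscale" "\<one>\<^bsub>\<Omega>A\<^esub> = T \<one>\<^bsub>\<Omega>B\<^esub> \<one>\<^bsub>\<Omega>H\<^esub>"
  "deg \<Omega>A = tensor_deg \<Omega>B \<Omega>H" "diff \<Omega>A = tensor_diff \<Omega>B \<Omega>H"
  by (simp_all add: crossed_calculus_def)

lemma amult_lsum:
  assumes xs: "set xs \<subseteq> carrier \<Omega>B \<times> carrier \<Omega>H" and ys: "set ys \<subseteq> carrier \<Omega>B \<times> carrier \<Omega>H"
  shows "lsum xs T \<odot>\<^bsub>\<Omega>A\<^esub> lsum ys T = lsum xs (\<lambda>\<omega> \<gamma>. lsum ys (pm \<omega> \<gamma>))"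
proof -
  have "hlift \<Omega>B \<Omega>H (\<lambda>i \<omega> j \<gamma>. hlift \<Omega>B \<Omega>H (\<lambda>k \<omega>' l \<gamma>'.
       signed (j * k) (lcoact3 H \<Omega>H \<gamma> (\<lambda>a b g. lcoact2 H \<Omega>H \<gamma>' (\<lambda>c g'.
         T ((\<omega> \<odot>\<^bsub>\<Omega>B\<^esub> act a \<omega>') \<odot>\<^bsub>\<Omega>B\<^esub> \<sigma> b c) (g \<odot>\<^bsub>\<Omega>H\<^esub> g'))))) (lsum ys T)) (lsum xs T) =
    lsum xs (\<lambda>\<omega> \<gamma>. lsum ys (pm \<omega> \<gamma>))"
  proof (rule BH.hlift_lsum[OF _ _ xs])
    show "bil sB s tscale (\<lambda>\<omega> \<gamma>. lsum ys (pm \<omega> \<gamma>))"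
      by (intro bilI lin_lsum pm_lin multilin)
    fix i j \<omega> \<gamma> assume \<omega>: "\<omega> \<in> deg \<Omega>B i" and \<gamma>: "\<gamma> \<in> deg \<Omega>H j"
    show "hlift \<Omega>B \<Omega>H (\<lambda>k \<omega>' l \<gamma>'.
       signed (j * k) (lcoact3 H \<Omega>H \<gamma> (\<lambda>a b g. lcoact2 H \<Omega>H \<gamma>' (\<lambda>c g'.
         T ((\<omega> \<odot>\<^bsub>\<Omega>B\<^esub> act a \<omega>') \<odot>\<^bsub>\<Omega>B\<^esub> \<sigma> b c) (g \<odot>\<^bsub>\<Omega>H\<^esub> g'))))) (lsum ys T) = lsum ys (pm \<omega> \<gamma>)"
    proof (rule BH.hlift_lsum[OF pm_bil(2) _ ys])
      fix k l \<omega>' \<gamma>' assume \<omega>': "\<omega>' \<in> deg \<Omega>B k" and \<gamma>': "\<gamma>' \<in> deg \<Omega>H l"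
      note c = tw.deg_carrier[OF \<omega>] tw.deg_carrier[OF \<omega>'] deg_carrier[OF \<gamma>] deg_carrier[OF \<gamma>']
      have "lcoact3 H \<Omega>H \<gamma> (\<lambda>a b g. lcoact2 H \<Omega>H \<gamma>' (\<lambda>c g'.
         T ((\<omega> \<odot>\<^bsub>\<Omega>B\<^esub> act a \<omega>') \<odot>\<^bsub>\<Omega>B\<^esub> \<sigma> b c) (g \<odot>\<^bsub>\<Omega>H\<^esub> g'))) =
        sw \<gamma> (\<lambda>x y. sw (pz x) (\<lambda>a b. sw \<gamma>' (\<lambda>u v. T (\<omega> \<bullet> ac a \<omega>' \<bullet> sig b u) (y \<star> v))))"
        unfolding lcoact3_def
      proof (rule lcoact2_sw[OF c(3), where g = "\<lambda>x y. sw x (\<lambda>a b. sw \<gamma>' (\<lambda>u v. T (\<omega> \<bullet> ac a \<omega>' \<bullet> sig b u) (y \<star>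
        v)))" and sX = tscale])
        fix x y assume x: "x \<in> carrier H" and y: "y \<in> carrier \<Omega>H"
        show "sw2 H x (\<lambda>a b. lcoact2 H \<Omega>H \<gamma>' (\<lambda>c g'. T ((\<omega> \<odot>\<^bsub>\<Omega>B\<^esub> act a \<omega>') \<odot>\<^bsub>\<Omega>B\<^esub> \<sigma> b c) (y \<odot>\<^bsub>\<Omega>H\<^esub> g'))) =
          sw x (\<lambda>a b. sw \<gamma>' (\<lambda>u v. T (\<omega> \<bullet> ac a \<omega>' \<bullet> sig b u) (y \<star> v)))"
        proof (rule comult_sw[where sX = tscale, OF x])
          fix a b assume ab: "a \<in> carrier H" "b \<in> carrier H"
          have "lcoact2 H \<Omega>H \<gamma>' (\<lambda>c g'. T ((\<omega> \<odot>\<^bsub>\<Omega>B\<^esub> act a \<omega>') \<odot>\<^bsub>\<Omega>B\<^esub> \<sigma> b c) (y \<odot>\<^bsub>\<Omega>H\<^esub> g')) =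
            sw \<gamma>' (\<lambda>u v. T (\<omega> \<bullet> ac a \<omega>' \<bullet> sig b (pz u)) (y \<star> v))"
          proof (rule lcoact2_sw[OF c(4), where g = "\<lambda>u v. T (\<omega> \<bullet> ac a \<omega>' \<bullet> sig b u) (y \<star> v)" and sX = tscale])
            fix u v assume u: "u \<in> carrier H" and v: "v \<in> carrier \<Omega>H"
            have "(\<omega> \<odot>\<^bsub>\<Omega>B\<^esub> act a \<omega>') \<odot>\<^bsub>\<Omega>B\<^esub> \<sigma> b u = \<omega> \<bullet> ac a \<omega>' \<bullet> sig b u"
              using ac_closed[of a \<omega>'] sig_B[of b u] by (simp add: ac_H[OF ab(1) c(2), symmetric] sig_H[OF ab(2) u,
                symmetric]
                tw.tmul_carrier c tw.mult_carrier tw.A_carrier)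
            moreover have "y \<odot>\<^bsub>\<Omega>H\<^esub> v = y \<star> v" by (simp add: tmul_carrier y v)
            ultimately show "T ((\<omega> \<odot>\<^bsub>\<Omega>B\<^esub> act a \<omega>') \<odot>\<^bsub>\<Omega>B\<^esub> \<sigma> b u) (y \<odot>\<^bsub>\<Omega>H\<^esub> v) = T (\<omega> \<bullet> ac a \<omega>' \<bullet> sig b u) (y \<star> v)"
              by simp
          qed (intro mlin)
          then show "lcoact2 H \<Omega>H \<gamma>' (\<lambda>c g'. T ((\<omega> \<odot>\<^bsub>\<Omega>B\<^esub> act a \<omega>') \<odot>\<^bsub>\<Omega>B\<^esub> \<sigma> b c) (y \<odot>\<^bsub>\<Omega>H\<^esub> g')) =
            sw \<gamma>' (\<lambda>u v. T (\<omega> \<bullet> ac a \<omega>' \<bullet> sig b u) (y \<star> v))" by (simp add: sig_pz)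
        qed (intro mlin)
      qed (intro mlin)
      then show "signed (j * k) (lcoact3 H \<Omega>H \<gamma> (\<lambda>a b g. lcoact2 H \<Omega>H \<gamma>' (\<lambda>c g'.
         T ((\<omega> \<odot>\<^bsub>\<Omega>B\<^esub> act a \<omega>') \<odot>\<^bsub>\<Omega>B\<^esub> \<sigma> b c) (g \<odot>\<^bsub>\<Omega>H\<^esub> g')))) = pm \<omega> \<gamma> \<omega>' \<gamma>'"
        by (simp add: pm_hom[OF \<gamma> \<omega>'])
    qed
  qed
  then show ?thesis by (simp add: crossed_calculus_def)
qed

lemma amult_T:
  "\<lbrakk>\<omega> \<in> carrier \<Omega>B; \<gamma> \<in> carrier \<Omega>H; \<omega>' \<in> carrier \<Omega>B; \<gamma>' \<in> carrier \<Omega>H\<rbrakk> \<Longrightarrow>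
    T \<omega> \<gamma> \<odot>\<^bsub>\<Omega>A\<^esub> T \<omega>' \<gamma>' = pm \<omega> \<gamma> \<omega>' \<gamma>'"
  using amult_lsum[of "[(\<omega>, \<gamma>)]" "[(\<omega>', \<gamma>')]"] by simp

lemma TC_T: "\<omega> \<in> carrier \<Omega>B \<Longrightarrow> \<gamma> \<in> carrier \<Omega>H \<Longrightarrow> T \<omega> \<gamma> \<in> TC"
  by (rule tensor_span_tens)

lemma amult_left_lsum:
  assumes ys: "set ys \<subseteq> carrier \<Omega>B \<times> carrier \<Omega>H"
  obtains L where "lin tscale tscale L" "\<And>x. x \<in> TC \<Longrightarrow> x \<odot>\<^bsub>\<Omega>A\<^esub> lsum ys T = L x"
    "\<And>\<omega> \<gamma>. L (T \<omega> \<gamma>) = lsum ys (pm \<omega> \<gamma>)"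
proof -
  have "bil sB s tscale (\<lambda>\<omega> \<gamma>. lsum ys (pm \<omega> \<gamma>))" by (intro bilI lin_lsum pm_lin multilin)
  then obtain L where L: "lin tscale tscale L" "\<And>\<omega> \<gamma>. L (T \<omega> \<gamma>) = lsum ys (pm \<omega> \<gamma>)"
    using bil_factors by blast
  have "x \<odot>\<^bsub>\<Omega>A\<^esub> lsum ys T = L x" if "x \<in> TC" for x
    using that ys unfolding BH.TC_lsum by (auto simp: amult_lsum lin_pull[OF L(1)] L(2))
  with L show thesis by (intro that)
qed

lemma amult_right_lsum:
  assumes ys: "set ys \<subseteq> carrier \<Omega>B \<times> carrier \<Omega>H"
  obtains L where "lin tscale tscale L" "\<And>x. x \<in> TC \<Longrightarrow> lsum ys T \<odot>\<^bsub>\<Omega>A\<^esub> x = L x"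
    "\<And>\<omega> \<gamma>. L (T \<omega> \<gamma>) = lsum ys (\<lambda>\<omega>' \<gamma>'. pm \<omega>' \<gamma>' \<omega> \<gamma>)"
proof -
  have "bil sB s tscale (\<lambda>\<omega> \<gamma>. lsum ys (\<lambda>\<omega>' \<gamma>'. pm \<omega>' \<gamma>' \<omega> \<gamma>))" by (intro bilI lin_lsum pm_lin multilin)
  then obtain L where L: "lin tscale tscale L" "\<And>\<omega> \<gamma>. L (T \<omega> \<gamma>) = lsum ys (\<lambda>\<omega>' \<gamma>'. pm \<omega>' \<gamma>' \<omega> \<gamma>)"
    using bil_factors by blast
  have "lsum ys T \<odot>\<^bsub>\<Omega>A\<^esub> x = L x" if "x \<in> TC" for x
    using that ys unfolding BH.TC_lsum by (auto simp: amult_lsum lin_pull[OF L(1)] L(2) intro: lsum_swap)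
  with L show thesis by (intro that)
qed

lemma amult_left:
  assumes "t \<in> TC"
  obtains L where "lin tscale tscale L" "\<And>x. x \<in> TC \<Longrightarrow> x \<odot>\<^bsub>\<Omega>A\<^esub> t = L x"
proof -
  obtain ys where ys: "set ys \<subseteq> carrier \<Omega>B \<times> carrier \<Omega>H" "t = lsum ys T" using assms BH.TC_lsum by blast
  show thesis by (rule amult_left_lsum[OF ys(1)]) (use ys(2) in \<open>auto intro: that\<close>)
qed

lemma amult_right:
  assumes "t \<in> TC"
  obtains L where "lin tscale tscale L" "\<And>x. x \<in> TC \<Longrightarrow> t \<odot>\<^bsub>\<Omega>A\<^esub> x = L x"
proof -
  obtain ys where ys: "set ys \<subseteq> carrier \<Omega>B \<times> carrier \<Omega>H" "t = lsum ys T" using assms BH.TC_lsum by blast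
  show thesis by (rule amult_right_lsum[OF ys(1)]) (use ys(2) in \<open>auto intro: that\<close>)
qed

lemma amult_left_pure:
  assumes "\<omega>' \<in> carrier \<Omega>B" "\<gamma>' \<in> carrier \<Omega>H"
  obtains L where "lin tscale tscale L" "\<And>x. x \<in> TC \<Longrightarrow> x \<odot>\<^bsub>\<Omega>A\<^esub> T \<omega>' \<gamma>' = L x"
    "\<And>\<omega> \<gamma>. L (T \<omega> \<gamma>) = pm \<omega> \<gamma> \<omega>' \<gamma>'"
  by (rule amult_left_lsum[of "[(\<omega>', \<gamma>')]"]) (use assms in \<open>auto intro: that\<close>)

lemma amult_right_pure:
  assumes "\<omega>' \<in> carrier \<Omega>B" "\<gamma>' \<in> carrier \<Omega>H"
  obtains L where "lin tscale tscale L" "\<And>x. x \<in> TC \<Longrightarrow> T \<omega>' \<gamma>' \<odot>\<^bsub>\<Omega>A\<^esub> x = L x"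
    "\<And>\<omega> \<gamma>. L (T \<omega> \<gamma>) = pm \<omega>' \<gamma>' \<omega> \<gamma>"
  by (rule amult_right_lsum[of "[(\<omega>', \<gamma>')]"]) (use assms in \<open>auto intro: that\<close>)

lemma sum_in_subspace:
  assumes K: "module.subspace tscale (K :: ('k, 'b, 'h) tensor set)" and "\<And>a b. (a, b) \<in> set xs \<Longrightarrow> f a b \<in> K"
  shows "lsum xs f \<in> K"
  using assms(2) by (induction xs) (auto intro!: BH.TV.subspace_0[OF K] BH.TV.subspace_add[OF K])

lemma signed_in_subspace:
  "module.subspace tscale (K :: ('k, 'b, 'h) tensor set) \<Longrightarrow> x \<in> K \<Longrightarrow> signed n x \<in> K"
  by (auto simp: signed_def intro: BH.TV.subspace_neg)

text \<open>
  As \<open>\<Omega>\<^sup>\<bullet>(\<Delta>)\<close> preserves the total degree, a first leg of degree zero leaves degree \<open>j\<close> for the second.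
\<close>

lemma sw_pz_deg:
  assumes \<gamma>: "\<gamma> \<in> deg \<Omega>H j" and f: "bil s s sX f"
  shows "sw \<gamma> (\<lambda>x y. f (pz x) y) = sw \<gamma> (\<lambda>x y. f (pz x) (hom_part j y))"
proof -
  note fl = mlin bil_left[OF f] bil_right[OF f] bil_right[OF f lin_ident[OF scale_vs]]
  have b: "bil s s sX (\<lambda>x y. f (pz x) y)" "bil s s sX (\<lambda>x y. f (pz x) (hom_part j y))"
    by (intro fl)+
  obtain L where L: "lin tscale sX L" "\<And>x. sw x (\<lambda>x y. f (pz x) y) = L (dcomult H \<Omega>H (proj x))"
    "\<And>x y. L (TT.T x y) = f (pz x) y" using sw_factor[OF b(1)] by blast
  obtain M where M: "lin tscale sX M" "\<And>x. sw x (\<lambda>x y. f (pz x) (hom_part j y)) = M (dcomult H \<Omega>H (proj x))"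
    "\<And>x y. M (TT.T x y) = f (pz x) (hom_part j y)" using sw_factor[OF b(2)] by blast
  have "dcomult H \<Omega>H \<gamma> \<in> tensor_deg \<Omega>H \<Omega>H j"
    using dcomult_hom \<gamma> unfolding dga_hom_def by simp
  then have "L (dcomult H \<Omega>H \<gamma>) = M (dcomult H \<Omega>H \<gamma>)"
    by (rule TT.tensor_deg_ext[OF L(1) M(1)])
      (auto simp: L(3) M(3) hom_simps hom_part_id lin_0[OF bil_left[OF f lin_ident[OF scale_vs]]])
  then show ?thesis by (simp add: L(2) M(2) hom_simps(1)[OF \<gamma>])
qed

lemma pm_deg:
  assumes "\<omega> \<in> deg \<Omega>B i" "\<gamma> \<in> deg \<Omega>H j" "\<omega>' \<in> deg \<Omega>B k" "\<gamma>' \<in> deg \<Omega>H l"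
  shows "pm \<omega> \<gamma> \<omega>' \<gamma>' \<in> tensor_deg \<Omega>B \<Omega>H ((i + j) + (k + l))"
proof -
  let ?n = "(i + j) + (k + l)"
  note sub = BH.tensor_deg_subspace[of ?n]
  have acd: "ac a \<omega>' \<in> deg \<Omega>B k" for a
    unfolding ac_def using assms(3) by (simp add: tw.hom_simps tw.act_deg pz_H)
  have d: "T (\<omega> \<bullet> ac a \<omega>' \<bullet> sig b u) (hom_part j y \<star> hom_part l v) \<in> tensor_deg \<Omega>B \<Omega>H ?n" for a b u y v
  proof -
    have 1: "\<omega> \<bullet> ac a \<omega>' \<in> deg \<Omega>B (i + k)" using tw.mult_deg[OF assms(1) acd] by (simp add: tw.tmul_hom[OF assms(1) acd])
    have 2: "\<omega> \<bullet> ac a \<omega>' \<bullet> sig b u \<in> deg \<Omega>B (i + k)" using tw.mult_deg[OF 1 sig_deg] by (simp add: tw.tmul_hom[OF 1 sig_deg])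
    have "hom_part j y \<star> hom_part l v \<in> deg \<Omega>H (j + l)"
      using mult_deg[OF hom_part_deg hom_part_deg, of j y l v] by (simp add: tmul_hom[OF hom_part_deg hom_part_deg])
    from BH.tensor_deg_T[OF 2 this] show ?thesis by (simp add: ac_simps)
  qed
  have b1: "bil s s tscale (\<lambda>x y. sw x (\<lambda>a b. sw \<gamma>' (\<lambda>u v. T (\<omega> \<bullet> ac a \<omega>' \<bullet> sig b u) (y \<star> v))))"
    "bil s s tscale (\<lambda>u v. T (\<omega> \<bullet> ac a \<omega>' \<bullet> sig b u) (y \<star> v))" for a b y by (intro mlin)+
  have "sw \<gamma>' (\<lambda>u v. T (\<omega> \<bullet> ac a \<omega>' \<bullet> sig b u) (y \<star> v)) = sw \<gamma>' (\<lambda>u v. T (\<omega> \<bullet> ac a \<omega>' \<bullet> sig b u) (y \<star> hom_part l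
    v))" for a b y
    using sw_pz_deg[OF assms(4) b1(2)[of a b y]] by (simp add: sig_pz)
  then have "pm \<omega> \<gamma> \<omega>' \<gamma>' = signed (j * k) (sw \<gamma> (\<lambda>x y. sw (pz x) (\<lambda>a b. sw \<gamma>' (\<lambda>u v.
    T (\<omega> \<bullet> ac a \<omega>' \<bullet> sig b u) (hom_part j y \<star> hom_part l v)))))"
    unfolding pm_hom[OF assms(2,3)] sw_pz_deg[OF assms(2) b1(1)] by simp
  then show ?thesis
    unfolding sw_def using d by (simp add: signed_in_subspace sum_in_subspace sub)
qed

lemma pm_TC: "pm \<omega> \<gamma> \<omega>' \<gamma>' \<in> TC"
proof -
  have "pm \<omega> \<gamma> \<omega>' \<gamma>' = sw \<gamma> (\<lambda>x y. sw y (\<lambda>p q. sw \<gamma>' (\<lambda>u v. T (\<omega> \<bullet> ac x \<omega>' \<bullet> sig p u) (ev q \<star> v))))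
     + sw \<gamma> (\<lambda>x y. sw y (\<lambda>p q. sw \<gamma>' (\<lambda>u v. T (\<omega> \<bullet> ac x (tw.sg \<omega>') \<bullet> sig p u) (od q \<star> v))))"
  proof -
    have bl: "bil sB s tscale (\<lambda>c h. T (\<omega> \<bullet> b \<bullet> c) h)" for b by (intro mlin)
    show ?thesis unfolding pm_def braid_sw cup_parity(1)[OF bl] cup_parity(2)[OF bl] sw_add ..
  qed
  then show ?thesis unfolding sw_def
    by (simp add: BH.TV.subspace_add[OF BH.TC_subspace] sum_in_subspace[OF BH.TC_subspace] TC_T tw.op_carrier op_carrier)
qed

lemma amult_TC: "x \<in> TC \<Longrightarrow> y \<in> TC \<Longrightarrow> x \<odot>\<^bsub>\<Omega>A\<^esub> y \<in> TC"
  unfolding BH.TC_lsum[of x] BH.TC_lsum[of y]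
  by (auto simp: amult_lsum intro!: sum_in_subspace[OF BH.TC_subspace] pm_TC)

text \<open>
  On the right, \<open>braid_mult\<close> splits the movement of \<open>\<gamma>\<close> past \<open>\<omega>'\<close>, \<open>b\<close> and \<open>c\<close>; \<open>cup_assoc\<close> then absorbs the movement
  past \<open>c\<close>, and \<open>braid_twist\<close> the one past \<open>b\<close>.
\<close>

lemma pm_assoc:
  "braid \<gamma> \<omega>' (\<lambda>b g. cup g \<gamma>' (\<lambda>c h. pm (\<omega> \<bullet> b \<bullet> c) h \<omega>'' \<gamma>'')) =
    braid \<gamma>' \<omega>'' (\<lambda>b g. cup g \<gamma>'' (\<lambda>c h. pm \<omega> \<gamma> (\<omega>' \<bullet> b \<bullet> c) h))"
proof -
  have f: "bil sB s tscale (\<lambda>z h'. T (u \<bullet> (v \<bullet> z)) h')" for u v by (intro mlin)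
  have F: "bil sB s tscale (\<lambda>z h. cup h \<gamma>'' (\<lambda>c' h'. T (u \<bullet> (v \<bullet> (z \<bullet> c'))) h'))" for u v by (intro mlin)
  have g: "bil sB s tscale (\<lambda>b g. cup g w (\<lambda>c h. T (u \<bullet> b \<bullet> c) h))" for u w by (intro mlin)
  have g2: "bil sB s tscale (\<lambda>b' g'. braid g' c (\<lambda>b'' g''. cup g'' h (\<lambda>c' h'. T (u \<bullet> (b' \<bullet> b'') \<bullet> c') h')))" for c
    h u by (intro mlin)
  have "pm \<omega> \<gamma> (\<omega>' \<bullet> b \<bullet> c) h = braid \<gamma> \<omega>' (\<lambda>b0 g0. braid g0 b (\<lambda>b1 g1. braid g1 c (\<lambda>b2 g2. cup g2 h (\<lambda>c' h'.
      T (\<omega> \<bullet> ((b0 \<bullet> b1) \<bullet> (b2 \<bullet> c'))) h'))))" for b c h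
    unfolding pm_def braid_mult[OF g] braid_mult[OF g2] by (simp add: tw.tmul_assoc)
  then have "braid \<gamma>' \<omega>'' (\<lambda>b g. cup g \<gamma>'' (\<lambda>c h. pm \<omega> \<gamma> (\<omega>' \<bullet> b \<bullet> c) h)) =
    braid \<gamma>' \<omega>'' (\<lambda>b g. braid \<gamma> \<omega>' (\<lambda>b0 g0. braid g0 b (\<lambda>b1 g1. cup g \<gamma>'' (\<lambda>c h. braid g1 c (\<lambda>b2 g2. cup g2 h (\<lambda>c' h'.
      T (\<omega> \<bullet> ((b0 \<bullet> b1) \<bullet> (b2 \<bullet> c'))) h'))))))"
    by (simp add: cup_braid_swap[of _ \<gamma>'' \<gamma> \<omega>'] cup_braid_swap[of _ \<gamma>''])
  also have "\<dots> = braid \<gamma>' \<omega>'' (\<lambda>b g. braid \<gamma> \<omega>' (\<lambda>b0 g0. braid g0 b (\<lambda>b1 g1. cup g1 g (\<lambda>c h. cup h \<gamma>'' (\<lambda>c' h'.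
      T (\<omega> \<bullet> ((b0 \<bullet> b1) \<bullet> (c \<bullet> c'))) h')))))"
    unfolding cup_assoc[OF f] ..
  also have "\<dots> = braid \<gamma> \<omega>' (\<lambda>b0 g0. braid \<gamma>' \<omega>'' (\<lambda>b g. braid g0 b (\<lambda>b1 g1. cup g1 g (\<lambda>c h. cup h \<gamma>'' (\<lambda>c' h'.
      T (\<omega> \<bullet> (b0 \<bullet> ((b1 \<bullet> c) \<bullet> c'))) h')))))"
    unfolding tw.tmul_assoc by (rule braid_swap)
  also have "\<dots> = braid \<gamma> \<omega>' (\<lambda>b0 g0. cup g0 \<gamma>' (\<lambda>c h. braid h \<omega>'' (\<lambda>b' h'. cup h' \<gamma>'' (\<lambda>c' h''.
      T (\<omega> \<bullet> (b0 \<bullet> ((c \<bullet> b') \<bullet> c'))) h''))))"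
    unfolding braid_twist[OF F] ..
  also have "\<dots> = braid \<gamma> \<omega>' (\<lambda>b g. cup g \<gamma>' (\<lambda>c h. pm (\<omega> \<bullet> b \<bullet> c) h \<omega>'' \<gamma>''))"
    unfolding pm_def by (simp add: tw.tmul_assoc)
  finally show ?thesis by simp
qed

lemma amult_assoc:
  assumes "x \<in> TC" "y \<in> TC" "z \<in> TC"
  shows "(x \<odot>\<^bsub>\<Omega>A\<^esub> y) \<odot>\<^bsub>\<Omega>A\<^esub> z = x \<odot>\<^bsub>\<Omega>A\<^esub> (y \<odot>\<^bsub>\<Omega>A\<^esub> z)"
proof -
  have pure: "(T \<omega> \<gamma> \<odot>\<^bsub>\<Omega>A\<^esub> T \<omega>' \<gamma>') \<odot>\<^bsub>\<Omega>A\<^esub> T \<omega>'' \<gamma>'' = T \<omega> \<gamma> \<odot>\<^bsub>\<Omega>A\<^esub> (T \<omega>' \<gamma>' \<odot>\<^bsub>\<Omega>A\<^esub> T \<omega>'' \<gamma>'')"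
    if c: "\<omega> \<in> carrier \<Omega>B" "\<gamma> \<in> carrier \<Omega>H" "\<omega>' \<in> carrier \<Omega>B" "\<gamma>' \<in> carrier \<Omega>H" "\<omega>'' \<in> carrier \<Omega>B" "\<gamma>'' \<in> carrier \<Omega>H"
    for \<omega> \<gamma> \<omega>' \<gamma>' \<omega>'' \<gamma>''
  proof -
    obtain L where L: "lin tscale tscale L" "\<And>x. x \<in> TC \<Longrightarrow> x \<odot>\<^bsub>\<Omega>A\<^esub> T \<omega>'' \<gamma>'' = L x" "\<And>\<omega> \<gamma>. L (T \<omega> \<gamma>) = pm \<omega> \<gamma> \<omega>'' \<gamma>''"
      using amult_left_pure[OF c(5,6)] by blast
    obtain R where R: "lin tscale tscale R" "\<And>x. x \<in> TC \<Longrightarrow> T \<omega> \<gamma> \<odot>\<^bsub>\<Omega>A\<^esub> x = R x" "\<And>\<omega>' \<gamma>'. R (T \<omega>' \<gamma>') = pm \<omega> \<gamma> \<omega>' \<gamma>'"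
      using amult_right_pure[OF c(1,2)] by blast
    have "L (pm \<omega> \<gamma> \<omega>' \<gamma>') = R (pm \<omega>' \<gamma>' \<omega>'' \<gamma>'')"
      using pm_assoc[of \<gamma> \<omega>' \<gamma>' \<omega> \<omega>'' \<gamma>''] unfolding pm_def[of \<omega> \<gamma> \<omega>' \<gamma>'] pm_def[of \<omega>' \<gamma>' \<omega>'' \<gamma>'']
      by (simp add: braid_pull[OF L(1)] cup_pull[OF L(1)] L(3) braid_pull[OF R(1)] cup_pull[OF R(1)] R(3))
    then show ?thesis by (simp add: amult_T c L(2) R(2) pm_TC)
  qed
  have step1: "(T \<omega> \<gamma> \<odot>\<^bsub>\<Omega>A\<^esub> T \<omega>' \<gamma>') \<odot>\<^bsub>\<Omega>A\<^esub> z = T \<omega> \<gamma> \<odot>\<^bsub>\<Omega>A\<^esub> (T \<omega>' \<gamma>' \<odot>\<^bsub>\<Omega>A\<^esub> z)"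
    if c: "\<omega> \<in> carrier \<Omega>B" "\<gamma> \<in> carrier \<Omega>H" "\<omega>' \<in> carrier \<Omega>B" "\<gamma>' \<in> carrier \<Omega>H" for \<omega> \<gamma> \<omega>' \<gamma>'
  proof -
    note x = TC_T[OF c(1,2)] and y = TC_T[OF c(3,4)]
    obtain L where L: "lin tscale tscale L" "\<And>z. z \<in> TC \<Longrightarrow> (T \<omega> \<gamma> \<odot>\<^bsub>\<Omega>A\<^esub> T \<omega>' \<gamma>') \<odot>\<^bsub>\<Omega>A\<^esub> z = L z"
      using amult_right[OF amult_TC[OF x y]] by blast
    obtain M where M: "lin tscale tscale M" "\<And>z. z \<in> TC \<Longrightarrow> T \<omega>' \<gamma>' \<odot>\<^bsub>\<Omega>A\<^esub> z = M z"
      using amult_right[OF y] by blast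
    obtain R where R: "lin tscale tscale R" "\<And>z. z \<in> TC \<Longrightarrow> T \<omega> \<gamma> \<odot>\<^bsub>\<Omega>A\<^esub> z = R z"
      using amult_right[OF x] by blast
    have "L z = R (M z)"
      by (rule BH.TC_ext[OF L(1) lin_comp[OF R(1) M(1)] assms(3)])
        (simp add: L(2)[symmetric] M(2)[symmetric] R(2)[symmetric] TC_T amult_TC y c deg_carrier pure tw.deg_carrier)
    then show ?thesis using L(2)[OF assms(3)] M(2)[OF assms(3)] R(2)[OF amult_TC[OF y assms(3)]] by simp
  qed
  have step2: "(T \<omega> \<gamma> \<odot>\<^bsub>\<Omega>A\<^esub> y) \<odot>\<^bsub>\<Omega>A\<^esub> z = T \<omega> \<gamma> \<odot>\<^bsub>\<Omega>A\<^esub> (y \<odot>\<^bsub>\<Omega>A\<^esub> z)"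
    if c: "\<omega> \<in> carrier \<Omega>B" "\<gamma> \<in> carrier \<Omega>H" for \<omega> \<gamma>
  proof -
    note x = TC_T[OF c(1,2)]
    obtain L where L: "lin tscale tscale L" "\<And>y. y \<in> TC \<Longrightarrow> T \<omega> \<gamma> \<odot>\<^bsub>\<Omega>A\<^esub> y = L y"
      using amult_right[OF x] by blast
    obtain M where M: "lin tscale tscale M" "\<And>y. y \<in> TC \<Longrightarrow> y \<odot>\<^bsub>\<Omega>A\<^esub> z = M y"
      using amult_left[OF assms(3)] by blast
    have "M (L y) = L (M y)"
      by (rule BH.TC_ext[where f = "\<lambda>y. M (L y)" and g = "\<lambda>y. L (M y)", OF lin_comp[OF M(1) L(1)] lin_comp[OF L(1)
        M(1)] assms(2)])
        (simp add: L(2)[symmetric] M(2)[symmetric] TC_T amult_TC assms(3) c deg_carrier step1 tw.deg_carrier x)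
    then show ?thesis
      using L(2)[OF assms(2)] M(2)[OF assms(2)] M(2)[OF amult_TC[OF x assms(2)]] L(2)[OF amult_TC[OF assms(2,3)]] by simp
  qed
  obtain L where L: "lin tscale tscale L" "\<And>x. x \<in> TC \<Longrightarrow> x \<odot>\<^bsub>\<Omega>A\<^esub> y = L x"
    using amult_left[OF assms(2)] by blast
  obtain M where M: "lin tscale tscale M" "\<And>x. x \<in> TC \<Longrightarrow> x \<odot>\<^bsub>\<Omega>A\<^esub> z = M x"
    using amult_left[OF assms(3)] by blast
  obtain R where R: "lin tscale tscale R" "\<And>x. x \<in> TC \<Longrightarrow> x \<odot>\<^bsub>\<Omega>A\<^esub> (y \<odot>\<^bsub>\<Omega>A\<^esub> z) = R x"
    using amult_left[OF amult_TC[OF assms(2,3)]] by blast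
  have "M (L x) = R x"
    by (rule BH.TC_ext[where f = "\<lambda>x. M (L x)", OF lin_comp[OF M(1) L(1)] R(1) assms(1)])
      (simp add: L(2)[symmetric] M(2)[symmetric] R(2)[symmetric] TC_T amult_TC assms(2) deg_carrier step2 tw.deg_carrier)
  then show ?thesis
    using L(2)[OF assms(1)] M(2)[OF amult_TC[OF assms(1,2)]] R(2)[OF assms(1)] by simp
qed

lemma pm_leibniz:
  assumes D: "lin tscale tscale D" "\<And>a h. D (T a h) = BH.pdiff a h"
  shows "D (pm \<omega> \<gamma> \<omega>' \<gamma>') = pm (tw.td \<omega>) \<gamma> \<omega>' \<gamma>' + pm (tw.sg \<omega>) (td \<gamma>) \<omega>' \<gamma>'
    + pm (tw.sg \<omega>) (sg \<gamma>) (tw.td \<omega>') \<gamma>' + pm (tw.sg \<omega>) (sg \<gamma>) (tw.sg \<omega>') (td \<gamma>')"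
proof -
  have bl: "bil sB s tscale (\<lambda>c h. T (u \<bullet> c) h)" "bil sB s tscale (\<lambda>b g. cup g v (\<lambda>c h. T (u \<bullet> b \<bullet> c) h))" for u v
    by (intro mlin)+
  have inner: "cup g \<gamma>' (\<lambda>c h. BH.pdiff (\<omega> \<bullet> b \<bullet> c) h) =
    cup g \<gamma>' (\<lambda>c h. T (tw.td \<omega> \<bullet> b \<bullet> c) h) + (cup g \<gamma>' (\<lambda>c h. T (tw.sg \<omega> \<bullet> tw.td b \<bullet> c) h)
     + cup (td g) \<gamma>' (\<lambda>c h. T (tw.sg \<omega> \<bullet> tw.sg b \<bullet> c) h)) + cup (sg g) (td \<gamma>') (\<lambda>c h. T (tw.sg \<omega> \<bullet> tw.sg b \<bullet> c) h)" for b g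
    using cup_diff[OF bl(1), of g \<gamma>' "tw.sg \<omega> \<bullet> tw.sg b"]
    by (simp add: BH.pdiff_def tw.tmul_parity tens_bilinear cup_add ac_simps)
  have "D (pm \<omega> \<gamma> \<omega>' \<gamma>') = braid \<gamma> \<omega>' (\<lambda>b g. cup g \<gamma>' (\<lambda>c h. BH.pdiff (\<omega> \<bullet> b \<bullet> c) h))"
    unfolding pm_def braid_pull[OF D(1)] cup_pull[OF D(1)] D(2) ..
  moreover have "bil sB s tscale (\<lambda>b g. cup g \<gamma>' (\<lambda>c h. T (tw.sg \<omega> \<bullet> b \<bullet> c) h))" by (intro mlin)
  note braid_diff[OF this, of \<gamma> \<omega>', unfolded braid_add]
  ultimately show ?thesis
    unfolding inner braid_add braid_sg[OF bl(2)] unfolding pm_def by (simp add: ac_simps)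
qed

lemma sg_hom: "\<omega> \<in> deg \<Omega>B p \<Longrightarrow> \<gamma> \<in> deg \<Omega>H q \<Longrightarrow> T (tw.sg \<omega>) (sg \<gamma>) = signed (p + q) (T \<omega> \<gamma>)"
  by (auto simp: tw.hom_simps hom_simps signed_def tens_neg)

lemma carrier_closed: "tw.sg \<omega> \<in> carrier \<Omega>B" "sg \<gamma> \<in> carrier \<Omega>H" "tw.td \<omega> \<in> carrier \<Omega>B" "td \<gamma> \<in> carrier \<Omega>H"
  by (simp_all add: op_carrier tw.op_carrier)

lemma amult_leibniz:
  assumes x: "x \<in> tensor_deg \<Omega>B \<Omega>H n" and y: "y \<in> TC"
  shows "tensor_diff \<Omega>B \<Omega>H (x \<odot>\<^bsub>\<Omega>A\<^esub> y) =
    tensor_diff \<Omega>B \<Omega>H x \<odot>\<^bsub>\<Omega>A\<^esub> y + signed n (x \<odot>\<^bsub>\<Omega>A\<^esub> tensor_diff \<Omega>B \<Omega>H y)"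
proof -
  obtain D where D: "lin tscale tscale D" "\<And>x y. D (T x y) = BH.pdiff x y"
    "\<And>t. t \<in> TC \<Longrightarrow> tensor_diff \<Omega>B \<Omega>H t = D t" using BH.pdiff_linear by blast
  have DTC: "D t \<in> TC" if "t \<in> TC" for t using BH.tensor_diff_lin(1)[OF that] D(3)[OF that] by simp
  have pure: "D (T \<omega> \<gamma> \<odot>\<^bsub>\<Omega>A\<^esub> T \<omega>' \<gamma>') = D (T \<omega> \<gamma>) \<odot>\<^bsub>\<Omega>A\<^esub> T \<omega>' \<gamma>' + signed (p + q) (T \<omega> \<gamma> \<odot>\<^bsub>\<Omega>A\<^esub> D (T \<omega>' \<gamma>'))"
    if h: "\<omega> \<in> deg \<Omega>B p" "\<gamma> \<in> deg \<Omega>H q" and c': "\<omega>' \<in> carrier \<Omega>B" "\<gamma>' \<in> carrier \<Omega>H" for \<omega> \<gamma> p q \<omega>' \<gamma>'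
  proof -
    note c = tw.deg_carrier[OF h(1)] deg_carrier[OF h(2)]
    obtain L where L: "lin tscale tscale L" "\<And>x. x \<in> TC \<Longrightarrow> x \<odot>\<^bsub>\<Omega>A\<^esub> T \<omega>' \<gamma>' = L x"
      "\<And>\<omega> \<gamma>. L (T \<omega> \<gamma>) = pm \<omega> \<gamma> \<omega>' \<gamma>'" using amult_left_pure[OF c'] by blast
    obtain R where R: "lin tscale tscale R" "\<And>x. x \<in> TC \<Longrightarrow> T \<omega> \<gamma> \<odot>\<^bsub>\<Omega>A\<^esub> x = R x"
      "\<And>\<omega>' \<gamma>'. R (T \<omega>' \<gamma>') = pm \<omega> \<gamma> \<omega>' \<gamma>'" using amult_right_pure[OF c] by blast
    have s: "pm (tw.sg \<omega>) (sg \<gamma>) a b = signed (p + q) (pm \<omega> \<gamma> a b)" for a b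
      using h lin_minus[OF pm_lin(1)[OF lin_ident[OF tw.scale_vs]]] lin_minus[OF pm_lin(2)[OF lin_ident[OF scale_vs]]]
      by (auto simp: tw.hom_simps hom_simps signed_def)
    show ?thesis
      unfolding amult_T[OF c c'] L(2)[OF DTC[OF TC_T[OF c]]] R(2)[OF DTC[OF TC_T[OF c']]] pm_leibniz[OF D(1,2)] s
      by (simp add: D(2) BH.pdiff_def lin_add[OF L(1)] lin_add[OF R(1)] L(3) R(3)) (simp add: signed_def)
  qed
  have step: "D (T \<omega> \<gamma> \<odot>\<^bsub>\<Omega>A\<^esub> y) = D (T \<omega> \<gamma>) \<odot>\<^bsub>\<Omega>A\<^esub> y + signed (p + q) (T \<omega> \<gamma> \<odot>\<^bsub>\<Omega>A\<^esub> D y)"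
    if h: "\<omega> \<in> deg \<Omega>B p" "\<gamma> \<in> deg \<Omega>H q" for \<omega> \<gamma> p q
  proof -
    note c = TC_T[OF tw.deg_carrier[OF h(1)] deg_carrier[OF h(2)]]
    obtain R where R: "lin tscale tscale R" "\<And>x. x \<in> TC \<Longrightarrow> T \<omega> \<gamma> \<odot>\<^bsub>\<Omega>A\<^esub> x = R x"
      using amult_right[OF c] by blast
    obtain R' where R': "lin tscale tscale R'" "\<And>x. x \<in> TC \<Longrightarrow> D (T \<omega> \<gamma>) \<odot>\<^bsub>\<Omega>A\<^esub> x = R' x"
      using amult_right[OF DTC[OF c]] by blast
    have "D (R y) = R' y + signed (p + q) (R (D y))"
    proof (rule BH.TC_ext[where f = "\<lambda>y. D (R y)" and g = "\<lambda>y. R' y + signed (p + q) (R (D y))", OF _ _ y])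
      show "lin tscale tscale (\<lambda>y. D (R y))" by (rule lin_comp[OF D(1) R(1)])
      show "lin tscale tscale (\<lambda>y. R' y + signed (p + q) (R (D y)))"
        by (intro lin_plus lin_signed_fun R' lin_comp[OF R(1) D(1)])
      fix p' q' \<omega>' \<gamma>' assume h': "\<omega>' \<in> deg \<Omega>B p'" "\<gamma>' \<in> deg \<Omega>H q'"
      note c' = tw.deg_carrier[OF h'(1)] deg_carrier[OF h'(2)]
      show "D (R (T \<omega>' \<gamma>')) = R' (T \<omega>' \<gamma>') + signed (p + q) (R (D (T \<omega>' \<gamma>')))"
        using pure[OF h c'] R(2)[OF TC_T[OF c']] R(2)[OF DTC[OF TC_T[OF c']]] R'(2)[OF TC_T[OF c']] by simp
    qed
    then show ?thesis using R(2)[OF y] R(2)[OF DTC[OF y]] R'(2)[OF y] by simp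
  qed
  obtain L where L: "lin tscale tscale L" "\<And>x. x \<in> TC \<Longrightarrow> x \<odot>\<^bsub>\<Omega>A\<^esub> y = L x"
    using amult_left[OF y] by blast
  obtain L' where L': "lin tscale tscale L'" "\<And>x. x \<in> TC \<Longrightarrow> x \<odot>\<^bsub>\<Omega>A\<^esub> D y = L' x"
    using amult_left[OF DTC[OF y]] by blast
  have "D (L x) = L (D x) + signed n (L' x)"
  proof (rule BH.tensor_deg_ext[where f = "\<lambda>x. D (L x)" and g = "\<lambda>x. L (D x) + signed n (L' x)", OF _ _ x])
    show "lin tscale tscale (\<lambda>x. D (L x))" by (rule lin_comp[OF D(1) L(1)])
    show "lin tscale tscale (\<lambda>x. L (D x) + signed n (L' x))"
      by (intro lin_plus lin_signed_fun L' lin_comp[OF L(1) D(1)])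
    fix p q \<omega> \<gamma> assume h: "p + q = n" "\<omega> \<in> deg \<Omega>B p" "\<gamma> \<in> deg \<Omega>H q"
    note c = TC_T[OF tw.deg_carrier[OF h(2)] deg_carrier[OF h(3)]]
    show "D (L (T \<omega> \<gamma>)) = L (D (T \<omega> \<gamma>)) + signed n (L' (T \<omega> \<gamma>))"
      using step[OF h(2,3)] h(1) L(2)[OF c] L(2)[OF DTC[OF c]] L'(2)[OF c] by simp
  qed
  then show ?thesis
    using BH.tensor_deg_TC[OF x] y L(2) L'(2) D(3) DTC amult_TC by metis
qed

lemma amult_deg:
  assumes x: "x \<in> tensor_deg \<Omega>B \<Omega>H m" and y: "y \<in> tensor_deg \<Omega>B \<Omega>H n"
  shows "x \<odot>\<^bsub>\<Omega>A\<^esub> y \<in> tensor_deg \<Omega>B \<Omega>H (m + n)"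
proof -
  note sub = BH.tensor_deg_subspace
  have vim: "BH.TV.subspace {t. L t \<in> tensor_deg \<Omega>B \<Omega>H k}" if "lin tscale tscale L" for L :: "('k, 'b, 'h) tensor \<Rightarrow>
    ('k, 'b, 'h) tensor" and k
    by (rule lin_vimage_subspace[OF that sub])
  have step: "T \<omega> \<gamma> \<odot>\<^bsub>\<Omega>A\<^esub> y \<in> tensor_deg \<Omega>B \<Omega>H (m + n)"
    if h: "p + q = m" "\<omega> \<in> deg \<Omega>B p" "\<gamma> \<in> deg \<Omega>H q" for \<omega> \<gamma> p q
  proof -
    note c = tw.deg_carrier[OF h(2)] deg_carrier[OF h(3)]
    obtain R where R: "lin tscale tscale R" "\<And>x. x \<in> TC \<Longrightarrow> T \<omega> \<gamma> \<odot>\<^bsub>\<Omega>A\<^esub> x = R x"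
      "\<And>\<omega>' \<gamma>'. R (T \<omega>' \<gamma>') = pm \<omega> \<gamma> \<omega>' \<gamma>'" using amult_right_pure[OF c] by blast
    have "y \<in> {t. R t \<in> tensor_deg \<Omega>B \<Omega>H (m + n)}"
      by (rule BH.tensor_deg_induct[OF vim[OF R(1)] y]) (use pm_deg[OF h(2,3)] h(1) in \<open>auto simp: R(3)\<close>)
    then show ?thesis using R(2)[OF BH.tensor_deg_TC[OF y]] by simp
  qed
  obtain L where L: "lin tscale tscale L" "\<And>x. x \<in> TC \<Longrightarrow> x \<odot>\<^bsub>\<Omega>A\<^esub> y = L x"
    using amult_left[OF BH.tensor_deg_TC[OF y]] by blast
  have "x \<in> {t. L t \<in> tensor_deg \<Omega>B \<Omega>H (m + n)}"
    by (rule BH.tensor_deg_induct[OF vim[OF L(1)] x])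
      (use step L(2)[OF TC_T[OF tw.deg_carrier deg_carrier]] in force)
  then show ?thesis using L(2)[OF BH.tensor_deg_TC[OF x]] by simp
qed

lemma pm_one: "pm \<one>\<^bsub>\<Omega>B\<^esub> \<one>\<^bsub>\<Omega>H\<^esub> \<omega> \<gamma> = T (tw.proj \<omega>) (proj \<gamma>)" "pm \<omega> \<gamma> \<one>\<^bsub>\<Omega>B\<^esub> \<one>\<^bsub>\<Omega>H\<^esub> = T (tw.proj \<omega>) (proj \<gamma>)"
proof -
  have bl: "bil sB s tscale (\<lambda>b g. cup g v (\<lambda>c h. T (u \<bullet> b \<bullet> c) h))" "bil sB s tscale (\<lambda>c h. T (u \<bullet> c) h)" for u v
    by (intro mlin)+
  have bl': "bil sB s tscale (\<lambda>b g. T (\<omega> \<bullet> b \<bullet> \<one>\<^bsub>\<Omega>B\<^esub>) (proj g))" by (intro mlin)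
  show "pm \<one>\<^bsub>\<Omega>B\<^esub> \<one>\<^bsub>\<Omega>H\<^esub> \<omega> \<gamma> = T (tw.proj \<omega>) (proj \<gamma>)"
    unfolding pm_def braid_one(1)[OF bl(1)] cup_one(1)[OF bl(2)] by simp
  show "pm \<omega> \<gamma> \<one>\<^bsub>\<Omega>B\<^esub> \<one>\<^bsub>\<Omega>H\<^esub> = T (tw.proj \<omega>) (proj \<gamma>)"
    unfolding pm_def cup_one(2)[OF bl(2)] braid_one(2)[OF bl'] by simp
qed

lemma amult_one:
  assumes "t \<in> TC"
  shows "T \<one>\<^bsub>\<Omega>B\<^esub> \<one>\<^bsub>\<Omega>H\<^esub> \<odot>\<^bsub>\<Omega>A\<^esub> t = t" "t \<odot>\<^bsub>\<Omega>A\<^esub> T \<one>\<^bsub>\<Omega>B\<^esub> \<one>\<^bsub>\<Omega>H\<^esub> = t"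
proof -
  obtain xs where xs: "set xs \<subseteq> carrier \<Omega>B \<times> carrier \<Omega>H" "t = lsum xs T" using assms BH.TC_lsum by blast
  have "lsum xs (pm \<one>\<^bsub>\<Omega>B\<^esub> \<one>\<^bsub>\<Omega>H\<^esub>) = t" "lsum xs (\<lambda>\<omega> \<gamma>. pm \<omega> \<gamma> \<one>\<^bsub>\<Omega>B\<^esub> \<one>\<^bsub>\<Omega>H\<^esub>) = t"
    unfolding xs(2) by (rule lsum_cong, use xs(1) in \<open>auto simp: pm_one tw.proj_id proj_id\<close>)+
  then show "T \<one>\<^bsub>\<Omega>B\<^esub> \<one>\<^bsub>\<Omega>H\<^esub> \<odot>\<^bsub>\<Omega>A\<^esub> t = t" "t \<odot>\<^bsub>\<Omega>A\<^esub> T \<one>\<^bsub>\<Omega>B\<^esub> \<one>\<^bsub>\<Omega>H\<^esub> = t"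
    using amult_lsum[of "[(\<one>\<^bsub>\<Omega>B\<^esub>, \<one>\<^bsub>\<Omega>H\<^esub>)]" xs] amult_lsum[of xs "[(\<one>\<^bsub>\<Omega>B\<^esub>, \<one>\<^bsub>\<Omega>H\<^esub>)]"] xs(1)
    by (simp_all add: xs(2)[symmetric] tw.one_closed one_closed pm_one tw.one_carrier one_carrier)
qed

sublocale OA: dg_algebra \<Omega>A
proof
  show "is_vspace \<Omega>A" by (simp add: is_vspace_def vector_space_tscale BH.TC_subspace)
  show "bilin_on \<Omega>A \<Omega>A \<Omega>A (\<odot>\<^bsub>\<Omega>A\<^esub>)"
    unfolding bilin_on_def
  proof (intro conjI ballI)
    fix t assume "t \<in> carrier \<Omega>A"
    then have t: "t \<in> TC" by simp
    obtain R where R: "lin tscale tscale R" "\<And>x. x \<in> TC \<Longrightarrow> t \<odot>\<^bsub>\<Omega>A\<^esub> x = R x" using amult_right[OF t] by blast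
    show "lin_on \<Omega>A \<Omega>A ((\<odot>\<^bsub>\<Omega>A\<^esub>) t)"
      unfolding lin_on_def using t R(2) amult_TC[OF t] BH.TV.subspace_add[OF BH.TC_subspace]
        BH.TV.subspace_scale[OF BH.TC_subspace]
      by (simp add: lin_add[OF R(1)] lin_scale[OF R(1)])
    obtain L where L: "lin tscale tscale L" "\<And>x. x \<in> TC \<Longrightarrow> x \<odot>\<^bsub>\<Omega>A\<^esub> t = L x" using amult_left[OF t] by blast
    show "lin_on \<Omega>A \<Omega>A (\<lambda>v. v \<odot>\<^bsub>\<Omega>A\<^esub> t)"
      unfolding lin_on_def using t L(2) amult_TC[OF _ t] BH.TV.subspace_add[OF BH.TC_subspace]
        BH.TV.subspace_scale[OF BH.TC_subspace]
      by (simp add: lin_add[OF L(1)] lin_scale[OF L(1)])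
  qed
  show "lin_on \<Omega>A \<Omega>A (diff \<Omega>A)"
    unfolding lin_on_def by (simp add: BH.tensor_diff_lin)
  show "carrier \<Omega>A = module.span (scale \<Omega>A) (\<Union>n. deg \<Omega>A n)"
    using BH.tensor_deg_total by simp
  show "f n = 0" if "\<And>n. f n \<in> deg \<Omega>A n" "(\<Sum>n\<le>N. f n) = 0" "n \<le> N" for f N n
    using BH.tensor_deg_direct[of f N n] that by simp
  show "\<one>\<^bsub>\<Omega>A\<^esub> \<in> deg \<Omega>A 0"
    using BH.tensor_deg_T[OF tw.one_deg one_deg] by simp
qed (simp_all add: amult_assoc amult_one TC_T tw.one_carrier one_carrier BH.tensor_deg_subspace
  amult_deg BH.tensor_diff_deg BH.tensor_diff_diff amult_leibniz)

section \<open>The crossed product calculus is generated in degree zero\<close>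

lemma sw_H_list:
  assumes h: "h \<in> carrier H"
  obtains xs where "set xs \<subseteq> carrier H \<times> carrier H"
    "\<And>f :: 'h \<Rightarrow> 'h \<Rightarrow> ('k, 'b, 'h) tensor. bil s s tscale f \<Longrightarrow> sw h f = lsum xs f"
proof -
  obtain xs where xs: "set xs \<subseteq> carrier H \<times> carrier H" "comult H h = lsum xs TT.T" "sw h TT.T = lsum xs TT.T"
    using comult_list[OF h] by blast
  have "sw h f = lsum xs f" if "bil s s tscale f" for f :: "'h \<Rightarrow> 'h \<Rightarrow> ('k, 'b, 'h) tensor"
    using tens_lsum_eq[of \<Omega>H \<Omega>H tscale f "S h" xs] that xs(3) unfolding sw_def by simp
  with xs(1) show thesis by (rule that)
qed

lemma amult_lsum_left:
  assumes "t \<in> TC" "\<And>a b. F a b \<in> TC"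
  shows "lsum xs F \<odot>\<^bsub>\<Omega>A\<^esub> t = lsum xs (\<lambda>a b. F a b \<odot>\<^bsub>\<Omega>A\<^esub> t)"
proof -
  obtain L where L: "lin tscale tscale L" "\<And>x. x \<in> TC \<Longrightarrow> x \<odot>\<^bsub>\<Omega>A\<^esub> t = L x"
    using amult_left[OF assms(1)] by blast
  have "lsum xs F \<in> TC" by (rule sum_in_subspace[OF BH.TC_subspace]) (rule assms(2))
  then show ?thesis by (simp add: L(2) assms(2) lin_pull[OF L(1)])
qed

text \<open>
  Moving a form past the unit of \<open>\<Omega>\<^sup>\<bullet>(B)\<close> has no effect, so that only the cocycle product remains.
\<close>

lemma amult_three:
  assumes "b \<in> carrier \<Omega>B" "\<gamma> \<in> carrier \<Omega>H" "\<delta> \<in> carrier \<Omega>H"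
  shows "T b \<one>\<^bsub>\<Omega>H\<^esub> \<odot>\<^bsub>\<Omega>A\<^esub> T \<one>\<^bsub>\<Omega>B\<^esub> \<gamma> = T b \<gamma>"
    and "T b \<gamma> \<odot>\<^bsub>\<Omega>A\<^esub> T \<one>\<^bsub>\<Omega>B\<^esub> \<delta> = cup \<gamma> \<delta> (\<lambda>c h. T (b \<bullet> c) h)"
proof -
  have bl: "bil sB s tscale (\<lambda>b g. cup g v (\<lambda>c h. T (u \<bullet> b \<bullet> c) h))" "bil sB s tscale (\<lambda>c h. T (u \<bullet> c) h)" for u v
    by (intro mlin)+
  have p: "proj (proj \<gamma>) = \<gamma>" "tw.proj b = b" using assms by (simp_all add: proj_id tw.proj_id)
  have 2: "T b \<gamma> \<odot>\<^bsub>\<Omega>A\<^esub> T \<one>\<^bsub>\<Omega>B\<^esub> \<delta> = cup \<gamma> \<delta> (\<lambda>c h. T (b \<bullet> c) h)"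
    if "\<gamma> \<in> carrier \<Omega>H" "\<delta> \<in> carrier \<Omega>H" for \<gamma> \<delta>
    unfolding amult_T[OF assms(1) that(1) tw.one_carrier that(2)] pm_def braid_one(2)[OF bl(1)]
    by (simp add: proj_id that)
  show "T b \<one>\<^bsub>\<Omega>H\<^esub> \<odot>\<^bsub>\<Omega>A\<^esub> T \<one>\<^bsub>\<Omega>B\<^esub> \<gamma> = T b \<gamma>"
    unfolding 2[OF one_carrier assms(2)] cup_one(1)[OF bl(2)] using p by simp
  show "T b \<gamma> \<odot>\<^bsub>\<Omega>A\<^esub> T \<one>\<^bsub>\<Omega>B\<^esub> \<delta> = cup \<gamma> \<delta> (\<lambda>c h. T (b \<bullet> c) h)" by (rule 2[OF assms(2,3)])
qed

text \<open>
  A subalgebra containing degree zero and closed under the differential contains all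
  \<open>\<phi>(\<gamma>\<^sub>-\<^sub>1) \<otimes> \<gamma>\<^sub>0\<close> for linear \<open>\<phi> : H \<rightarrow> B\<close>. The statement is carried from \<open>\<gamma>\<close> to \<open>\<gamma> dh\<close> by the
  convolution inverse \<open>\<tau>\<close> of \<open>\<sigma>\<close>, which gives
  \<open>\<phi>(\<gamma>\<^sub>-\<^sub>1h\<^sub>1) \<otimes> \<gamma>\<^sub>0 dh\<^sub>2 = (\<phi>(\<gamma>\<^sub>-\<^sub>2h\<^sub>1) \<tau>(\<gamma>\<^sub>-\<^sub>1 \<otimes> h\<^sub>2) \<otimes> \<gamma>\<^sub>0)(1 \<otimes> dh\<^sub>3)\<close>.
\<close>

lemma subalgebra_total:
  assumes K: "module.subspace tscale K" and K0: "tensor_deg \<Omega>B \<Omega>H 0 \<subseteq> K" and KT: "K \<subseteq> TC"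
    and Kd: "\<And>x. x \<in> K \<Longrightarrow> tensor_diff \<Omega>B \<Omega>H x \<in> K"
    and Km: "\<And>x y. x \<in> K \<Longrightarrow> y \<in> K \<Longrightarrow> x \<odot>\<^bsub>\<Omega>A\<^esub> y \<in> K"
  shows "TC \<subseteq> K"
proof -
  have deg0: "T b h \<in> K" if "b \<in> carrier B" "h \<in> carrier H" for b h
    using BH.tensor_deg_T[of b 0 h 0] that K0 by (auto simp: tw.deg_zero deg_zero)
  have oneH: "\<one>\<^bsub>\<Omega>H\<^esub> \<in> carrier H" using one_deg deg_zero by simp
  have diffT: "tensor_diff \<Omega>B \<Omega>H (T a b) = BH.pdiff a b" if "a \<in> carrier \<Omega>B" "b \<in> carrier \<Omega>H" for a b
    using BH.tensor_diff_lsum[of "[(a, b)]"] that by simp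
  have formsB: "T \<omega> \<one>\<^bsub>\<Omega>H\<^esub> \<in> K" if "\<omega> \<in> carrier \<Omega>B" for \<omega>
    using that
  proof (induction rule: tw.calculus_induct)
    case (base b)
    then show ?case by (rule deg0[OF _ oneH])
  next
    case (add x y)
    then show ?case by (simp add: tens_bilinear BH.TV.subspace_add[OF K])
  next
    case (diff x)
    then show ?case using Kd[OF diff.IH] by (simp add: diffT one_carrier BH.pdiff_def tw.td_carrier)
  next
    case (mult x y)
    have bl: "bil sB s tscale (\<lambda>b g. cup g v (\<lambda>c h. T (u \<bullet> b \<bullet> c) h))" "bil sB s tscale (\<lambda>c h. T (u \<bullet> c) h)" for u v
      by (intro mlin)+
    have "pm x \<one>\<^bsub>\<Omega>H\<^esub> y \<one>\<^bsub>\<Omega>H\<^esub> = T (x \<bullet> y) \<one>\<^bsub>\<Omega>H\<^esub>"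
      unfolding pm_def braid_one(1)[OF bl(1)] cup_one(1)[OF bl(2)] by simp
    then show ?case
      using Km[OF mult.IH] mult.hyps by (simp add: amult_T one_carrier tw.tmul_carrier)
  qed
  obtain tau where tau: "bil s s sB tau" "\<And>h g. tau h g \<in> carrier B"
    "\<And>h g. tau (pz h) g = tau h g" "\<And>h g. tau h (pz g) = tau h g"
    "\<And>sX f \<gamma> \<delta>. bil sB s sX f \<Longrightarrow>
      sw \<gamma> (\<lambda>a b. sw \<delta> (\<lambda>a' b'. cup b b' (\<lambda>c h. f (tau a a' \<bullet> c) h))) = (f \<one>\<^bsub>\<Omega>B\<^esub> (\<gamma> \<star> \<delta>) :: ('k, 'b, 'h) tensor)"
    using cup_inverse by blast
  (* all \<phi> simultaneously, since the step from \<gamma> to \<gamma> dh replaces \<phi> by \<beta> *)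
  define P where "P \<gamma> \<longleftrightarrow> (\<forall>\<phi>. lin s sB \<phi> \<longrightarrow> (\<forall>x. \<phi> (pz x) = \<phi> x) \<longrightarrow> (\<forall>x. \<phi> x \<in> carrier B) \<longrightarrow>
    sw \<gamma> (\<lambda>x y. T (\<phi> x) y) \<in> K)" for \<gamma>
  have P_base: "P h" if h: "h \<in> carrier H" for h
    unfolding P_def
  proof (intro allI impI)
    fix \<phi> assume \<phi>: "lin s sB \<phi>" "\<forall>x. \<phi> (pz x) = \<phi> x" "\<forall>x. \<phi> x \<in> carrier B"
    have bl: "bil s s tscale (\<lambda>x y. T (\<phi> x) y)" by (intro mlin \<phi>(1))
    obtain xs where xs: "set xs \<subseteq> carrier H \<times> carrier H"
      "\<And>f :: 'h \<Rightarrow> 'h \<Rightarrow> ('k, 'b, 'h) tensor. bil s s tscale f \<Longrightarrow> sw h f = lsum xs f"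
      using sw_H_list[OF h] by blast
    show "sw h (\<lambda>x y. T (\<phi> x) y) \<in> K"
      unfolding xs(2)[OF bl] by (rule sum_in_subspace[OF K]) (use xs(1) \<phi>(3) deg0 in blast)
  qed
  have T1: "T \<one>\<^bsub>\<Omega>B\<^esub> h \<in> K" "T \<one>\<^bsub>\<Omega>B\<^esub> (td h) \<in> K" if "h \<in> carrier H" for h
  proof -
    show 1: "T \<one>\<^bsub>\<Omega>B\<^esub> h \<in> K" by (rule deg0[OF one_B that])
    show "T \<one>\<^bsub>\<Omega>B\<^esub> (td h) \<in> K"
      using Kd[OF 1] that by (simp add: diffT tw.one_carrier A_carrier BH.pdiff_def)
  qed
  have P_step: "P (\<gamma> \<star> td h)" if \<gamma>: "P \<gamma>" and h: "h \<in> carrier H" for \<gamma> h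
    unfolding P_def
  proof (intro allI impI)
    fix \<phi> assume \<phi>: "lin s sB \<phi>" "\<forall>x. \<phi> (pz x) = \<phi> x" "\<forall>x. \<phi> x \<in> carrier B"
    note tl = mlin bil_left[OF tau(1)] bil_right[OF tau(1)] bil_right[OF tau(1) lin_ident[OF scale_vs]] lin_comp[OF
      \<phi>(1)] \<phi>(1)
    have bl: "bil s s tscale (\<lambda>x y. T (\<phi> x) y)" by (intro tl)
    have \<phi>_cong: "\<phi> x = \<phi> y" if "pz x = pz y" for x y using \<phi>(2) that by metis
    have sgn: "T (\<phi> (a \<star> sg a')) b = T (\<phi> (a \<star> a')) b" for a a' b
      by (rule arg_cong[where f = "\<lambda>z. T z b"], rule \<phi>_cong) (simp add: tmul_parity)
    define \<beta> where "\<beta> a a' = sw a (\<lambda>p q. sw a' (\<lambda>p' q'. \<phi> (p \<star> p') \<bullet> tau q q'))" for a a'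
    have \<beta>_bil: "bil s s sB \<beta>" unfolding \<beta>_def by (intro tl)
    have \<beta>_B: "\<beta> a a' \<in> carrier B" for a a'
    proof -
      interpret V: vector_space sB by (rule tw.scale_vs)
      have sub: "V.subspace (carrier B)" using tw.deg_subspace[of 0] by (simp add: tw.deg_zero)
      have sum: "lsum xs f \<in> carrier B" if "\<And>a b. f a b \<in> carrier B" for xs :: "('h \<times> 'h) list" and f
        using that by (induction xs) (auto intro!: V.subspace_0[OF sub] V.subspace_add[OF sub])
      show ?thesis unfolding \<beta>_def sw_def by (intro sum B_mult_closed tau(2)) (use \<phi>(3) in blast)
    qed
    have \<beta>_pz: "\<beta> (pz a) a' = \<beta> a a'" "\<beta> a (pz a') = \<beta> a a'" for a a'
    proof -
      have \<phi>p: "\<phi> (pz p \<star> p') = \<phi> (p \<star> p')" "\<phi> (p \<star> pz p') = \<phi> (p \<star> p')" for p p'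
        by (rule \<phi>_cong, simp add: tmul_parity)+
      have b1: "bil s s sB (\<lambda>p q. sw a' (\<lambda>p' q'. \<phi> (p \<star> p') \<bullet> tau q q'))" by (intro tl)
      have b2: "bil s s sB (\<lambda>p' q'. \<phi> (p \<star> p') \<bullet> tau q q')" for p q by (intro tl)
      show "\<beta> (pz a) a' = \<beta> a a'" unfolding \<beta>_def sw_parity(4)[OF b1] by (simp add: \<phi>p tau(3))
      show "\<beta> a (pz a') = \<beta> a a'" unfolding \<beta>_def sw_parity(4)[OF b2] by (simp add: \<phi>p tau(4))
    qed
    note \<beta>l = tl bil_left[OF \<beta>_bil] bil_right[OF \<beta>_bil] bil_right[OF \<beta>_bil lin_ident[OF scale_vs]]
    define V where "V a' b' = sw \<gamma> (\<lambda>a b. cup b b' (\<lambda>c h. T (\<beta> a a' \<bullet> c) h))" for a' b'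
    have V_bil: "bil s s tscale V" unfolding V_def by (intro \<beta>l)
    have V_pz: "V (pz a') b' = V a' b'" for a' b' by (simp add: V_def \<beta>_pz)
    have key: "sw (\<gamma> \<star> \<delta>) (\<lambda>x y. T (\<phi> x) y) =
      sw \<delta> V" for \<delta>
    proof -
      have f: "bil sB s tscale (\<lambda>z h. T (u \<bullet> z) h)" for u by (intro tl)
      have "sw (\<gamma> \<star> \<delta>) (\<lambda>x y. T (\<phi> x) y) = sw \<gamma> (\<lambda>a b. sw \<delta> (\<lambda>a' b'. T (\<phi> (a \<star> a')) (b \<star> b')))"
        by (rule sw_mult_even[OF bl sgn])
      also have "\<dots> = sw \<gamma> (\<lambda>a b. sw \<delta> (\<lambda>a' b'. sw b (\<lambda>p q. sw b' (\<lambda>p' q'. cup q q' (\<lambda>c h. T (\<phi> (a \<star> a') \<bullet> (tau p p'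
        \<bullet> c)) h)))))"
        unfolding tau(5)[OF f] by (simp add: tw.proj_id tw.A_carrier \<phi>(3))
      also have "\<dots> = sw \<gamma> (\<lambda>a b. sw \<delta> (\<lambda>a' b'. sw a (\<lambda>p q. sw a' (\<lambda>p' q'. cup b b' (\<lambda>c h. T (\<phi> (p \<star> p') \<bullet> (tau q q'
        \<bullet> c)) h)))))"
        by (rule coassoc2[where sX = tscale, symmetric]) (intro trilI tl)+
      also have "\<dots> = sw \<gamma> (\<lambda>a b. sw \<delta> (\<lambda>a' b'. cup b b' (\<lambda>c h. T (\<beta> a a' \<bullet> c) h)))"
      proof -
        have "sw a (\<lambda>p q. sw a' (\<lambda>p' q'. cup b b' (\<lambda>c h. T (\<phi> (p \<star> p') \<bullet> (tau q q' \<bullet> c)) h))) =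
          cup b b' (\<lambda>c h. T (\<beta> a a' \<bullet> c) h)" for a a' b b'
        proof -
          have l: "lin sB tscale (\<lambda>z. cup b b' (\<lambda>c h. T (z \<bullet> c) h))" by (intro tl)
          show ?thesis unfolding \<beta>_def sw_pull[OF l] by (simp add: tw.tmul_assoc)
        qed
        then show ?thesis by simp
      qed
      also have "\<dots> = sw \<delta> V" unfolding V_def by (rule sw_swap)
      finally show ?thesis .
    qed
    have V_K: "V a' b' \<in> K" if b': "b' \<in> carrier \<Omega>H" "T \<one>\<^bsub>\<Omega>B\<^esub> b' \<in> K" for a' b'
    proof -
      have "sw \<gamma> (\<lambda>a b. T (\<beta> a a') (proj b)) \<odot>\<^bsub>\<Omega>A\<^esub> T \<one>\<^bsub>\<Omega>B\<^esub> b' =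
        sw \<gamma> (\<lambda>a b. T (\<beta> a a') (proj b) \<odot>\<^bsub>\<Omega>A\<^esub> T \<one>\<^bsub>\<Omega>B\<^esub> b')"
        unfolding sw_def by (rule amult_lsum_left) (intro TC_T tw.one_carrier b' tw.A_carrier \<beta>_B proj_carrier)+
      also have "\<dots> = sw \<gamma> (\<lambda>a b. cup (proj b) b' (\<lambda>c h. T (\<beta> a a' \<bullet> c) h))"
        by (simp add: amult_three(2)[OF tw.A_carrier[OF \<beta>_B] proj_carrier b'(1)])
      finally have "V a' b' = sw \<gamma> (\<lambda>a b. T (\<beta> a a') b) \<odot>\<^bsub>\<Omega>A\<^esub> T \<one>\<^bsub>\<Omega>B\<^esub> b'"
        unfolding sw_absorb(2)[of \<gamma> "\<lambda>a b. T (\<beta> a a') b"] V_def by (simp add: cup_sw)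
      moreover have "lin s sB (\<lambda>a. \<beta> a a')" by (intro \<beta>l)
      then have "sw \<gamma> (\<lambda>a b. T (\<beta> a a') b) \<in> K" using \<gamma> \<beta>_pz \<beta>_B unfolding P_def by blast
      ultimately show ?thesis using Km[OF _ b'(2)] by simp
    qed
    obtain xs where xs: "set xs \<subseteq> carrier H \<times> carrier H"
      "\<And>f :: 'h \<Rightarrow> 'h \<Rightarrow> ('k, 'b, 'h) tensor. bil s s tscale f \<Longrightarrow> sw h f = lsum xs f"
      using sw_H_list[OF h] by blast
    have "V (td a) b = 0" "V (sg a) b = V a b" for a b
      using V_pz[of "td a" b] V_pz[of "sg a" b] V_pz[of a b] lin_0[OF bil_left[OF V_bil lin_ident[OF scale_vs]]] by simp_all
    then have "sw (\<gamma> \<star> td h) (\<lambda>x y. T (\<phi> x) y) = sw h (\<lambda>a b. V a (td b))"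
      unfolding key sw_td[OF V_bil] by simp
    also have "\<dots> = lsum xs (\<lambda>a b. V a (td b))"
      by (rule xs(2)) (intro mlin bil_left[OF V_bil] bil_right[OF V_bil])
    also have "\<dots> \<in> K"
      by (rule sum_in_subspace[OF K], rule V_K[OF carrier_closed(4)]) (use xs(1) T1(2) in auto)
    finally show "sw (\<gamma> \<star> td h) (\<lambda>x y. T (\<phi> x) y) \<in> K" .
  qed
  have P_wedge: "P (wedge_list \<Omega>H (a # map (diff \<Omega>H) as))" if "a \<in> carrier H" "set as \<subseteq> carrier H" for a as
    using that
  proof (induction as rule: rev_induct)
    case Nil
    then show ?case using P_base by simp
  next
    case (snoc c as)
    have cc: "set (a # map (diff \<Omega>H) as) \<subseteq> carrier \<Omega>H" "c \<in> carrier \<Omega>H"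
      using snoc.prems by (auto intro: diff_carrier A_carrier)
    have "wedge_list \<Omega>H (a # map (diff \<Omega>H) (as @ [c])) = wedge_list \<Omega>H (a # map (diff \<Omega>H) as) \<star> td c"
      using wedge_list_append[OF cc(1), of "[diff \<Omega>H c]"] wedge_list_carrier[OF cc(1)] cc(2)
      by (simp add: tmul_carrier diff_carrier td_carrier)
    then show ?case using P_step snoc by simp
  qed
  (* \<phi> = \<epsilon> recovers the forms 1 \<otimes> \<gamma> *)
  have formsH: "T \<one>\<^bsub>\<Omega>B\<^esub> \<gamma> \<in> K" if \<gamma>: "\<gamma> \<in> carrier \<Omega>H" for \<gamma>
  proof -
    interpret VH: vector_space s by (rule scale_vs)
    let ?\<phi> = "\<lambda>x. sB (eps x) \<one>\<^bsub>\<Omega>B\<^esub>"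
    have \<phi>: "lin s sB ?\<phi>" "\<forall>x. ?\<phi> (pz x) = ?\<phi> x" "\<forall>x. ?\<phi> x \<in> carrier B"
      using vspace_closed(2)[OF tw.B.vspace one_B one_B] by (auto simp: scale_B intro: multilin)
    let ?G = "{\<gamma>. sw \<gamma> (\<lambda>x y. T (?\<phi> x) y) \<in> K}"
    have l: "lin s tscale (\<lambda>\<gamma>. sw \<gamma> (\<lambda>x y. T (?\<phi> x) y))" by (intro mlin)
    have "VH.subspace ?G"
      by (rule lin_vimage_subspace[OF l K])
    then have "deg \<Omega>H n \<subseteq> ?G" for n
      unfolding generated by (intro VH.span_minimal) (use P_wedge \<phi> in \<open>auto simp: P_def\<close>)
    then have "VH.span (\<Union>n. deg \<Omega>H n) \<subseteq> ?G"
      by (intro VH.span_minimal[OF _ \<open>VH.subspace ?G\<close>]) (rule UN_least)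
    then have "carrier \<Omega>H \<subseteq> ?G" by (simp only: deg_total)
    then have "sw \<gamma> (\<lambda>x y. T (?\<phi> x) y) \<in> K" using \<gamma> by blast
    moreover have "lin s tscale (T \<one>\<^bsub>\<Omega>B\<^esub>)" by (intro mlin)
    ultimately show ?thesis
      using sw_counit(1)[of tscale "T \<one>\<^bsub>\<Omega>B\<^esub>" \<gamma>] by (simp add: tens_bilinear proj_id \<gamma>)
  qed
  show ?thesis
  proof
    fix t assume "t \<in> TC"
    then show "t \<in> K"
    proof (rule BH.TC_induct[OF K])
      fix p q \<omega> \<gamma> assume "\<omega> \<in> deg \<Omega>B p" "\<gamma> \<in> deg \<Omega>H q"
      then have c: "\<omega> \<in> carrier \<Omega>B" "\<gamma> \<in> carrier \<Omega>H" by (simp_all add: tw.deg_carrier deg_carrier)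
      show "T \<omega> \<gamma> \<in> K"
        using Km[OF formsB[OF c(1)] formsH[OF c(2)]] amult_three(1)[OF c c(2)] by simp
    qed
  qed
qed


section \<open>The calculus on the crossed product algebra\<close>

abbreviation A where "A \<equiv> crossed_product H B act \<sigma>"
abbreviation \<rho> where "\<rho> \<equiv> crossed_coaction H B"

lemma T_BH: "tens B H = T" "tensor_span B H = tensor_span \<Omega>B \<Omega>H"
  by (rule tens_cong tensor_span_cong; simp add: scale_B scale_H)+

lemma A_simps [simp]:
  "scale A = tscale" "\<one>\<^bsub>A\<^esub> = T \<one>\<^bsub>\<Omega>B\<^esub> \<one>\<^bsub>\<Omega>H\<^esub>" "carrier A = tensor_deg \<Omega>B \<Omega>H 0"
proof -
  have "tensor_deg \<Omega>B \<Omega>H 0 = tensor_span \<Omega>B \<Omega>H (carrier B) (carrier H)"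
    using BH.TV.span_eq_iff[THEN iffD2, OF tensor_span_subspace[of \<Omega>B \<Omega>H "carrier B" "carrier H"]]
    by (simp add: tensor_deg_def tw.deg_zero deg_zero)
  then show "carrier A = tensor_deg \<Omega>B \<Omega>H 0" by (simp add: crossed_product_def T_BH)
qed (simp_all add: crossed_product_def T_BH tw.one_eq one_eq)

lemma A_lsum: "t \<in> tensor_deg \<Omega>B \<Omega>H 0 \<longleftrightarrow> (\<exists>xs. set xs \<subseteq> carrier B \<times> carrier H \<and> t = lsum xs T)"
proof -
  have "tensor_deg \<Omega>B \<Omega>H 0 = tensor_span B H (carrier B) (carrier H)"
    using A_simps(3) by (simp add: crossed_product_def)
  then show ?thesis
    using tensor_span_lsum[OF is_vspaceD(2)[OF tw.B.vspace] is_vspaceD(1)[OF tw.B.vspace], of t H] by (simp add: T_BH)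
qed

lemma BH_carrier: "set xs \<subseteq> carrier B \<times> carrier H \<Longrightarrow> set xs \<subseteq> carrier \<Omega>B \<times> carrier \<Omega>H"
  using tw.A_carrier A_carrier by auto

lemma amult_eq:
  assumes "a \<in> carrier A" "a' \<in> carrier A"
  shows "a \<odot>\<^bsub>\<Omega>A\<^esub> a' = a \<odot>\<^bsub>A\<^esub> a'"
proof -
  obtain xs where xs: "set xs \<subseteq> carrier B \<times> carrier H" "a = lsum xs T" using assms(1) A_lsum by auto
  obtain ys where ys: "set ys \<subseteq> carrier B \<times> carrier H" "a' = lsum ys T" using assms(2) A_lsum by auto
  note mH = H_mult
  have pure: "sw3 H h (\<lambda>h1 h2 h3. sw2 H h' (\<lambda>h'1 h'2.
      T ((b \<odot>\<^bsub>B\<^esub> act h1 b') \<odot>\<^bsub>B\<^esub> \<sigma> h2 h'1) (h3 \<odot>\<^bsub>H\<^esub> h'2))) = pm b h b' h'"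
    if b: "b \<in> carrier B" "b' \<in> carrier B" and h: "h \<in> carrier H" "h' \<in> carrier H" for b b' h h'
  proof -
    have b2: "bil s s tscale (\<lambda>a c. sw h' (\<lambda>u v. T (b \<bullet> ac a b' \<bullet> sig c u) (y \<star> v)))" for y by (intro mlin)
    have "sw3 H h (\<lambda>h1 h2 h3. sw2 H h' (\<lambda>h'1 h'2. T ((b \<odot>\<^bsub>B\<^esub> act h1 b') \<odot>\<^bsub>B\<^esub> \<sigma> h2 h'1) (h3 \<odot>\<^bsub>H\<^esub> h'2))) =
      sw h (\<lambda>x y. sw x (\<lambda>a c. sw h' (\<lambda>u v. T (b \<bullet> ac a b' \<bullet> sig c u) (y \<star> v))))"
      unfolding sw3_def
    proof (rule comult_sw[where sX = tscale, OF h(1)])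
      fix x y assume x: "x \<in> carrier H" "y \<in> carrier H"
      show "sw2 H x (\<lambda>h1 h2. sw2 H h' (\<lambda>h'1 h'2. T ((b \<odot>\<^bsub>B\<^esub> act h1 b') \<odot>\<^bsub>B\<^esub> \<sigma> h2 h'1) (y \<odot>\<^bsub>H\<^esub> h'2))) =
        sw x (\<lambda>a c. sw h' (\<lambda>u v. T (b \<bullet> ac a b' \<bullet> sig c u) (y \<star> v)))"
      proof (rule comult_sw[where sX = tscale, OF x(1)])
        fix a c assume a: "a \<in> carrier H" "c \<in> carrier H"
        show "sw2 H h' (\<lambda>h'1 h'2. T ((b \<odot>\<^bsub>B\<^esub> act a b') \<odot>\<^bsub>B\<^esub> \<sigma> c h'1) (y \<odot>\<^bsub>H\<^esub> h'2)) =
          sw h' (\<lambda>u v. T (b \<bullet> ac a b' \<bullet> sig c u) (y \<star> v))"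
        proof (rule comult_sw[where sX = tscale, OF h(2)])
          fix u v assume u: "u \<in> carrier H" "v \<in> carrier H"
          have "(b \<odot>\<^bsub>B\<^esub> act a b') \<odot>\<^bsub>B\<^esub> \<sigma> c u = b \<bullet> ac a b' \<bullet> sig c u"
            unfolding ac_H[OF a(1) tw.A_carrier[OF b(2)], symmetric] sig_H[OF a(2) u(1), symmetric]
            by (simp add: B_mult[symmetric] B_mult_closed b ac_B sig_B)
          then show "T ((b \<odot>\<^bsub>B\<^esub> act a b') \<odot>\<^bsub>B\<^esub> \<sigma> c u) (y \<odot>\<^bsub>H\<^esub> v) = T (b \<bullet> ac a b' \<bullet> sig c u) (y \<star> v)"
            by (simp add: mH x u)
        qed (intro mlin)
      qed (intro mlin)
    qed (intro mlin)
    also have "\<dots> = pm b h b' h'"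
      using pm_hom[of h 0 b' 0 b h'] b h unfolding sw_parity(4)[OF b2] ac_pz sig_pz
      by (simp add: tw.deg_zero deg_zero signed_def)
    finally show ?thesis .
  qed
  have "a \<odot>\<^bsub>A\<^esub> a' = tlift B H (\<lambda>b h. tlift B H (\<lambda>b' h'. sw3 H h (\<lambda>h1 h2 h3. sw2 H h' (\<lambda>h'1 h'2.
      T ((b \<odot>\<^bsub>B\<^esub> act h1 b') \<odot>\<^bsub>B\<^esub> \<sigma> h2 h'1) (h3 \<odot>\<^bsub>H\<^esub> h'2)))) (lsum ys (tens B H))) (lsum xs (tens B H))"
    by (simp add: crossed_product_def T_BH xs(2) ys(2))
  also have "\<dots> = lsum xs (\<lambda>\<omega> \<gamma>. lsum ys (pm \<omega> \<gamma>))"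
  proof (rule tlift_lsum[where sX = tscale, OF tw.B.vspace H_vspace _ xs(1)])
    show "bil (scale B) (scale H) tscale (\<lambda>\<omega> \<gamma>. lsum ys (pm \<omega> \<gamma>))"
      unfolding scale_B scale_H by (intro bilI lin_lsum pm_lin multilin)
    fix b h assume bh: "b \<in> carrier B" "h \<in> carrier H"
    show "tlift B H (\<lambda>b' h'. sw3 H h (\<lambda>h1 h2 h3. sw2 H h' (\<lambda>h'1 h'2.
      T ((b \<odot>\<^bsub>B\<^esub> act h1 b') \<odot>\<^bsub>B\<^esub> \<sigma> h2 h'1) (h3 \<odot>\<^bsub>H\<^esub> h'2)))) (lsum ys (tens B H)) = lsum ys (pm b h)"
      by (rule tlift_lsum[where sX = tscale, OF tw.B.vspace H_vspace _ ys(1)])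
        (use pm_bil(2) pure bh in \<open>simp_all add: scale_B scale_H\<close>)
  qed
  also have "\<dots> = a \<odot>\<^bsub>\<Omega>A\<^esub> a'"
    unfolding xs(2) ys(2) by (rule amult_lsum[OF BH_carrier[OF xs(1)] BH_carrier[OF ys(1)], symmetric])
  finally show ?thesis by simp
qed

lemma A_TC: "a \<in> carrier A \<Longrightarrow> a \<in> TC"
  using BH.tensor_deg_TC by simp

lemma A_closed: "a \<in> carrier A \<Longrightarrow> a' \<in> carrier A \<Longrightarrow> a \<odot>\<^bsub>\<Omega>A\<^esub> a' \<in> carrier A"
  using amult_deg[of a 0 a' 0] by simp

lemma kalgebra_A: "kalgebra A"
proof
  note sub = BH.tensor_deg_subspace[of 0]
  show "is_vspace A" by (simp add: is_vspace_def vector_space_tscale sub)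
  show "bilin_on A A A (\<odot>\<^bsub>A\<^esub>)"
    unfolding bilin_on_def
  proof (intro conjI ballI)
    fix t assume t: "t \<in> carrier A"
    have cl: "x + y \<in> carrier A" "tscale c x \<in> carrier A" if "x \<in> carrier A" "y \<in> carrier A" for x y c
      using that BH.TV.subspace_add[OF sub] BH.TV.subspace_scale[OF sub] by simp_all
    obtain R where R: "lin tscale tscale R" "\<And>x. x \<in> TC \<Longrightarrow> t \<odot>\<^bsub>\<Omega>A\<^esub> x = R x"
      using amult_right[OF A_TC[OF t]] by blast
    show "lin_on A A ((\<odot>\<^bsub>A\<^esub>) t)"
      unfolding lin_on_def using t A_closed[OF t] cl
      by (simp del: A_simps(3) add: amult_eq[symmetric] R(2) A_TC lin_add[OF R(1)] lin_scale[OF R(1)])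
    obtain L where L: "lin tscale tscale L" "\<And>x. x \<in> TC \<Longrightarrow> x \<odot>\<^bsub>\<Omega>A\<^esub> t = L x"
      using amult_left[OF A_TC[OF t]] by blast
    show "lin_on A A (\<lambda>v. v \<odot>\<^bsub>A\<^esub> t)"
      unfolding lin_on_def using t A_closed[OF _ t] cl
      by (simp del: A_simps(3) add: amult_eq[symmetric] L(2) A_TC lin_add[OF L(1)] lin_scale[OF L(1)])
  qed
  show one: "\<one>\<^bsub>A\<^esub> \<in> carrier A" using OA.one_deg by simp
  show "(a \<odot>\<^bsub>A\<^esub> b) \<odot>\<^bsub>A\<^esub> c = a \<odot>\<^bsub>A\<^esub> (b \<odot>\<^bsub>A\<^esub> c)" if "a \<in> carrier A" "b \<in> carrier A" "c \<in> carrier A" for a b c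
    using that amult_assoc[OF that[THEN A_TC]] A_closed by (simp del: A_simps add: amult_eq[symmetric])
  show "\<one>\<^bsub>A\<^esub> \<odot>\<^bsub>A\<^esub> a = a" "a \<odot>\<^bsub>A\<^esub> \<one>\<^bsub>A\<^esub> = a" if "a \<in> carrier A" for a
    using amult_one[OF A_TC[OF that]] amult_eq[OF one that] amult_eq[OF that one] by simp_all
qed

sublocale CA: calculus A \<Omega>A
proof (rule calculus.intro[OF kalgebra_A OA.dg_algebra_axioms], rule calculus_axioms.intro)
  show "deg \<Omega>A n = module.span (scale \<Omega>A) {wedge_list \<Omega>A (a # map (diff \<Omega>A) as) |a as.
      a \<in> carrier A \<and> set as \<subseteq> carrier A \<and> length as = n}" for n
  proof -
    have "deg \<Omega>A n = module.span (scale \<Omega>A) {wedge_list \<Omega>A (a # map (diff \<Omega>A) as) |a as.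
      a \<in> deg \<Omega>A 0 \<and> set as \<subseteq> deg \<Omega>A 0 \<and> length as = n}"
      by (rule OA.generatedI) (use subalgebra_total in simp)
    then show ?thesis by simp
  qed
qed (simp_all add: amult_eq)

section \<open>The differential of the coaction\<close>

sublocale AH: dg_pair \<Omega>A \<Omega>H by unfold_locales

lemma AT_bil: "bil tscale s tscale AH.T"
  using AH.T_bil by simp

lemmas AT_lin [multilin] = bil_left[OF AT_bil] bil_right[OF AT_bil] bil_right[OF AT_bil lin_ident[OF scale_vs]]

lemma OA_lin [multilin]:
  "lin s' tscale g \<Longrightarrow> lin s' tscale (\<lambda>x. OA.sg (g x))" "lin s' tscale g \<Longrightarrow> lin s' tscale (\<lambda>x. OA.td (g x))"
  "lin s' tscale g \<Longrightarrow> lin s' tscale (\<lambda>x. OA.tmul (g x) w)" "lin s' tscale g \<Longrightarrow> lin s' tscale (\<lambda>x. OA.tmul w (g x))"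
  using lin_comp[OF OA.sg_lin] lin_comp[OF OA.td_lin] bil_left[OF OA.tmul_bil] bil_right[OF OA.tmul_bil] by simp_all

lemmas mlinA = AT_lin OA_lin mlin

lemma OA_sg: "\<omega> \<in> carrier \<Omega>B \<Longrightarrow> \<gamma> \<in> carrier \<Omega>H \<Longrightarrow> OA.sg (T \<omega> \<gamma>) = T (tw.sg \<omega>) (sg \<gamma>)"
proof -
  assume c: "\<omega> \<in> carrier \<Omega>B" "\<gamma> \<in> carrier \<Omega>H"
  have "bil sB s tscale (\<lambda>a b. T (tw.sg a) (sg b))" by (intro mlin)
  then obtain G where G: "lin tscale tscale G" "\<And>a b. G (T a b) = T (tw.sg a) (sg b)"
    using bil_factors by blast
  have "OA.sg (T \<omega> \<gamma>) = G (T \<omega> \<gamma>)"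
  proof (rule BH.TC_ext[OF _ G(1) TC_T[OF c]])
    show "lin tscale tscale OA.sg" using OA.sg_lin by simp
    fix p q x y assume h: "x \<in> deg \<Omega>B p" "y \<in> deg \<Omega>H q"
    have "T x y \<in> deg \<Omega>A (p + q)" using BH.tensor_deg_T[OF h] by simp
    from OA.hom_simps(4)[OF this] show "OA.sg (T x y) = G (T x y)" by (simp add: G(2) sg_hom[OF h])
  qed
  then show ?thesis by (simp add: G(2))
qed

lemma OA_td: "\<omega> \<in> carrier \<Omega>B \<Longrightarrow> \<gamma> \<in> carrier \<Omega>H \<Longrightarrow> OA.td (T \<omega> \<gamma>) = BH.pdiff \<omega> \<gamma>"
  using BH.tensor_diff_lsum[of "[(\<omega>, \<gamma>)]"] OA.td_carrier[of "T \<omega> \<gamma>"] TC_T by simp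

lemma OA_tmul: "\<omega> \<in> carrier \<Omega>B \<Longrightarrow> \<gamma> \<in> carrier \<Omega>H \<Longrightarrow> \<omega>' \<in> carrier \<Omega>B \<Longrightarrow> \<gamma>' \<in> carrier \<Omega>H \<Longrightarrow>
    OA.tmul (T \<omega> \<gamma>) (T \<omega>' \<gamma>') = pm \<omega> \<gamma> \<omega>' \<gamma>'"
  using OA.tmul_carrier[of "T \<omega> \<gamma>" "T \<omega>' \<gamma>'"] TC_T by (simp add: amult_T)

text \<open>
  The differential of \<open>\<rho>\<close>, as identified in \<open>differential_coaction\<close>.
\<close>

definition Phi :: "('k, 'b, 'h) tensor \<Rightarrow> ('k, ('k, 'b, 'h) tensor, 'h) tensor" where
  "Phi = (SOME L. lin tscale tscale L \<and> (\<forall>\<omega> \<gamma>. L (T \<omega> \<gamma>) = sw \<gamma> (\<lambda>g1 g2. AH.T (T \<omega> g1) g2)))"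

lemma Phi_lin: "lin tscale tscale Phi" and Phi_T: "Phi (T \<omega> \<gamma>) = sw \<gamma> (\<lambda>g1 g2. AH.T (T \<omega> g1) g2)"
proof -
  have "bil sB s tscale (\<lambda>\<omega> \<gamma>. sw \<gamma> (\<lambda>g1 g2. AH.T (T \<omega> g1) g2))" by (intro mlinA)
  from bil_factors[OF this]
  have "\<exists>L. lin tscale tscale L \<and> (\<forall>\<omega> \<gamma>. L (T \<omega> \<gamma>) = sw \<gamma> (\<lambda>g1 g2. AH.T (T \<omega> g1) g2))" by metis
  from someI_ex[OF this] show "lin tscale tscale Phi" "Phi (T \<omega> \<gamma>) = sw \<gamma> (\<lambda>g1 g2. AH.T (T \<omega> g1) g2)"
    unfolding Phi_def by blast+
qed

lemma Phi_list: "Phi (T \<omega> \<gamma>) = lsum (map (\<lambda>(g1, g2). (T \<omega> g1, g2)) (S \<gamma>)) AH.T"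
  using lsum_map[of "T \<omega>" "\<lambda>y. y" "S \<gamma>" AH.T] by (simp add: Phi_T sw_def)

lemma Phi_list_carrier: "\<omega> \<in> carrier \<Omega>B \<Longrightarrow>
    set (map (\<lambda>(g1, g2). (T \<omega> g1, g2)) (S \<gamma>)) \<subseteq> carrier \<Omega>A \<times> carrier \<Omega>H"
  using S_carrier[of \<gamma>] TC_T by auto

lemma Phi_deg: "t \<in> tensor_deg \<Omega>B \<Omega>H n \<Longrightarrow> Phi t \<in> tensor_deg \<Omega>A \<Omega>H n"
proof -
  assume t: "t \<in> tensor_deg \<Omega>B \<Omega>H n"
  note sub = AH.tensor_deg_subspace[of n]
  have "BH.TV.subspace {t. Phi t \<in> tensor_deg \<Omega>A \<Omega>H n}"
    by (rule lin_vimage_subspace[OF Phi_lin sub])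
  from BH.tensor_deg_induct[OF this t] have "t \<in> {t. Phi t \<in> tensor_deg \<Omega>A \<Omega>H n}"
  proof
    fix p q \<omega> \<gamma> assume h: "p + q = n" "\<omega> \<in> deg \<Omega>B p" "\<gamma> \<in> deg \<Omega>H q"
    have "bil s s tscale (\<lambda>g1 g2. AH.T (T \<omega> g1) g2)" by (intro mlinA)
    then obtain L where L: "lin tscale tscale L" "\<And>x. sw x (\<lambda>g1 g2. AH.T (T \<omega> g1) g2) = L (dcomult H \<Omega>H (proj x))"
      "\<And>a b. L (TT.T a b) = AH.T (T \<omega> a) b" using sw_factor by blast
    have "TT.TV.subspace {t. L t \<in> tensor_deg \<Omega>A \<Omega>H n}"
      by (rule lin_vimage_subspace[OF L(1) sub])
    moreover have "dcomult H \<Omega>H \<gamma> \<in> tensor_deg \<Omega>H \<Omega>H q"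
      using dcomult_hom h(3) unfolding dga_hom_def by simp
    ultimately have "dcomult H \<Omega>H \<gamma> \<in> {t. L t \<in> tensor_deg \<Omega>A \<Omega>H n}"
    proof (rule TT.tensor_deg_induct)
      fix a b x y assume g: "a + b = q" "x \<in> deg \<Omega>H a" "y \<in> deg \<Omega>H b"
      have "T \<omega> x \<in> deg \<Omega>A (p + a)" using BH.tensor_deg_T[OF h(2) g(2)] by simp
      from AH.tensor_deg_T[OF this g(3)] show "TT.T x y \<in> {t. L t \<in> tensor_deg \<Omega>A \<Omega>H n}"
        using h(1) g(1) by (simp add: L(3) add.assoc)
    qed
    then show "T \<omega> \<gamma> \<in> {t. Phi t \<in> tensor_deg \<Omega>A \<Omega>H n}"
      by (simp add: Phi_T L(2) hom_simps(1)[OF h(3)])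
  qed simp
  then show ?thesis by simp
qed

lemma Phi_TC: "t \<in> TC \<Longrightarrow> Phi t \<in> AH.TC"
proof -
  assume "t \<in> TC"
  then obtain xs where xs: "set xs \<subseteq> carrier \<Omega>B \<times> carrier \<Omega>H" "t = lsum xs T" using BH.TC_lsum by blast
  have "lsum xs (\<lambda>\<omega> \<gamma>. Phi (T \<omega> \<gamma>)) \<in> AH.TC"
    using xs(1)
  proof (induction xs)
    case (Cons z xs)
    obtain \<omega> \<gamma> where z: "z = (\<omega>, \<gamma>)" by (cases z)
    have "Phi (T \<omega> \<gamma>) \<in> AH.TC"
      unfolding Phi_list by (rule AH.lsum_TC[OF Phi_list_carrier]) (use Cons.prems z in auto)
    then show ?case using Cons by (auto simp del: ca_simps simp: z intro!: AH.TV.subspace_add[OF AH.TC_subspace])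
  qed (simp del: ca_simps add: AH.TV.subspace_0[OF AH.TC_subspace])
  then show ?thesis by (simp add: xs(2) lin_pull[OF Phi_lin])
qed

text \<open>
  The coproduct of the second leg distributes over braiding and cocycle product by \<open>braid_comult\<close> and
  \<open>cup_comult\<close>. The signs that these produce combine to the sign of moving \<open>\<gamma>\<^sub>[\<^sub>2\<^sub>]\<close> past \<open>\<omega>' \<otimes> \<gamma>'\<^sub>[\<^sub>1\<^sub>]\<close>.
\<close>

lemma Phi_mult_T:
  assumes c: "\<omega> \<in> carrier \<Omega>B" "\<gamma> \<in> carrier \<Omega>H" "\<omega>' \<in> carrier \<Omega>B" "\<gamma>' \<in> carrier \<Omega>H"
  shows "Phi (pm \<omega> \<gamma> \<omega>' \<gamma>') = Phi (T \<omega> \<gamma>) \<odot>\<^bsub>tensor_dga \<Omega>A \<Omega>H\<^esub> Phi (T \<omega>' \<gamma>')"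
proof -
  define G where "G b c h1 h2 = AH.T (T (\<omega> \<bullet> b \<bullet> c) h1) h2" for b c h1 h2
  have G: "lin sB tscale (\<lambda>c. G b c x y)" "bil s s tscale (G b c)" for b c x y
    unfolding G_def[abs_def] by (intro mlinA)+
  define E where "E b g1 g2 = sw \<gamma>' (\<lambda>d1 d2. cup g1 d1 (\<lambda>c h. G b c h (ev g2 \<star> d2)) + cup g1 (sg d1) (\<lambda>c h. G b c h
    (od g2 \<star> d2)))"
    for b g1 g2
  have E: "lin sB tscale (\<lambda>b. E b x y)" "bil s s tscale (E b)" for b x y
    unfolding E_def[abs_def] G_def[abs_def] by (intro mlinA)+
  have G0: "cup g d (\<lambda>c h. G b c h 0) = 0" for g d b
    unfolding cup_def by (simp add: lin_0[OF bil_right[OF G(2) lin_ident[OF scale_vs]]])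
  have "Phi (pm \<omega> \<gamma> \<omega>' \<gamma>') = braid \<gamma> \<omega>' (\<lambda>b g. cup g \<gamma>' (\<lambda>c h. sw h (G b c)))"
    unfolding pm_def by (simp add: braid_pull[OF Phi_lin] cup_pull[OF Phi_lin] Phi_T G_def[abs_def])
  also have "\<dots> = braid \<gamma> \<omega>' (\<lambda>b g. sw g (E b))"
    unfolding cup_comult[OF G] E_def ..
  also have "\<dots> = sw \<gamma> (\<lambda>g1 g2. braid g1 \<omega>' (\<lambda>b g. E b g (ev g2)) + braid g1 (tw.sg \<omega>') (\<lambda>b g. E b g (od g2)))"
    by (rule braid_comult[OF E])
  also have "\<dots> = sw \<gamma> (\<lambda>g1 g2. sw \<gamma>' (\<lambda>d1 d2. AH.T (pm \<omega> g1 \<omega>' d1) (ev g2 \<star> d2) + AH.T (pm \<omega> g1 (tw.sg \<omega>') (sg d1))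
    (od g2 \<star> d2)))"
  proof -
    have 1: "braid g1 \<omega>' (\<lambda>b g. E b g (ev g2)) = sw \<gamma>' (\<lambda>d1 d2. AH.T (pm \<omega> g1 \<omega>' d1) (ev g2 \<star> d2))" for g1 g2
    proof -
      have "braid g1 \<omega>' (\<lambda>b g. E b g (ev g2)) = sw \<gamma>' (\<lambda>d1 d2. braid g1 \<omega>' (\<lambda>b g. cup g d1 (\<lambda>c h. G b c h (ev g2 \<star> d2))))"
        unfolding braid_def sw_lsum_swap E_def by (simp add: G0)
      moreover have "braid g1 \<omega>' (\<lambda>b g. cup g d1 (\<lambda>c h. G b c h w)) = AH.T (pm \<omega> g1 \<omega>' d1) w" for d1 w
      proof -
        have l: "lin tscale tscale (\<lambda>z. AH.T z w)" by (intro mlinA lin_ident vector_space_tscale)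
        show ?thesis unfolding pm_def braid_pull[OF l] cup_pull[OF l] G_def ..
      qed
      ultimately show ?thesis by simp
    qed
    have 2: "braid g1 (tw.sg \<omega>') (\<lambda>b g. E b g (od g2)) = sw \<gamma>' (\<lambda>d1 d2. AH.T (pm \<omega> g1 (tw.sg \<omega>') (sg d1)) (od g2 \<star>
      d2))" for g1 g2
    proof -
      have "braid g1 (tw.sg \<omega>') (\<lambda>b g. E b g (od g2)) = sw \<gamma>' (\<lambda>d1 d2. braid g1 (tw.sg \<omega>') (\<lambda>b g. cup g (sg d1) (\<lambda>c
        h. G b c h (od g2 \<star> d2))))"
        unfolding braid_def sw_lsum_swap E_def by (simp add: G0)
      moreover have "braid g1 (tw.sg \<omega>') (\<lambda>b g. cup g d1 (\<lambda>c h. G b c h w)) = AH.T (pm \<omega> g1 (tw.sg \<omega>') d1) w" for d1 w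
      proof -
        have l: "lin tscale tscale (\<lambda>z. AH.T z w)" by (intro mlinA lin_ident vector_space_tscale)
        show ?thesis unfolding pm_def braid_pull[OF l] cup_pull[OF l] G_def ..
      qed
      ultimately show ?thesis by simp
    qed
    show ?thesis unfolding 1 2 sw_add ..
  qed
  also have "\<dots> = sw \<gamma> (\<lambda>g1 g2. sw \<gamma>' (\<lambda>d1 d2. AH.pmul (T \<omega> g1) g2 (T \<omega>' d1) d2))"
  proof (rule sw_cong, rule sw_cong)
    fix g1 g2 d1 d2 assume g: "g1 \<in> carrier \<Omega>H" "g2 \<in> carrier \<Omega>H" "d1 \<in> carrier \<Omega>H" "d2 \<in> carrier \<Omega>H"
    show "AH.T (pm \<omega> g1 \<omega>' d1) (ev g2 \<star> d2) + AH.T (pm \<omega> g1 (tw.sg \<omega>') (sg d1)) (od g2 \<star> d2) =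
      AH.pmul (T \<omega> g1) g2 (T \<omega>' d1) d2"
      unfolding AH.pmul_def by (simp add: OA_sg OA_tmul c g carrier_closed)
  qed
  also have "\<dots> = Phi (T \<omega> \<gamma>) \<odot>\<^bsub>tensor_dga \<Omega>A \<Omega>H\<^esub> Phi (T \<omega>' \<gamma>')"
    unfolding Phi_list AH.tensor_dga_mult[OF Phi_list_carrier[OF c(1)] Phi_list_carrier[OF c(3)]]
    unfolding lsum_map[of "T \<omega>" "\<lambda>y. y", simplified] lsum_map[of "T \<omega>'" "\<lambda>y. y", simplified] sw_def ..
  finally show ?thesis .
qed


text \<open>
  A representing list of \<open>Phi\<close> on a sum of pure tensors, to which \<open>AH.tensor_dga_mult\<close> applies.
\<close>

definition Phi_terms :: "('b \<times> 'h) list \<Rightarrow> (('k, 'b, 'h) tensor \<times> 'h) list" where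
  "Phi_terms xs = concat (map (\<lambda>(\<omega>, \<gamma>). map (\<lambda>(g1, g2). (T \<omega> g1, g2)) (S \<gamma>)) xs)"

lemma Phi_terms_carrier: "set xs \<subseteq> carrier \<Omega>B \<times> carrier \<Omega>H \<Longrightarrow> set (Phi_terms xs) \<subseteq> carrier \<Omega>A \<times> carrier \<Omega>H"
  unfolding Phi_terms_def using Phi_list_carrier by (fastforce simp del: ca_simps)

lemma Phi_terms_lsum: "lsum (Phi_terms xs) f = lsum xs (\<lambda>\<omega> \<gamma>. sw \<gamma> (\<lambda>g1 g2. f (T \<omega> g1) g2))"
  unfolding Phi_terms_def lsum_concat sw_def using lsum_map[of "T \<omega>" "\<lambda>y. y" "S \<gamma>" f for \<omega> \<gamma>] by simp

lemma Phi_lsum: "Phi (lsum xs T) = lsum (Phi_terms xs) AH.T"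
  by (simp add: lin_pull[OF Phi_lin] Phi_T Phi_terms_lsum)

lemma Phi_mult:
  assumes "x \<in> TC" "y \<in> TC"
  shows "Phi (x \<odot>\<^bsub>\<Omega>A\<^esub> y) = Phi x \<odot>\<^bsub>tensor_dga \<Omega>A \<Omega>H\<^esub> Phi y"
proof -
  obtain xs where xs: "set xs \<subseteq> carrier \<Omega>B \<times> carrier \<Omega>H" "x = lsum xs T" using assms(1) BH.TC_lsum by blast
  obtain ys where ys: "set ys \<subseteq> carrier \<Omega>B \<times> carrier \<Omega>H" "y = lsum ys T" using assms(2) BH.TC_lsum by blast
  have "Phi (x \<odot>\<^bsub>\<Omega>A\<^esub> y) = lsum xs (\<lambda>\<omega> \<gamma>. lsum ys (\<lambda>\<omega>' \<gamma>'. Phi (pm \<omega> \<gamma> \<omega>' \<gamma>')))"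
    unfolding xs(2) ys(2) amult_lsum[OF xs(1) ys(1)] by (simp add: lin_pull[OF Phi_lin])
  also have "\<dots> = lsum xs (\<lambda>\<omega> \<gamma>. lsum ys (\<lambda>\<omega>' \<gamma>'. sw \<gamma> (\<lambda>g1 g2. sw \<gamma>' (\<lambda>d1 d2. AH.pmul (T \<omega> g1) g2 (T \<omega>' d1) d2))))"
  proof (rule lsum_cong, rule lsum_cong)
    fix \<omega> \<gamma> \<omega>' \<gamma>' assume h: "(\<omega>, \<gamma>) \<in> set xs" "(\<omega>', \<gamma>') \<in> set ys"
    have c: "\<omega> \<in> carrier \<Omega>B" "\<gamma> \<in> carrier \<Omega>H" "\<omega>' \<in> carrier \<Omega>B" "\<gamma>' \<in> carrier \<Omega>H" using h xs(1) ys(1) by auto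
    have "set (Phi_terms [(\<omega>, \<gamma>)]) \<subseteq> carrier \<Omega>A \<times> carrier \<Omega>H" "set (Phi_terms [(\<omega>', \<gamma>')]) \<subseteq> carrier \<Omega>A \<times> carrier \<Omega>H"
      by (rule Phi_terms_carrier, use c in simp)+
    from AH.tensor_dga_mult[OF this]
    have "Phi (T \<omega> \<gamma>) \<odot>\<^bsub>tensor_dga \<Omega>A \<Omega>H\<^esub> Phi (T \<omega>' \<gamma>') =
      sw \<gamma> (\<lambda>g1 g2. sw \<gamma>' (\<lambda>d1 d2. AH.pmul (T \<omega> g1) g2 (T \<omega>' d1) d2))"
      using Phi_lsum[of "[(\<omega>, \<gamma>)]"] Phi_lsum[of "[(\<omega>', \<gamma>')]"] by (simp add: Phi_terms_lsum)
    then show "Phi (pm \<omega> \<gamma> \<omega>' \<gamma>') = sw \<gamma> (\<lambda>g1 g2. sw \<gamma>' (\<lambda>d1 d2. AH.pmul (T \<omega> g1) g2 (T \<omega>' d1) d2))"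
      by (simp only: Phi_mult_T[OF c])
  qed
  also have "\<dots> = lsum (Phi_terms xs) (\<lambda>u g. lsum (Phi_terms ys) (\<lambda>u' g'. AH.pmul u g u' g'))"
    unfolding Phi_terms_lsum sw_lsum_swap ..
  also have "\<dots> = Phi x \<odot>\<^bsub>tensor_dga \<Omega>A \<Omega>H\<^esub> Phi y"
    unfolding xs(2) ys(2) Phi_lsum by (rule AH.tensor_dga_mult[OF Phi_terms_carrier[OF xs(1)] Phi_terms_carrier[OF
      ys(1)], symmetric])
  finally show ?thesis .
qed

lemma Phi_one: "Phi (T \<one>\<^bsub>\<Omega>B\<^esub> \<one>\<^bsub>\<Omega>H\<^esub>) = AH.T (T \<one>\<^bsub>\<Omega>B\<^esub> \<one>\<^bsub>\<Omega>H\<^esub>) \<one>\<^bsub>\<Omega>H\<^esub>"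
proof -
  have "bil s s tscale (\<lambda>g1 g2. AH.T (T \<one>\<^bsub>\<Omega>B\<^esub> g1) g2)" by (intro mlinA)
  from sw_one[OF this] show ?thesis by (simp add: Phi_T)
qed

lemma Phi_diff:
  assumes "x \<in> TC"
  shows "Phi (tensor_diff \<Omega>B \<Omega>H x) = tensor_diff \<Omega>A \<Omega>H (Phi x)"
proof -
  obtain D where D: "lin tscale tscale D" "\<And>x y. D (T x y) = BH.pdiff x y"
    "\<And>t. t \<in> TC \<Longrightarrow> tensor_diff \<Omega>B \<Omega>H t = D t" using BH.pdiff_linear by blast
  obtain E where E: "lin tscale tscale E" "\<And>x y. E (AH.T x y) = AH.pdiff x y"
    "\<And>t. t \<in> AH.TC \<Longrightarrow> tensor_diff \<Omega>A \<Omega>H t = E t" using AH.pdiff_linear by blast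
  have "Phi (D x) = E (Phi x)"
  proof (rule BH.TC_ext[OF lin_comp[OF Phi_lin D(1)] lin_comp[OF E(1) Phi_lin] assms])
    fix p q \<omega> \<gamma> assume h: "\<omega> \<in> deg \<Omega>B p" "\<gamma> \<in> deg \<Omega>H q"
    note c = tw.deg_carrier[OF h(1)] deg_carrier[OF h(2)]
    have b: "bil s s tscale (\<lambda>g1 g2. AH.T (T (tw.sg \<omega>) g1) g2)" by (intro mlinA)
    have "Phi (D (T \<omega> \<gamma>)) = sw \<gamma> (\<lambda>g1 g2. AH.T (T (tw.td \<omega>) g1) g2 + (AH.T (T (tw.sg \<omega>) (td g1)) g2 + AH.T (T
      (tw.sg \<omega>) (sg g1)) (td g2)))"
      by (simp add: D(2) BH.pdiff_def lin_add[OF Phi_lin] Phi_T sw_td[OF b] sw_add)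
    also have "\<dots> = sw \<gamma> (\<lambda>g1 g2. AH.pdiff (T \<omega> g1) g2)"
    proof (rule sw_cong)
      fix a b assume ab: "a \<in> carrier \<Omega>H" "b \<in> carrier \<Omega>H"
      show "AH.T (T (tw.td \<omega>) a) b + (AH.T (T (tw.sg \<omega>) (td a)) b + AH.T (T (tw.sg \<omega>) (sg a)) (td b)) = AH.pdiff (T \<omega> a) b"
        by (simp add: AH.pdiff_def OA_sg[OF c(1) ab(1)] OA_td[OF c(1) ab(1)] BH.pdiff_def bilD[OF AT_bil] add.assoc)
    qed
    also have "\<dots> = E (Phi (T \<omega> \<gamma>))"
      by (simp add: Phi_T sw_pull[OF E(1)] E(2))
    finally show "Phi (D (T \<omega> \<gamma>)) = E (Phi (T \<omega> \<gamma>))" .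
  qed
  then show ?thesis by (simp only: D(3)[OF assms] E(3)[OF Phi_TC[OF assms]])
qed

lemma Phi_hom: "dga_hom \<Omega>A (tensor_dga \<Omega>A \<Omega>H) Phi"
proof -
  have "lin_on \<Omega>A (tensor_dga \<Omega>A \<Omega>H) Phi"
    unfolding lin_on_def AH.tensor_dga_simps using Phi_TC
    by (auto simp: lin_add[OF Phi_lin] lin_scale[OF Phi_lin])
  moreover have "Phi x \<in> deg (tensor_dga \<Omega>A \<Omega>H) n" if "x \<in> deg \<Omega>A n" for x n
    using Phi_deg that by simp
  ultimately show ?thesis
    unfolding dga_hom_def using Phi_mult Phi_one Phi_diff by simp
qed

lemma tens_A: "tens A H = AH.T" "tens \<Omega>A H = AH.T" "tens (tensor_space B H) H = AH.T"
  by (rule tens_cong; simp add: scale_H tensor_space_def)+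

lemma coaction_A:
  assumes a: "a \<in> carrier A"
  shows "\<rho> a = Phi a"
proof -
  obtain xs where xs: "set xs \<subseteq> carrier B \<times> carrier H" "a = lsum xs T" using a A_lsum by auto
  have b: "bil s s tscale (\<lambda>g1 g2. AH.T (T \<omega> g1) g2)" for \<omega> by (intro mlinA)
  have "\<rho> a = tlift B H (\<lambda>b h. sw2 H h (\<lambda>h1 h2. AH.T (T b h1) h2)) (lsum xs (tens B H))"
    unfolding crossed_coaction_def tens_A T_BH xs(2) ..
  also have "\<dots> = lsum xs (\<lambda>b h. Phi (T b h))"
  proof (rule tlift_lsum[where sX = tscale, OF tw.B.vspace H_vspace _ xs(1)])
    show "bil (scale B) (scale H) tscale (\<lambda>b h. Phi (T b h))"
      unfolding scale_B scale_H by (intro bilI lin_comp[OF Phi_lin] mlinA)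
    show "sw2 H h (\<lambda>h1 h2. AH.T (T b' h1) h2) = Phi (T b' h)" if "b' \<in> carrier B" "h \<in> carrier H" for b' h
      unfolding Phi_T by (rule comult_sw[OF that(2) b refl])
  qed
  also have "\<dots> = Phi a" by (simp add: xs(2) lin_pull[OF Phi_lin])
  finally show ?thesis .
qed

lemma differential_coaction: "x \<in> TC \<Longrightarrow> differential \<Omega>A (tensor_dga \<Omega>A \<Omega>H) \<rho> x = Phi x"
  using CA.differential_unique[OF Phi_hom, of \<rho> x] coaction_A by simp

section \<open>The coaction on the calculus\<close>

definition right_deg0 :: "('k, ('k, 'b, 'h) tensor, 'h) tensor \<Rightarrow> ('k, ('k, 'b, 'h) tensor, 'h) tensor" where
  "right_deg0 = (SOME L. lin tscale tscale L \<and> (\<forall>u \<gamma>. L (AH.T u \<gamma>) = AH.T u (pz \<gamma>)))"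

lemma right_deg0_lin: "lin tscale tscale right_deg0" and right_deg0_T: "right_deg0 (AH.T u \<gamma>) = AH.T u (pz \<gamma>)"
proof -
  have "bil tscale s tscale (\<lambda>u \<gamma>. AH.T u (pz \<gamma>))" by (intro mlinA lin_ident vector_space_tscale)
  then have "bil (scale \<Omega>A) s tscale (\<lambda>u \<gamma>. AH.T u (pz \<gamma>))" by simp
  from bil_factors[OF this]
  have "\<exists>L. lin tscale tscale L \<and> (\<forall>u \<gamma>. L (AH.T u \<gamma>) = AH.T u (pz \<gamma>))" by metis
  from someI_ex[OF this] show "lin tscale tscale right_deg0" "right_deg0 (AH.T u \<gamma>) = AH.T u (pz \<gamma>)"
    unfolding right_deg0_def by blast+
qed

text \<open>
  The coaction on the calculus: \<open>\<gamma>\<^sub>0 \<otimes> \<gamma>\<^sub>1\<close> is the component of \<open>\<gamma>\<^sub>[\<^sub>1\<^sub>] \<otimes> \<gamma>\<^sub>[\<^sub>2\<^sub>]\<close> whose second leg has degree zero.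
\<close>

definition delta :: "('k, 'b, 'h) tensor \<Rightarrow> ('k, ('k, 'b, 'h) tensor, 'h) tensor" where
  "delta t = right_deg0 (Phi t)"

lemma delta_lin: "lin tscale tscale delta"
  unfolding delta_def[abs_def] by (rule lin_comp[OF right_deg0_lin Phi_lin])

lemma delta_T: "delta (T \<omega> \<gamma>) = sw \<gamma> (\<lambda>a b. AH.T (T \<omega> a) (pz b))"
  by (simp add: delta_def Phi_T sw_pull[OF right_deg0_lin] right_deg0_T)

lemma delta_A: "a \<in> carrier A \<Longrightarrow> delta a = \<rho> a"
proof -
  assume a: "a \<in> carrier A"
  obtain xs where xs: "set xs \<subseteq> carrier B \<times> carrier H" "a = lsum xs T" using a A_lsum by auto
  have b: "bil s s tscale (\<lambda>a b. AH.T (T \<omega> a) (pz b))" "bil s s tscale (\<lambda>g1 g2. AH.T (T \<omega> g1) g2)" for \<omega>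
    by (intro mlinA)+
  have "delta (T \<omega> h) = Phi (T \<omega> h)" if "h \<in> carrier H" for \<omega> h
    unfolding delta_T Phi_T by (rule sw_H_cong[OF that b]) (simp add: pz_id)
  then show ?thesis using xs(1)
    unfolding coaction_A[OF a] unfolding xs(2) lin_pull[OF delta_lin] lin_pull[OF Phi_lin]
    by (intro lsum_cong) auto
qed

lemma sw_pz_deg_right:
  assumes \<gamma>: "\<gamma> \<in> deg \<Omega>H j" and f: "bil s s sX f"
  shows "sw \<gamma> (\<lambda>x y. f x (pz y)) = sw \<gamma> (\<lambda>x y. f (hom_part j x) (pz y))"
proof -
  note fl = mlin bil_left[OF f] bil_right[OF f] bil_right[OF f lin_ident[OF scale_vs]]
  have b: "bil s s sX (\<lambda>x y. f x (pz y))" "bil s s sX (\<lambda>x y. f (hom_part j x) (pz y))"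
    by (intro fl lin_ident scale_vs)+
  obtain L where L: "lin tscale sX L" "\<And>x. sw x (\<lambda>x y. f x (pz y)) = L (dcomult H \<Omega>H (proj x))"
    "\<And>x y. L (TT.T x y) = f x (pz y)" using sw_factor[OF b(1)] by blast
  obtain M where M: "lin tscale sX M" "\<And>x. sw x (\<lambda>x y. f (hom_part j x) (pz y)) = M (dcomult H \<Omega>H (proj x))"
    "\<And>x y. M (TT.T x y) = f (hom_part j x) (pz y)" using sw_factor[OF b(2)] by blast
  have "dcomult H \<Omega>H \<gamma> \<in> tensor_deg \<Omega>H \<Omega>H j"
    using dcomult_hom \<gamma> unfolding dga_hom_def by simp
  then have "L (dcomult H \<Omega>H \<gamma>) = M (dcomult H \<Omega>H \<gamma>)"
    by (rule TT.tensor_deg_ext[OF L(1) M(1)])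
      (auto simp: L(3) M(3) hom_simps hom_part_id lin_0[OF bil_right[OF f lin_ident[OF scale_vs]]])
  then show ?thesis by (simp add: L(2) M(2) hom_simps(1)[OF \<gamma>])
qed

lemma delta_deg:
  assumes t: "t \<in> tensor_deg \<Omega>B \<Omega>H n"
  shows "delta t \<in> tensor_span \<Omega>A H (tensor_deg \<Omega>B \<Omega>H n) (carrier H)"
proof -
  let ?K = "tensor_span \<Omega>A H (tensor_deg \<Omega>B \<Omega>H n) (carrier H)"
  note sub = tensor_span_subspace[of \<Omega>A H "tensor_deg \<Omega>B \<Omega>H n" "carrier H"]
  have "BH.TV.subspace {t. delta t \<in> ?K}"
    by (rule lin_vimage_subspace[OF delta_lin sub])
  then have "t \<in> {t. delta t \<in> ?K}"
  proof (rule BH.tensor_deg_induct[OF _ t])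
    fix p q \<omega> \<gamma> assume h: "p + q = n" "\<omega> \<in> deg \<Omega>B p" "\<gamma> \<in> deg \<Omega>H q"
    have b: "bil s s tscale (\<lambda>a b. AH.T (T \<omega> a) b)" by (intro mlinA)
    have "AH.T (T \<omega> (hom_part q a)) (pz b) \<in> ?K" for a b
      using BH.tensor_deg_T[OF h(2) hom_part_deg[of q a]] h(1)
      unfolding tens_A(2)[symmetric] by (intro tensor_span_tens pz_H) simp
    then have "lsum zs (\<lambda>a b. AH.T (T \<omega> (hom_part q a)) (pz b)) \<in> ?K" for zs
      by (induction zs) (auto intro!: AH.TV.subspace_0[OF sub] AH.TV.subspace_add[OF sub])
    then show "T \<omega> \<gamma> \<in> {t. delta t \<in> ?K}"
      unfolding mem_Collect_eq delta_T sw_pz_deg_right[OF h(3) b] unfolding sw_def .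
  qed
  then show ?thesis by simp
qed

lemma delta_TC:
  assumes t: "t \<in> TC"
  shows "delta t \<in> tensor_span \<Omega>A H TC (carrier H)"
proof -
  let ?K = "tensor_span \<Omega>A H TC (carrier H)"
  note sub = tensor_span_subspace[of \<Omega>A H TC "carrier H"]
  have "BH.TV.subspace {t. delta t \<in> ?K}"
    by (rule lin_vimage_subspace[OF delta_lin sub])
  then have "t \<in> {t. delta t \<in> ?K}"
  proof (rule BH.TC_induct[OF _ t])
    fix p q \<omega> \<gamma> assume h: "\<omega> \<in> deg \<Omega>B p" "\<gamma> \<in> deg \<Omega>H q"
    have "tensor_deg \<Omega>B \<Omega>H (p + q) \<subseteq> TC" using BH.tensor_deg_TC by blast
    then have "tensor_span \<Omega>A H (tensor_deg \<Omega>B \<Omega>H (p + q)) (carrier H) \<subseteq> ?K"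
      unfolding tensor_span_def by (intro AH.TV.span_mono) auto
    with delta_deg[OF BH.tensor_deg_T[OF h]] show "T \<omega> \<gamma> \<in> {t. delta t \<in> ?K}" by blast
  qed
  then show ?thesis by simp
qed

text \<open>
  The term \<open>\<omega> \<otimes> \<gamma>\<^sub>[\<^sub>1\<^sub>] \<otimes> d\<gamma>\<^sub>[\<^sub>2\<^sub>]\<close> of the total differential has no component with last leg of degree zero.
\<close>

lemma delta_diff:
  assumes x: "x \<in> TC"
  shows "delta (tensor_diff \<Omega>B \<Omega>H x) = tlift \<Omega>A H (\<lambda>y h. tens \<Omega>A H (tensor_diff \<Omega>B \<Omega>H y) h) (delta x)"
proof -
  have bl: "bil tscale s tscale (\<lambda>y h. AH.T (OA.td y) h)" by (intro mlinA lin_ident vector_space_tscale)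
  then have "bil (scale \<Omega>A) s tscale (\<lambda>y h. AH.T (OA.td y) h)" by simp
  then obtain L where L: "lin tscale tscale L" "\<And>y h. L (AH.T y h) = AH.T (OA.td y) h"
    using bil_factors by blast
  have V: "module.subspace (scale \<Omega>A) TC" "vector_space (scale \<Omega>A)" "is_vspace \<Omega>A"
    using BH.TC_subspace vector_space_tscale OA.vspace by simp_all
  obtain zs where zs: "set zs \<subseteq> TC \<times> carrier H" "delta x = lsum zs (tens \<Omega>A H)"
    using delta_TC[OF x] tensor_span_lsum[OF V(1,2)] by blast
  have "tlift \<Omega>A H (\<lambda>y h. tens \<Omega>A H (tensor_diff \<Omega>B \<Omega>H y) h) (lsum zs (tens \<Omega>A H)) = lsum zs (\<lambda>y h. AH.T (OA.td y) h)"
    by (rule tlift_lsum[OF V(3) H_vspace]) (use zs(1) bl OA.td_carrier in \<open>simp_all add: scale_H tens_A\<close>)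
  then have R: "tlift \<Omega>A H (\<lambda>y h. tens \<Omega>A H (tensor_diff \<Omega>B \<Omega>H y) h) (delta x) = L (delta x)"
    by (simp add: zs(2) lin_pull[OF L(1)] tens_A L(2))
  have l: "lin tscale tscale (\<lambda>x. delta (OA.td x))" by (intro lin_comp[OF delta_lin] mlinA lin_ident vector_space_tscale)
  have "delta (OA.td x) = L (delta x)"
  proof (rule BH.TC_ext[OF l lin_comp[OF L(1) delta_lin] x])
    fix p q \<omega> \<gamma> assume h: "\<omega> \<in> deg \<Omega>B p" "\<gamma> \<in> deg \<Omega>H q"
    note c = tw.deg_carrier[OF h(1)] deg_carrier[OF h(2)]
    have b: "bil s s tscale (\<lambda>a b. AH.T (T (tw.sg \<omega>) a) (pz b))" by (intro mlinA)
    have "delta (OA.td (T \<omega> \<gamma>)) = sw \<gamma> (\<lambda>a b. AH.T (T (tw.td \<omega>) a) (pz b) + AH.T (T (tw.sg \<omega>) (td a)) (pz b))"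
      by (simp add: OA_td[OF c] BH.pdiff_def lin_add[OF delta_lin] delta_T sw_td[OF b] sw_add)
    also have "\<dots> = sw \<gamma> (\<lambda>a b. AH.T (OA.td (T \<omega> a)) (pz b))"
      by (rule sw_cong) (simp add: OA_td[OF c(1)] BH.pdiff_def bilD[OF AT_bil])
    also have "\<dots> = L (delta (T \<omega> \<gamma>))"
      by (simp add: delta_T sw_pull[OF L(1)] L(2))
    finally show "delta (OA.td (T \<omega> \<gamma>)) = L (delta (T \<omega> \<gamma>))" .
  qed
  then show ?thesis unfolding R using OA.td_carrier[of x] x by simp
qed

text \<open>
  The projection of the last leg onto degree zero is multiplicative and kills the odd part, which carries the
  Koszul signs. The lists \<open>us\<close> and \<open>vs\<close> are arbitrary, so that they can be taken in a subalgebra.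
\<close>

lemma delta_mult:
  assumes "x \<in> TC" "y \<in> TC" "delta x = lsum us AH.T" "delta y = lsum vs AH.T"
  shows "delta (x \<odot>\<^bsub>\<Omega>A\<^esub> y) = lsum us (\<lambda>u g. lsum vs (\<lambda>v h. AH.T (OA.tmul u v) (pz g \<star> pz h)))"
proof -
  obtain xs where xs: "set xs \<subseteq> carrier \<Omega>B \<times> carrier \<Omega>H" "x = lsum xs T" using assms(1) BH.TC_lsum by blast
  obtain ys where ys: "set ys \<subseteq> carrier \<Omega>B \<times> carrier \<Omega>H" "y = lsum ys T" using assms(2) BH.TC_lsum by blast
  let ?m = "\<lambda>u g v h. AH.T (OA.tmul u v) (pz g \<star> pz h)"
  have pm: "right_deg0 (AH.pmul u g v h) = ?m u g v h" for u g v h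
    by (simp add: AH.pmul_def lin_add[OF right_deg0_lin] right_deg0_T tmul_parity)
  have DL: "delta (lsum zs T) = lsum (map (\<lambda>(a, b). (a, pz b)) (Phi_terms zs)) AH.T" for zs
    using lsum_map[of "\<lambda>a. a" pz "Phi_terms zs" AH.T] by (simp add: delta_def Phi_lsum lin_pull[OF right_deg0_lin]
      right_deg0_T)
  have eq: "lsum us f = lsum (Phi_terms zs) (\<lambda>a b. f a (pz b))"
    if "bil tscale s tscale f" "delta (lsum zs T) = lsum us AH.T"
    for us zs and f :: "('k, 'b, 'h) tensor \<Rightarrow> 'h \<Rightarrow> ('k, ('k, 'b, 'h) tensor, 'h) tensor"
  proof -
    have "lsum us AH.T = lsum (map (\<lambda>(a, b). (a, pz b)) (Phi_terms zs)) AH.T" using that(2) DL by simp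
    from tens_lsum_eq[OF _ this, of tscale f] that(1)
    show ?thesis using lsum_map[of "\<lambda>a. a" pz "Phi_terms zs" f] by simp
  qed
  have b: "bil tscale s tscale (\<lambda>u g. lsum vs (?m u g))" "bil tscale s tscale (?m u g)" for u g
    by (intro mlinA lin_ident vector_space_tscale scale_vs)+
  have "delta (x \<odot>\<^bsub>\<Omega>A\<^esub> y) = right_deg0 (lsum (Phi_terms xs) AH.T \<odot>\<^bsub>tensor_dga \<Omega>A \<Omega>H\<^esub> lsum (Phi_terms ys) AH.T)"
    unfolding delta_def Phi_mult[OF assms(1,2)] unfolding xs(2) ys(2) Phi_lsum ..
  also have "\<dots> = lsum (Phi_terms xs) (\<lambda>u g. lsum (Phi_terms ys) (\<lambda>v h. ?m u g v h))"
    unfolding AH.tensor_dga_mult[OF Phi_terms_carrier[OF xs(1)] Phi_terms_carrier[OF ys(1)]] by (simp add: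
      lin_pull[OF right_deg0_lin] pm)
  also have "\<dots> = lsum us (\<lambda>u g. lsum vs (?m u g))"
    using eq[OF b(1), of xs us] eq[OF b(2), of ys vs] assms(3,4) by (simp add: xs(2) ys(2))
  finally show ?thesis .
qed

text \<open>
  Applied to the crossed product algebra and to its calculus alike: each axiom compares two linear maps
  on the total space, which are evaluated on pure tensors.
\<close>

lemma delta_comodule_algebra:
  fixes V :: "('k, ('k, 'b, 'h) tensor, 'z) alg_scheme"
  assumes V: "kalgebra V" "scale V = tscale" "carrier V \<subseteq> TC" "\<one>\<^bsub>V\<^esub> = T \<one>\<^bsub>\<Omega>B\<^esub> \<one>\<^bsub>\<Omega>H\<^esub>"
    and mult: "\<And>a b. a \<in> carrier V \<Longrightarrow> b \<in> carrier V \<Longrightarrow> a \<odot>\<^bsub>V\<^esub> b = a \<odot>\<^bsub>\<Omega>A\<^esub> b"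
    and r: "\<And>a. a \<in> carrier V \<Longrightarrow> r a = delta a"
    and span: "\<And>a. a \<in> carrier V \<Longrightarrow> delta a \<in> tensor_span V H (carrier V) (carrier H)"
  shows "comodule_algebra H V r"
proof (rule comodule_algebra.intro[OF Hopf.hopf_algebra_axioms V(1)], rule comodule_algebra_axioms.intro)
  interpret V: kalgebra V by (rule V)
  have T: "tens V H = AH.T" by (rule tens_cong) (simp_all add: V(2) scale_H)
  have lists: "\<exists>us. set us \<subseteq> carrier V \<times> carrier H \<and> delta a = lsum us AH.T" if "a \<in> carrier V" for a
    using span[OF that] unfolding tensor_span_lsum[OF is_vspaceD(2)[OF V.vspace] is_vspaceD(1)[OF V.vspace]] T .
  have lift: "tlift V H f (delta a) = L (delta a)"
    if a: "a \<in> carrier V" and L: "lin tscale sX L" and f: "\<And>u h. u \<in> carrier V \<Longrightarrow> h \<in> carrier H \<Longrightarrow> f u h = L (AH.T u h)"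
    for f a and sX :: "'k \<Rightarrow> 'x::ab_group_add \<Rightarrow> 'x" and L
  proof -
    obtain us where us: "set us \<subseteq> carrier V \<times> carrier H" "delta a = lsum us AH.T" using lists[OF a] by blast
    have b: "bil (scale V) (scale H) sX (\<lambda>u h. L (AH.T u h))"
      unfolding V(2) scale_H by (intro bilI lin_comp[OF L] mlinA lin_ident vector_space_tscale scale_vs)
    show ?thesis
      using tlift_lsum[OF V.vspace H_vspace b us(1) f] by (simp add: us(2) T lin_pull[OF L])
  qed
  note TC = subsetD[OF V(3)]
  show "lin_on V (tensor_space V H) r"
    unfolding lin_on_def using span vspace_closed[OF V.vspace]
    by (auto simp: tensor_space_def r lin_add[OF delta_lin] lin_scale[OF delta_lin] V(2))
  show "r \<one>\<^bsub>V\<^esub> = \<one>\<^bsub>tensor_alg V H\<^esub>"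
  proof -
    have "bil s s tscale (\<lambda>a b. AH.T (T \<one>\<^bsub>\<Omega>B\<^esub> a) (pz b))" by (intro mlinA)
    from sw_one[OF this] show ?thesis
      using r[OF V.one_closed] by (simp add: V(4) delta_T tensor_alg_def T one_eq[symmetric])
  qed
  show "r (a \<odot>\<^bsub>V\<^esub> b) = r a \<odot>\<^bsub>tensor_alg V H\<^esub> r b" if a: "a \<in> carrier V" and b: "b \<in> carrier V" for a b
  proof -
    obtain us where us: "set us \<subseteq> carrier V \<times> carrier H" "delta a = lsum us AH.T" using lists[OF a] by blast
    obtain vs where vs: "set vs \<subseteq> carrier V \<times> carrier H" "delta b = lsum vs AH.T" using lists[OF b] by blast
    let ?m = "\<lambda>u g v h. AH.T (OA.tmul u v) (pz g \<star> pz h)"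
    have bl: "bil (scale V) (scale H) tscale (\<lambda>u g. lsum vs (?m u g))" "bil (scale V) (scale H) tscale (?m u g)" for u g
      unfolding V(2) scale_H by (intro mlinA lin_ident vector_space_tscale scale_vs)+
    have pure: "AH.T (u \<odot>\<^bsub>V\<^esub> v) (g \<odot>\<^bsub>H\<^esub> h) = ?m u g v h"
      if "u \<in> carrier V" "g \<in> carrier H" "v \<in> carrier V" "h \<in> carrier H" for u g v h
      using that TC by (simp add: pz_id OA.tmul_carrier tmul_carrier A_carrier mult mult_eq)
    have "r a \<odot>\<^bsub>tensor_alg V H\<^esub> r b =
      tlift V H (\<lambda>u g. tlift V H (\<lambda>v h. AH.T (u \<odot>\<^bsub>V\<^esub> v) (g \<odot>\<^bsub>H\<^esub> h)) (lsum vs (tens V H))) (lsum us (tens V H))"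
      by (simp add: tensor_alg_def r a b us(2) vs(2) T)
    also have "\<dots> = lsum us (\<lambda>u g. lsum vs (?m u g))"
      by (intro tlift_lsum[OF V.vspace H_vspace bl(1) us(1)] tlift_lsum[OF V.vspace H_vspace bl(2) vs(1)] pure)
    also have "\<dots> = delta (a \<odot>\<^bsub>V\<^esub> b)"
      unfolding mult[OF a b] by (rule delta_mult[OF TC[OF a] TC[OF b] us(2) vs(2), symmetric])
    finally show ?thesis
      using V.mult_bilin a b r[of "a \<odot>\<^bsub>V\<^esub> b"] unfolding bilin_on_def lin_on_def by simp
  qed
  show "tlift V H (\<lambda>a0 h. scale V (counit H h) a0) (r a) = a" if a: "a \<in> carrier V" for a
  proof -
    have "bil (scale \<Omega>A) s tscale (\<lambda>u h. tscale (eps h) u)"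
      unfolding ca_simps by (intro bilI lin_scaled lin_scaled_const eps_multilin lin_ident vector_space_tscale)
    then obtain L where L: "lin tscale tscale L" "\<And>u h. L (AH.T u h) = tscale (eps h) u"
      using bil_factors by blast
    have "L (delta a) = a"
    proof (rule BH.TC_ext[OF lin_comp[OF L(1) delta_lin] lin_ident[OF vector_space_tscale] TC[OF a]])
      fix p q \<omega> \<gamma> assume h: "\<omega> \<in> deg \<Omega>B p" "\<gamma> \<in> deg \<Omega>H q"
      have "lin s tscale (T \<omega>)" by (intro mlin)
      from sw_counit(2)[OF this, of \<gamma>] show "L (delta (T \<omega> \<gamma>)) = T \<omega> \<gamma>"
        by (simp add: delta_T sw_pull[OF L(1)] L(2) hom_simps(1)[OF h(2)])
    qed
    moreover have "tlift V H (\<lambda>a0 h. scale V (counit H h) a0) (delta a) = L (delta a)"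
      by (rule lift[OF a L(1)]) (simp add: L(2) V(2) eps_def pz_id)
    ultimately show ?thesis by (simp add: r a)
  qed
  show "tlift V H (\<lambda>a0 h. tlift V H (\<lambda>x g. tens (tensor_space V H) H (tens V H x g) h) (r a0)) (r a) =
      tlift V H (\<lambda>a0 h. sw2 H h (\<lambda>h1 h2. tens (tensor_space V H) H (tens V H a0 h1) h2)) (r a)"
    if a: "a \<in> carrier V" for a
  proof -
    define U where "U = tens (tensor_space V H) H"
    have "bil (scale (tensor_space V H)) (scale H) tscale U"
      unfolding U_def by (rule tens_lin) (simp_all add: tensor_space_def vector_space_tscale scale_H scale_vs)
    then have U: "bil tscale s tscale U" by (simp add: tensor_space_def scale_H)
    note Ul = bil_left[OF U] bil_right[OF U] bil_right[OF U lin_ident[OF scale_vs]] lin_comp[OF delta_lin] delta_lin mlinA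
      lin_ident vector_space_tscale scale_vs
    have "bil (scale \<Omega>A) s tscale (\<lambda>u h. U (delta u) h)"
      unfolding ca_simps by (intro Ul)
    then obtain L where L: "lin tscale tscale L" "\<And>u h. L (AH.T u h) = U (delta u) h"
      using bil_factors by blast
    have b2: "bil s s tscale (\<lambda>h1 h2. U (AH.T u h1) h2)" for u by (intro Ul)
    have "bil (scale \<Omega>A) s tscale (\<lambda>u h. sw h (\<lambda>h1 h2. U (AH.T u h1) h2))"
      unfolding ca_simps by (intro Ul)
    then obtain M where M: "lin tscale tscale M" "\<And>u h. M (AH.T u h) = sw h (\<lambda>h1 h2. U (AH.T u h1) h2)"
      using bil_factors by blast
    have 1: "tlift V H (\<lambda>a0 h. tlift V H (\<lambda>x g. U (tens V H x g) h) (r a0)) (delta a) = L (delta a)"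
    proof (rule lift[OF a L(1)])
      fix u h assume u: "u \<in> carrier V" "h \<in> carrier H"
      have l: "lin tscale tscale (\<lambda>t. U t h)" by (intro Ul)
      show "tlift V H (\<lambda>x g. U (tens V H x g) h) (r u) = L (AH.T u h)"
        unfolding r[OF u(1)] L(2) T by (rule lift[OF u(1) l refl])
    qed
    have 2: "tlift V H (\<lambda>a0 h. sw2 H h (\<lambda>h1 h2. U (tens V H a0 h1) h2)) (delta a) = M (delta a)"
      by (rule lift[OF a M(1)]) (simp only: M(2) T comult_sw[OF _ b2 refl])
    have "L (delta a) = M (delta a)"
    proof (rule BH.TC_ext[OF lin_comp[OF L(1) delta_lin] lin_comp[OF M(1) delta_lin] TC[OF a]])
      fix p q \<omega> \<gamma> assume h: "\<omega> \<in> deg \<Omega>B p" "\<gamma> \<in> deg \<Omega>H q"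
      have lU: "lin tscale tscale (\<lambda>t. U t z)" for z by (intro Ul)
      have "L (delta (T \<omega> \<gamma>)) = sw \<gamma> (\<lambda>a b. sw a (\<lambda>c d. U (AH.T (T \<omega> c) (pz d)) (pz b)))"
        by (simp add: delta_T sw_pull[OF L(1)] L(2) sw_pull[OF lU])
      also have "\<dots> = sw \<gamma> (\<lambda>a b. sw b (\<lambda>c d. U (AH.T (T \<omega> a) (pz c)) (pz d)))"
        by (rule coassoc[where sX = tscale]) (intro trilI Ul)+
      also have "\<dots> = M (delta (T \<omega> \<gamma>))"
        by (simp add: delta_T sw_pull[OF M(1)] M(2) sw_parity(4)[OF b2])
      finally show "L (delta (T \<omega> \<gamma>)) = M (delta (T \<omega> \<gamma>))" .
    qed
    then show ?thesis unfolding r[OF a] U_def[symmetric] 1 2 .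
  qed
qed

lemma covariant: "covariant_calculus H A \<rho> \<Omega>A"
proof (rule covariant_calculus.intro[OF _ CA.calculus_axioms], goal_cases)
  case 1
  have "tensor_span A H = tensor_span \<Omega>A H" by (rule tensor_span_cong) simp_all
  then show ?case
    by (intro delta_comodule_algebra[OF kalgebra_A]) (use A_TC delta_A delta_deg[of _ 0] amult_eq in \<open>auto simp
      del: A_simps(3) simp: A_simps(3)[symmetric]\<close>)
next
  case 2
  have "comodule_algebra H \<Omega>A delta"
    by (rule delta_comodule_algebra[OF OA.kalgebra_axioms]) (use delta_TC in simp_all)
  moreover have "\<forall>n. \<forall>x\<in>deg \<Omega>A n. delta x \<in> tensor_span \<Omega>A H (deg \<Omega>A n) (carrier H)"
    using delta_deg by simp
  moreover have "\<forall>a\<in>carrier A. delta a = \<rho> a" using delta_A by blast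
  moreover have "\<forall>x\<in>carrier \<Omega>A. delta (diff \<Omega>A x) = tlift \<Omega>A H (\<lambda>y h. tens \<Omega>A H (diff \<Omega>A y) h) (delta x)"
    using delta_diff by simp
  ultimately show ?case by (intro covariant_calculus_axioms.intro exI[of _ delta] conjI)
qed

lemma coaction_differentiable: "differentiable \<Omega>A (tensor_dga \<Omega>A \<Omega>H) \<rho>"
  unfolding differentiable_def using Phi_hom coaction_A by (intro exI[of _ Phi]) simp

lemma differential_coaction_T:
  assumes c: "\<omega> \<in> carrier \<Omega>B" "\<gamma> \<in> carrier \<Omega>H"
  shows "differential \<Omega>A (tensor_dga \<Omega>A \<Omega>H) \<rho> (T \<omega> \<gamma>) =
    tlift \<Omega>H \<Omega>H (\<lambda>\<gamma>1 \<gamma>2. AH.T (T \<omega> \<gamma>1) \<gamma>2) (dcomult H \<Omega>H \<gamma>)"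
proof -
  have b: "bil s s tscale (\<lambda>g1 g2. AH.T (T \<omega> g1) g2)" by (intro mlinA)
  have "dcomult H \<Omega>H \<gamma> = lsum (S \<gamma>) TT.T"
    using dcomult_sw[of \<gamma>] by (simp add: proj_id c(2) sw_def)
  then show ?thesis
    using tlift_lsum[OF vspace vspace b S_carrier[of \<gamma>] refl] by (simp add: differential_coaction TC_T c Phi_T sw_def)
qed

end

theorem theorem3p16:
  fixes H :: "('k::field, 'h::ab_group_add) hopf"
    and B :: "('k, 'b::ab_group_add) alg"
    and act :: "'h \<Rightarrow> 'b \<Rightarrow> 'b"
    and \<sigma> :: "'h \<Rightarrow> 'h \<Rightarrow> 'b"
    and \<Omega>B :: "('k, 'b) dga"
    and \<Omega>H :: "('k, 'h) dga"
  defines "A \<equiv> crossed_product H B act \<sigma>"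
    and "\<Omega>A \<equiv> crossed_calculus H \<Omega>B \<Omega>H act \<sigma>"
    and "\<rho> \<equiv> crossed_coaction H B"
  assumes "hopf_algebra H"
    and "bij_betw (antipode H) (carrier H) (carrier H)"
    and "twisted_module_algebra H B act \<sigma>"
    and "twisted_module_calculus H B act \<sigma> \<Omega>B"
    and "calculus H \<Omega>H"
    and "differentiable \<Omega>H (tensor_dga \<Omega>H \<Omega>H) (comult H)"
  shows "covariant_calculus H A \<rho> \<Omega>A \<and>
    differentiable \<Omega>A (tensor_dga \<Omega>A \<Omega>H) \<rho> \<and>
    (\<forall>\<omega>\<in>carrier \<Omega>B. \<forall>\<gamma>\<in>carrier \<Omega>H.
      differential \<Omega>A (tensor_dga \<Omega>A \<Omega>H) \<rho> (tens \<Omega>B \<Omega>H \<omega> \<gamma>) =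
      tlift \<Omega>H \<Omega>H (\<lambda>\<gamma>1 \<gamma>2. tens \<Omega>A \<Omega>H (tens \<Omega>B \<Omega>H \<omega> \<gamma>1) \<gamma>2) (dcomult H \<Omega>H \<gamma>))"
proof -
  interpret crossed_product_calculus H B act \<sigma> \<Omega>B \<Omega>H
    by (intro crossed_product_calculus.intro differentiable_hopf_algebra.intro
      differentiable_hopf_algebra_axioms.intro assms)
  show ?thesis
    unfolding A_def \<Omega>A_def \<rho>_def using covariant coaction_differentiable differential_coaction_T by blast
qed

end
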